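(* Let $H$ be a Hopf algebra over $k$ with invertible antipode. There is an isomorphism between the category of symmetric partial $H$-module algebras and the category of algebra objects in the monoidal category of partial $H$-modules, i.e. $\mathsf{ParAct}_H\cong\mathsf{Alg}({}_{H_{par}}\mathcal M)$.
   Context: $k$ is a commutative ring; all algebras are associative unital $k$-algebras. $H$ is a Hopf algebra over $k$ with Sweedler notation $\Delta(h)=h_{(1)}\otimes h_{(2)}$ and antipode $S$. A symmetric partial action of $H$ on a unital algebra $B$ (making $B$ a symmetric partial left $H$-module algebra) is a linear map $H\otimes B\to B$, $h\otimes b\mapsto h\cdot b$, such that for all $h,l\in H$, $a,b\in B$: $1_H\cdot a=a$; $h\cdot(ab)=(h_{(1)}\cdot a)(h_{(2)}\cdot b)$; $h\cdot(l\cdot a)=(h_{(1)}\cdot1_B)(h_{(2)}l\cdot a)$; $h\cdot(l\cdot a)=(h_{(1)}l\cdot a)(h_{(2)}\cdot1_B)$. $\mathsf{ParAct}_H$ is the category of symmetric partial left $H$-module algebras, with morphisms the algebra maps $f$ satisfying $f(h\cdot a)=h\cdot f(a)$. A partial representation of $H$ on a unital algebra $B$ is a $k$-linear map $\pi:H\to B$ such that for all $h,l\in H$: $\pi(1_H)=1_B$; $\pi(h)\pi(l_{(1)})\pi(S(l_{(2)}))=\pi(hl_{(1)})\pi(S(l_{(2)}))$; $\pi(h_{(1)})\pi(S(h_{(2)}))\pi(l)=\pi(h_{(1)})\pi(S(h_{(2)})l)$; $\pi(h)\pi(S(l_{(1)}))\pi(l_{(2)})=\pi(hS(l_{(1)}))\pi(l_{(2)})$;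 $\pi(S(h_{(1)}))\pi(h_{(2)})\pi(l)=\pi(S(h_{(1)}))\pi(h_{(2)}l)$. A partial $H$-module is a $k$-module $M$ with a partial representation $\pi:H\to\mathrm{End}_k(M)$; write $h\bullet m=\pi(h)(m)$. Morphisms are $k$-linear maps commuting with all $h\bullet-$. $H_{par}$ is the quotient of the tensor algebra $T(H)$ by the ideal generated by, for all $h,l\in H$: $1_H-1_{T(H)}$; $h\otimes l_{(1)}\otimes S(l_{(2)})-hl_{(1)}\otimes S(l_{(2)})$; $h_{(1)}\otimes S(h_{(2)})\otimes l-h_{(1)}\otimes S(h_{(2)})l$; $h\otimes S(l_{(1)})\otimes l_{(2)}-hS(l_{(1)})\otimes l_{(2)}$; $S(h_{(1)})\otimes h_{(2)}\otimes l-S(h_{(1)})\otimes h_{(2)}l$; $[h]$ denotes the class of $h$. The category of partial $H$-modules is identified with the category ${}_{H_{par}}\mathcal M$ of left $H_{par}$-modules via $[h]m=h\bullet m$. $A\subseteq H_{par}$ is the subalgebra generated by $\varepsilon_h=[h_{(1)}][S(h_{(2)})]$, $h\in H$. Monoidal structure on ${}_{H_{par}}\mathcal M$: with $t:A\to H_{par}$ the anti-algebra map with $t(\varepsilon_h)=[h_{(2)}][S^{-1}(h_{(1)})]$, every module $M$ is an $A$-bimodule via left multiplication by $a\in A\subseteq H_{par}$ and $ma=t(a)m$; the tensor product is $M\otimes_AN$ with $h\bullet(m\otimes_An)=(h_{(1)}\bullet m)\otimes_A(h_{(2)}\bullet n)$; the unit object is $A$ with $h\bullet a=[h_{(1)}]a[S(h_{(2)})]$.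 $\mathsf{Alg}({}_{H_{par}}\mathcal M)$ is the category of algebra (monoid) objects in this monoidal category; such an object is in particular a $k$-algebra, via the canonical maps $B\otimes_kB\to B\otimes_AB\to B$ and $k\to A\to B$. *)

theory Defs
  imports "HOL-Algebra.Module" "HOL-Algebra.QuotRing" "HOL-Algebra.Subrings"
    "HOL-Algebra.Free_Abelian_Groups"
begin

section \<open>Categories and isomorphisms of categories\<close>

text \<open>The same function can be an arrow between several pairs of objects, so composition and
  arrow maps of functors are indexed by the objects involved.\<close>

record ('o, 'a) category =
  cat_ob :: "'o set"
  cat_hom :: "'o \<Rightarrow> 'o \<Rightarrow> 'a set"
  cat_id :: "'o \<Rightarrow> 'a"
  cat_comp :: "'o \<Rightarrow> 'o \<Rightarrow> 'o \<Rightarrow> 'a \<Rightarrow> 'a \<Rightarrow> 'a"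

definition is_category :: "('o, 'a) category \<Rightarrow> bool" where
  "is_category C \<longleftrightarrow>
     (\<forall>X\<in>cat_ob C. cat_id C X \<in> cat_hom C X X) \<and>
     (\<forall>X\<in>cat_ob C. \<forall>Y\<in>cat_ob C. \<forall>Z\<in>cat_ob C. \<forall>f\<in>cat_hom C X Y. \<forall>g\<in>cat_hom C Y Z.
        cat_comp C X Y Z g f \<in> cat_hom C X Z) \<and>
     (\<forall>X\<in>cat_ob C. \<forall>Y\<in>cat_ob C. \<forall>f\<in>cat_hom C X Y.
        cat_comp C X X Y f (cat_id C X) = f \<and> cat_comp C X Y Y (cat_id C Y) f = f) \<and>
     (\<forall>W\<in>cat_ob C. \<forall>X\<in>cat_ob C. \<forall>Y\<in>cat_ob C. \<forall>Z\<in>cat_ob C.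
        \<forall>f\<in>cat_hom C W X. \<forall>g\<in>cat_hom C X Y. \<forall>h\<in>cat_hom C Y Z.
          cat_comp C W X Z (cat_comp C X Y Z h g) f = cat_comp C W Y Z h (cat_comp C W X Y g f))"

definition is_functor ::
  "('o, 'a) category \<Rightarrow> ('p, 'b) category \<Rightarrow> ('o \<Rightarrow> 'p) \<Rightarrow> ('o \<Rightarrow> 'o \<Rightarrow> 'a \<Rightarrow> 'b) \<Rightarrow> bool" where
  "is_functor C D Fo Fa \<longleftrightarrow>
     (\<forall>X\<in>cat_ob C. Fo X \<in> cat_ob D) \<and>
     (\<forall>X\<in>cat_ob C. \<forall>Y\<in>cat_ob C. \<forall>f\<in>cat_hom C X Y. Fa X Y f \<in> cat_hom D (Fo X) (Fo Y)) \<and>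
     (\<forall>X\<in>cat_ob C. Fa X X (cat_id C X) = cat_id D (Fo X)) \<and>
     (\<forall>X\<in>cat_ob C. \<forall>Y\<in>cat_ob C. \<forall>Z\<in>cat_ob C. \<forall>f\<in>cat_hom C X Y. \<forall>g\<in>cat_hom C Y Z.
        Fa X Z (cat_comp C X Y Z g f) = cat_comp D (Fo X) (Fo Y) (Fo Z) (Fa Y Z g) (Fa X Y f))"

definition isomorphic_categories :: "('o, 'a) category \<Rightarrow> ('p, 'b) category \<Rightarrow> bool" where
  "isomorphic_categories C D \<longleftrightarrow> is_category C \<and> is_category D \<and>
     (\<exists>Fo Fa Go Ga. is_functor C D Fo Fa \<and> is_functor D C Go Ga \<and>
        (\<forall>X\<in>cat_ob C. Go (Fo X) = X) \<and>
        (\<forall>X\<in>cat_ob C. \<forall>Y\<in>cat_ob C. \<forall>f\<in>cat_hom C X Y. Ga (Fo X) (Fo Y) (Fa X Y f) = f) \<and>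
        (\<forall>U\<in>cat_ob D. Fo (Go U) = U) \<and>
        (\<forall>U\<in>cat_ob D. \<forall>V\<in>cat_ob D. \<forall>f\<in>cat_hom D U V. Fa (Go U) (Go V) (Ga U V f) = f))"


section \<open>Modules and algebras\<close>

text \<open>The library's \<^locale>\<open>module\<close> requires commutative scalars.  In a module record that is not an
  algebra, the \<^const>\<open>mult\<close> and \<^const>\<open>one\<close> fields carry no information.\<close>

definition left_module :: "('r, 'p) ring_scheme \<Rightarrow> ('r, 'm, 'q) module_scheme \<Rightarrow> bool" where
  "left_module R M \<longleftrightarrow> ring R \<and> abelian_group M \<and>
     (\<forall>r\<in>carrier R. \<forall>x\<in>carrier M. r \<odot>\<^bsub>M\<^esub> x \<in> carrier M) \<and>
     (\<forall>r\<in>carrier R. \<forall>s\<in>carrier R. \<forall>x\<in>carrier M.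
        (r \<oplus>\<^bsub>R\<^esub> s) \<odot>\<^bsub>M\<^esub> x = r \<odot>\<^bsub>M\<^esub> x \<oplus>\<^bsub>M\<^esub> s \<odot>\<^bsub>M\<^esub> x) \<and>
     (\<forall>r\<in>carrier R. \<forall>x\<in>carrier M. \<forall>y\<in>carrier M.
        r \<odot>\<^bsub>M\<^esub> (x \<oplus>\<^bsub>M\<^esub> y) = r \<odot>\<^bsub>M\<^esub> x \<oplus>\<^bsub>M\<^esub> r \<odot>\<^bsub>M\<^esub> y) \<and>
     (\<forall>r\<in>carrier R. \<forall>s\<in>carrier R. \<forall>x\<in>carrier M.
        (r \<otimes>\<^bsub>R\<^esub> s) \<odot>\<^bsub>M\<^esub> x = r \<odot>\<^bsub>M\<^esub> (s \<odot>\<^bsub>M\<^esub> x)) \<and>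
     (\<forall>x\<in>carrier M. \<one>\<^bsub>R\<^esub> \<odot>\<^bsub>M\<^esub> x = x)"

definition linear_on ::
  "('r, 'p) ring_scheme \<Rightarrow> ('r, 'm, 'q) module_scheme \<Rightarrow> ('r, 'n, 's) module_scheme \<Rightarrow> ('m \<Rightarrow> 'n) \<Rightarrow> bool" where
  "linear_on R M N f \<longleftrightarrow> f \<in> carrier M \<rightarrow> carrier N \<and>
     (\<forall>x\<in>carrier M. \<forall>y\<in>carrier M. f (x \<oplus>\<^bsub>M\<^esub> y) = f x \<oplus>\<^bsub>N\<^esub> f y) \<and>
     (\<forall>r\<in>carrier R. \<forall>x\<in>carrier M. f (r \<odot>\<^bsub>M\<^esub> x) = r \<odot>\<^bsub>N\<^esub> f x)"

definition k_algebra :: "('k, 'p) ring_scheme \<Rightarrow> ('k, 'b, 'q) module_scheme \<Rightarrow> bool" where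
  "k_algebra k B \<longleftrightarrow> module k B \<and> ring B \<and>
     (\<forall>c\<in>carrier k. \<forall>x\<in>carrier B. \<forall>y\<in>carrier B.
        (c \<odot>\<^bsub>B\<^esub> x) \<otimes>\<^bsub>B\<^esub> y = c \<odot>\<^bsub>B\<^esub> (x \<otimes>\<^bsub>B\<^esub> y) \<and>
        x \<otimes>\<^bsub>B\<^esub> (c \<odot>\<^bsub>B\<^esub> y) = c \<odot>\<^bsub>B\<^esub> (x \<otimes>\<^bsub>B\<^esub> y))"

definition algebra_map ::
  "('k, 'p) ring_scheme \<Rightarrow> ('k, 'b, 'q) module_scheme \<Rightarrow> ('k, 'c, 's) module_scheme \<Rightarrow> ('b \<Rightarrow> 'c) \<Rightarrow> bool" where
  "algebra_map k B C f \<longleftrightarrow> linear_on k B C f \<and> f \<in> ring_hom B C"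

text \<open>Records whose operations agree on the carrier but differ outside of it describe the same
  structure.  Objects of categories are therefore required to have operations that are
  \<^const>\<open>undefined\<close> outside of the carrier, so that equality of records is equality of structures;
  this matters for isomorphisms (as opposed to equivalences) of categories.\<close>

definition extensional2 :: "'a set \<Rightarrow> 'b set \<Rightarrow> ('a \<Rightarrow> 'b \<Rightarrow> 'c) \<Rightarrow> bool" where
  "extensional2 X Y f \<longleftrightarrow> f = (\<lambda>x\<in>X. \<lambda>y\<in>Y. f x y)"

definition normal_algebra :: "('k, 'p) ring_scheme \<Rightarrow> ('k, 'b, 'q) module_scheme \<Rightarrow> bool" where
  "normal_algebra k B \<longleftrightarrow>
     extensional2 (carrier B) (carrier B) (add B) \<and>
     extensional2 (carrier B) (carrier B) (mult B) \<and>
     extensional2 (carrier k) (carrier B) (smult B)"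

definition normal_module :: "('r, 'p) ring_scheme \<Rightarrow> ('r, 'm, 'q) module_scheme \<Rightarrow> bool" where
  "normal_module R M \<longleftrightarrow>
     extensional2 (carrier M) (carrier M) (add M) \<and>
     extensional2 (carrier R) (carrier M) (smult M) \<and>
     mult M = undefined \<and> one M = undefined"


section \<open>Tensor products\<close>

text \<open>The tensor product of a right module \<open>M\<close> (action \<open>ra\<close>) and a left module \<open>N\<close> (action \<open>la\<close>)
  over a ring with carrier \<open>R\<close>: the free abelian group on pairs modulo the subgroup generated by
  the usual relations.  Its elements are cosets.\<close>

type_synonym ('m, 'n) tensor = "('m \<times> 'n \<Rightarrow>\<^sub>0 int) set"

definition tensor_relations ::
  "'r set \<Rightarrow> ('m, 'p) ring_scheme \<Rightarrow> ('m \<Rightarrow> 'r \<Rightarrow> 'm) \<Rightarrow> ('n, 'q) ring_scheme \<Rightarrow> ('r \<Rightarrow> 'n \<Rightarrow> 'n)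
     \<Rightarrow> ('m \<times> 'n \<Rightarrow>\<^sub>0 int) set" where
  "tensor_relations R M ra N la = generate (free_Abelian_group (carrier M \<times> carrier N))
     ({frag_of (x \<oplus>\<^bsub>M\<^esub> x', y) - frag_of (x, y) - frag_of (x', y) | x x' y.
         x \<in> carrier M \<and> x' \<in> carrier M \<and> y \<in> carrier N} \<union>
      {frag_of (x, y \<oplus>\<^bsub>N\<^esub> y') - frag_of (x, y) - frag_of (x, y') | x y y'.
         x \<in> carrier M \<and> y \<in> carrier N \<and> y' \<in> carrier N} \<union>
      {frag_of (ra x r, y) - frag_of (x, la r y) | x r y.
         x \<in> carrier M \<and> r \<in> R \<and> y \<in> carrier N})"

definition tensor_group ::
  "'r set \<Rightarrow> ('m, 'p) ring_scheme \<Rightarrow> ('m \<Rightarrow> 'r \<Rightarrow> 'm) \<Rightarrow> ('n, 'q) ring_scheme \<Rightarrow> ('r \<Rightarrow> 'n \<Rightarrow> 'n)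
     \<Rightarrow> ('m, 'n) tensor ring" where
  "tensor_group R M ra N la =
     (let Q = free_Abelian_group (carrier M \<times> carrier N) Mod tensor_relations R M ra N la
      in \<lparr>carrier = carrier Q, monoid.mult = undefined, one = undefined,
          ring.zero = \<one>\<^bsub>Q\<^esub>, add = (\<otimes>\<^bsub>Q\<^esub>)\<rparr>)"

definition tensor_pure ::
  "'r set \<Rightarrow> ('m, 'p) ring_scheme \<Rightarrow> ('m \<Rightarrow> 'r \<Rightarrow> 'm) \<Rightarrow> ('n, 'q) ring_scheme \<Rightarrow> ('r \<Rightarrow> 'n \<Rightarrow> 'n)
     \<Rightarrow> 'm \<Rightarrow> 'n \<Rightarrow> ('m, 'n) tensor" where
  "tensor_pure R M ra N la x y =
     tensor_relations R M ra N la #>\<^bsub>free_Abelian_group (carrier M \<times> carrier N)\<^esub> frag_of (x, y)"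

text \<open>The map induced on a tensor product by a balanced biadditive \<open>f\<close> with values in the abelian
  group \<open>G\<close>, i.e. \<open>\<Sum> x \<otimes> y \<mapsto> \<Sum> f x y\<close>.  It is only used for such \<open>f\<close>, where the choice of the
  representative of the coset \<open>X\<close> is irrelevant.\<close>

definition tensor_lift ::
  "('g, 'p) ring_scheme \<Rightarrow> ('m \<Rightarrow> 'n \<Rightarrow> 'g) \<Rightarrow> ('m, 'n) tensor \<Rightarrow> 'g" where
  "tensor_lift G f X = (let c = (SOME c. c \<in> X) in
     \<Oplus>\<^bsub>G\<^esub>p\<in>Poly_Mapping.keys c. [Poly_Mapping.lookup c p] \<cdot>\<^bsub>G\<^esub> f (fst p) (snd p))"

definition tensor_k ::
  "('k, 'p) ring_scheme \<Rightarrow> ('k, 'm, 'q) module_scheme \<Rightarrow> ('k, 'n, 's) module_scheme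
     \<Rightarrow> ('k, ('m, 'n) tensor) module" where
  "tensor_k k M N =
     (let ra = (\<lambda>x c. c \<odot>\<^bsub>M\<^esub> x); G = tensor_group (carrier k) M ra N (smult N)
      in \<lparr>carrier = carrier G, monoid.mult = undefined, one = undefined, ring.zero = \<zero>\<^bsub>G\<^esub>, add = add G,
          smult = (\<lambda>c. tensor_lift G
            (\<lambda>x y. tensor_pure (carrier k) M ra N (smult N) (c \<odot>\<^bsub>M\<^esub> x) y))\<rparr>)"

definition pure_k ::
  "('k, 'p) ring_scheme \<Rightarrow> ('k, 'm, 'q) module_scheme \<Rightarrow> ('k, 'n, 's) module_scheme
     \<Rightarrow> 'm \<Rightarrow> 'n \<Rightarrow> ('m, 'n) tensor" where
  "pure_k k M N = tensor_pure (carrier k) M (\<lambda>x c. c \<odot>\<^bsub>M\<^esub> x) N (smult N)"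


section \<open>Hopf algebras\<close>

record ('k, 'h) hopf = "('k, 'h) module" +
  comul :: "'h \<Rightarrow> ('h, 'h) tensor"
  counit :: "'h \<Rightarrow> 'k"
  antipode :: "'h \<Rightarrow> 'h"

text \<open>\<open>sweedler H G f h\<close> is the element of \<open>G\<close> written \<open>f(h\<^sub>1, h\<^sub>2)\<close> in Sweedler notation.\<close>

definition sweedler ::
  "('k, 'h) hopf \<Rightarrow> ('g, 'p) ring_scheme \<Rightarrow> ('h \<Rightarrow> 'h \<Rightarrow> 'g) \<Rightarrow> 'h \<Rightarrow> 'g" where
  "sweedler H G f h = tensor_lift G f (comul H h)"

locale hopf_algebra =
  fixes k :: "'k ring" and H :: "('k, 'h) hopf"
  assumes k_cring: "cring k"
    and H_algebra: "k_algebra k H"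
    and comul_linear: "linear_on k H (tensor_k k H H) (comul H)"
    and coassoc: "h \<in> carrier H \<Longrightarrow>
      sweedler H (tensor_k k H (tensor_k k H H))
        (\<lambda>x z. sweedler H (tensor_k k H (tensor_k k H H))
           (\<lambda>x1 x2. pure_k k H (tensor_k k H H) x1 (pure_k k H H x2 z)) x) h =
      sweedler H (tensor_k k H (tensor_k k H H))
        (\<lambda>x y. pure_k k H (tensor_k k H H) x (comul H y)) h"
    and counit_linear: "counit H \<in> carrier H \<rightarrow> carrier k"
      "x \<in> carrier H \<Longrightarrow> y \<in> carrier H \<Longrightarrow>
        counit H (x \<oplus>\<^bsub>H\<^esub> y) = counit H x \<oplus>\<^bsub>k\<^esub> counit H y"
      "c \<in> carrier k \<Longrightarrow> x \<in> carrier H \<Longrightarrow> counit H (c \<odot>\<^bsub>H\<^esub> x) = c \<otimes>\<^bsub>k\<^esub> counit H x"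
    and counit_left: "h \<in> carrier H \<Longrightarrow> sweedler H H (\<lambda>x y. counit H x \<odot>\<^bsub>H\<^esub> y) h = h"
    and counit_right: "h \<in> carrier H \<Longrightarrow> sweedler H H (\<lambda>x y. counit H y \<odot>\<^bsub>H\<^esub> x) h = h"
    and comul_mult: "h \<in> carrier H \<Longrightarrow> l \<in> carrier H \<Longrightarrow>
      comul H (h \<otimes>\<^bsub>H\<^esub> l) =
      sweedler H (tensor_k k H H) (\<lambda>h1 h2. sweedler H (tensor_k k H H)
        (\<lambda>l1 l2. pure_k k H H (h1 \<otimes>\<^bsub>H\<^esub> l1) (h2 \<otimes>\<^bsub>H\<^esub> l2)) l) h"
    and comul_one: "comul H \<one>\<^bsub>H\<^esub> = pure_k k H H \<one>\<^bsub>H\<^esub> \<one>\<^bsub>H\<^esub>"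
    and counit_mult: "h \<in> carrier H \<Longrightarrow> l \<in> carrier H \<Longrightarrow>
      counit H (h \<otimes>\<^bsub>H\<^esub> l) = counit H h \<otimes>\<^bsub>k\<^esub> counit H l"
    and counit_one: "counit H \<one>\<^bsub>H\<^esub> = \<one>\<^bsub>k\<^esub>"
    and antipode_linear: "linear_on k H H (antipode H)"
    and antipode_left: "h \<in> carrier H \<Longrightarrow>
      sweedler H H (\<lambda>x y. antipode H x \<otimes>\<^bsub>H\<^esub> y) h = counit H h \<odot>\<^bsub>H\<^esub> \<one>\<^bsub>H\<^esub>"
    and antipode_right: "h \<in> carrier H \<Longrightarrow>
      sweedler H H (\<lambda>x y. x \<otimes>\<^bsub>H\<^esub> antipode H y) h = counit H h \<odot>\<^bsub>H\<^esub> \<one>\<^bsub>H\<^esub>"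

definition invertible_antipode :: "('k, 'h) hopf \<Rightarrow> bool" where
  "invertible_antipode H \<longleftrightarrow> bij_betw (antipode H) (carrier H) (carrier H)"

definition antipode_inv :: "('k, 'h) hopf \<Rightarrow> 'h \<Rightarrow> 'h" where
  "antipode_inv H = inv_into (carrier H) (antipode H)"


section \<open>Symmetric partial module algebras\<close>

text \<open>A pair \<open>(B, act)\<close>, where the linear map \<open>H \<otimes> B \<rightarrow> B\<close> is given as a \<open>k\<close>-bilinear function.\<close>

definition partial_module_algebra ::
  "'k ring \<Rightarrow> ('k, 'h) hopf \<Rightarrow> ('k, 'b) module \<Rightarrow> ('h \<Rightarrow> 'b \<Rightarrow> 'b) \<Rightarrow> bool" where
  "partial_module_algebra k H B act \<longleftrightarrow> k_algebra k B \<and>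
     (\<forall>h\<in>carrier H. linear_on k B B (act h)) \<and>
     (\<forall>a\<in>carrier B. linear_on k H B (\<lambda>h. act h a)) \<and>
     (\<forall>a\<in>carrier B. act \<one>\<^bsub>H\<^esub> a = a) \<and>
     (\<forall>h\<in>carrier H. \<forall>a\<in>carrier B. \<forall>b\<in>carrier B.
        act h (a \<otimes>\<^bsub>B\<^esub> b) = sweedler H B (\<lambda>h1 h2. act h1 a \<otimes>\<^bsub>B\<^esub> act h2 b) h) \<and>
     (\<forall>h\<in>carrier H. \<forall>l\<in>carrier H. \<forall>a\<in>carrier B.
        act h (act l a) = sweedler H B (\<lambda>h1 h2. act h1 \<one>\<^bsub>B\<^esub> \<otimes>\<^bsub>B\<^esub> act (h2 \<otimes>\<^bsub>H\<^esub> l) a) h \<and>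
        act h (act l a) = sweedler H B (\<lambda>h1 h2. act (h1 \<otimes>\<^bsub>H\<^esub> l) a \<otimes>\<^bsub>B\<^esub> act h2 \<one>\<^bsub>B\<^esub>) h)"

definition ParAct ::
  "'k ring \<Rightarrow> ('k, 'h) hopf \<Rightarrow> (('k, 'b) module \<times> ('h \<Rightarrow> 'b \<Rightarrow> 'b), 'b \<Rightarrow> 'b) category" where
  "ParAct k H = \<lparr>
     cat_ob = {(B, act). partial_module_algebra k H B act \<and> normal_algebra k B \<and>
                 extensional2 (carrier H) (carrier B) act},
     cat_hom = (\<lambda>(B, act) (B', act'). {f \<in> extensional (carrier B). algebra_map k B B' f \<and>
                 (\<forall>h\<in>carrier H. \<forall>a\<in>carrier B. f (act h a) = act' h (f a))}),
     cat_id = (\<lambda>(B, act). \<lambda>x\<in>carrier B. x),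
     cat_comp = (\<lambda>X Y Z g f. compose (carrier (fst X)) g f)\<rparr>"


section \<open>The tensor algebra and the algebra \<open>H\<^sub>p\<^sub>a\<^sub>r\<close>\<close>

definition quotient_algebra ::
  "('k, 'a) module \<Rightarrow> 'a set \<Rightarrow> ('k, 'a set) module" where
  "quotient_algebra R I = \<lparr>carrier = carrier (R Quot I), monoid.mult = mult (R Quot I),
     one = \<one>\<^bsub>R Quot I\<^esub>, ring.zero = \<zero>\<^bsub>R Quot I\<^esub>, add = add (R Quot I),
     smult = (\<lambda>c X. \<Union>x\<in>X. I +>\<^bsub>R\<^esub> (c \<odot>\<^bsub>R\<^esub> x))\<rparr>"

text \<open>The free \<open>k\<close>-algebra on a set: finitely supported functions on words, with convolution.\<close>

definition free_algebra :: "'k ring \<Rightarrow> 'h set \<Rightarrow> ('k, 'h list \<Rightarrow> 'k) module" where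
  "free_algebra k X = \<lparr>
     carrier = {f. (\<forall>w. f w \<in> carrier k) \<and> finite {w. f w \<noteq> \<zero>\<^bsub>k\<^esub>} \<and>
                   (\<forall>w. w \<notin> lists X \<longrightarrow> f w = \<zero>\<^bsub>k\<^esub>)},
     monoid.mult = (\<lambda>f g w. \<Oplus>\<^bsub>k\<^esub>i\<in>{..length w}. f (take i w) \<otimes>\<^bsub>k\<^esub> g (drop i w)),
     one = (\<lambda>w. if w = [] then \<one>\<^bsub>k\<^esub> else \<zero>\<^bsub>k\<^esub>),
     ring.zero = (\<lambda>w. \<zero>\<^bsub>k\<^esub>),
     add = (\<lambda>f g w. f w \<oplus>\<^bsub>k\<^esub> g w),
     smult = (\<lambda>c f w. c \<otimes>\<^bsub>k\<^esub> f w)\<rparr>"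

definition free_gen :: "'k ring \<Rightarrow> 'h \<Rightarrow> 'h list \<Rightarrow> 'k" where
  "free_gen k x = (\<lambda>w. if w = [x] then \<one>\<^bsub>k\<^esub> else \<zero>\<^bsub>k\<^esub>)"

text \<open>The tensor powers of \<open>H\<close> have different types, so the tensor algebra \<open>T(H)\<close> is obtained
  from the free algebra on the set underlying \<open>H\<close> by making the insertion of generators
  \<open>k\<close>-linear.  A word \<open>h\<^sub>1 \<dots> h\<^sub>n\<close> represents \<open>h\<^sub>1 \<otimes> \<dots> \<otimes> h\<^sub>n\<close>.\<close>

definition tensor_algebra_ideal :: "'k ring \<Rightarrow> ('k, 'h) hopf \<Rightarrow> ('h list \<Rightarrow> 'k) set" where
  "tensor_algebra_ideal k H = (let F = free_algebra k (carrier H) in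
     Idl\<^bsub>F\<^esub> ({free_gen k (x \<oplus>\<^bsub>H\<^esub> y) \<ominus>\<^bsub>F\<^esub> (free_gen k x \<oplus>\<^bsub>F\<^esub> free_gen k y) | x y.
              x \<in> carrier H \<and> y \<in> carrier H} \<union>
            {free_gen k (c \<odot>\<^bsub>H\<^esub> x) \<ominus>\<^bsub>F\<^esub> (c \<odot>\<^bsub>F\<^esub> free_gen k x) | c x.
              c \<in> carrier k \<and> x \<in> carrier H}))"

definition tensor_algebra :: "'k ring \<Rightarrow> ('k, 'h) hopf \<Rightarrow> ('k, ('h list \<Rightarrow> 'k) set) module" where
  "tensor_algebra k H = quotient_algebra (free_algebra k (carrier H)) (tensor_algebra_ideal k H)"

definition tensor_gen :: "'k ring \<Rightarrow> ('k, 'h) hopf \<Rightarrow> 'h \<Rightarrow> ('h list \<Rightarrow> 'k) set" where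
  "tensor_gen k H x = tensor_algebra_ideal k H +>\<^bsub>free_algebra k (carrier H)\<^esub> free_gen k x"

definition Hpar_ideal :: "'k ring \<Rightarrow> ('k, 'h) hopf \<Rightarrow> ('h list \<Rightarrow> 'k) set set" where
  "Hpar_ideal k H = (let T = tensor_algebra k H; i = tensor_gen k H; S = antipode H in
     Idl\<^bsub>T\<^esub>
      ({i \<one>\<^bsub>H\<^esub> \<ominus>\<^bsub>T\<^esub> \<one>\<^bsub>T\<^esub>} \<union>
       {sweedler H T (\<lambda>l1 l2. i h \<otimes>\<^bsub>T\<^esub> i l1 \<otimes>\<^bsub>T\<^esub> i (S l2)) l \<ominus>\<^bsub>T\<^esub>
        sweedler H T (\<lambda>l1 l2. i (h \<otimes>\<^bsub>H\<^esub> l1) \<otimes>\<^bsub>T\<^esub> i (S l2)) l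
        | h l. h \<in> carrier H \<and> l \<in> carrier H} \<union>
       {sweedler H T (\<lambda>h1 h2. i h1 \<otimes>\<^bsub>T\<^esub> i (S h2) \<otimes>\<^bsub>T\<^esub> i l) h \<ominus>\<^bsub>T\<^esub>
        sweedler H T (\<lambda>h1 h2. i h1 \<otimes>\<^bsub>T\<^esub> i (S h2 \<otimes>\<^bsub>H\<^esub> l)) h
        | h l. h \<in> carrier H \<and> l \<in> carrier H} \<union>
       {sweedler H T (\<lambda>l1 l2. i h \<otimes>\<^bsub>T\<^esub> i (S l1) \<otimes>\<^bsub>T\<^esub> i l2) l \<ominus>\<^bsub>T\<^esub>
        sweedler H T (\<lambda>l1 l2. i (h \<otimes>\<^bsub>H\<^esub> S l1) \<otimes>\<^bsub>T\<^esub> i l2) l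
        | h l. h \<in> carrier H \<and> l \<in> carrier H} \<union>
       {sweedler H T (\<lambda>h1 h2. i (S h1) \<otimes>\<^bsub>T\<^esub> i h2 \<otimes>\<^bsub>T\<^esub> i l) h \<ominus>\<^bsub>T\<^esub>
        sweedler H T (\<lambda>h1 h2. i (S h1) \<otimes>\<^bsub>T\<^esub> i (h2 \<otimes>\<^bsub>H\<^esub> l)) h
        | h l. h \<in> carrier H \<and> l \<in> carrier H}))"

type_synonym ('k, 'h) hpar = "('h list \<Rightarrow> 'k) set set"

definition Hpar :: "'k ring \<Rightarrow> ('k, 'h) hopf \<Rightarrow> ('k, ('k, 'h) hpar) module" where
  "Hpar k H = quotient_algebra (tensor_algebra k H) (Hpar_ideal k H)"

definition cls :: "'k ring \<Rightarrow> ('k, 'h) hopf \<Rightarrow> 'h \<Rightarrow> ('k, 'h) hpar" where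
  "cls k H h = Hpar_ideal k H +>\<^bsub>tensor_algebra k H\<^esub> tensor_gen k H h"

definition eps :: "'k ring \<Rightarrow> ('k, 'h) hopf \<Rightarrow> 'h \<Rightarrow> ('k, 'h) hpar" where
  "eps k H = sweedler H (Hpar k H)
     (\<lambda>h1 h2. cls k H h1 \<otimes>\<^bsub>Hpar k H\<^esub> cls k H (antipode H h2))"

definition Apar :: "'k ring \<Rightarrow> ('k, 'h) hopf \<Rightarrow> ('k, 'h) hpar set" where
  "Apar k H = \<Inter>{U. subring U (Hpar k H) \<and>
     (\<forall>c\<in>carrier k. \<forall>x\<in>U. c \<odot>\<^bsub>Hpar k H\<^esub> x \<in> U) \<and> eps k H ` carrier H \<subseteq> U}"

text \<open>The anti-algebra map \<open>t\<close>; it is unique because the \<open>\<epsilon>\<^sub>h\<close> generate \<^const>\<open>Apar\<close>.\<close>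

definition tmap :: "'k ring \<Rightarrow> ('k, 'h) hopf \<Rightarrow> ('k, 'h) hpar \<Rightarrow> ('k, 'h) hpar" where
  "tmap k H = (THE t. t \<in> extensional (Apar k H) \<and>
     linear_on k ((Hpar k H)\<lparr>carrier := Apar k H\<rparr>) (Hpar k H) t \<and>
     t \<one>\<^bsub>Hpar k H\<^esub> = \<one>\<^bsub>Hpar k H\<^esub> \<and>
     (\<forall>a\<in>Apar k H. \<forall>b\<in>Apar k H. t (a \<otimes>\<^bsub>Hpar k H\<^esub> b) = t b \<otimes>\<^bsub>Hpar k H\<^esub> t a) \<and>
     (\<forall>h\<in>carrier H. t (eps k H h) = sweedler H (Hpar k H)
        (\<lambda>h1 h2. cls k H h2 \<otimes>\<^bsub>Hpar k H\<^esub> cls k H (antipode_inv H h1)) h))"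


section \<open>The monoidal category of partial modules\<close>

text \<open>Partial \<open>H\<close>-modules are treated as left modules over \<^const>\<open>Hpar\<close>.  Given an abelian group \<open>G\<close>
  with operators \<open>act h\<close>, \<open>induced_module\<close> is \<open>G\<close> with the \<^const>\<open>Hpar\<close>-module structure such that
  \<open>[h] x = act h x\<close>; it is unique because \<^const>\<open>Hpar\<close> is generated as a ring by the classes \<open>[h]\<close>
  (note that \<open>c 1 = [c 1\<^sub>H]\<close> for \<open>c \<in> k\<close>).\<close>

definition induced_module ::
  "'k ring \<Rightarrow> ('k, 'h) hopf \<Rightarrow> ('g, 'p) ring_scheme \<Rightarrow> ('h \<Rightarrow> 'g \<Rightarrow> 'g) \<Rightarrow> (('k, 'h) hpar, 'g) module" where
  "induced_module k H G act =
     (let M = (\<lambda>s. \<lparr>carrier = carrier G, monoid.mult = undefined, one = undefined,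
                    ring.zero = \<zero>\<^bsub>G\<^esub>, add = add G, smult = s\<rparr>)
      in M (THE s. extensional2 (carrier (Hpar k H)) (carrier G) s \<and>
                   left_module (Hpar k H) (M s) \<and>
                   (\<forall>h\<in>carrier H. \<forall>x\<in>carrier G. s (cls k H h) x = act h x)))"

definition par_hom ::
  "'k ring \<Rightarrow> ('k, 'h) hopf \<Rightarrow> (('k, 'h) hpar, 'm) module \<Rightarrow> (('k, 'h) hpar, 'n) module \<Rightarrow> ('m \<Rightarrow> 'n) set" where
  "par_hom k H M N = {f \<in> extensional (carrier M). linear_on (Hpar k H) M N f}"

text \<open>\<open>m a = t(a) m\<close> for \<open>a \<in> A\<close>\<close>

definition right_act ::
  "'k ring \<Rightarrow> ('k, 'h) hopf \<Rightarrow> (('k, 'h) hpar, 'm) module \<Rightarrow> 'm \<Rightarrow> ('k, 'h) hpar \<Rightarrow> 'm" where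
  "right_act k H M m a = tmap k H a \<odot>\<^bsub>M\<^esub> m"

definition pure_A ::
  "'k ring \<Rightarrow> ('k, 'h) hopf \<Rightarrow> (('k, 'h) hpar, 'm) module \<Rightarrow> (('k, 'h) hpar, 'n) module
     \<Rightarrow> 'm \<Rightarrow> 'n \<Rightarrow> ('m, 'n) tensor" where
  "pure_A k H M N = tensor_pure (Apar k H) M (right_act k H M) N (smult N)"

definition tensor_A ::
  "'k ring \<Rightarrow> ('k, 'h) hopf \<Rightarrow> (('k, 'h) hpar, 'm) module \<Rightarrow> (('k, 'h) hpar, 'n) module
     \<Rightarrow> (('k, 'h) hpar, ('m, 'n) tensor) module" where
  "tensor_A k H M N =
     (let G = tensor_group (Apar k H) M (right_act k H M) N (smult N)
      in induced_module k H G
           (\<lambda>h. tensor_lift G (\<lambda>m n. sweedler H G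
              (\<lambda>h1 h2. pure_A k H M N (cls k H h1 \<odot>\<^bsub>M\<^esub> m) (cls k H h2 \<odot>\<^bsub>N\<^esub> n)) h)))"

definition unit_A :: "'k ring \<Rightarrow> ('k, 'h) hopf \<Rightarrow> (('k, 'h) hpar, ('k, 'h) hpar) module" where
  "unit_A k H = induced_module k H ((Hpar k H)\<lparr>carrier := Apar k H\<rparr>)
     (\<lambda>h a. sweedler H (Hpar k H)
        (\<lambda>h1 h2. cls k H h1 \<otimes>\<^bsub>Hpar k H\<^esub> a \<otimes>\<^bsub>Hpar k H\<^esub> cls k H (antipode H h2)) h)"

text \<open>\<open>tensor_map k H P Q f g\<close> is \<open>f \<otimes>\<^sub>A g\<close> with target \<open>P \<otimes>\<^sub>A Q\<close>.\<close>

definition tensor_map ::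
  "'k ring \<Rightarrow> ('k, 'h) hopf \<Rightarrow> (('k, 'h) hpar, 'p) module \<Rightarrow> (('k, 'h) hpar, 'q) module
     \<Rightarrow> ('m \<Rightarrow> 'p) \<Rightarrow> ('n \<Rightarrow> 'q) \<Rightarrow> ('m, 'n) tensor \<Rightarrow> ('p, 'q) tensor" where
  "tensor_map k H P Q f g =
     tensor_lift (tensor_A k H P Q) (\<lambda>m n. pure_A k H P Q (f m) (g n))"

definition associator ::
  "'k ring \<Rightarrow> ('k, 'h) hopf \<Rightarrow> (('k, 'h) hpar, 'm) module \<Rightarrow> (('k, 'h) hpar, 'n) module
     \<Rightarrow> (('k, 'h) hpar, 'p) module \<Rightarrow> (('m, 'n) tensor, 'p) tensor \<Rightarrow> ('m, ('n, 'p) tensor) tensor" where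
  "associator k H M N P =
     (let T = tensor_A k H M (tensor_A k H N P)
      in tensor_lift T (\<lambda>X p. tensor_lift T
           (\<lambda>m n. pure_A k H M (tensor_A k H N P) m (pure_A k H N P n p)) X))"

definition left_unitor ::
  "(('k, 'h) hpar, 'm) module \<Rightarrow> (('k, 'h) hpar, 'm) tensor \<Rightarrow> 'm" where
  "left_unitor M = tensor_lift M (\<lambda>a m. a \<odot>\<^bsub>M\<^esub> m)"

definition right_unitor ::
  "'k ring \<Rightarrow> ('k, 'h) hopf \<Rightarrow> (('k, 'h) hpar, 'm) module \<Rightarrow> ('m, ('k, 'h) hpar) tensor \<Rightarrow> 'm" where
  "right_unitor k H M = tensor_lift M (\<lambda>m a. right_act k H M m a)"


section \<open>Algebra objects\<close>

definition algebra_object ::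
  "'k ring \<Rightarrow> ('k, 'h) hopf \<Rightarrow> (('k, 'h) hpar, 'b) module
     \<Rightarrow> (('b, 'b) tensor \<Rightarrow> 'b) \<Rightarrow> (('k, 'h) hpar \<Rightarrow> 'b) \<Rightarrow> bool" where
  "algebra_object k H B \<mu> \<eta> \<longleftrightarrow> left_module (Hpar k H) B \<and>
     \<mu> \<in> par_hom k H (tensor_A k H B B) B \<and>
     \<eta> \<in> par_hom k H (unit_A k H) B \<and>
     (\<forall>X\<in>carrier (tensor_A k H (tensor_A k H B B) B).
        \<mu> (tensor_map k H B B \<mu> (\<lambda>b. b) X) =
        \<mu> (tensor_map k H B B (\<lambda>b. b) \<mu> (associator k H B B B X))) \<and>
     (\<forall>X\<in>carrier (tensor_A k H (unit_A k H) B).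
        \<mu> (tensor_map k H B B \<eta> (\<lambda>b. b) X) = left_unitor B X) \<and>
     (\<forall>X\<in>carrier (tensor_A k H B (unit_A k H)).
        \<mu> (tensor_map k H B B (\<lambda>b. b) \<eta> X) = right_unitor k H B X)"

definition algebra_object_map ::
  "'k ring \<Rightarrow> ('k, 'h) hopf \<Rightarrow>
     (('k, 'h) hpar, 'b) module \<times> (('b, 'b) tensor \<Rightarrow> 'b) \<times> (('k, 'h) hpar \<Rightarrow> 'b) \<Rightarrow>
     (('k, 'h) hpar, 'c) module \<times> (('c, 'c) tensor \<Rightarrow> 'c) \<times> (('k, 'h) hpar \<Rightarrow> 'c) \<Rightarrow>
     ('b \<Rightarrow> 'c) \<Rightarrow> bool" where
  "algebra_object_map k H = (\<lambda>(B, \<mu>, \<eta>) (C, \<mu>', \<eta>') f.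
     f \<in> par_hom k H B C \<and>
     (\<forall>X\<in>carrier (tensor_A k H B B). f (\<mu> X) = \<mu>' (tensor_map k H C C f f X)) \<and>
     (\<forall>a\<in>carrier (unit_A k H). f (\<eta> a) = \<eta>' a))"

definition AlgHpar ::
  "'k ring \<Rightarrow> ('k, 'h) hopf \<Rightarrow>
     ((('k, 'h) hpar, 'b) module \<times> (('b, 'b) tensor \<Rightarrow> 'b) \<times> (('k, 'h) hpar \<Rightarrow> 'b),
      'b \<Rightarrow> 'b) category" where
  "AlgHpar k H = \<lparr>
     cat_ob = {(B, \<mu>, \<eta>). algebra_object k H B \<mu> \<eta> \<and> normal_module (Hpar k H) B},
     cat_hom = (\<lambda>U V. {f. algebra_object_map k H U V f}),
     cat_id = (\<lambda>U. \<lambda>x\<in>carrier (fst U). x),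
     cat_comp = (\<lambda>U V W g f. compose (carrier (fst U)) g f)\<rparr>"

end

theory Submission
  imports Defs
begin

text \<open>The isomorphism does not change the underlying \<open>k\<close>-modules or the maps: a multiplication on a
  partial \<open>H\<close>-module with the axioms of a symmetric partial action is the same thing as a
  multiplication that is defined on the tensor product over \<open>A\<close>.

  Let \<open>B\<close> be a symmetric partial module algebra.  The action is a partial representation on \<open>B\<close>, so \<open>B\<close>
  is a module over \<open>H\<^sub>p\<^sub>a\<^sub>r\<close>.  In this module \<open>\<epsilon>\<^sub>h\<close> is the left multiplication by \<open>h \<cdot> 1\<close> and
  \<open>t(\<epsilon>\<^sub>h)\<close> is the right multiplication by \<open>h \<cdot> 1\<close>; hence an arbitrary \<open>a \<in> A\<close> and its image \<open>t(a)\<close>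
  act as the left and right multiplication by \<open>a \<cdot> 1\<close> (lemmas \<open>hact_A\<close> and \<open>hact_t\<close>).  Therefore the
  multiplication of \<open>B\<close> is balanced over \<open>A\<close>, the induced map on \<open>B \<otimes>\<^sub>A B\<close> is linear over \<open>H\<^sub>p\<^sub>a\<^sub>r\<close> by the
  rule for \<open>h \<cdot> (ab)\<close>, and \<open>a \<mapsto> a \<cdot> 1\<close> is a unit for it.

  Conversely, in an algebra object the unit laws express \<open>\<eta>(a) b\<close> and \<open>b \<eta>(a)\<close> by the actions of
  \<open>a\<close> and \<open>t(a)\<close> on \<open>b\<close>, and \<open>h \<cdot> 1 = \<eta>(\<epsilon>\<^sub>h)\<close> by linearity of \<open>\<eta>\<close>.  The two identities
  \<open>[h][l] = \<epsilon>\<^bsub>h\<^sub>1\<^esub> [h\<^sub>2 l] = t(\<epsilon>\<^bsub>h\<^sub>2\<^esub>) [h\<^sub>1 l]\<close> in \<open>H\<^sub>p\<^sub>a\<^sub>r\<close> (lemmas \<open>e_reduce\<close> and \<open>e'_reduce\<close>) turn into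
  the two axioms for \<open>h \<cdot> (l \<cdot> a)\<close>.  The two constructions are mutually inverse because a module over
  \<open>H\<^sub>p\<^sub>a\<^sub>r\<close> is determined by the operators \<open>[h]\<close>, an additive map on a tensor product by its values on
  pure tensors, and \<open>\<eta>\<close> by \<open>\<eta>(1)\<close>.  The same remarks identify the two notions of morphism (\<open>hom_eq\<close>).

  Most of the text is about the existence of the objects that occur in this argument.
  \<^item> The map \<open>t\<close> is the restriction of an anti-endomorphism of \<open>H\<^sub>p\<^sub>a\<^sub>r\<close> with \<open>[h] \<mapsto> [S\<inverse>(h)]\<close>, which comes from
    the universal property of \<open>H\<^sub>p\<^sub>a\<^sub>r\<close> (\<open>Hpar_universal\<close>, \<open>op_par_rep\<close>).
  \<^item> The diagonal action is well defined on \<open>M \<otimes>\<^sub>A N\<close> (\<open>diagonal_balanced\<close>) and is a partial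
    representation (lemmas \<open>pi_rel2\<close> to \<open>pi_rel5\<close>).  For associativity it is also needed that \<open>A\<close> acts on
    \<open>M \<otimes>\<^sub>A N\<close> through \<open>M\<close> and \<open>t(A)\<close> through \<open>N\<close> (\<open>TM_A_left\<close>, \<open>TM_A_right\<close>).
  \<^item> \<open>A\<close> itself is a symmetric partial module algebra with action \<open>[h\<^sub>1] a [S(h\<^sub>2)]\<close>
    (\<open>ad_partial_module_algebra\<close>), so that the unit object is an instance of the first construction.

  The identities between Sweedler sums are computed for an arbitrary partial representation \<open>\<phi>\<close> of \<open>H\<close> in
  an algebra \<open>E\<close>, with \<open>e h\<close> and \<open>e' h\<close> in the roles of \<open>\<epsilon>\<^sub>h\<close> and \<open>t(\<epsilon>\<^sub>h)\<close>.  They come in mirror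
  pairs.  Since the antipode is bijective, \<open>H\<close> with the opposite comultiplication is a Hopf algebra with
  antipode \<open>S\<inverse>\<close>, and \<open>\<phi>\<close> is also a partial representation of it, with \<open>e\<close> and \<open>e'\<close> exchanged; so one
  identity of each pair is computed and the other one is its instance for the opposite comultiplication.\<close>

section \<open>Tensor products and their universal property\<close>

definition additive_on :: "('a, 'p) ring_scheme \<Rightarrow> ('b, 'q) ring_scheme \<Rightarrow> ('a \<Rightarrow> 'b) \<Rightarrow> bool" where
  "additive_on G G' f \<longleftrightarrow> f \<in> carrier G \<rightarrow> carrier G' \<and>
     (\<forall>x\<in>carrier G. \<forall>y\<in>carrier G. f (x \<oplus>\<^bsub>G\<^esub> y) = f x \<oplus>\<^bsub>G'\<^esub> f y)"

lemma additive_onI: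
  assumes "\<And>x. x \<in> carrier G \<Longrightarrow> f x \<in> carrier G'"
    and "\<And>x y. x \<in> carrier G \<Longrightarrow> y \<in> carrier G \<Longrightarrow> f (x \<oplus>\<^bsub>G\<^esub> y) = f x \<oplus>\<^bsub>G'\<^esub> f y"
  shows "additive_on G G' f"
  using assms by (auto simp: additive_on_def)

lemma additive_on_closed: "additive_on G G' f \<Longrightarrow> x \<in> carrier G \<Longrightarrow> f x \<in> carrier G'"
  by (auto simp: additive_on_def)

lemma additive_on_add:
  "additive_on G G' f \<Longrightarrow> x \<in> carrier G \<Longrightarrow> y \<in> carrier G \<Longrightarrow> f (x \<oplus>\<^bsub>G\<^esub> y) = f x \<oplus>\<^bsub>G'\<^esub> f y"
  by (auto simp: additive_on_def)

lemma additive_on_comp: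
  "additive_on G G' f \<Longrightarrow> additive_on G' G'' g \<Longrightarrow> additive_on G G'' (\<lambda>x. g (f x))"
  by (auto simp: additive_on_def Pi_def)

lemma additive_on_group_hom:
  assumes "abelian_group G" "abelian_group G'" "additive_on G G' f"
  shows "group_hom (add_monoid G) (add_monoid G') f"
proof -
  interpret G: abelian_group G by fact
  interpret G': abelian_group G' by fact
  show ?thesis
    by unfold_locales (use assms(3) in \<open>auto simp: additive_on_def hom_def\<close>)
qed

lemma additive_on_zero:
  assumes "abelian_group G" "abelian_group G'" "additive_on G G' f"
  shows "f \<zero>\<^bsub>G\<^esub> = \<zero>\<^bsub>G'\<^esub>"
  using group_hom.hom_one[OF additive_on_group_hom[OF assms]] by simp

lemma additive_on_minus:
  assumes "abelian_group G" "abelian_group G'" "additive_on G G' f" "x \<in> carrier G"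
  shows "f (\<ominus>\<^bsub>G\<^esub> x) = \<ominus>\<^bsub>G'\<^esub> f x"
  using group_hom.hom_inv[OF additive_on_group_hom[OF assms(1-3)]] assms(4) by (simp add: a_inv_def)

text \<open>The sum in \<^const>\<open>tensor_lift\<close> for an explicit representative.  It is a homomorphism in the
  representative, and this is the source of all rules for lifts and for Sweedler sums.\<close>

definition frag_eval :: "('g, 'p) ring_scheme \<Rightarrow> ('m \<Rightarrow> 'n \<Rightarrow> 'g) \<Rightarrow> ('m \<times> 'n \<Rightarrow>\<^sub>0 int) \<Rightarrow> 'g" where
  "frag_eval G f c = (\<Oplus>\<^bsub>G\<^esub>p\<in>Poly_Mapping.keys c. [Poly_Mapping.lookup c p] \<cdot>\<^bsub>G\<^esub> f (fst p) (snd p))"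

lemma tensor_lift_eq_frag_eval: "tensor_lift G f X = frag_eval G f (SOME c. c \<in> X)"
  by (simp add: tensor_lift_def frag_eval_def Let_def)

context
  fixes G :: "('g, 'p) ring_scheme" and f :: "'m \<Rightarrow> 'n \<Rightarrow> 'g" and P :: "'m set" and Q :: "'n set"
  assumes G: "abelian_group G" and f: "\<And>x y. x \<in> P \<Longrightarrow> y \<in> Q \<Longrightarrow> f x y \<in> carrier G"
begin

interpretation G: abelian_group G by (rule G)

lemma int_multiple_closed:
  fixes n :: int
  shows "p \<in> P \<times> Q \<Longrightarrow> [n] \<cdot>\<^bsub>G\<^esub> f (fst p) (snd p) \<in> carrier G"
  using f by (intro G.add.int_pow_closed) auto

lemma frag_eval_superset:
  assumes "finite K" "Poly_Mapping.keys c \<subseteq> K" "K \<subseteq> P \<times> Q"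
  shows "frag_eval G f c = (\<Oplus>\<^bsub>G\<^esub>p\<in>K. [Poly_Mapping.lookup c p] \<cdot>\<^bsub>G\<^esub> f (fst p) (snd p))"
  unfolding frag_eval_def
proof (rule G.add.finprod_mono_neutral_cong_left)
  show "\<And>i. i \<in> K - Poly_Mapping.keys c \<Longrightarrow> [Poly_Mapping.lookup c i] \<cdot>\<^bsub>G\<^esub> f (fst i) (snd i) = \<zero>\<^bsub>G\<^esub>"
    by (simp add: in_keys_iff add_pow_def int_pow_def)
  show "(\<lambda>p. [Poly_Mapping.lookup c p] \<cdot>\<^bsub>G\<^esub> f (fst p) (snd p)) \<in> K \<rightarrow> carrier G"
    by (rule funcsetI, rule int_multiple_closed) (use assms(3) in auto)
qed (use assms in auto)

lemma frag_eval_closed: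
  assumes "Poly_Mapping.keys c \<subseteq> P \<times> Q"
  shows "frag_eval G f c \<in> carrier G"
  unfolding frag_eval_def using assms by (intro G.finsum_closed funcsetI int_multiple_closed) auto

lemma frag_eval_add:
  assumes "Poly_Mapping.keys c \<subseteq> P \<times> Q" "Poly_Mapping.keys d \<subseteq> P \<times> Q"
  shows "frag_eval G f (c + d) = frag_eval G f c \<oplus>\<^bsub>G\<^esub> frag_eval G f d"
proof -
  let ?K = "Poly_Mapping.keys c \<union> Poly_Mapping.keys d"
  have K: "finite ?K" "?K \<subseteq> P \<times> Q" using assms by auto
  have c: "\<And>c :: 'm \<times> 'n \<Rightarrow>\<^sub>0 int. (\<lambda>p. [Poly_Mapping.lookup c p] \<cdot>\<^bsub>G\<^esub> f (fst p) (snd p)) \<in> ?K \<rightarrow> carrier G"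
    by (rule funcsetI, rule int_multiple_closed) (use K(2) in auto)
  have "frag_eval G f (c + d) = (\<Oplus>\<^bsub>G\<^esub>p\<in>?K. [Poly_Mapping.lookup (c + d) p] \<cdot>\<^bsub>G\<^esub> f (fst p) (snd p))"
    using K by (intro frag_eval_superset) (auto dest: subsetD[OF keys_add])
  also have "\<dots> = (\<Oplus>\<^bsub>G\<^esub>p\<in>?K. [Poly_Mapping.lookup c p] \<cdot>\<^bsub>G\<^esub> f (fst p) (snd p) \<oplus>\<^bsub>G\<^esub>
       [Poly_Mapping.lookup d p] \<cdot>\<^bsub>G\<^esub> f (fst p) (snd p))"
  proof (rule G.finsum_cong')
    show "(\<lambda>p. [Poly_Mapping.lookup c p] \<cdot>\<^bsub>G\<^esub> f (fst p) (snd p) \<oplus>\<^bsub>G\<^esub>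
       [Poly_Mapping.lookup d p] \<cdot>\<^bsub>G\<^esub> f (fst p) (snd p)) \<in> ?K \<rightarrow> carrier G"
      using c[of c] c[of d] by (simp add: Pi_def)
    fix p assume "p \<in> ?K"
    then have "f (fst p) (snd p) \<in> carrier G" using K(2) f by force
    then show "[Poly_Mapping.lookup (c + d) p] \<cdot>\<^bsub>G\<^esub> f (fst p) (snd p) =
      [Poly_Mapping.lookup c p] \<cdot>\<^bsub>G\<^esub> f (fst p) (snd p) \<oplus>\<^bsub>G\<^esub> [Poly_Mapping.lookup d p] \<cdot>\<^bsub>G\<^esub> f (fst p) (snd p)"
      by (simp add: lookup_add G.add.int_pow_mult)
  qed simp
  also have "\<dots> = (\<Oplus>\<^bsub>G\<^esub>p\<in>?K. [Poly_Mapping.lookup c p] \<cdot>\<^bsub>G\<^esub> f (fst p) (snd p)) \<oplus>\<^bsub>G\<^esub>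
       (\<Oplus>\<^bsub>G\<^esub>p\<in>?K. [Poly_Mapping.lookup d p] \<cdot>\<^bsub>G\<^esub> f (fst p) (snd p))"
    by (rule G.finsum_addf[OF c c])
  also have "\<dots> = frag_eval G f c \<oplus>\<^bsub>G\<^esub> frag_eval G f d"
    using K by (simp add: frag_eval_superset[of ?K])
  finally show ?thesis .
qed

lemma frag_eval_0: "frag_eval G f 0 = \<zero>\<^bsub>G\<^esub>"
  by (simp add: frag_eval_def)

lemma frag_eval_uminus:
  assumes "Poly_Mapping.keys c \<subseteq> P \<times> Q"
  shows "frag_eval G f (- c) = \<ominus>\<^bsub>G\<^esub> frag_eval G f c"
proof -
  have "frag_eval G f (- c) \<oplus>\<^bsub>G\<^esub> frag_eval G f c = \<zero>\<^bsub>G\<^esub>"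
    using frag_eval_add[of "- c" c] assms by (simp add: frag_eval_0)
  then show ?thesis using assms by (simp add: G.minus_equality frag_eval_closed)
qed

lemma frag_eval_diff:
  assumes "Poly_Mapping.keys c \<subseteq> P \<times> Q" "Poly_Mapping.keys d \<subseteq> P \<times> Q"
  shows "frag_eval G f (c - d) = frag_eval G f c \<ominus>\<^bsub>G\<^esub> frag_eval G f d"
  using frag_eval_add[of c "- d"] assms by (simp add: frag_eval_uminus a_minus_def)

lemma frag_eval_of:
  assumes "x \<in> P" "y \<in> Q"
  shows "frag_eval G f (frag_of (x, y)) = f x y"
  using f[OF assms] by (simp add: frag_eval_def)

end

lemma frag_eval_additive:
  assumes G: "abelian_group G" and G': "abelian_group G'" and p: "additive_on G G' \<phi>"
    and f: "\<And>x y. x \<in> P \<Longrightarrow> y \<in> Q \<Longrightarrow> f x y \<in> carrier G"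
    and c: "Poly_Mapping.keys c \<subseteq> P \<times> Q"
  shows "\<phi> (frag_eval G f c) = frag_eval G' (\<lambda>x y. \<phi> (f x y)) c"
proof -
  interpret G: abelian_group G by fact
  interpret G': abelian_group G' by fact
  have f': "\<phi> (f x y) \<in> carrier G'" if "x \<in> P" "y \<in> Q" for x y
    using that f additive_on_closed[OF p] by auto
  show ?thesis using c
  proof (induction c rule: free_Abelian_group_induct[consumes 1, case_names zero diff of])
    case zero
    show ?case using additive_on_zero[OF G G' p] by (simp add: frag_eval_def)
  next
    case (diff c d)
    then have "frag_eval G f c \<in> carrier G" "frag_eval G f d \<in> carrier G"
      using f by (auto intro!: frag_eval_closed[OF G, of P Q])
    then show ?case using diff
      by (simp add: frag_eval_diff[OF G f, of P Q] frag_eval_diff[OF G' f', of P Q] a_minus_def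
          additive_on_add[OF p] additive_on_minus[OF G G' p])
  next
    case (of a)
    then show ?case
      using frag_eval_of[OF G, of P Q f "fst a" "snd a"] frag_eval_of[OF G', of P Q "\<lambda>x y. \<phi> (f x y)" "fst a" "snd a"] f f'
      by (auto simp: mem_Times_iff)
  qed
qed

lemma frag_eval_fun_add:
  assumes G: "abelian_group G"
    and f: "\<And>x y. x \<in> P \<Longrightarrow> y \<in> Q \<Longrightarrow> f x y \<in> carrier G"
    and g: "\<And>x y. x \<in> P \<Longrightarrow> y \<in> Q \<Longrightarrow> g x y \<in> carrier G"
    and c: "Poly_Mapping.keys c \<subseteq> P \<times> Q"
  shows "frag_eval G (\<lambda>x y. f x y \<oplus>\<^bsub>G\<^esub> g x y) c = frag_eval G f c \<oplus>\<^bsub>G\<^esub> frag_eval G g c"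
proof -
  interpret G: abelian_group G by fact
  have fg: "f x y \<oplus>\<^bsub>G\<^esub> g x y \<in> carrier G" if "x \<in> P" "y \<in> Q" for x y
    using that f g by auto
  show ?thesis using c
  proof (induction c rule: free_Abelian_group_induct[consumes 1, case_names zero diff of])
    case zero
    show ?case by (simp add: frag_eval_def)
  next
    case (diff c d)
    then have "frag_eval G f c \<in> carrier G" "frag_eval G f d \<in> carrier G"
      "frag_eval G g c \<in> carrier G" "frag_eval G g d \<in> carrier G"
      using f g by (auto intro!: frag_eval_closed[OF G, of P Q])
    then show ?case using diff
      by (simp add: frag_eval_diff[OF G f, of P Q] frag_eval_diff[OF G g, of P Q]
          frag_eval_diff[OF G fg, of P Q] a_minus_def G.minus_add G.a_ac)
  next
    case (of a)
    then show ?case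
      using frag_eval_of[OF G, of P Q f "fst a" "snd a"] frag_eval_of[OF G, of P Q g "fst a" "snd a"]
        frag_eval_of[OF G, of P Q "\<lambda>x y. f x y \<oplus>\<^bsub>G\<^esub> g x y" "fst a" "snd a"] f g fg
      by (auto simp: mem_Times_iff)
  qed
qed

text \<open>Fubini for two independent formal combinations; Sweedler sums over different elements commute because of it.\<close>

lemma frag_eval_swap:
  assumes G: "abelian_group G"
    and f: "\<And>x y u v. x \<in> P \<Longrightarrow> y \<in> Q \<Longrightarrow> u \<in> P' \<Longrightarrow> v \<in> Q' \<Longrightarrow> f x y u v \<in> carrier G"
    and c: "Poly_Mapping.keys c \<subseteq> P \<times> Q" and d: "Poly_Mapping.keys d \<subseteq> P' \<times> Q'"
  shows "frag_eval G (\<lambda>x y. frag_eval G (f x y) d) c = frag_eval G (\<lambda>u v. frag_eval G (\<lambda>x y. f x y u v) c) d"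
proof -
  interpret G: abelian_group G by fact
  have 1: "frag_eval G (f x y) d \<in> carrier G" if "x \<in> P" "y \<in> Q" for x y
    by (rule frag_eval_closed[OF G, of P' Q']) (use that f d in auto)
  have 2: "frag_eval G (\<lambda>x y. f x y u v) c \<in> carrier G"
    if "u \<in> P'" "v \<in> Q'" "Poly_Mapping.keys c \<subseteq> P \<times> Q" for u v c
    by (rule frag_eval_closed[OF G, of P Q]) (use that f in auto)
  have 3: "frag_eval G (\<lambda>u v. frag_eval G (\<lambda>x y. f x y u v) c) d \<in> carrier G" if "Poly_Mapping.keys c \<subseteq> P \<times> Q" for c
    by (rule frag_eval_closed[OF G, of P' Q']) (use that 2 d in auto)
  have cong: "frag_eval G g d = frag_eval G g' d"
    if "\<And>u v. u \<in> P' \<Longrightarrow> v \<in> Q' \<Longrightarrow> g u v = g' u v" "\<And>u v. u \<in> P' \<Longrightarrow> v \<in> Q' \<Longrightarrow> g' u v \<in> carrier G" for g g'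
    unfolding frag_eval_def
    by (rule G.finsum_cong'[OF refl]) (use that d in \<open>force intro!: G.add.int_pow_closed\<close>)+
  have "frag_eval G (\<lambda>u v. frag_eval G (\<lambda>x y. f x y u v) (c - d')) d =
      frag_eval G (\<lambda>u v. frag_eval G (\<lambda>x y. f x y u v) c) d \<ominus>\<^bsub>G\<^esub> frag_eval G (\<lambda>u v. frag_eval G (\<lambda>x y. f x y u v) d') d"
    if "Poly_Mapping.keys c \<subseteq> P \<times> Q" "Poly_Mapping.keys d' \<subseteq> P \<times> Q" for c d'
  proof -
    have k: "Poly_Mapping.keys (c - d') \<subseteq> P \<times> Q" using keys_diff[of c d'] that by auto
    have "frag_eval G (\<lambda>u v. frag_eval G (\<lambda>x y. f x y u v) c) d =
      frag_eval G (\<lambda>u v. frag_eval G (\<lambda>x y. f x y u v) (c - d') \<oplus>\<^bsub>G\<^esub> frag_eval G (\<lambda>x y. f x y u v) d') d"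
    proof (rule cong)
      fix u v assume uv: "u \<in> P'" "v \<in> Q'"
      show "frag_eval G (\<lambda>x y. f x y u v) (c - d') \<oplus>\<^bsub>G\<^esub> frag_eval G (\<lambda>x y. f x y u v) d' \<in> carrier G"
        using 2[OF uv k] 2[OF uv that(2)] by simp
      have "frag_eval G (\<lambda>x y. f x y u v) (c - d') = frag_eval G (\<lambda>x y. f x y u v) c \<ominus>\<^bsub>G\<^esub> frag_eval G (\<lambda>x y. f x y u v) d'"
        by (rule frag_eval_diff[OF G, of P Q]) (use that uv f in auto)
      then show "frag_eval G (\<lambda>x y. f x y u v) c = frag_eval G (\<lambda>x y. f x y u v) (c - d') \<oplus>\<^bsub>G\<^esub> frag_eval G (\<lambda>x y. f x y u v) d'"
        using 2[OF uv that(1)] 2[OF uv that(2)] by (simp add: a_minus_def G.a_assoc G.l_neg)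
    qed
    also have "\<dots> = frag_eval G (\<lambda>u v. frag_eval G (\<lambda>x y. f x y u v) (c - d')) d \<oplus>\<^bsub>G\<^esub> frag_eval G (\<lambda>u v. frag_eval G (\<lambda>x y. f x y u v) d') d"
      by (rule frag_eval_fun_add[OF G _ _ d]) (use 2 k that in auto)
    finally show ?thesis using 3[OF k] 3[OF that(2)] by (simp add: a_minus_def G.a_assoc G.r_neg)
  qed
  note diff' = this
  show ?thesis using c
  proof (induction c rule: free_Abelian_group_induct[consumes 1, case_names zero diff of])
    case zero
    have "frag_eval G (\<lambda>u v. \<zero>\<^bsub>G\<^esub>) d = \<zero>\<^bsub>G\<^esub>"
      unfolding frag_eval_def using G.add.int_pow_one
      by (intro G.add.finprod_one_eqI) (simp add: add_pow_def)
    then show ?case by (simp add: frag_eval_def)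
  next
    case (diff c d')
    then show ?case by (simp add: diff' frag_eval_diff[OF G 1, of P Q])
  next
    case (of a)
    then have a: "fst a \<in> P" "snd a \<in> Q" by auto
    have "frag_eval G (\<lambda>u v. frag_eval G (\<lambda>x y. f x y u v) (frag_of a)) d = frag_eval G (f (fst a) (snd a)) d"
    proof (rule cong)
      fix u v assume "u \<in> P'" "v \<in> Q'"
      then show "frag_eval G (\<lambda>x y. f x y u v) (frag_of a) = f (fst a) (snd a) u v"
        using frag_eval_of[OF G, of P Q "\<lambda>x y. f x y u v" "fst a" "snd a"] f a by simp
    qed (use f a in auto)
    then show ?case using frag_eval_of[OF G, of P Q "\<lambda>x y. frag_eval G (f x y) d" "fst a" "snd a"] a 1 by simp
  qed
qed

text \<open>The relations of a tensor product mention the actions only through their values, so the actions are just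
  functions that preserve the carriers.  The locale thereby covers tensor products over \<open>k\<close>, where the
  right action is the left one, as well as those over \<open>A\<close>, where it is twisted by \<^const>\<open>tmap\<close>.\<close>

locale tensor_product =
  fixes R :: "'r set" and M :: "('m, 'p) ring_scheme" and ra :: "'m \<Rightarrow> 'r \<Rightarrow> 'm"
    and N :: "('n, 'q) ring_scheme" and la :: "'r \<Rightarrow> 'n \<Rightarrow> 'n"
  assumes M: "abelian_group M" and N: "abelian_group N"
    and ra_closed: "x \<in> carrier M \<Longrightarrow> r \<in> R \<Longrightarrow> ra x r \<in> carrier M"
    and la_closed: "y \<in> carrier N \<Longrightarrow> r \<in> R \<Longrightarrow> la r y \<in> carrier N"
begin

sublocale M: abelian_group M by (rule M)
sublocale N: abelian_group N by (rule N)

abbreviation "F \<equiv> free_Abelian_group (carrier M \<times> carrier N)"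
abbreviation "Rel \<equiv> tensor_relations R M ra N la"
abbreviation "T \<equiv> tensor_group R M ra N la"
abbreviation "pure \<equiv> tensor_pure R M ra N la"

sublocale F: comm_group F by (rule abelian_free_Abelian_group)

definition rel_gens :: "('m \<times> 'n \<Rightarrow>\<^sub>0 int) set" where
  "rel_gens = {frag_of (x \<oplus>\<^bsub>M\<^esub> x', y) - frag_of (x, y) - frag_of (x', y) | x x' y.
         x \<in> carrier M \<and> x' \<in> carrier M \<and> y \<in> carrier N} \<union>
      {frag_of (x, y \<oplus>\<^bsub>N\<^esub> y') - frag_of (x, y) - frag_of (x, y') | x y y'.
         x \<in> carrier M \<and> y \<in> carrier N \<and> y' \<in> carrier N} \<union>
      {frag_of (ra x r, y) - frag_of (x, la r y) | x r y.
         x \<in> carrier M \<and> r \<in> R \<and> y \<in> carrier N}"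

lemma Rel_eq: "Rel = generate F rel_gens"
  by (simp add: tensor_relations_def rel_gens_def)

lemma keys_diff_subset:
  "Poly_Mapping.keys a \<subseteq> S \<Longrightarrow> Poly_Mapping.keys b \<subseteq> S \<Longrightarrow> Poly_Mapping.keys (a - b) \<subseteq> S"
  using keys_diff[of a b] by blast

lemma rel_gens_subset: "rel_gens \<subseteq> carrier F"
proof
  fix r assume "r \<in> rel_gens"
  then show "r \<in> carrier F"
    unfolding rel_gens_def
    by (elim UnE CollectE exE conjE) (simp_all add: keys_diff_subset ra_closed la_closed)
qed

lemma Rel_subgroup: "subgroup Rel F"
  unfolding Rel_eq by (rule F.generate_is_subgroup[OF rel_gens_subset])

sublocale Rel: normal Rel F
  by (rule F.subgroup_imp_normal[OF Rel_subgroup])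

lemma coset_closed [simp]: "Poly_Mapping.keys c \<subseteq> carrier M \<times> carrier N \<Longrightarrow> Rel #>\<^bsub>F\<^esub> c \<in> carrier T"
  by (auto simp: tensor_group_def FactGroup_def Let_def intro!: F.rcosetsI Rel.subset)

lemma T_carrierE:
  assumes "X \<in> carrier T"
  obtains c where "Poly_Mapping.keys c \<subseteq> carrier M \<times> carrier N" "X = Rel #>\<^bsub>F\<^esub> c"
  using assms by (auto simp: tensor_group_def FactGroup_def Let_def RCOSETS_def)

lemma T_add:
  "Poly_Mapping.keys c \<subseteq> carrier M \<times> carrier N \<Longrightarrow> Poly_Mapping.keys d \<subseteq> carrier M \<times> carrier N \<Longrightarrow>
    (Rel #>\<^bsub>F\<^esub> c) \<oplus>\<^bsub>T\<^esub> (Rel #>\<^bsub>F\<^esub> d) = Rel #>\<^bsub>F\<^esub> (c + d)"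
  using Rel.rcos_sum[of c d] by (simp add: tensor_group_def FactGroup_def Let_def)

lemma T_zero: "\<zero>\<^bsub>T\<^esub> = Rel"
  by (simp add: tensor_group_def FactGroup_def Let_def)

lemma T_abelian: "abelian_group T"
proof (rule comm_group_abelian_groupI)
  have "comm_group (F Mod Rel)" by (rule F.abelian_FactGroup[OF Rel_subgroup])
  then show "comm_group (add_monoid T)"
    by (simp add: tensor_group_def Let_def FactGroup_def)
qed

sublocale T: abelian_group T by (rule T_abelian)

lemma coset_eq_iff:
  assumes "Poly_Mapping.keys c \<subseteq> carrier M \<times> carrier N" "Poly_Mapping.keys d \<subseteq> carrier M \<times> carrier N"
  shows "Rel #>\<^bsub>F\<^esub> c = Rel #>\<^bsub>F\<^esub> d \<longleftrightarrow> c - d \<in> Rel"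
proof -
  have "c \<in> Rel #>\<^bsub>F\<^esub> d \<longleftrightarrow> c - d \<in> Rel"
    by (force simp: r_coset_def)
  then show ?thesis
    using F.rcos_self[OF _ Rel_subgroup, of c] F.repr_independence[OF _ _ Rel_subgroup, of c d] assms by auto
qed

lemma pure_closed [simp, intro]: "x \<in> carrier M \<Longrightarrow> y \<in> carrier N \<Longrightarrow> pure x y \<in> carrier T"
  by (auto simp: tensor_pure_def intro!: coset_closed)

lemma pure_eqI:
  assumes "frag_of (x, y) - c \<in> rel_gens" "x \<in> carrier M" "y \<in> carrier N"
    "Poly_Mapping.keys c \<subseteq> carrier M \<times> carrier N"
  shows "pure x y = Rel #>\<^bsub>F\<^esub> c"
  unfolding tensor_pure_def
  by (subst coset_eq_iff) (use assms in \<open>auto simp: Rel_eq intro: generate.incl\<close>)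

lemma pure_add_left:
  assumes "x \<in> carrier M" "x' \<in> carrier M" "y \<in> carrier N"
  shows "pure (x \<oplus>\<^bsub>M\<^esub> x') y = pure x y \<oplus>\<^bsub>T\<^esub> pure x' y"
proof -
  have "pure (x \<oplus>\<^bsub>M\<^esub> x') y = Rel #>\<^bsub>F\<^esub> (frag_of (x, y) + frag_of (x', y))"
    by (rule pure_eqI) (use assms in \<open>auto simp: rel_gens_def algebra_simps dest: subsetD[OF keys_add]\<close>)
  then show ?thesis using assms by (simp add: tensor_pure_def T_add)
qed

lemma pure_add_right:
  assumes "x \<in> carrier M" "y \<in> carrier N" "y' \<in> carrier N"
  shows "pure x (y \<oplus>\<^bsub>N\<^esub> y') = pure x y \<oplus>\<^bsub>T\<^esub> pure x y'"
proof -
  have "pure x (y \<oplus>\<^bsub>N\<^esub> y') = Rel #>\<^bsub>F\<^esub> (frag_of (x, y) + frag_of (x, y'))"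
    by (rule pure_eqI) (use assms in \<open>auto simp: rel_gens_def algebra_simps dest: subsetD[OF keys_add]\<close>)
  then show ?thesis using assms by (simp add: tensor_pure_def T_add)
qed

lemma pure_balanced:
  assumes "x \<in> carrier M" "r \<in> R" "y \<in> carrier N"
  shows "pure (ra x r) y = pure x (la r y)"
proof -
  have "pure (ra x r) y = Rel #>\<^bsub>F\<^esub> frag_of (x, la r y)"
    by (rule pure_eqI) (use assms in \<open>auto simp: rel_gens_def ra_closed la_closed\<close>)
  then show ?thesis by (simp add: tensor_pure_def)
qed

lemma pure_additive_left: "y \<in> carrier N \<Longrightarrow> additive_on M T (\<lambda>x. pure x y)"
  by (rule additive_onI) (auto simp: pure_add_left)

lemma pure_additive_right: "x \<in> carrier M \<Longrightarrow> additive_on N T (pure x)"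
  by (rule additive_onI) (auto simp: pure_add_right)

text \<open>Negatives of pure tensors are pure, so sums of pure tensors already exhaust the tensor product.\<close>

lemma tensor_induct [consumes 1, case_names pure add]:
  assumes X: "X \<in> carrier T"
    and pure: "\<And>x y. x \<in> carrier M \<Longrightarrow> y \<in> carrier N \<Longrightarrow> P (pure x y)"
    and add: "\<And>X Y. X \<in> carrier T \<Longrightarrow> Y \<in> carrier T \<Longrightarrow> P X \<Longrightarrow> P Y \<Longrightarrow> P (X \<oplus>\<^bsub>T\<^esub> Y)"
  shows "P X"
proof -
  obtain c where c: "Poly_Mapping.keys c \<subseteq> carrier M \<times> carrier N" "X = Rel #>\<^bsub>F\<^esub> c"
    using X by (rule T_carrierE)
  have neg: "Rel #>\<^bsub>F\<^esub> (- c) = \<ominus>\<^bsub>T\<^esub> (Rel #>\<^bsub>F\<^esub> c)" if "Poly_Mapping.keys c \<subseteq> carrier M \<times> carrier N" for c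
  proof -
    have "(Rel #>\<^bsub>F\<^esub> (- c)) \<oplus>\<^bsub>T\<^esub> (Rel #>\<^bsub>F\<^esub> c) = Rel #>\<^bsub>F\<^esub> 0"
      using that by (subst T_add) auto
    also have "\<dots> = \<zero>\<^bsub>T\<^esub>" using F.coset_mult_one[OF Rel.subset] by (simp add: T_zero)
    finally show ?thesis using that by (simp add: T.minus_equality)
  qed
  have "P (Rel #>\<^bsub>F\<^esub> c) \<and> P (Rel #>\<^bsub>F\<^esub> (- c))"
    using c(1)
  proof (induction c rule: free_Abelian_group_induct[consumes 1, case_names zero diff of])
    case zero
    have "pure \<zero>\<^bsub>M\<^esub> \<zero>\<^bsub>N\<^esub> = \<zero>\<^bsub>T\<^esub>"
      using additive_on_zero[OF M T_abelian pure_additive_left[OF N.zero_closed]] .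
    then have "P \<zero>\<^bsub>T\<^esub>" using pure by (metis M.zero_closed N.zero_closed)
    moreover have "Rel #>\<^bsub>F\<^esub> 0 = \<zero>\<^bsub>T\<^esub>" using F.coset_mult_one[OF Rel.subset] by (simp add: T_zero)
    ultimately show ?case by simp
  next
    case (diff x y)
    have "P ((Rel #>\<^bsub>F\<^esub> x) \<oplus>\<^bsub>T\<^esub> (Rel #>\<^bsub>F\<^esub> (- y)))" "P ((Rel #>\<^bsub>F\<^esub> y) \<oplus>\<^bsub>T\<^esub> (Rel #>\<^bsub>F\<^esub> (- x)))"
      using diff by (auto intro!: add)
    then show ?case using diff by (simp add: T_add)
  next
    case (of a)
    obtain x y where a: "a = (x, y)" "x \<in> carrier M" "y \<in> carrier N" using of by auto
    have "\<ominus>\<^bsub>T\<^esub> pure x y = pure (\<ominus>\<^bsub>M\<^esub> x) y"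
      using additive_on_minus[OF M T_abelian pure_additive_left] a by simp
    then show ?case using a pure[of "\<ominus>\<^bsub>M\<^esub> x" y] pure[of x y] neg[of "frag_of a"]
      by (simp add: tensor_pure_def)
  qed
  then show ?thesis using c by simp
qed

lemma additive_eqI:
  assumes "additive_on T G f" "additive_on T G g" "X \<in> carrier T"
    and "\<And>x y. x \<in> carrier M \<Longrightarrow> y \<in> carrier N \<Longrightarrow> f (pure x y) = g (pure x y)"
  shows "f X = g X"
  using assms(3)
  by (induction X rule: tensor_induct) (simp_all add: assms(4) additive_on_add[OF assms(1)] additive_on_add[OF assms(2)])

definition balanced :: "('g, 's) ring_scheme \<Rightarrow> ('m \<Rightarrow> 'n \<Rightarrow> 'g) \<Rightarrow> bool" where
  "balanced G f \<longleftrightarrow> (\<forall>y\<in>carrier N. additive_on M G (\<lambda>x. f x y)) \<and> (\<forall>x\<in>carrier M. additive_on N G (f x)) \<and>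
     (\<forall>x\<in>carrier M. \<forall>r\<in>R. \<forall>y\<in>carrier N. f (ra x r) y = f x (la r y))"

lemma balancedI:
  assumes "\<And>y. y \<in> carrier N \<Longrightarrow> additive_on M G (\<lambda>x. f x y)" "\<And>x. x \<in> carrier M \<Longrightarrow> additive_on N G (f x)"
    "\<And>x r y. x \<in> carrier M \<Longrightarrow> r \<in> R \<Longrightarrow> y \<in> carrier N \<Longrightarrow> f (ra x r) y = f x (la r y)"
  shows "balanced G f"
  using assms by (simp add: balanced_def)

lemma representative_keys:
  assumes "X \<in> carrier T" "c \<in> X"
  shows "Poly_Mapping.keys c \<subseteq> carrier M \<times> carrier N"
proof -
  obtain d where d: "Poly_Mapping.keys d \<subseteq> carrier M \<times> carrier N" "X = Rel #>\<^bsub>F\<^esub> d"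
    using assms(1) by (rule T_carrierE)
  obtain r where r: "r \<in> Rel" "c = r + d" using assms(2) d(2) by (auto simp: r_coset_def)
  have "Poly_Mapping.keys r \<subseteq> carrier M \<times> carrier N" using subsetD[OF Rel.subset r(1)] by simp
  then show ?thesis using r(2) d(1) keys_add[of r d] by auto
qed

text \<open>A balanced function kills the generators of the relations, hence the subgroup generated by them; the
  representative chosen by \<^const>\<open>tensor_lift\<close> is therefore irrelevant.\<close>

lemma tensor_lift_coset:
  assumes G: "abelian_group G" and f: "balanced G f"
    and c: "Poly_Mapping.keys c \<subseteq> carrier M \<times> carrier N"
  shows "tensor_lift G f (Rel #>\<^bsub>F\<^esub> c) = frag_eval G f c"
proof -
  interpret G: abelian_group G by fact
  have fc: "\<And>x y. x \<in> carrier M \<Longrightarrow> y \<in> carrier N \<Longrightarrow> f x y \<in> carrier G"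
    using f by (auto simp: balanced_def additive_on_def)
  note ev = frag_eval_diff[OF G fc, of "carrier M" "carrier N"] frag_eval_of[OF G fc, of "carrier M" "carrier N"]
     frag_eval_add[OF G fc, of "carrier M" "carrier N"] frag_eval_uminus[OF G fc, of "carrier M" "carrier N"]
  have cancel_sum: "u \<oplus>\<^bsub>G\<^esub> v \<ominus>\<^bsub>G\<^esub> u \<ominus>\<^bsub>G\<^esub> v = \<zero>\<^bsub>G\<^esub>" if "u \<in> carrier G" "v \<in> carrier G" for u v
  proof -
    have "u \<oplus>\<^bsub>G\<^esub> v \<ominus>\<^bsub>G\<^esub> u = v" using that by (simp add: a_minus_def G.a_assoc G.a_comm[of u v] G.r_neg)
    then show ?thesis using that by (simp add: a_minus_def G.r_neg)
  qed
  have gens: "frag_eval G f r = \<zero>\<^bsub>G\<^esub>" if r: "r \<in> rel_gens" for r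
  proof -
    consider (l) x x' y where "r = frag_of (x \<oplus>\<^bsub>M\<^esub> x', y) - frag_of (x, y) - frag_of (x', y)"
         "x \<in> carrier M" "x' \<in> carrier M" "y \<in> carrier N"
      | (rt) x y y' where "r = frag_of (x, y \<oplus>\<^bsub>N\<^esub> y') - frag_of (x, y) - frag_of (x, y')"
         "x \<in> carrier M" "y \<in> carrier N" "y' \<in> carrier N"
      | (b) x s y where "r = frag_of (ra x s, y) - frag_of (x, la s y)" "x \<in> carrier M" "s \<in> R" "y \<in> carrier N"
      using r unfolding rel_gens_def by blast
    then show ?thesis
    proof cases
      case l
      then have "f (x \<oplus>\<^bsub>M\<^esub> x') y = f x y \<oplus>\<^bsub>G\<^esub> f x' y" using f by (auto simp: balanced_def additive_on_def)
      moreover have "f x y \<in> carrier G" "f x' y \<in> carrier G" using l fc by auto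
      ultimately have "f (x \<oplus>\<^bsub>M\<^esub> x') y \<ominus>\<^bsub>G\<^esub> f x y \<ominus>\<^bsub>G\<^esub> f x' y = \<zero>\<^bsub>G\<^esub>"
        by (simp add: cancel_sum)
      then show ?thesis using l by (simp add: ev keys_diff_subset)
    next
      case rt
      then have "f x (y \<oplus>\<^bsub>N\<^esub> y') = f x y \<oplus>\<^bsub>G\<^esub> f x y'" using f by (auto simp: balanced_def additive_on_def)
      moreover have "f x y \<in> carrier G" "f x y' \<in> carrier G" using rt fc by auto
      ultimately have "f x (y \<oplus>\<^bsub>N\<^esub> y') \<ominus>\<^bsub>G\<^esub> f x y \<ominus>\<^bsub>G\<^esub> f x y' = \<zero>\<^bsub>G\<^esub>"
        by (simp add: cancel_sum)
      then show ?thesis using rt by (simp add: ev keys_diff_subset)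
    next
      case b
      then have "f (ra x s) y = f x (la s y)" using f by (auto simp: balanced_def)
      then show ?thesis using b fc by (simp add: ev ra_closed la_closed G.r_neg a_minus_def)
    qed
  qed
  have Rel0: "frag_eval G f r = \<zero>\<^bsub>G\<^esub> \<and> Poly_Mapping.keys r \<subseteq> carrier M \<times> carrier N" if "r \<in> Rel" for r
    using that unfolding Rel_eq
  proof (induction r rule: generate.induct)
    case one
    show ?case by (simp add: frag_eval_0[OF G fc, of "carrier M" "carrier N"])
  next
    case (incl r)
    then show ?case using gens subsetD[OF rel_gens_subset incl] by simp
  next
    case (inv r)
    then have "Poly_Mapping.keys r \<subseteq> carrier M \<times> carrier N" using subsetD[OF rel_gens_subset inv] by simp
    then show ?case using gens[OF inv] by (simp add: ev)
  next
    case (eng r s)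
    then show ?case using keys_add[of r s] by (auto simp: ev)
  qed
  have "c \<in> Rel #>\<^bsub>F\<^esub> c" using F.rcos_self[OF _ Rel_subgroup] c by simp
  then have "(SOME d. d \<in> Rel #>\<^bsub>F\<^esub> c) \<in> Rel #>\<^bsub>F\<^esub> c" by (rule someI)
  then obtain r where r: "r \<in> Rel" "(SOME d. d \<in> Rel #>\<^bsub>F\<^esub> c) = r + c"
    by (auto simp: r_coset_def)
  then show ?thesis using Rel0[OF r(1)] c frag_eval_closed[OF G fc c]
    by (simp add: tensor_lift_eq_frag_eval ev)
qed

lemma tensor_lift_pure:
  assumes G: "abelian_group G" and f: "balanced G f" and "x \<in> carrier M" "y \<in> carrier N"
  shows "tensor_lift G f (pure x y) = f x y"
proof -
  have fc: "\<And>x y. x \<in> carrier M \<Longrightarrow> y \<in> carrier N \<Longrightarrow> f x y \<in> carrier G"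
    using f by (auto simp: balanced_def additive_on_def)
  show ?thesis unfolding tensor_pure_def
    by (subst tensor_lift_coset[OF G f]) (use assms fc in \<open>auto intro: frag_eval_of[OF G, of "carrier M" "carrier N"]\<close>)
qed

lemma tensor_lift_additive:
  assumes G: "abelian_group G" and f: "balanced G f"
  shows "additive_on T G (tensor_lift G f)"
proof (rule additive_onI)
  have fc: "\<And>x y. x \<in> carrier M \<Longrightarrow> y \<in> carrier N \<Longrightarrow> f x y \<in> carrier G"
    using f by (auto simp: balanced_def additive_on_def)
  fix X assume "X \<in> carrier T"
  then obtain c where c: "Poly_Mapping.keys c \<subseteq> carrier M \<times> carrier N" "X = Rel #>\<^bsub>F\<^esub> c"
    by (rule T_carrierE)
  then show "tensor_lift G f X \<in> carrier G"
    by (simp add: tensor_lift_coset[OF G f] frag_eval_closed[OF G fc])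
  fix Y assume "Y \<in> carrier T"
  then obtain d where d: "Poly_Mapping.keys d \<subseteq> carrier M \<times> carrier N" "Y = Rel #>\<^bsub>F\<^esub> d"
    by (rule T_carrierE)
  have "Poly_Mapping.keys (c + d) \<subseteq> carrier M \<times> carrier N"
    using c d keys_add[of c d] by auto
  then show "tensor_lift G f (X \<oplus>\<^bsub>T\<^esub> Y) = tensor_lift G f X \<oplus>\<^bsub>G\<^esub> tensor_lift G f Y"
    using c d by (simp add: T_add tensor_lift_coset[OF G f] frag_eval_add[OF G fc, of "carrier M" "carrier N"])
qed

end

text \<open>The same underlying group occurs in records of different types (rings, modules, tensor groups); the
  transfer lemmas move facts between them.\<close>

lemma abelian_group_transfer:
  assumes "abelian_group G" "carrier G' = carrier G" "add G' = add G" "\<zero>\<^bsub>G'\<^esub> = \<zero>\<^bsub>G\<^esub>"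
  shows "abelian_group G'"
proof -
  interpret G: abelian_group G by fact
  show ?thesis
    by (rule abelian_groupI) (auto simp: assms(2-4) G.a_ac intro: G.a_inv_closed G.l_neg)
qed

lemma frag_eval_transfer:
  assumes "carrier G' = carrier G" "add G' = add G" "\<zero>\<^bsub>G'\<^esub> = \<zero>\<^bsub>G\<^esub>"
  shows "frag_eval G' f c = frag_eval G f c"
  by (simp add: frag_eval_def finsum_def finprod_def add_pow_def int_pow_def nat_pow_def m_inv_def assms Let_def cong: if_cong)

lemma (in tensor_product) tensor_lift_cong:
  assumes G: "abelian_group G" and X: "X \<in> carrier T"
    and g: "\<And>x y. x \<in> carrier M \<Longrightarrow> y \<in> carrier N \<Longrightarrow> g x y \<in> carrier G"
    and eq: "\<And>x y. x \<in> carrier M \<Longrightarrow> y \<in> carrier N \<Longrightarrow> f x y = g x y"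
  shows "tensor_lift G f X = tensor_lift G g X"
proof -
  interpret G: abelian_group G by fact
  obtain c where "Poly_Mapping.keys c \<subseteq> carrier M \<times> carrier N" "X = Rel #>\<^bsub>F\<^esub> c"
    using X by (rule T_carrierE)
  then have "c \<in> X" using F.rcos_self[OF _ Rel_subgroup, of c] by simp
  then have "(SOME c. c \<in> X) \<in> X" by (rule someI)
  note keys = subsetD[OF representative_keys[OF X this]]
  show ?thesis unfolding tensor_lift_eq_frag_eval frag_eval_def
  proof (rule G.finsum_cong'[OF refl])
    show "(\<lambda>p. [Poly_Mapping.lookup (SOME c. c \<in> X) p] \<cdot>\<^bsub>G\<^esub> g (fst p) (snd p))
       \<in> Poly_Mapping.keys (SOME c. c \<in> X) \<rightarrow> carrier G"
      by (rule funcsetI, rule int_multiple_closed[OF G, of "carrier M" "carrier N"]) (use g keys in blast)+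
    show "[Poly_Mapping.lookup (SOME c. c \<in> X) p] \<cdot>\<^bsub>G\<^esub> f (fst p) (snd p) =
      [Poly_Mapping.lookup (SOME c. c \<in> X) p] \<cdot>\<^bsub>G\<^esub> g (fst p) (snd p)"
      if "p \<in> Poly_Mapping.keys (SOME c. c \<in> X)" for p
      using keys[OF that] eq by (simp add: mem_Times_iff)
  qed
qed

section \<open>Linear maps and tensor products over \<open>k\<close>\<close>

lemma linear_onI:
  assumes "\<And>x. x \<in> carrier M \<Longrightarrow> f x \<in> carrier N"
    and "\<And>x y. x \<in> carrier M \<Longrightarrow> y \<in> carrier M \<Longrightarrow> f (x \<oplus>\<^bsub>M\<^esub> y) = f x \<oplus>\<^bsub>N\<^esub> f y"
    and "\<And>r x. r \<in> carrier R \<Longrightarrow> x \<in> carrier M \<Longrightarrow> f (r \<odot>\<^bsub>M\<^esub> x) = r \<odot>\<^bsub>N\<^esub> f x"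
  shows "linear_on R M N f"
  using assms by (auto simp: linear_on_def)

lemma linear_on_additive: "linear_on R M N f \<Longrightarrow> additive_on M N f"
  by (auto simp: linear_on_def additive_on_def)

lemma linear_on_closed: "linear_on R M N f \<Longrightarrow> x \<in> carrier M \<Longrightarrow> f x \<in> carrier N"
  by (auto simp: linear_on_def)

lemma linear_on_add:
  "linear_on R M N f \<Longrightarrow> x \<in> carrier M \<Longrightarrow> y \<in> carrier M \<Longrightarrow> f (x \<oplus>\<^bsub>M\<^esub> y) = f x \<oplus>\<^bsub>N\<^esub> f y"
  by (auto simp: linear_on_def)

lemma linear_on_smult:
  "linear_on R M N f \<Longrightarrow> r \<in> carrier R \<Longrightarrow> x \<in> carrier M \<Longrightarrow> f (r \<odot>\<^bsub>M\<^esub> x) = r \<odot>\<^bsub>N\<^esub> f x"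
  by (auto simp: linear_on_def)

lemma linear_on_comp: "linear_on R N P g \<Longrightarrow> linear_on R M N f \<Longrightarrow> linear_on R M P (\<lambda>x. g (f x))"
  by (auto simp: linear_on_def Pi_def)

lemma linear_on_id: "linear_on R M M (\<lambda>x. x)"
  by (auto simp: linear_on_def)

lemma linear_on_cong:
  assumes "linear_on R M N g" "\<And>x. x \<in> carrier M \<Longrightarrow> f x = g x" "abelian_group M"
    "\<And>r x. r \<in> carrier R \<Longrightarrow> x \<in> carrier M \<Longrightarrow> r \<odot>\<^bsub>M\<^esub> x \<in> carrier M"
  shows "linear_on R M N f"
proof -
  interpret abelian_group M by fact
  show ?thesis using assms by (auto simp: linear_on_def Pi_def)
qed

lemma linear_on_smult_const:
  assumes "module k G" "c \<in> carrier k" "linear_on k M G f"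
  shows "linear_on k M G (\<lambda>x. c \<odot>\<^bsub>G\<^esub> f x)"
proof -
  interpret module k G by fact
  have comm: "c \<odot>\<^bsub>G\<^esub> (r \<odot>\<^bsub>G\<^esub> y) = r \<odot>\<^bsub>G\<^esub> (c \<odot>\<^bsub>G\<^esub> y)" if "r \<in> carrier k" "y \<in> carrier G" for r y
    using that assms(2) by (metis R.m_comm smult_assoc1)
  show ?thesis using assms(2,3) by (auto simp: linear_on_def Pi_def smult_r_distr comm)
qed

lemma k_algebraD:
  assumes "k_algebra k E"
  shows "module k E" "ring E"
    "\<And>c x y. c \<in> carrier k \<Longrightarrow> x \<in> carrier E \<Longrightarrow> y \<in> carrier E \<Longrightarrow> (c \<odot>\<^bsub>E\<^esub> x) \<otimes>\<^bsub>E\<^esub> y = c \<odot>\<^bsub>E\<^esub> (x \<otimes>\<^bsub>E\<^esub> y)"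
    "\<And>c x y. c \<in> carrier k \<Longrightarrow> x \<in> carrier E \<Longrightarrow> y \<in> carrier E \<Longrightarrow> x \<otimes>\<^bsub>E\<^esub> (c \<odot>\<^bsub>E\<^esub> y) = c \<odot>\<^bsub>E\<^esub> (x \<otimes>\<^bsub>E\<^esub> y)"
  using assms by (auto simp: k_algebra_def)

lemma linear_on_mult_right:
  assumes "k_algebra k E" "c \<in> carrier E" "linear_on k M E f"
  shows "linear_on k M E (\<lambda>x. f x \<otimes>\<^bsub>E\<^esub> c)"
proof -
  interpret ring E by (rule k_algebraD[OF assms(1)])
  show ?thesis using assms(2,3) by (auto simp: linear_on_def Pi_def l_distr k_algebraD[OF assms(1)])
qed

lemma linear_on_mult_left:
  assumes "k_algebra k E" "c \<in> carrier E" "linear_on k M E f"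
  shows "linear_on k M E (\<lambda>x. c \<otimes>\<^bsub>E\<^esub> f x)"
proof -
  interpret ring E by (rule k_algebraD[OF assms(1)])
  show ?thesis using assms(2,3) by (auto simp: linear_on_def Pi_def r_distr k_algebraD[OF assms(1)])
qed

definition bilinear_on ::
  "('r, 'p) ring_scheme \<Rightarrow> ('r, 'm, 'q) module_scheme \<Rightarrow> ('r, 'n, 's) module_scheme \<Rightarrow>
     ('r, 'g, 't) module_scheme \<Rightarrow> ('m \<Rightarrow> 'n \<Rightarrow> 'g) \<Rightarrow> bool" where
  "bilinear_on R M N G f \<longleftrightarrow> (\<forall>y\<in>carrier N. linear_on R M G (\<lambda>x. f x y)) \<and> (\<forall>x\<in>carrier M. linear_on R N G (f x))"

lemma bilinear_onI:
  assumes "\<And>y. y \<in> carrier N \<Longrightarrow> linear_on R M G (\<lambda>x. f x y)" "\<And>x. x \<in> carrier M \<Longrightarrow> linear_on R N G (\<lambda>y. f x y)"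
  shows "bilinear_on R M N G f"
  using assms by (auto simp: bilinear_on_def)

lemma bilinear_onD:
  assumes "bilinear_on R M N G f"
  shows "y \<in> carrier N \<Longrightarrow> linear_on R M G (\<lambda>x. f x y)" "x \<in> carrier M \<Longrightarrow> linear_on R N G (\<lambda>y. f x y)"
    "x \<in> carrier M \<Longrightarrow> y \<in> carrier N \<Longrightarrow> f x y \<in> carrier G"
  using assms by (auto simp: bilinear_on_def linear_on_def)

text \<open>Scalars act on a tensor product through the left factor.\<close>

locale tensor_scalars = tensor_product R M ra N la + Mk: module k M
  for k :: "('k, 'p) ring_scheme" and R :: "'r set" and M :: "('k, 'm, 'q) module_scheme" and ra
    and N :: "('n, 's) ring_scheme" and la +
  assumes ra_smult: "c \<in> carrier k \<Longrightarrow> x \<in> carrier M \<Longrightarrow> r \<in> R \<Longrightarrow> ra (c \<odot>\<^bsub>M\<^esub> x) r = c \<odot>\<^bsub>M\<^esub> ra x r"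
begin

definition TT :: "('k, ('m, 'n) tensor) module" where
  "TT = \<lparr>carrier = carrier T, monoid.mult = undefined, one = undefined, ring.zero = \<zero>\<^bsub>T\<^esub>, add = add T,
          smult = (\<lambda>c. tensor_lift T (\<lambda>x y. pure (c \<odot>\<^bsub>M\<^esub> x) y))\<rparr>"

lemma TT_simps:
  "carrier TT = carrier T" "\<zero>\<^bsub>TT\<^esub> = \<zero>\<^bsub>T\<^esub>" "add TT = add T"
  "smult TT = (\<lambda>c. tensor_lift T (\<lambda>x y. pure (c \<odot>\<^bsub>M\<^esub> x) y))"
  by (simp_all add: TT_def)

lemma scaled_pure_balanced:
  assumes c: "c \<in> carrier k"
  shows "balanced T (\<lambda>x y. pure (c \<odot>\<^bsub>M\<^esub> x) y)"
proof (rule balancedI)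
  fix y assume "y \<in> carrier N"
  then show "additive_on M T (\<lambda>x. pure (c \<odot>\<^bsub>M\<^esub> x) y)"
    using c by (intro additive_onI) (auto simp: Mk.smult_r_distr pure_add_left)
next
  fix x assume "x \<in> carrier M"
  then show "additive_on N T (pure (c \<odot>\<^bsub>M\<^esub> x))"
    using c by (auto intro!: pure_additive_right)
next
  fix x r y assume *: "x \<in> carrier M" "r \<in> R" "y \<in> carrier N"
  then show "pure (c \<odot>\<^bsub>M\<^esub> ra x r) y = pure (c \<odot>\<^bsub>M\<^esub> x) (la r y)"
    using pure_balanced[of "c \<odot>\<^bsub>M\<^esub> x" r y] c by (simp add: ra_smult[symmetric])
qed

lemma smult_pure:
  assumes "c \<in> carrier k" "x \<in> carrier M" "y \<in> carrier N"
  shows "c \<odot>\<^bsub>TT\<^esub> pure x y = pure (c \<odot>\<^bsub>M\<^esub> x) y"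
  unfolding TT_simps using tensor_lift_pure[OF T_abelian scaled_pure_balanced] assms by blast

lemma smult_additive: "c \<in> carrier k \<Longrightarrow> additive_on T T (\<lambda>X. c \<odot>\<^bsub>TT\<^esub> X)"
  unfolding TT_simps using tensor_lift_additive[OF T_abelian scaled_pure_balanced] by auto

lemma TT_module: "module k TT"
proof (rule moduleI)
  show "cring k" by (rule Mk.R.is_cring)
  show "abelian_group TT" by (rule abelian_group_transfer[OF T_abelian]) (simp_all add: TT_simps)
  note smult_closed = additive_on_closed[OF smult_additive]
  fix c X assume c: "c \<in> carrier k" and X: "X \<in> carrier TT"
  show "c \<odot>\<^bsub>TT\<^esub> X \<in> carrier TT"
    using smult_closed c X by (simp add: TT_simps(1))
  show "c \<odot>\<^bsub>TT\<^esub> (X \<oplus>\<^bsub>TT\<^esub> Y) = c \<odot>\<^bsub>TT\<^esub> X \<oplus>\<^bsub>TT\<^esub> c \<odot>\<^bsub>TT\<^esub> Y" if "Y \<in> carrier TT" for Y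
    using additive_on_add[OF smult_additive[OF c]] that X by (simp add: TT_simps(1,3))
  fix d assume d: "d \<in> carrier k"
  have X': "X \<in> carrier T" using X by (simp add: TT_simps)
  have sum: "additive_on T T (\<lambda>X. c \<odot>\<^bsub>TT\<^esub> X \<oplus>\<^bsub>T\<^esub> d \<odot>\<^bsub>TT\<^esub> X)"
  proof (rule additive_onI)
    fix X Y assume XY: "X \<in> carrier T" "Y \<in> carrier T"
    have cl: "c \<odot>\<^bsub>TT\<^esub> X \<in> carrier T" "d \<odot>\<^bsub>TT\<^esub> X \<in> carrier T" "c \<odot>\<^bsub>TT\<^esub> Y \<in> carrier T" "d \<odot>\<^bsub>TT\<^esub> Y \<in> carrier T"
      using smult_closed c d XY by auto
    show "c \<odot>\<^bsub>TT\<^esub> X \<oplus>\<^bsub>T\<^esub> d \<odot>\<^bsub>TT\<^esub> X \<in> carrier T" using cl by auto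
    show "c \<odot>\<^bsub>TT\<^esub> (X \<oplus>\<^bsub>T\<^esub> Y) \<oplus>\<^bsub>T\<^esub> d \<odot>\<^bsub>TT\<^esub> (X \<oplus>\<^bsub>T\<^esub> Y) =
       c \<odot>\<^bsub>TT\<^esub> X \<oplus>\<^bsub>T\<^esub> d \<odot>\<^bsub>TT\<^esub> X \<oplus>\<^bsub>T\<^esub> (c \<odot>\<^bsub>TT\<^esub> Y \<oplus>\<^bsub>T\<^esub> d \<odot>\<^bsub>TT\<^esub> Y)"
      using cl XY by (simp add: additive_on_add[OF smult_additive[OF c]] additive_on_add[OF smult_additive[OF d]] T.a_ac)
  qed
  have "(c \<oplus>\<^bsub>k\<^esub> d) \<odot>\<^bsub>TT\<^esub> X = c \<odot>\<^bsub>TT\<^esub> X \<oplus>\<^bsub>T\<^esub> d \<odot>\<^bsub>TT\<^esub> X"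
    by (rule additive_eqI[OF smult_additive sum X'])
      (use c d in \<open>auto simp: smult_pure Mk.smult_l_distr pure_add_left\<close>)
  then show "(c \<oplus>\<^bsub>k\<^esub> d) \<odot>\<^bsub>TT\<^esub> X = c \<odot>\<^bsub>TT\<^esub> X \<oplus>\<^bsub>TT\<^esub> d \<odot>\<^bsub>TT\<^esub> X"
    by (simp add: TT_simps(3))
  show "(c \<otimes>\<^bsub>k\<^esub> d) \<odot>\<^bsub>TT\<^esub> X = c \<odot>\<^bsub>TT\<^esub> (d \<odot>\<^bsub>TT\<^esub> X)"
    by (rule additive_eqI[OF smult_additive additive_on_comp[OF smult_additive[OF d] smult_additive[OF c]] X'])
      (use c d in \<open>auto simp: smult_pure Mk.smult_assoc1\<close>)
next
  fix X assume X: "X \<in> carrier TT"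
  show "\<one>\<^bsub>k\<^esub> \<odot>\<^bsub>TT\<^esub> X = X"
    by (rule additive_eqI[OF smult_additive, where g = "\<lambda>X. X"])
      (use X in \<open>auto simp: smult_pure TT_simps(1) additive_on_def\<close>)
qed

lemma pure_linear_left: "y \<in> carrier N \<Longrightarrow> linear_on k M TT (\<lambda>x. pure x y)"
  by (intro linear_onI) (auto simp: TT_simps(1,3) pure_add_left smult_pure)

lemma tensor_lift_scalar_linear:
  assumes "module k G" and f: "balanced G f" and l: "\<And>y. y \<in> carrier N \<Longrightarrow> linear_on k M G (\<lambda>x. f x y)"
  shows "linear_on k TT G (tensor_lift G f)"
proof -
  interpret G: module k G by fact
  have add: "additive_on T G (tensor_lift G f)" by (rule tensor_lift_additive[OF G.abelian_group_axioms f])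
  show ?thesis
  proof (rule linear_onI)
    fix c X assume c: "c \<in> carrier k" "X \<in> carrier TT"
    have sc: "additive_on G G (\<lambda>x. c \<odot>\<^bsub>G\<^esub> x)" using c by (intro additive_onI) (auto simp: G.smult_r_distr)
    show "tensor_lift G f (c \<odot>\<^bsub>TT\<^esub> X) = c \<odot>\<^bsub>G\<^esub> tensor_lift G f X"
      by (rule additive_eqI[OF additive_on_comp[OF smult_additive[OF c(1)] add] additive_on_comp[OF add sc]])
        (use c in \<open>auto simp: smult_pure TT_simps(1) tensor_lift_pure[OF G.abelian_group_axioms f] linear_on_smult[OF l]\<close>)
  qed (use add in \<open>auto simp: additive_on_def TT_simps\<close>)
qed

end

locale tensor_k_product = M: module k M + N: module k N
  for k :: "('k, 'p) ring_scheme" and M :: "('k, 'm, 'q) module_scheme" and N :: "('k, 'n, 's) module_scheme"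
begin

sublocale tp: tensor_scalars k "carrier k" M "\<lambda>x c. c \<odot>\<^bsub>M\<^esub> x" N "smult N"
proof unfold_locales
  show "r \<odot>\<^bsub>M\<^esub> (c \<odot>\<^bsub>M\<^esub> x) = c \<odot>\<^bsub>M\<^esub> (r \<odot>\<^bsub>M\<^esub> x)"
    if "c \<in> carrier k" "x \<in> carrier M" "r \<in> carrier k" for c x r
    using that by (metis M.R.m_comm M.smult_assoc1)
qed auto

abbreviation "TT \<equiv> tensor_k k M N"

lemma TT_eq: "tp.TT = TT"
  by (simp add: tensor_k_def tp.TT_def Let_def)

lemmas TT_simps = tp.TT_simps[unfolded TT_eq] and TT_module = tp.TT_module[unfolded TT_eq]
  and smult_pure = tp.smult_pure[unfolded TT_eq]

lemma pure_k_eq: "pure_k k M N = tp.pure"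
  by (simp add: pure_k_def)

lemma pure_bilinear: "bilinear_on k M N TT (pure_k k M N)"
proof (rule bilinear_onI)
  fix y assume y: "y \<in> carrier N"
  then show "linear_on k M TT (\<lambda>x. pure_k k M N x y)"
    by (intro linear_onI) (auto simp: pure_k_eq TT_simps(1,3) tp.pure_add_left smult_pure)
next
  fix x assume y: "x \<in> carrier M"
  then show "linear_on k N TT (pure_k k M N x)"
    by (intro linear_onI) (auto simp: pure_k_eq TT_simps(1,3) tp.pure_add_right smult_pure tp.pure_balanced)
qed

lemma bilinear_balanced:
  assumes "bilinear_on k M N G f"
  shows "tp.balanced G f"
proof (rule tp.balancedI)
  show "additive_on M G (\<lambda>x. f x y)" if "y \<in> carrier N" for y
    using bilinear_onD(1)[OF assms that] by (rule linear_on_additive)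
  show "additive_on N G (f x)" if "x \<in> carrier M" for x
    using bilinear_onD(2)[OF assms that] by (rule linear_on_additive)
  show "f (r \<odot>\<^bsub>M\<^esub> x) y = f x (r \<odot>\<^bsub>N\<^esub> y)" if "x \<in> carrier M" "r \<in> carrier k" "y \<in> carrier N" for x y r
    using linear_on_smult[OF bilinear_onD(1)[OF assms]] linear_on_smult[OF bilinear_onD(2)[OF assms]] that by simp
qed

lemma tensor_lift_linear:
  assumes "module k G" "bilinear_on k M N G f"
  shows "linear_on k TT G (tensor_lift G f)"
  using tp.tensor_lift_scalar_linear[OF assms(1) bilinear_balanced[OF assms(2)] bilinear_onD(1)[OF assms(2)]]
  by (simp add: TT_eq)

lemma tensor_lift_pure_k:
  assumes "module k G" "bilinear_on k M N G f" "x \<in> carrier M" "y \<in> carrier N"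
  shows "tensor_lift G f (pure_k k M N x y) = f x y"
proof -
  interpret G: module k G by fact
  show ?thesis unfolding pure_k_eq
    by (rule tp.tensor_lift_pure[OF G.abelian_group_axioms bilinear_balanced[OF assms(2)] assms(3,4)])
qed

end

section \<open>Sweedler notation\<close>

context hopf_algebra
begin

abbreviation HC where "HC \<equiv> carrier H"
abbreviation S where "S \<equiv> antipode H"
abbreviation \<epsilon> where "\<epsilon> \<equiv> counit H"
abbreviation hmult (infixl "\<star>" 70) where "x \<star> y \<equiv> x \<otimes>\<^bsub>H\<^esub> y"
abbreviation unit where "unit \<equiv> \<one>\<^bsub>H\<^esub>"
abbreviation sw where "sw \<equiv> sweedler H"

sublocale k: cring k by (rule k_cring)
sublocale HM: module k H by (rule k_algebraD[OF H_algebra])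
sublocale H: ring H by (rule k_algebraD[OF H_algebra])
sublocale HH: tensor_k_product k H H by unfold_locales

lemma HHH: "tensor_k_product k H (tensor_k k H H)"
  unfolding tensor_k_product_def using HH.TT_module HM.module_axioms by simp

lemma S_closed [simp, intro]: "x \<in> HC \<Longrightarrow> S x \<in> HC"
  using linear_on_closed[OF antipode_linear] .

lemma counit_closed [simp, intro]: "x \<in> HC \<Longrightarrow> \<epsilon> x \<in> carrier k"
  using counit_linear(1) by auto

lemma comul_closed: "h \<in> HC \<Longrightarrow> comul H h \<in> carrier HH.tp.T"
  using linear_on_closed[OF comul_linear] by (simp add: HH.TT_simps)

lemma sw_eq: "sw G f h = frag_eval G f (SOME c. c \<in> comul H h)"
  by (simp add: sweedler_def tensor_lift_eq_frag_eval)

lemma sw_representative: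
  assumes "h \<in> HC"
  shows "Poly_Mapping.keys (SOME c. c \<in> comul H h) \<subseteq> HC \<times> HC"
proof (rule HH.tp.representative_keys[OF comul_closed[OF assms]])
  obtain c where "Poly_Mapping.keys c \<subseteq> HC \<times> HC" "comul H h = HH.tp.Rel #>\<^bsub>HH.tp.F\<^esub> c"
    using comul_closed[OF assms] by (rule HH.tp.T_carrierE)
  then have "c \<in> comul H h" using HH.tp.F.rcos_self[OF _ HH.tp.Rel_subgroup, of c] by simp
  then show "(SOME c. c \<in> comul H h) \<in> comul H h" by (rule someI)
qed

lemma sw_closed [intro]:
  assumes "abelian_group G" "h \<in> HC" "\<And>x y. x \<in> HC \<Longrightarrow> y \<in> HC \<Longrightarrow> f x y \<in> carrier G"
  shows "sw G f h \<in> carrier G"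
  unfolding sw_eq by (rule frag_eval_closed[OF assms(1), of HC HC]) (use assms sw_representative in blast)+

lemma sw_cong:
  assumes "abelian_group G" "h \<in> HC" "\<And>x y. x \<in> HC \<Longrightarrow> y \<in> HC \<Longrightarrow> g x y \<in> carrier G"
    "\<And>x y. x \<in> HC \<Longrightarrow> y \<in> HC \<Longrightarrow> f x y = g x y"
  shows "sw G f h = sw G g h"
  unfolding sweedler_def
  by (rule HH.tp.tensor_lift_cong[OF assms(1) comul_closed[OF assms(2)]]) (use assms in auto)

lemma sw_additive:
  assumes "abelian_group G" "abelian_group G'" "additive_on G G' \<phi>" "h \<in> HC"
    "\<And>x y. x \<in> HC \<Longrightarrow> y \<in> HC \<Longrightarrow> f x y \<in> carrier G"
  shows "\<phi> (sw G f h) = sw G' (\<lambda>x y. \<phi> (f x y)) h"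
  unfolding sw_eq by (rule frag_eval_additive[OF assms(1-3), of HC HC]) (use assms sw_representative in blast)+

lemma sw_add:
  assumes "abelian_group G" "h \<in> HC"
    "\<And>x y. x \<in> HC \<Longrightarrow> y \<in> HC \<Longrightarrow> f x y \<in> carrier G" "\<And>x y. x \<in> HC \<Longrightarrow> y \<in> HC \<Longrightarrow> g x y \<in> carrier G"
  shows "sw G (\<lambda>x y. f x y \<oplus>\<^bsub>G\<^esub> g x y) h = sw G f h \<oplus>\<^bsub>G\<^esub> sw G g h"
  unfolding sw_eq by (rule frag_eval_fun_add[OF assms(1), of HC HC]) (use assms sw_representative in blast)+

lemma sw_swap:
  assumes "abelian_group G" "h \<in> HC" "l \<in> HC"
    "\<And>x y u v. x \<in> HC \<Longrightarrow> y \<in> HC \<Longrightarrow> u \<in> HC \<Longrightarrow> v \<in> HC \<Longrightarrow> f x y u v \<in> carrier G"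
  shows "sw G (\<lambda>x y. sw G (\<lambda>u v. f x y u v) l) h = sw G (\<lambda>u v. sw G (\<lambda>x y. f x y u v) h) l"
  unfolding sw_eq by (rule frag_eval_swap[OF assms(1), of HC HC HC HC]) (use assms sw_representative in blast)+

lemma sw_tensor_lift: "sw G f h = tensor_lift G f (comul H h)"
  by (simp add: sweedler_def)

lemma sw_linear:
  assumes "module k G" "bilinear_on k H H G f"
  shows "linear_on k H G (sw G f)"
  unfolding sw_tensor_lift by (rule linear_on_comp[OF HH.tensor_lift_linear[OF assms] comul_linear])

text \<open>A Sweedler sum of linear maps is linear: the components are fixed by the representative of the coproduct.\<close>

lemma sw_body_linear:
  assumes G: "module k G" and h: "h \<in> HC" and M: "module k M"
    and F: "\<And>u v. u \<in> HC \<Longrightarrow> v \<in> HC \<Longrightarrow> linear_on k M G (\<lambda>x. F x u v)"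
  shows "linear_on k M G (\<lambda>x. sw G (F x) h)"
proof -
  interpret G: module k G by fact
  interpret M: module k M by fact
  show ?thesis
  proof (rule linear_onI)
    fix x assume x: "x \<in> carrier M"
    show "sw G (F x) h \<in> carrier G"
      by (rule sw_closed[OF G.abelian_group_axioms h linear_on_closed[OF F x]])
    have "sw G (F (x \<oplus>\<^bsub>M\<^esub> y)) h = sw G (\<lambda>u v. F x u v \<oplus>\<^bsub>G\<^esub> F y u v) h" if y: "y \<in> carrier M" for y
      by (rule sw_cong[OF G.abelian_group_axioms h]) (use x y in \<open>auto simp: linear_on_add[OF F] intro!: linear_on_closed[OF F]\<close>)
    then show "sw G (F (x \<oplus>\<^bsub>M\<^esub> y)) h = sw G (F x) h \<oplus>\<^bsub>G\<^esub> sw G (F y) h" if y: "y \<in> carrier M" for y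
      using y x by (simp add: sw_add[OF G.abelian_group_axioms h] linear_on_closed[OF F])
    fix r assume r: "r \<in> carrier k"
    have "additive_on G G (\<lambda>x. r \<odot>\<^bsub>G\<^esub> x)" using r by (intro additive_onI) (auto simp: G.smult_r_distr)
    then have "r \<odot>\<^bsub>G\<^esub> sw G (F x) h = sw G (\<lambda>u v. r \<odot>\<^bsub>G\<^esub> F x u v) h"
      by (rule sw_additive[OF G.abelian_group_axioms G.abelian_group_axioms]) (use h x linear_on_closed[OF F] in auto)
    also have "\<dots> = sw G (F (r \<odot>\<^bsub>M\<^esub> x)) h"
      by (rule sw_cong[OF G.abelian_group_axioms h]) (use x r in \<open>auto simp: linear_on_smult[OF F] intro!: linear_on_closed[OF F]\<close>)
    finally show "sw G (F (r \<odot>\<^bsub>M\<^esub> x)) h = r \<odot>\<^bsub>G\<^esub> sw G (F x) h" by simp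
  qed
qed

text \<open>Coassociativity, \<open>F(h\<^sub>1, h\<^sub>2, h\<^sub>3)\<close> being well defined.  The equation of \<^locale>\<open>hopf_algebra\<close> lives in the threefold tensor
  product; the linear map induced by \<open>F\<close> carries it to \<open>G\<close>.\<close>

lemma sw_coassoc:
  assumes G: "module k G" and h: "h \<in> HC"
    and F1: "\<And>y z. y \<in> HC \<Longrightarrow> z \<in> HC \<Longrightarrow> linear_on k H G (\<lambda>x. F x y z)"
    and F2: "\<And>x z. x \<in> HC \<Longrightarrow> z \<in> HC \<Longrightarrow> linear_on k H G (\<lambda>y. F x y z)"
    and F3: "\<And>x y. x \<in> HC \<Longrightarrow> y \<in> HC \<Longrightarrow> linear_on k H G (\<lambda>z. F x y z)"
  shows "sw G (\<lambda>x z. sw G (\<lambda>u v. F u v z) x) h = sw G (\<lambda>u y. sw G (\<lambda>v z. F u v z) y) h"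
proof -
  interpret G: module k G by fact
  interpret HHH: tensor_k_product k H "tensor_k k H H" by (rule HHH)
  note Gg = G.abelian_group_axioms
  have Fc: "F x y z \<in> carrier G" if "x \<in> HC" "y \<in> HC" "z \<in> HC" for x y z
    using linear_on_closed[OF F1] that by auto
  let ?T3 = "tensor_k k H (tensor_k k H H)"
  interpret T3: module k ?T3 by (rule HHH.TT_module)
  interpret T2: module k "tensor_k k H H" by (rule HH.TT_module)
  have bil: "bilinear_on k H H G (F x)" if "x \<in> HC" for x
    by (rule bilinear_onI) (use that F2 F3 in auto)
  define \<Phi> where "\<Phi> = (\<lambda>x t. tensor_lift G (F x) t)"
  have \<Phi>: "bilinear_on k H (tensor_k k H H) G \<Phi>"
  proof (rule bilinear_onI)
    show "linear_on k (tensor_k k H H) G (\<lambda>t. \<Phi> x t)" if "x \<in> HC" for x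
      unfolding \<Phi>_def by (rule HH.tensor_lift_linear[OF G bil[OF that]])
    have \<Phi>add: "additive_on HH.tp.T G (\<Phi> x)" if "x \<in> HC" for x
      unfolding \<Phi>_def by (rule HH.tp.tensor_lift_additive[OF Gg HH.bilinear_balanced[OF bil[OF that]]])
    have \<Phi>pure: "\<Phi> x (HH.tp.pure y z) = F x y z" if "x \<in> HC" "y \<in> HC" "z \<in> HC" for x y z
      unfolding \<Phi>_def by (rule HH.tp.tensor_lift_pure[OF Gg HH.bilinear_balanced[OF bil]]) (use that in auto)
    fix t assume "t \<in> carrier (tensor_k k H H)"
    then have t: "t \<in> carrier HH.tp.T" by (simp add: HH.TT_simps)
    show "linear_on k H G (\<lambda>x. \<Phi> x t)"
      using t
    proof (induction t rule: HH.tp.tensor_induct)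
      case (pure y z)
      show ?case by (rule linear_on_cong[OF F1[OF pure]]) (use pure \<Phi>pure HM.abelian_group_axioms in auto)
    next
      case (add X Y)
      have c: "\<Phi> x X \<in> carrier G" "\<Phi> x Y \<in> carrier G" if "x \<in> HC" for x
        using that additive_on_closed[OF \<Phi>add] add by auto
      show ?case
        by (rule linear_onI) (simp_all add: additive_on_add[OF \<Phi>add] add.hyps c linear_on_add[OF add.IH(1)] linear_on_add[OF add.IH(2)]
           linear_on_smult[OF add.IH(1)] linear_on_smult[OF add.IH(2)] G.a_ac G.smult_r_distr)
    qed
  qed
  have lin: "linear_on k ?T3 G (tensor_lift G \<Phi>)" by (rule HHH.tensor_lift_linear[OF G \<Phi>])
  note add = linear_on_additive[OF lin]
  have p3: "tensor_lift G \<Phi> (pure_k k H (tensor_k k H H) x t) = \<Phi> x t" if "x \<in> HC" "t \<in> carrier (tensor_k k H H)" for x t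
    by (rule HHH.tensor_lift_pure_k[OF G \<Phi> that])
  have p2: "\<Phi> x (pure_k k H H y z) = F x y z" if "x \<in> HC" "y \<in> HC" "z \<in> HC" for x y z
    unfolding \<Phi>_def by (rule HH.tensor_lift_pure_k[OF G bil]) (use that in auto)
  note pc = bilinear_onD(3)[OF HH.pure_bilinear] bilinear_onD(3)[OF HHH.pure_bilinear]
  have "tensor_lift G \<Phi> (sw ?T3 (\<lambda>x z. sw ?T3 (\<lambda>x1 x2. pure_k k H (tensor_k k H H) x1 (pure_k k H H x2 z)) x) h) =
     sw G (\<lambda>x z. tensor_lift G \<Phi> (sw ?T3 (\<lambda>x1 x2. pure_k k H (tensor_k k H H) x1 (pure_k k H H x2 z)) x)) h"
    by (rule sw_additive[OF T3.abelian_group_axioms Gg add h]) (auto intro!: sw_closed T3.abelian_group_axioms pc)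
  also have "\<dots> = sw G (\<lambda>x z. sw G (\<lambda>u v. F u v z) x) h"
  proof (rule sw_cong[OF Gg h])
    fix x z assume xz: "x \<in> HC" "z \<in> HC"
    show "sw G (\<lambda>u v. F u v z) x \<in> carrier G" by (rule sw_closed[OF Gg]) (use xz Fc in auto)
    have "tensor_lift G \<Phi> (sw ?T3 (\<lambda>x1 x2. pure_k k H (tensor_k k H H) x1 (pure_k k H H x2 z)) x) =
      sw G (\<lambda>x1 x2. tensor_lift G \<Phi> (pure_k k H (tensor_k k H H) x1 (pure_k k H H x2 z))) x"
      by (rule sw_additive[OF T3.abelian_group_axioms Gg add]) (use xz in \<open>auto intro!: pc\<close>)
    also have "\<dots> = sw G (\<lambda>u v. F u v z) x"
      by (rule sw_cong[OF Gg]) (use xz in \<open>auto simp: p3 p2 pc Fc\<close>)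
    finally show "tensor_lift G \<Phi> (sw ?T3 (\<lambda>x1 x2. pure_k k H (tensor_k k H H) x1 (pure_k k H H x2 z)) x) = sw G (\<lambda>u v. F u v z) x" .
  qed
  finally have L: "tensor_lift G \<Phi> (sw ?T3 (\<lambda>x z. sw ?T3 (\<lambda>x1 x2. pure_k k H (tensor_k k H H) x1 (pure_k k H H x2 z)) x) h) =
     sw G (\<lambda>x z. sw G (\<lambda>u v. F u v z) x) h" .
  have cm: "comul H y \<in> carrier (tensor_k k H H)" if "y \<in> HC" for y
    using linear_on_closed[OF comul_linear that] .
  have \<Phi>_comul: "\<Phi> x (comul H y) = sw G (F x) y" for x y
    by (simp add: \<Phi>_def sw_tensor_lift)
  have "tensor_lift G \<Phi> (sw ?T3 (\<lambda>x y. pure_k k H (tensor_k k H H) x (comul H y)) h) =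
     sw G (\<lambda>x y. tensor_lift G \<Phi> (pure_k k H (tensor_k k H H) x (comul H y))) h"
    by (rule sw_additive[OF T3.abelian_group_axioms Gg add h]) (auto intro!: pc cm)
  also have "\<dots> = sw G (\<lambda>u y. sw G (\<lambda>v z. F u v z) y) h"
    by (rule sw_cong[OF Gg h]) (auto simp: p3 cm \<Phi>_comul intro!: sw_closed Gg Fc)
  finally show ?thesis using coassoc[OF h] L by simp
qed

lemma sw_comul_mult:
  assumes G: "module k G" and h: "h \<in> HC" "l \<in> HC" and F: "bilinear_on k H H G F"
  shows "sw G F (h \<star> l) = sw G (\<lambda>h1 h2. sw G (\<lambda>l1 l2. F (h1 \<star> l1) (h2 \<star> l2)) l) h"
proof -
  interpret G: module k G by fact
  note Gg = G.abelian_group_axioms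
  interpret T2: module k "tensor_k k H H" by (rule HH.TT_module)
  note add = linear_on_additive[OF HH.tensor_lift_linear[OF G F]]
  note pc = bilinear_onD(3)[OF HH.pure_bilinear]
  have "sw G F (h \<star> l) = tensor_lift G F (sw (tensor_k k H H) (\<lambda>h1 h2. sw (tensor_k k H H)
        (\<lambda>l1 l2. pure_k k H H (h1 \<star> l1) (h2 \<star> l2)) l) h)"
    by (simp add: sw_tensor_lift[of G F] comul_mult h)
  also have "\<dots> = sw G (\<lambda>h1 h2. tensor_lift G F (sw (tensor_k k H H)
        (\<lambda>l1 l2. pure_k k H H (h1 \<star> l1) (h2 \<star> l2)) l)) h"
    by (rule sw_additive[OF T2.abelian_group_axioms Gg add]) (use h in \<open>auto intro!: sw_closed T2.abelian_group_axioms pc\<close>)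
  also have "\<dots> = sw G (\<lambda>h1 h2. sw G (\<lambda>l1 l2. F (h1 \<star> l1) (h2 \<star> l2)) l) h"
  proof (rule sw_cong[OF Gg h(1)])
    fix x y assume xy: "x \<in> HC" "y \<in> HC"
    show "sw G (\<lambda>l1 l2. F (x \<star> l1) (y \<star> l2)) l \<in> carrier G"
      by (rule sw_closed[OF Gg h(2)]) (use xy in \<open>auto intro!: bilinear_onD(3)[OF F]\<close>)
    have "tensor_lift G F (sw (tensor_k k H H) (\<lambda>l1 l2. pure_k k H H (x \<star> l1) (y \<star> l2)) l) =
      sw G (\<lambda>l1 l2. tensor_lift G F (pure_k k H H (x \<star> l1) (y \<star> l2))) l"
      by (rule sw_additive[OF T2.abelian_group_axioms Gg add h(2)]) (use xy in \<open>auto intro!: pc\<close>)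
    also have "\<dots> = sw G (\<lambda>l1 l2. F (x \<star> l1) (y \<star> l2)) l"
      by (rule sw_cong[OF Gg h(2)]) (use xy in \<open>auto simp: HH.tensor_lift_pure_k[OF G F] intro!: bilinear_onD(3)[OF F]\<close>)
    finally show "tensor_lift G F (sw (tensor_k k H H) (\<lambda>l1 l2. pure_k k H H (x \<star> l1) (y \<star> l2)) l) =
       sw G (\<lambda>l1 l2. F (x \<star> l1) (y \<star> l2)) l" .
  qed
  finally show ?thesis .
qed

lemma sw_unit:
  assumes G: "module k G" and F: "bilinear_on k H H G F"
  shows "sw G F unit = F unit unit"
  by (simp add: sw_tensor_lift comul_one HH.tensor_lift_pure_k[OF G F])

lemma sw_counit_left:
  assumes G: "abelian_group G" and h: "h \<in> HC" and f: "additive_on H G f"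
  shows "sw G (\<lambda>x y. f (\<epsilon> x \<odot>\<^bsub>H\<^esub> y)) h = f h"
  using sw_additive[OF HM.abelian_group_axioms G f h, of "\<lambda>x y. \<epsilon> x \<odot>\<^bsub>H\<^esub> y"] counit_left[OF h] by simp

lemma sw_counit_right:
  assumes G: "abelian_group G" and h: "h \<in> HC" and f: "additive_on H G f"
  shows "sw G (\<lambda>x y. f (\<epsilon> y \<odot>\<^bsub>H\<^esub> x)) h = f h"
  using sw_additive[OF HM.abelian_group_axioms G f h, of "\<lambda>x y. \<epsilon> y \<odot>\<^bsub>H\<^esub> x"] counit_right[OF h] by simp

lemma sw_antipode_left:
  assumes G: "abelian_group G" and h: "h \<in> HC" and f: "additive_on H G f"
  shows "sw G (\<lambda>x y. f (S x \<star> y)) h = f (\<epsilon> h \<odot>\<^bsub>H\<^esub> unit)"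
  using sw_additive[OF HM.abelian_group_axioms G f h, of "\<lambda>x y. S x \<star> y"] antipode_left[OF h] by simp

lemma sw_antipode_right:
  assumes G: "abelian_group G" and h: "h \<in> HC" and f: "additive_on H G f"
  shows "sw G (\<lambda>x y. f (x \<star> S y)) h = f (\<epsilon> h \<odot>\<^bsub>H\<^esub> unit)"
  using sw_additive[OF HM.abelian_group_axioms G f h, of "\<lambda>x y. x \<star> S y"] antipode_right[OF h] by simp

end

section \<open>Sweedler calculus in a Hopf algebra\<close>

context hopf_algebra
begin

text \<open>Rules that decompose the linearity of an expression in one variable; almost every use of
  coassociativity leaves such side conditions.\<close>

lemma linear_antipode: "linear_on k M H f \<Longrightarrow> linear_on k M H (\<lambda>x. S (f x))"
  by (rule linear_on_comp[OF antipode_linear])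

lemma linear_counit_smult:
  assumes "module k G" "g \<in> carrier G" "linear_on k M H f"
  shows "linear_on k M G (\<lambda>x. \<epsilon> (f x) \<odot>\<^bsub>G\<^esub> g)"
proof -
  interpret G: module k G by fact
  note f = linear_on_closed[OF assms(3)]
  show ?thesis
    by (rule linear_onI)
      (simp_all add: f assms(2) linear_on_add[OF assms(3)] linear_on_smult[OF assms(3)] counit_linear G.smult_l_distr G.smult_assoc1)
qed

lemma linear_sw:
  assumes "module k G" "linear_on k M H f" "\<And>y. y \<in> HC \<Longrightarrow> linear_on k H G (\<lambda>x. F x y)"
    "\<And>x. x \<in> HC \<Longrightarrow> linear_on k H G (\<lambda>y. F x y)"
  shows "linear_on k M G (\<lambda>x. sw G F (f x))"
  by (rule linear_on_comp[OF sw_linear[OF assms(1)] assms(2)]) (rule bilinear_onI, use assms in auto)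

lemma linear_sw_body:
  assumes "module k G" "h \<in> HC" "\<And>u v. u \<in> HC \<Longrightarrow> v \<in> HC \<Longrightarrow> linear_on k H G (\<lambda>x. F x u v)"
  shows "linear_on k H G (\<lambda>x. sw G (\<lambda>u v. F x u v) h)"
  by (rule sw_body_linear[OF assms(1,2) HM.module_axioms assms(3)])

lemmas lin = linear_on_id linear_antipode linear_counit_smult linear_sw linear_sw_body
  linear_on_mult_left[OF H_algebra] linear_on_mult_right[OF H_algebra] linear_on_smult_const HM.module_axioms

lemma sw_linear_apply:
  assumes "module k G" "module k G'" "linear_on k G G' \<phi>" "h \<in> HC"
    "\<And>x y. x \<in> HC \<Longrightarrow> y \<in> HC \<Longrightarrow> f x y \<in> carrier G"
  shows "\<phi> (sw G f h) = sw G' (\<lambda>x y. \<phi> (f x y)) h"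
proof -
  interpret G: module k G by fact
  interpret G': module k G' by fact
  show ?thesis
    by (rule sw_additive[OF G.abelian_group_axioms G'.abelian_group_axioms linear_on_additive[OF assms(3)] assms(4,5)])
qed

lemma sw_mult_left:
  assumes "k_algebra k E" "c \<in> carrier E" "h \<in> HC" "\<And>x y. x \<in> HC \<Longrightarrow> y \<in> HC \<Longrightarrow> f x y \<in> carrier E"
  shows "c \<otimes>\<^bsub>E\<^esub> sw E f h = sw E (\<lambda>x y. c \<otimes>\<^bsub>E\<^esub> f x y) h"
  by (rule sw_linear_apply[OF k_algebraD(1)[OF assms(1)] k_algebraD(1)[OF assms(1)]
        linear_on_mult_left[OF assms(1,2) linear_on_id] assms(3,4)])

lemma sw_mult_right:
  assumes "k_algebra k E" "c \<in> carrier E" "h \<in> HC" "\<And>x y. x \<in> HC \<Longrightarrow> y \<in> HC \<Longrightarrow> f x y \<in> carrier E"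
  shows "sw E f h \<otimes>\<^bsub>E\<^esub> c = sw E (\<lambda>x y. f x y \<otimes>\<^bsub>E\<^esub> c) h"
  by (rule sw_linear_apply[OF k_algebraD(1)[OF assms(1)] k_algebraD(1)[OF assms(1)]
        linear_on_mult_right[OF assms(1,2) linear_on_id] assms(3,4)])

lemma sw_smult:
  assumes "module k G" "c \<in> carrier k" "h \<in> HC" "\<And>x y. x \<in> HC \<Longrightarrow> y \<in> HC \<Longrightarrow> f x y \<in> carrier G"
  shows "c \<odot>\<^bsub>G\<^esub> sw G f h = sw G (\<lambda>x y. c \<odot>\<^bsub>G\<^esub> f x y) h"
  by (rule sw_linear_apply[OF assms(1,1) linear_on_smult_const[OF assms(1,2) linear_on_id] assms(3,4)])

lemma sw_eps_left:
  assumes G: "module k G" and f: "linear_on k H G f" and h: "h \<in> HC"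
  shows "sw G (\<lambda>x y. \<epsilon> x \<odot>\<^bsub>G\<^esub> f y) h = f h"
proof -
  interpret G: module k G by fact
  have "sw G (\<lambda>x y. \<epsilon> x \<odot>\<^bsub>G\<^esub> f y) h = sw G (\<lambda>x y. f (\<epsilon> x \<odot>\<^bsub>H\<^esub> y)) h"
    by (rule sw_cong[OF G.abelian_group_axioms h]) (auto simp: linear_on_smult[OF f] linear_on_closed[OF f])
  then show ?thesis using sw_counit_left[OF G.abelian_group_axioms h linear_on_additive[OF f]] by simp
qed

lemma sw_eps_right:
  assumes G: "module k G" and f: "linear_on k H G f" and h: "h \<in> HC"
  shows "sw G (\<lambda>x y. \<epsilon> y \<odot>\<^bsub>G\<^esub> f x) h = f h"
proof -
  interpret G: module k G by fact
  have "sw G (\<lambda>x y. \<epsilon> y \<odot>\<^bsub>G\<^esub> f x) h = sw G (\<lambda>x y. f (\<epsilon> y \<odot>\<^bsub>H\<^esub> x)) h"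
    by (rule sw_cong[OF G.abelian_group_axioms h]) (auto simp: linear_on_smult[OF f] linear_on_closed[OF f])
  then show ?thesis using sw_counit_right[OF G.abelian_group_axioms h linear_on_additive[OF f]] by simp
qed

lemma sw_S_left:
  assumes G: "module k G" and f: "linear_on k H G f" and h: "h \<in> HC"
  shows "sw G (\<lambda>x y. f (S x \<star> y)) h = \<epsilon> h \<odot>\<^bsub>G\<^esub> f unit"
proof -
  interpret G: module k G by fact
  show ?thesis
    using sw_antipode_left[OF G.abelian_group_axioms h linear_on_additive[OF f]] h by (simp add: linear_on_smult[OF f])
qed

lemma sw_S_right:
  assumes G: "module k G" and f: "linear_on k H G f" and h: "h \<in> HC"
  shows "sw G (\<lambda>x y. f (x \<star> S y)) h = \<epsilon> h \<odot>\<^bsub>G\<^esub> f unit"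
proof -
  interpret G: module k G by fact
  show ?thesis
    using sw_antipode_right[OF G.abelian_group_axioms h linear_on_additive[OF f]] h by (simp add: linear_on_smult[OF f])
qed

context
  fixes G :: "('k, 'g, 'z) module_scheme" and F :: "'h \<Rightarrow> 'h \<Rightarrow> 'g" and h :: 'h
  assumes G: "module k G" and h: "h \<in> HC"
    and F1: "\<And>y. y \<in> HC \<Longrightarrow> linear_on k H G (\<lambda>x. F x y)"
    and F2: "\<And>x. x \<in> HC \<Longrightarrow> linear_on k H G (\<lambda>y. F x y)"
begin

interpretation G: module k G by (rule G)

private lemma Fc: "x \<in> HC \<Longrightarrow> y \<in> HC \<Longrightarrow> F x y \<in> carrier G"
  using linear_on_closed[OF F1] by auto

private lemma F1': "y \<in> HC \<Longrightarrow> linear_on k M H f \<Longrightarrow> linear_on k M G (\<lambda>x. F (f x) y)"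
  by (rule linear_on_comp[OF F1])

private lemma F2': "x \<in> HC \<Longrightarrow> linear_on k M H f \<Longrightarrow> linear_on k M G (\<lambda>y. F x (f y))"
  by (rule linear_on_comp[OF F2])

text \<open>The eight ways in which an antipode next to its neighbouring leg disappears from a trilinear
  expression; the primed variants have the other bracketing of the threefold coproduct.\<close>

lemma collapse_S_right:
  "sw G (\<lambda>u y. sw G (\<lambda>v w. F u (S v \<star> w)) y) h = F h unit"
proof -
  have "sw G (\<lambda>u y. sw G (\<lambda>v w. F u (S v \<star> w)) y) h = sw G (\<lambda>u y. \<epsilon> y \<odot>\<^bsub>G\<^esub> F u unit) h"
    by (rule sw_cong[OF G.abelian_group_axioms h]) (auto simp: sw_S_left[OF G F2] Fc)
  then show ?thesis using sw_eps_right[OF G F1 h] by simp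
qed

lemma collapse_right_S:
  "sw G (\<lambda>u y. sw G (\<lambda>v w. F u (v \<star> S w)) y) h = F h unit"
proof -
  have "sw G (\<lambda>u y. sw G (\<lambda>v w. F u (v \<star> S w)) y) h = sw G (\<lambda>u y. \<epsilon> y \<odot>\<^bsub>G\<^esub> F u unit) h"
    by (rule sw_cong[OF G.abelian_group_axioms h]) (auto simp: sw_S_right[OF G F2] Fc)
  then show ?thesis using sw_eps_right[OF G F1 h] by simp
qed

lemma collapse_S_left:
  "sw G (\<lambda>x z. sw G (\<lambda>u v. F (S u \<star> v) z) x) h = F unit h"
proof -
  have "sw G (\<lambda>x z. sw G (\<lambda>u v. F (S u \<star> v) z) x) h = sw G (\<lambda>x z. \<epsilon> x \<odot>\<^bsub>G\<^esub> F unit z) h"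
    by (rule sw_cong[OF G.abelian_group_axioms h]) (auto simp: sw_S_left[OF G F1] Fc)
  then show ?thesis using sw_eps_left[OF G F2 h] by simp
qed

lemma collapse_left_S:
  "sw G (\<lambda>x z. sw G (\<lambda>u v. F (u \<star> S v) z) x) h = F unit h"
proof -
  have "sw G (\<lambda>x z. sw G (\<lambda>u v. F (u \<star> S v) z) x) h = sw G (\<lambda>x z. \<epsilon> x \<odot>\<^bsub>G\<^esub> F unit z) h"
    by (rule sw_cong[OF G.abelian_group_axioms h]) (auto simp: sw_S_right[OF G F1] Fc)
  then show ?thesis using sw_eps_left[OF G F2 h] by simp
qed

lemma collapse_S_right':
  "sw G (\<lambda>x z. sw G (\<lambda>u v. F u (S v \<star> z)) x) h = F h unit"
  by (subst sw_coassoc[OF G h, where F="\<lambda>u v z. F u (S v \<star> z)"])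
    (auto intro!: F1' F2' lin simp: collapse_S_right)

lemma collapse_right_S':
  "sw G (\<lambda>x z. sw G (\<lambda>u v. F u (v \<star> S z)) x) h = F h unit"
  by (subst sw_coassoc[OF G h, where F="\<lambda>u v z. F u (v \<star> S z)"])
    (auto intro!: F1' F2' lin simp: collapse_right_S)

lemma collapse_S_left':
  "sw G (\<lambda>x y. sw G (\<lambda>u v. F (S x \<star> u) v) y) h = F unit h"
  by (subst sw_coassoc[OF G h, where F="\<lambda>x u v. F (S x \<star> u) v", symmetric])
    (auto intro!: F1' F2' lin simp: collapse_S_left)

lemma collapse_left_S':
  "sw G (\<lambda>x y. sw G (\<lambda>u v. F (x \<star> S u) v) y) h = F unit h"
  by (subst sw_coassoc[OF G h, where F="\<lambda>x u v. F (x \<star> S u) v", symmetric])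
    (auto intro!: F1' F2' lin simp: collapse_left_S)

end

lemma antipode_unit: "S unit = unit"
proof -
  have "S unit \<star> unit = sw H (\<lambda>x y. S x \<star> y) unit"
    by (rule sw_unit[OF HM.module_axioms, symmetric], rule bilinear_onI) (auto intro!: lin)
  also have "\<dots> = unit" by (simp add: antipode_left counit_one)
  finally show ?thesis by simp
qed

text \<open>Both sides are convolution inverses of the multiplication \<open>H \<otimes> H \<rightarrow> H\<close>: insert
  \<open>S(h\<^sub>1 l\<^sub>1) (h\<^sub>2 l\<^sub>2) S(l\<^sub>3) S(h\<^sub>3)\<close> and collapse it from either side.\<close>

lemma antipode_mult:
  assumes h: "h \<in> HC" and l: "l \<in> HC"
  shows "S (h \<star> l) = S l \<star> S h"
proof -
  note G = HM.abelian_group_axioms and M = HM.module_axioms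
  define K where "K = (\<lambda>x u v p q r. (S (x \<star> p) \<star> (u \<star> q)) \<star> (S r \<star> S v))"
  have Kc: "K x u v p q r \<in> HC" if "x \<in> HC" "u \<in> HC" "v \<in> HC" "p \<in> HC" "q \<in> HC" "r \<in> HC" for x u v p q r
    using that by (simp add: K_def)
  have Klin: "\<And>x u v p q. x \<in> HC \<Longrightarrow> u \<in> HC \<Longrightarrow> v \<in> HC \<Longrightarrow> p \<in> HC \<Longrightarrow> q \<in> HC \<Longrightarrow> linear_on k H H (\<lambda>r. K x u v p q r)"
    "\<And>x u v p r. x \<in> HC \<Longrightarrow> u \<in> HC \<Longrightarrow> v \<in> HC \<Longrightarrow> p \<in> HC \<Longrightarrow> r \<in> HC \<Longrightarrow> linear_on k H H (\<lambda>q. K x u v p q r)"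
    "\<And>x u v q r. x \<in> HC \<Longrightarrow> u \<in> HC \<Longrightarrow> v \<in> HC \<Longrightarrow> q \<in> HC \<Longrightarrow> r \<in> HC \<Longrightarrow> linear_on k H H (\<lambda>p. K x u v p q r)"
    "\<And>x u p q r. x \<in> HC \<Longrightarrow> u \<in> HC \<Longrightarrow> p \<in> HC \<Longrightarrow> q \<in> HC \<Longrightarrow> r \<in> HC \<Longrightarrow> linear_on k H H (\<lambda>v. K x u v p q r)"
    "\<And>x v p q r. x \<in> HC \<Longrightarrow> v \<in> HC \<Longrightarrow> p \<in> HC \<Longrightarrow> q \<in> HC \<Longrightarrow> r \<in> HC \<Longrightarrow> linear_on k H H (\<lambda>u. K x u v p q r)"
    "\<And>u v p q r. u \<in> HC \<Longrightarrow> v \<in> HC \<Longrightarrow> p \<in> HC \<Longrightarrow> q \<in> HC \<Longrightarrow> r \<in> HC \<Longrightarrow> linear_on k H H (\<lambda>x. K x u v p q r)"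
    unfolding K_def by (auto intro!: lin)
  \<comment> \<open>Collapsing from the right recovers \<open>S(h l)\<close>.\<close>
  have i1: "sw H (\<lambda>p z. sw H (\<lambda>q r. K x u v p q r) z) l = S (x \<star> l) \<star> (u \<star> S v)"
    if "x \<in> HC" "u \<in> HC" "v \<in> HC" for x u v
  proof -
    have "sw H (\<lambda>p z. sw H (\<lambda>q r. K x u v p q r) z) l =
      sw H (\<lambda>p z. sw H (\<lambda>q r. S (x \<star> p) \<star> (u \<star> ((q \<star> S r) \<star> S v))) z) l"
      by (rule sw_cong[OF G l]) (auto simp: K_def that H.m_assoc intro!: sw_cong[OF G] sw_closed G)
    also have "\<dots> = S (x \<star> l) \<star> (u \<star> (unit \<star> S v))"
      by (rule collapse_right_S[OF M l]) (auto intro!: lin simp: that)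
    finally show ?thesis using that by simp
  qed
  have i2: "sw H (\<lambda>u v. S (x \<star> l) \<star> (u \<star> S v)) y = \<epsilon> y \<odot>\<^bsub>H\<^esub> S (x \<star> l)" if "x \<in> HC" "y \<in> HC" for x y
  proof -
    have "linear_on k H H (\<lambda>w. S (x \<star> l) \<star> w)" using that l by (auto intro!: lin)
    then show ?thesis using sw_S_right[OF M _ that(2)] that l by fastforce
  qed
  have "S (h \<star> l) = sw H (\<lambda>x y. \<epsilon> y \<odot>\<^bsub>H\<^esub> S (x \<star> l)) h"
    by (rule sw_eps_right[OF M _ h, symmetric]) (auto intro!: lin l)
  also have "\<dots> = sw H (\<lambda>x y. sw H (\<lambda>u v. sw H (\<lambda>p z. sw H (\<lambda>q r. K x u v p q r) z) l) y) h"
  proof (rule sw_cong[OF G h], goal_cases)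
    case (2 x y)
    have "sw H (\<lambda>u v. sw H (\<lambda>p z. sw H (\<lambda>q r. K x u v p q r) z) l) y = sw H (\<lambda>u v. S (x \<star> l) \<star> (u \<star> S v)) y"
      by (rule sw_cong[OF G 2(2)]) (use i1 2 l in auto)
    then show ?case using i2 2 by simp
  qed (auto intro!: sw_closed G Kc l)
  also have "\<dots> = sw H (\<lambda>w v. sw H (\<lambda>x u. sw H (\<lambda>p z. sw H (\<lambda>q r. K x u v p q r) z) l) w) h"
    by (rule sw_coassoc[OF M h, symmetric]) (auto intro!: lin Klin l)
  also have "\<dots> = sw H (\<lambda>w v. sw H (\<lambda>x u. sw H (\<lambda>s r. sw H (\<lambda>p q. K x u v p q r) s) l) w) h"
  proof (rule sw_cong[OF G h], goal_cases)
    case (2 w v)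
    show ?case
    proof (rule sw_cong[OF G 2(1)], goal_cases)
      case (2 x u)
      then show ?case using \<open>v \<in> HC\<close> by (intro sw_coassoc[OF M l, symmetric]) (auto intro!: Klin)
    qed (use 2 l in \<open>auto intro!: sw_closed G Kc\<close>)
  qed (use l in \<open>auto intro!: sw_closed G Kc\<close>)
  also have "\<dots> = sw H (\<lambda>w v. sw H (\<lambda>s r. sw H (\<lambda>x u. sw H (\<lambda>p q. K x u v p q r) s) w) l) h"
    by (rule sw_cong[OF G h]) (use l in \<open>auto intro!: sw_closed G Kc sw_swap\<close>)
  also have "\<dots> = sw H (\<lambda>w v. sw H (\<lambda>s r. sw H (\<lambda>a b. (S a \<star> b) \<star> (S r \<star> S v)) (w \<star> s)) l) h"
  proof (rule sw_cong[OF G h], goal_cases)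
    case (2 w v)
    show ?case
    proof (rule sw_cong[OF G l], goal_cases)
      case (2 s r)
      show ?case unfolding K_def using 2 \<open>w \<in> HC\<close> \<open>v \<in> HC\<close>
        by (intro sw_comul_mult[OF M _ _ bilinear_onI, symmetric]) (auto intro!: lin)
    qed (use 2 in \<open>auto intro!: sw_closed G\<close>)
  qed (use l in \<open>auto intro!: sw_closed G\<close>)
  also have "\<dots> = sw H (\<lambda>w v. sw H (\<lambda>s r. \<epsilon> s \<odot>\<^bsub>H\<^esub> (\<epsilon> w \<odot>\<^bsub>H\<^esub> (S r \<star> S v))) l) h"
  proof (rule sw_cong[OF G h], goal_cases)
    case (2 w v)
    show ?case
    proof (rule sw_cong[OF G l], goal_cases)
      case (2 s r)
      have "sw H (\<lambda>a b. (S a \<star> b) \<star> (S r \<star> S v)) (w \<star> s) = \<epsilon> (w \<star> s) \<odot>\<^bsub>H\<^esub> (unit \<star> (S r \<star> S v))"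
        by (rule sw_S_left[OF M, of "\<lambda>z. z \<star> (S r \<star> S v)"]) (use 2 \<open>w \<in> HC\<close> \<open>v \<in> HC\<close> in \<open>auto intro!: lin\<close>)
      then show ?case using 2 \<open>w \<in> HC\<close> \<open>v \<in> HC\<close> by (simp add: counit_mult k.m_comm[of "\<epsilon> w"] HM.smult_assoc1)
    qed (use 2 in auto)
  qed (use l in \<open>auto intro!: sw_closed G\<close>)
  also have "\<dots> = sw H (\<lambda>w v. \<epsilon> w \<odot>\<^bsub>H\<^esub> (S l \<star> S v)) h"
    by (rule sw_cong[OF G h]) (auto intro!: sw_eps_left[OF M _ l] lin l)
  also have "\<dots> = S l \<star> S h"
    by (rule sw_eps_left[OF M _ h]) (auto intro!: lin l)
  finally show ?thesis .
qed

text \<open>The antipode reverses the coproduct.  As for products, this is uniqueness of convolution inverses, now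
  of the coproduct \<open>H \<rightarrow> H \<otimes> H\<close>: collapse \<open>S(h\<^sub>1)\<^sub>1 h\<^sub>2 S(h\<^sub>5) \<otimes> S(h\<^sub>1)\<^sub>2 h\<^sub>3 S(h\<^sub>4)\<close> from either side.\<close>

lemma sw_antipode:
  assumes G: "module k G" and h: "h \<in> HC"
    and F1: "\<And>y. y \<in> HC \<Longrightarrow> linear_on k H G (\<lambda>x. F x y)"
    and F2: "\<And>x. x \<in> HC \<Longrightarrow> linear_on k H G (\<lambda>y. F x y)"
  shows "sw G F (S h) = sw G (\<lambda>x y. F (S y) (S x)) h"
proof -
  interpret G: module k G by fact
  note Gg = G.abelian_group_axioms
  have Fc: "F x y \<in> carrier G" if "x \<in> HC" "y \<in> HC" for x y
    using linear_on_closed[OF F1] that by auto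
  have F1': "\<And>f y. y \<in> HC \<Longrightarrow> linear_on k H H f \<Longrightarrow> linear_on k H G (\<lambda>x. F (f x) y)"
    by (rule linear_on_comp[OF F1])
  have F2': "\<And>f x. x \<in> HC \<Longrightarrow> linear_on k H H f \<Longrightarrow> linear_on k H G (\<lambda>y. F x (f y))"
    by (rule linear_on_comp[OF F2])
  \<comment> \<open>\<open>Mf z a b\<close> attaches the two outermost legs, the coproduct of \<open>z\<close>, to \<open>a\<close> and \<open>b\<close>.\<close>
  define Mf where "Mf = (\<lambda>z a b. sw G (\<lambda>r s. F (a \<star> S s) (b \<star> S r)) z)"
  have Mf_lin: "\<And>a b. a \<in> HC \<Longrightarrow> b \<in> HC \<Longrightarrow> linear_on k H G (\<lambda>z. Mf z a b)"
    "\<And>z b f. z \<in> HC \<Longrightarrow> b \<in> HC \<Longrightarrow> linear_on k H H f \<Longrightarrow> linear_on k H G (\<lambda>a. Mf z (f a) b)"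
    "\<And>z a f. z \<in> HC \<Longrightarrow> a \<in> HC \<Longrightarrow> linear_on k H H f \<Longrightarrow> linear_on k H G (\<lambda>b. Mf z a (f b))"
    unfolding Mf_def by (auto intro!: lin G F1' F2')
  have Mfc: "Mf z a b \<in> carrier G" if "z \<in> HC" "a \<in> HC" "b \<in> HC" for z a b
    using linear_on_closed[OF Mf_lin(1)] that by auto
  \<comment> \<open>The four legs of \<open>y\<close> cancel in two pairs, first the inner and then the outer one.\<close>
  have A: "sw G (\<lambda>y' z. sw G (\<lambda>p q. Mf z (a \<star> p) (b \<star> q)) y') y = \<epsilon> y \<odot>\<^bsub>G\<^esub> F a b"
    if "a \<in> HC" "b \<in> HC" "y \<in> HC" for a b y
  proof -
    have "sw G (\<lambda>y' z. sw G (\<lambda>p q. Mf z (a \<star> p) (b \<star> q)) y') y =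
       sw G (\<lambda>p w. sw G (\<lambda>q z. Mf z (a \<star> p) (b \<star> q)) w) y"
      by (rule sw_coassoc[OF G that(3)]) (auto intro!: Mf_lin lin simp: that)
    also have "\<dots> = sw G (\<lambda>p w. F (a \<star> (p \<star> S w)) (b \<star> unit)) y"
    proof (rule sw_cong[OF Gg that(3)], goal_cases)
      case (2 p w)
      have "sw G (\<lambda>q z. Mf z (a \<star> p) (b \<star> q)) w = sw G (\<lambda>q z. sw G (\<lambda>r s. F (a \<star> (p \<star> S s)) (b \<star> (q \<star> S r))) z) w"
        unfolding Mf_def by (rule sw_cong[OF Gg 2(2)]) (use 2 that in \<open>auto simp: H.m_assoc intro!: sw_cong[OF Gg] sw_closed Gg Fc\<close>)
      also have "\<dots> = F (a \<star> (p \<star> S w)) (b \<star> unit)"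
        by (rule collapse_left_S'[OF G 2(2), where F="\<lambda>x s. F (a \<star> (p \<star> S s)) (b \<star> x)"])
          (use 2 that in \<open>auto intro!: F1' F2' lin\<close>)
      finally show ?case .
    qed (use that in \<open>auto intro!: Fc\<close>)
    also have "\<dots> = \<epsilon> y \<odot>\<^bsub>G\<^esub> F (a \<star> unit) (b \<star> unit)"
      by (rule sw_S_right[OF G, where f="\<lambda>x. F (a \<star> x) (b \<star> unit)"]) (use that in \<open>auto intro!: F1' F2' lin\<close>)
    finally show ?thesis using that by simp
  qed
  have "sw G F (S h) = sw G (\<lambda>x y. \<epsilon> y \<odot>\<^bsub>G\<^esub> sw G F (S x)) h"
    by (rule sw_eps_right[OF G _ h, symmetric]) (auto intro!: lin G F1 F2)
  also have "\<dots> = sw G (\<lambda>x y. sw G (\<lambda>y' z. sw G (Mf z) (S x \<star> y')) y) h"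
  proof (rule sw_cong[OF Gg h], goal_cases)
    case (2 x y)
    have "\<epsilon> y \<odot>\<^bsub>G\<^esub> sw G F (S x) = sw G (\<lambda>a b. \<epsilon> y \<odot>\<^bsub>G\<^esub> F a b) (S x)"
      by (rule sw_smult[OF G]) (use 2 in \<open>auto intro!: Fc\<close>)
    also have "\<dots> = sw G (\<lambda>a b. sw G (\<lambda>y' z. sw G (\<lambda>p q. Mf z (a \<star> p) (b \<star> q)) y') y) (S x)"
      by (rule sw_cong[OF Gg]) (use 2 in \<open>auto simp: A intro!: sw_closed Gg Mfc Fc G.smult_closed\<close>)
    also have "\<dots> = sw G (\<lambda>y' z. sw G (\<lambda>a b. sw G (\<lambda>p q. Mf z (a \<star> p) (b \<star> q)) y') (S x)) y"
      by (rule sw_swap[OF Gg]) (use 2 in \<open>auto intro!: sw_closed Gg Mfc\<close>)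
    also have "\<dots> = sw G (\<lambda>y' z. sw G (Mf z) (S x \<star> y')) y"
      by (rule sw_cong[OF Gg 2(2)])
        (use 2 in \<open>auto intro!: sw_comul_mult[OF G, symmetric] bilinear_onI Mf_lin lin sw_closed Gg Mfc\<close>)
    finally show ?case .
  qed (auto intro!: sw_closed Gg Mfc)
  also have "\<dots> = sw G (Mf h) unit"
    by (rule collapse_S_left'[OF G h, where F="\<lambda>x z. sw G (Mf z) x"]) (auto intro!: lin G Mf_lin)
  also have "\<dots> = Mf h unit unit"
    by (rule sw_unit[OF G]) (auto intro!: bilinear_onI Mf_lin lin h)
  also have "\<dots> = sw G (\<lambda>x y. F (S y) (S x)) h"
    unfolding Mf_def by (rule sw_cong[OF Gg h]) (auto intro!: Fc)
  finally show ?thesis .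
qed

lemma sw_transfer:
  "carrier G' = carrier G \<Longrightarrow> add G' = add G \<Longrightarrow> \<zero>\<^bsub>G'\<^esub> = \<zero>\<^bsub>G\<^esub> \<Longrightarrow> sw G' f h = sw G f h"
  unfolding sw_eq by (rule frag_eval_transfer)

end

lemma tensor_transfer:
  assumes "carrier M' = carrier M" "add M' = add M" "carrier N' = carrier N" "add N' = add N"
  shows "tensor_relations R M' ra N' la = tensor_relations R M ra N la"
    and "tensor_group R M' ra N' la = tensor_group R M ra N la"
    and "tensor_pure R M' ra N' la = tensor_pure R M ra N la"
proof -
  show *: "tensor_relations R M' ra N' la = tensor_relations R M ra N la"
    using assms by (simp add: tensor_relations_def)
  show "tensor_group R M' ra N' la = tensor_group R M ra N la"
    unfolding tensor_group_def * by (simp add: assms)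
  show "tensor_pure R M' ra N' la = tensor_pure R M ra N la"
    unfolding tensor_pure_def[abs_def] * by (simp add: assms)
qed

lemma tensor_k_transfer:
  assumes "carrier M' = carrier M" "add M' = add M" "smult M' = smult M"
    "carrier N' = carrier N" "add N' = add N" "smult N' = smult N"
  shows "tensor_k k M' N' = tensor_k k M N" "pure_k k M' N' = pure_k k M N"
  by (simp_all add: tensor_k_def pure_k_def tensor_transfer[OF assms(1,2,4,5)] assms(3,6))

lemma module_transfer:
  assumes "module k M" "carrier M' = carrier M" "add M' = add M" "\<zero>\<^bsub>M'\<^esub> = \<zero>\<^bsub>M\<^esub>"
    "\<And>c x. c \<in> carrier k \<Longrightarrow> x \<in> carrier M \<Longrightarrow> c \<odot>\<^bsub>M'\<^esub> x = c \<odot>\<^bsub>M\<^esub> x"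
  shows "module k M'"
proof -
  interpret M: module k M by fact
  show ?thesis
    by (rule moduleI[OF M.R.is_cring abelian_group_transfer[OF M.abelian_group_axioms assms(2-4)]])
      (simp_all add: assms(2-5) M.smult_l_distr M.smult_r_distr M.smult_assoc1)
qed

lemma ring_transfer:
  assumes "ring R" "carrier R' = carrier R" "add R' = add R" "\<zero>\<^bsub>R'\<^esub> = \<zero>\<^bsub>R\<^esub>" "mult R' = mult R" "\<one>\<^bsub>R'\<^esub> = \<one>\<^bsub>R\<^esub>"
  shows "ring R'"
proof -
  interpret R: ring R by fact
  show ?thesis
    by (rule ringI[OF abelian_group_transfer[OF R.abelian_group_axioms assms(2-4)]])
      (auto simp: assms R.l_distr R.r_distr R.m_assoc intro!: monoidI)
qed

text \<open>With a bijective antipode the opposite comultiplication gives a Hopf algebra \<open>cop\<close> with antipode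
  \<open>\<tau>\<close>, the inverse of \<open>S\<close>.  Applying a result to \<open>cop\<close> instead of \<open>H\<close> yields its mirror image.\<close>

locale hopf_bij = hopf_algebra k H for k :: "'k ring" and H :: "('k, 'h) hopf" +
  assumes antipode_bij: "invertible_antipode H"
begin

abbreviation \<tau> where "\<tau> \<equiv> antipode_inv H"

lemma tau_closed [simp, intro]: "x \<in> HC \<Longrightarrow> \<tau> x \<in> HC"
  using antipode_bij by (auto simp: antipode_inv_def invertible_antipode_def bij_betw_def intro: inv_into_into)

lemma S_tau [simp]: "x \<in> HC \<Longrightarrow> S (\<tau> x) = x"
  using antipode_bij by (auto simp: antipode_inv_def invertible_antipode_def bij_betw_def intro: f_inv_into_f)

lemma tau_S [simp]: "x \<in> HC \<Longrightarrow> \<tau> (S x) = x"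
  using antipode_bij by (auto simp: antipode_inv_def invertible_antipode_def bij_betw_def)

lemma S_inj: "x \<in> HC \<Longrightarrow> y \<in> HC \<Longrightarrow> S x = S y \<Longrightarrow> x = y"
  by (metis tau_S)

lemma antipode_inv_linear: "linear_on k H H \<tau>"
proof (rule linear_onI)
  fix x y assume "x \<in> HC" "y \<in> HC"
  then show "\<tau> (x \<oplus>\<^bsub>H\<^esub> y) = \<tau> x \<oplus>\<^bsub>H\<^esub> \<tau> y"
    by - (rule S_inj, simp_all add: linear_on_add[OF antipode_linear])
next
  fix c x assume "c \<in> carrier k" "x \<in> HC"
  then show "\<tau> (c \<odot>\<^bsub>H\<^esub> x) = c \<odot>\<^bsub>H\<^esub> \<tau> x"
    by - (rule S_inj, simp_all add: linear_on_smult[OF antipode_linear])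
qed simp

lemma linear_tau: "linear_on k M H f \<Longrightarrow> linear_on k M H (\<lambda>x. \<tau> (f x))"
  by (rule linear_on_comp[OF antipode_inv_linear])

lemma tau_mult: "h \<in> HC \<Longrightarrow> l \<in> HC \<Longrightarrow> \<tau> (h \<star> l) = \<tau> l \<star> \<tau> h"
  by (rule S_inj) (simp_all add: antipode_mult)

lemma tau_unit: "\<tau> unit = unit"
  by (rule S_inj) (simp_all add: antipode_unit)

lemma sw_tau:
  assumes G: "module k G" and h: "h \<in> HC"
    and F1: "\<And>y. y \<in> HC \<Longrightarrow> linear_on k H G (\<lambda>x. F x y)"
    and F2: "\<And>x. x \<in> HC \<Longrightarrow> linear_on k H G (\<lambda>y. F x y)"
  shows "sw G F (\<tau> h) = sw G (\<lambda>x y. F (\<tau> y) (\<tau> x)) h"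
proof -
  interpret G: module k G by fact
  have "sw G (\<lambda>x y. F (\<tau> y) (\<tau> x)) (S (\<tau> h)) = sw G (\<lambda>x y. F (\<tau> (S x)) (\<tau> (S y))) (\<tau> h)"
    by (rule sw_antipode[OF G]) (use h in \<open>auto intro!: linear_on_comp[OF F1] linear_on_comp[OF F2] antipode_inv_linear\<close>)
  also have "\<dots> = sw G F (\<tau> h)"
    by (rule sw_cong[OF G.abelian_group_axioms]) (use h linear_on_closed[OF F1] in auto)
  finally show ?thesis using h by simp
qed

definition cop :: "('k, 'h) hopf" where
  "cop = H\<lparr>comul := \<lambda>h. sw (tensor_k k H H) (\<lambda>x y. pure_k k H H y x) h, antipode := \<tau>\<rparr>"

lemma cop_simps [simp]:
  "carrier cop = HC" "mult cop = mult H" "\<one>\<^bsub>cop\<^esub> = unit" "\<zero>\<^bsub>cop\<^esub> = \<zero>\<^bsub>H\<^esub>" "add cop = add H" "smult cop = smult H"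
  "counit cop = \<epsilon>" "antipode cop = \<tau>" "comul cop h = sw (tensor_k k H H) (\<lambda>x y. pure_k k H H y x) h"
  by (simp_all add: cop_def)

lemma cop_tensor [simp]: "tensor_k k cop cop = tensor_k k H H" "pure_k k cop cop = pure_k k H H"
   "tensor_k k cop (tensor_k k H H) = tensor_k k H (tensor_k k H H)" "pure_k k cop (tensor_k k H H) = pure_k k H (tensor_k k H H)"
  by (rule tensor_k_transfer, simp_all)+

lemma cop_linear [simp]: "linear_on k cop N f = linear_on k H N f" "linear_on k M cop g = linear_on k M H g"
  by (simp_all add: linear_on_def)

lemma cop_comul_closed: "h \<in> HC \<Longrightarrow> comul cop h \<in> carrier HH.tp.T"
proof -
  interpret T2: module k "tensor_k k H H" by (rule HH.TT_module)
  assume h: "h \<in> HC"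
  have "comul cop h \<in> carrier (tensor_k k H H)"
    unfolding cop_simps by (rule sw_closed[OF T2.abelian_group_axioms h]) (rule bilinear_onD(3)[OF HH.pure_bilinear])
  then show ?thesis by (simp add: HH.TT_simps)
qed

lemma sw_cop:
  assumes G: "module k G" and h: "h \<in> HC"
    and F1: "\<And>y. y \<in> HC \<Longrightarrow> linear_on k H G (\<lambda>x. F x y)"
    and F2: "\<And>x. x \<in> HC \<Longrightarrow> linear_on k H G (\<lambda>y. F x y)"
  shows "sweedler cop G F h = sw G (\<lambda>x y. F y x) h"
proof -
  interpret G: module k G by fact
  interpret T2: module k "tensor_k k H H" by (rule HH.TT_module)
  have b: "bilinear_on k H H G F" by (rule bilinear_onI) (auto intro: F1 F2)
  have "sweedler cop G F h = tensor_lift G F (sw (tensor_k k H H) (\<lambda>x y. pure_k k H H y x) h)"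
    by (simp add: sweedler_def[of cop])
  also have "\<dots> = sw G (\<lambda>x y. tensor_lift G F (pure_k k H H y x)) h"
    by (rule sw_linear_apply[OF HH.TT_module G HH.tensor_lift_linear[OF G b] h]) (rule bilinear_onD(3)[OF HH.pure_bilinear])
  also have "\<dots> = sw G (\<lambda>x y. F y x) h"
    by (rule sw_cong[OF G.abelian_group_axioms h]) (auto simp: HH.tensor_lift_pure_k[OF G b] linear_on_closed[OF F1])
  finally show ?thesis .
qed

text \<open>An expression such as \<open>par_rep.e cop E \<phi> x\<close> is known only for \<open>x\<close> in the carrier, so it has to be
  replaced by a bilinear function before linearity can be used.\<close>

lemma sw_cop_cong:
  assumes G: "module k G" and h: "h \<in> HC"
    and F1: "\<And>y. y \<in> HC \<Longrightarrow> linear_on k H G (\<lambda>x. F x y)"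
    and F2: "\<And>x. x \<in> HC \<Longrightarrow> linear_on k H G (\<lambda>y. F x y)"
    and eq: "\<And>x y. x \<in> HC \<Longrightarrow> y \<in> HC \<Longrightarrow> F' x y = F x y"
  shows "sweedler cop G F' h = sw G (\<lambda>x y. F y x) h"
proof -
  interpret G: module k G by fact
  have "sweedler cop G F' h = sweedler cop G F h"
    unfolding sweedler_def[of cop]
    by (rule HH.tp.tensor_lift_cong[OF G.abelian_group_axioms cop_comul_closed[OF h]])
      (auto simp: eq intro: linear_on_closed[OF F1])
  then show ?thesis by (simp add: sw_cop[OF G h F1 F2])
qed

text \<open>Apply \<open>\<tau>\<close>, which reverses products, to the antipode axiom.\<close>

lemma sw_tau_left:
  assumes h: "h \<in> HC"
  shows "sw H (\<lambda>x y. \<tau> y \<star> x) h = \<epsilon> h \<odot>\<^bsub>H\<^esub> unit"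
proof (rule S_inj)
  note G = HM.abelian_group_axioms
  show "sw H (\<lambda>x y. \<tau> y \<star> x) h \<in> HC" by (rule sw_closed[OF G h]) auto
  have "S (sw H (\<lambda>x y. \<tau> y \<star> x) h) = sw H (\<lambda>x y. S (\<tau> y \<star> x)) h"
    by (rule sw_linear_apply[OF HM.module_axioms HM.module_axioms antipode_linear h]) auto
  also have "\<dots> = sw H (\<lambda>x y. S x \<star> y) h"
    by (rule sw_cong[OF G h]) (auto simp: antipode_mult)
  finally show "S (sw H (\<lambda>x y. \<tau> y \<star> x) h) = S (\<epsilon> h \<odot>\<^bsub>H\<^esub> unit)"
    using h by (simp add: antipode_left linear_on_smult[OF antipode_linear] antipode_unit)
qed (use h in auto)

lemma sw_tau_right:
  assumes h: "h \<in> HC"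
  shows "sw H (\<lambda>x y. y \<star> \<tau> x) h = \<epsilon> h \<odot>\<^bsub>H\<^esub> unit"
proof (rule S_inj)
  note G = HM.abelian_group_axioms
  show "sw H (\<lambda>x y. y \<star> \<tau> x) h \<in> HC" by (rule sw_closed[OF G h]) auto
  have "S (sw H (\<lambda>x y. y \<star> \<tau> x) h) = sw H (\<lambda>x y. S (y \<star> \<tau> x)) h"
    by (rule sw_linear_apply[OF HM.module_axioms HM.module_axioms antipode_linear h]) auto
  also have "\<dots> = sw H (\<lambda>x y. x \<star> S y) h"
    by (rule sw_cong[OF G h]) (auto simp: antipode_mult)
  finally show "S (sw H (\<lambda>x y. y \<star> \<tau> x) h) = S (\<epsilon> h \<odot>\<^bsub>H\<^esub> unit)"
    using h by (simp add: antipode_right linear_on_smult[OF antipode_linear] antipode_unit)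
qed (use h in auto)

lemma collapse_tau_left:
  assumes G: "module k G" and h: "h \<in> HC"
    and F1: "\<And>y. y \<in> HC \<Longrightarrow> linear_on k H G (\<lambda>x. F x y)"
    and F2: "\<And>x. x \<in> HC \<Longrightarrow> linear_on k H G (\<lambda>y. F x y)"
  shows "sw G (\<lambda>b y. sw G (\<lambda>c d. F (c \<star> \<tau> b) d) y) h = F unit h"
proof -
  interpret G: module k G by fact
  have "sw G (\<lambda>b y. sw G (\<lambda>c d. F (c \<star> \<tau> b) d) y) h = sw G (\<lambda>z d. sw G (\<lambda>b c. F (c \<star> \<tau> b) d) z) h"
    by (rule sw_coassoc[OF G h, symmetric]) (auto intro!: linear_on_comp[OF F1] F2 lin linear_tau)
  also have "\<dots> = sw G (\<lambda>z d. \<epsilon> z \<odot>\<^bsub>G\<^esub> F unit d) h"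
  proof (rule sw_cong[OF G.abelian_group_axioms h], goal_cases)
    case (2 z d)
    have "sw G (\<lambda>b c. F (c \<star> \<tau> b) d) z = F (sw H (\<lambda>b c. c \<star> \<tau> b) z) d"
      by (rule sw_linear_apply[OF HM.module_axioms G F1, symmetric]) (use 2 in auto)
    then show ?case using 2 by (simp add: sw_tau_right linear_on_smult[OF F1])
  qed (auto intro: linear_on_closed[OF F1])
  also have "\<dots> = F unit h" by (rule sw_eps_left[OF G F2 h]) simp
  finally show ?thesis .
qed

lemma cop_module: "module k cop"
  by (rule module_transfer[OF HM.module_axioms]) auto

lemma cop_algebra: "k_algebra k cop"
  using cop_module ring_transfer[OF H.ring_axioms, of cop] H_algebra by (auto simp: k_algebra_def)

text \<open>Coassociativity and multiplicativity of the opposite comultiplication are those of the original one with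
  the legs renamed.\<close>

lemma cop_hopf_algebra: "hopf_algebra k cop"
proof (rule hopf_algebra.intro)
  note M = HM.module_axioms and C = cop_module
  interpret T2: module k "tensor_k k H H" by (rule HH.TT_module)
  interpret HHH: tensor_k_product k H "tensor_k k H H" by (rule HHH)
  let ?T3 = "tensor_k k H (tensor_k k H H)"
  interpret T3: module k ?T3 by (rule HHH.TT_module)
  note T = T2.module_axioms T3.module_axioms
  note p2 = linear_on_comp[OF bilinear_onD(1)[OF HH.pure_bilinear]] linear_on_comp[OF bilinear_onD(2)[OF HH.pure_bilinear]]
  note p3 = linear_on_comp[OF bilinear_onD(1)[OF HHH.pure_bilinear]] linear_on_comp[OF bilinear_onD(2)[OF HHH.pure_bilinear]]
  note pc = bilinear_onD(3)[OF HH.pure_bilinear] bilinear_onD(3)[OF HHH.pure_bilinear]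
  show "cring k" by (rule k_cring)
  show "k_algebra k cop" by (rule cop_algebra)
  have lin_comul: "linear_on k H (tensor_k k H H) (comul cop)"
    unfolding cop_def by (auto intro!: lin T p2)
  then show "linear_on k cop (tensor_k k cop cop) (comul cop)" by simp
  show "counit cop \<in> carrier cop \<rightarrow> carrier k" using counit_linear(1) by simp
  show "counit cop (x \<oplus>\<^bsub>cop\<^esub> y) = counit cop x \<oplus>\<^bsub>k\<^esub> counit cop y" if "x \<in> carrier cop" "y \<in> carrier cop" for x y
    using counit_linear(2) that by simp
  show "counit cop (c \<odot>\<^bsub>cop\<^esub> x) = c \<otimes>\<^bsub>k\<^esub> counit cop x" if "c \<in> carrier k" "x \<in> carrier cop" for c x
    using counit_linear(3) that by simp
  show "counit cop (h \<otimes>\<^bsub>cop\<^esub> l) = counit cop h \<otimes>\<^bsub>k\<^esub> counit cop l" if "h \<in> carrier cop" "l \<in> carrier cop" for h l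
    using counit_mult that by simp
  show "counit cop \<one>\<^bsub>cop\<^esub> = \<one>\<^bsub>k\<^esub>" using counit_one by simp
  show "linear_on k cop cop (antipode cop)" using antipode_inv_linear by simp
  show "comul cop \<one>\<^bsub>cop\<^esub> = pure_k k cop cop \<one>\<^bsub>cop\<^esub> \<one>\<^bsub>cop\<^esub>"
    using sw_unit[OF T(1), of "\<lambda>x y. pure_k k H H y x"] by (simp add: bilinear_onI p2 lin)
  fix h assume "h \<in> carrier cop"
  then have h: "h \<in> HC" by simp
  have t: "sw cop f h = sw H f h" for f by (rule sw_transfer) auto
  have "sweedler cop cop (\<lambda>x y. counit cop x \<odot>\<^bsub>cop\<^esub> y) h = sw cop (\<lambda>x y. \<epsilon> y \<odot>\<^bsub>H\<^esub> x) h"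
    by (subst sw_cop[OF C h]) (auto intro!: lin M)
  then show "sweedler cop cop (\<lambda>x y. counit cop x \<odot>\<^bsub>cop\<^esub> y) h = h" by (simp add: t counit_right[OF h])
  have "sweedler cop cop (\<lambda>x y. counit cop y \<odot>\<^bsub>cop\<^esub> x) h = sw cop (\<lambda>x y. \<epsilon> x \<odot>\<^bsub>H\<^esub> y) h"
    by (subst sw_cop[OF C h]) (auto intro!: lin M)
  then show "sweedler cop cop (\<lambda>x y. counit cop y \<odot>\<^bsub>cop\<^esub> x) h = h" by (simp add: t counit_left[OF h])
  have "sweedler cop cop (\<lambda>x y. antipode cop x \<otimes>\<^bsub>cop\<^esub> y) h = sw cop (\<lambda>x y. \<tau> y \<star> x) h"
    by (subst sw_cop[OF C h]) (auto intro!: lin linear_tau M)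
  then show "sweedler cop cop (\<lambda>x y. antipode cop x \<otimes>\<^bsub>cop\<^esub> y) h = counit cop h \<odot>\<^bsub>cop\<^esub> \<one>\<^bsub>cop\<^esub>"
    by (simp add: t sw_tau_left[OF h])
  have "sweedler cop cop (\<lambda>x y. x \<otimes>\<^bsub>cop\<^esub> antipode cop y) h = sw cop (\<lambda>x y. y \<star> \<tau> x) h"
    by (subst sw_cop[OF C h]) (auto intro!: lin linear_tau M)
  then show "sweedler cop cop (\<lambda>x y. x \<otimes>\<^bsub>cop\<^esub> antipode cop y) h = counit cop h \<odot>\<^bsub>cop\<^esub> \<one>\<^bsub>cop\<^esub>"
    by (simp add: t sw_tau_right[OF h])
  show "sweedler cop (tensor_k k cop (tensor_k k cop cop))
        (\<lambda>x z. sweedler cop (tensor_k k cop (tensor_k k cop cop))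
           (\<lambda>x1 x2. pure_k k cop (tensor_k k cop cop) x1 (pure_k k cop cop x2 z)) x) h =
      sweedler cop (tensor_k k cop (tensor_k k cop cop))
        (\<lambda>x y. pure_k k cop (tensor_k k cop cop) x (comul cop y)) h"
    (is "?l = ?r")
  proof -
    have "?l = sw ?T3 (\<lambda>z x. sw ?T3 (\<lambda>x2 x1. pure_k k H (tensor_k k H H) x1 (pure_k k H H x2 z)) x) h"
      unfolding cop_tensor
    proof (rule sw_cop_cong[OF T(2) h], goal_cases)
      case (3 x z)
      show ?case by (rule sw_cop[OF T(2) 3(1)]) (use 3 in \<open>auto intro!: p3 p2 lin pc\<close>)
    qed (auto intro!: lin T p3 p2 pc)
    also have "\<dots> = sw ?T3 (\<lambda>y x. sw ?T3 (\<lambda>z x2. pure_k k H (tensor_k k H H) x (pure_k k H H x2 z)) y) h"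
      by (rule sw_coassoc[OF T(2) h, symmetric]) (auto intro!: p3 p2 lin pc)
    also have "\<dots> = sw ?T3 (\<lambda>y x. pure_k k H (tensor_k k H H) x (comul cop y)) h"
    proof (rule sw_cong[OF T3.abelian_group_axioms h], goal_cases)
      case (2 y x)
      show ?case unfolding cop_simps
        by (rule sw_linear_apply[OF T bilinear_onD(2)[OF HHH.pure_bilinear] 2(1), symmetric]) (use 2 in \<open>auto intro!: pc\<close>)
    next
      case (1 y x)
      then show ?case using linear_on_closed[OF lin_comul] pc by blast
    qed
    also have "\<dots> = ?r" unfolding cop_tensor
      by (rule sw_cop[OF T(2) h, symmetric]) (auto intro!: p3 lin linear_on_closed[OF lin_comul, simplified] lin_comul T p2)
    finally show ?thesis .
  qed
  fix l assume "l \<in> carrier cop"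
  then have l: "l \<in> HC" by simp
  have "comul cop (h \<star> l) = sw (tensor_k k H H) (\<lambda>h1 h2. sw (tensor_k k H H) (\<lambda>l1 l2. pure_k k H H (h2 \<star> l2) (h1 \<star> l1)) l) h"
    unfolding cop_simps
    by (rule sw_comul_mult[OF T(1) h l, where F="\<lambda>x y. pure_k k H H y x"]) (auto intro!: bilinear_onI p2 lin)
  also have "\<dots> = sweedler cop (tensor_k k H H) (\<lambda>h1 h2. sweedler cop (tensor_k k H H)
        (\<lambda>l1 l2. pure_k k H H (h1 \<star> l1) (h2 \<star> l2)) l) h"
  proof (rule sw_cop_cong[OF T(1) h, symmetric], goal_cases)
    case (3 x y)
    show ?case by (rule sw_cop[OF T(1) l]) (use 3 in \<open>auto intro!: p2 lin\<close>)
  qed (use l in \<open>auto intro!: p2 lin T\<close>)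
  finally show "comul cop (h \<otimes>\<^bsub>cop\<^esub> l) =
      sweedler cop (tensor_k k cop cop) (\<lambda>h1 h2. sweedler cop (tensor_k k cop cop)
        (\<lambda>l1 l2. pure_k k cop cop (h1 \<otimes>\<^bsub>cop\<^esub> l1) (h2 \<otimes>\<^bsub>cop\<^esub> l2)) l) h" by simp
qed

lemma cop_hopf_bij: "hopf_bij k cop"
proof -
  have "bij_betw \<tau> HC HC"
    by (rule bij_betw_byWitness[where f' = S]) auto
  then show ?thesis
    by (auto simp: hopf_bij_def hopf_bij_axioms_def invertible_antipode_def cop_hopf_algebra)
qed

lemma antipode_inv_cop: "x \<in> HC \<Longrightarrow> antipode_inv cop x = S x"
  by (metis cop_simps(1,8) S_closed hopf_bij.tau_S[OF cop_hopf_bij] tau_S)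

end

section \<open>Partial representations\<close>

lemma left_moduleD:
  assumes "left_module R M"
  shows "ring R" "abelian_group M"
    "\<And>r x. r \<in> carrier R \<Longrightarrow> x \<in> carrier M \<Longrightarrow> r \<odot>\<^bsub>M\<^esub> x \<in> carrier M"
    "\<And>r s x. r \<in> carrier R \<Longrightarrow> s \<in> carrier R \<Longrightarrow> x \<in> carrier M \<Longrightarrow> (r \<oplus>\<^bsub>R\<^esub> s) \<odot>\<^bsub>M\<^esub> x = r \<odot>\<^bsub>M\<^esub> x \<oplus>\<^bsub>M\<^esub> s \<odot>\<^bsub>M\<^esub> x"
    "\<And>r x y. r \<in> carrier R \<Longrightarrow> x \<in> carrier M \<Longrightarrow> y \<in> carrier M \<Longrightarrow> r \<odot>\<^bsub>M\<^esub> (x \<oplus>\<^bsub>M\<^esub> y) = r \<odot>\<^bsub>M\<^esub> x \<oplus>\<^bsub>M\<^esub> r \<odot>\<^bsub>M\<^esub> y"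
    "\<And>r s x. r \<in> carrier R \<Longrightarrow> s \<in> carrier R \<Longrightarrow> x \<in> carrier M \<Longrightarrow> (r \<otimes>\<^bsub>R\<^esub> s) \<odot>\<^bsub>M\<^esub> x = r \<odot>\<^bsub>M\<^esub> (s \<odot>\<^bsub>M\<^esub> x)"
    "\<And>x. x \<in> carrier M \<Longrightarrow> \<one>\<^bsub>R\<^esub> \<odot>\<^bsub>M\<^esub> x = x"
  using assms by (auto simp: left_module_def)

definition restrict_scalars :: "('k, 'e, 'z) module_scheme \<Rightarrow> ('e, 'm, 'y) module_scheme \<Rightarrow> ('k, 'm) module" where
  "restrict_scalars E M = \<lparr>carrier = carrier M, monoid.mult = undefined, one = undefined, ring.zero = \<zero>\<^bsub>M\<^esub>, add = add M,
     smult = \<lambda>c x. (c \<odot>\<^bsub>E\<^esub> \<one>\<^bsub>E\<^esub>) \<odot>\<^bsub>M\<^esub> x\<rparr>"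

lemma restrict_scalars_simps [simp]:
  "carrier (restrict_scalars E M) = carrier M" "\<zero>\<^bsub>restrict_scalars E M\<^esub> = \<zero>\<^bsub>M\<^esub>" "add (restrict_scalars E M) = add M"
  "c \<odot>\<^bsub>restrict_scalars E M\<^esub> x = (c \<odot>\<^bsub>E\<^esub> \<one>\<^bsub>E\<^esub>) \<odot>\<^bsub>M\<^esub> x"
  by (simp_all add: restrict_scalars_def)

lemma restrict_scalars_module:
  assumes E: "k_algebra k E" and M: "left_module E M"
  shows "module k (restrict_scalars E M)"
proof -
  interpret E: module k E by (rule k_algebraD[OF E])
  interpret ER: ring E by (rule k_algebraD[OF E])
  have mul: "(c \<otimes>\<^bsub>k\<^esub> d) \<odot>\<^bsub>E\<^esub> \<one>\<^bsub>E\<^esub> = (c \<odot>\<^bsub>E\<^esub> \<one>\<^bsub>E\<^esub>) \<otimes>\<^bsub>E\<^esub> (d \<odot>\<^bsub>E\<^esub> \<one>\<^bsub>E\<^esub>)" if "c \<in> carrier k" "d \<in> carrier k" for c d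
    using that by (simp add: E.smult_assoc1 k_algebraD(3)[OF E])
  show ?thesis
    by (rule moduleI[OF E.R.is_cring abelian_group_transfer[OF left_moduleD(2)[OF M]]])
      (simp_all add: left_moduleD[OF M] E.smult_l_distr mul)
qed

lemma linear_on_act_left:
  assumes E: "k_algebra k E" and M: "left_module E M" and f: "linear_on k K E f" and m: "m \<in> carrier M"
  shows "linear_on k K (restrict_scalars E M) (\<lambda>x. f x \<odot>\<^bsub>M\<^esub> m)"
proof -
  interpret E: module k E by (rule k_algebraD[OF E])
  interpret ER: ring E by (rule k_algebraD[OF E])
  have c: "c \<odot>\<^bsub>E\<^esub> a = (c \<odot>\<^bsub>E\<^esub> \<one>\<^bsub>E\<^esub>) \<otimes>\<^bsub>E\<^esub> a" if "c \<in> carrier k" "a \<in> carrier E" for c a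
    using that by (simp add: k_algebraD[OF E])
  show ?thesis
    by (rule linear_onI)
      (simp_all add: m left_moduleD[OF M] linear_on_closed[OF f] linear_on_add[OF f] linear_on_smult[OF f]
        c[OF _ linear_on_closed[OF f]])
qed

lemma linear_on_act_right:
  assumes E: "k_algebra k E" and M: "left_module E M" and f: "linear_on k K (restrict_scalars E M) f" and a: "a \<in> carrier E"
  shows "linear_on k K (restrict_scalars E M) (\<lambda>x. a \<odot>\<^bsub>M\<^esub> f x)"
proof -
  interpret E: module k E by (rule k_algebraD[OF E])
  interpret ER: ring E by (rule k_algebraD[OF E])
  have fc: "f x \<in> carrier M" if "x \<in> carrier K" for x using linear_on_closed[OF f that] by simp
  have "(c \<odot>\<^bsub>E\<^esub> \<one>\<^bsub>E\<^esub>) \<otimes>\<^bsub>E\<^esub> a = a \<otimes>\<^bsub>E\<^esub> (c \<odot>\<^bsub>E\<^esub> \<one>\<^bsub>E\<^esub>)" if "c \<in> carrier k" for c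
    using that a by (simp add: k_algebraD[OF E])
  then have c: "a \<odot>\<^bsub>M\<^esub> ((c \<odot>\<^bsub>E\<^esub> \<one>\<^bsub>E\<^esub>) \<odot>\<^bsub>M\<^esub> x) = (c \<odot>\<^bsub>E\<^esub> \<one>\<^bsub>E\<^esub>) \<odot>\<^bsub>M\<^esub> (a \<odot>\<^bsub>M\<^esub> x)" if "c \<in> carrier k" "x \<in> carrier M" for c x
    using that a by (metis left_moduleD(6)[OF M] E.smult_closed ER.one_closed)
  show ?thesis
    by (rule linear_onI)
      (simp_all add: a fc left_moduleD[OF M] linear_on_add[OF f] linear_on_smult[OF f] c)
qed

text \<open>Since \<open>\<tau>\<close> reverses the coproduct, the opposite coproduct of \<open>h\<close> is the image under \<open>S\<close> of the coproduct of
  \<open>\<tau> h\<close>.  At \<open>S l\<close> this turns sums over the legs of the opposite coproduct into sums over \<open>S(l\<^sub>1), S(l\<^sub>2)\<close>.\<close>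

lemma (in hopf_bij) sw_cop_tau:
  assumes G: "module k G" and h: "h \<in> HC"
    and F1: "\<And>y. y \<in> HC \<Longrightarrow> linear_on k H G (\<lambda>x. F x y)"
    and F2: "\<And>x. x \<in> HC \<Longrightarrow> linear_on k H G (\<lambda>y. F x y)"
  shows "sweedler cop G F h = sw G (\<lambda>x y. F (S x) (S y)) (\<tau> h)"
  using sw_antipode[OF G _ F2 F1, of "\<tau> h"] h by (simp add: sw_cop[OF G h F1 F2])

locale par_rep = hopf_bij k H for k :: "'k ring" and H :: "('k, 'h) hopf" +
  fixes E :: "('k, 'e, 'z) module_scheme" and \<phi> :: "'h \<Rightarrow> 'e"
  assumes E_algebra: "k_algebra k E" and phi_linear: "linear_on k H E \<phi>" and phi_unit: "\<phi> unit = \<one>\<^bsub>E\<^esub>"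
    and pr2: "h \<in> HC \<Longrightarrow> l \<in> HC \<Longrightarrow> sw E (\<lambda>x y. \<phi> h \<otimes>\<^bsub>E\<^esub> \<phi> x \<otimes>\<^bsub>E\<^esub> \<phi> (S y)) l = sw E (\<lambda>x y. \<phi> (h \<star> x) \<otimes>\<^bsub>E\<^esub> \<phi> (S y)) l"
    and pr3: "h \<in> HC \<Longrightarrow> l \<in> HC \<Longrightarrow> sw E (\<lambda>x y. \<phi> x \<otimes>\<^bsub>E\<^esub> \<phi> (S y) \<otimes>\<^bsub>E\<^esub> \<phi> l) h = sw E (\<lambda>x y. \<phi> x \<otimes>\<^bsub>E\<^esub> \<phi> (S y \<star> l)) h"
    and pr4: "h \<in> HC \<Longrightarrow> l \<in> HC \<Longrightarrow> sw E (\<lambda>x y. \<phi> h \<otimes>\<^bsub>E\<^esub> \<phi> (S x) \<otimes>\<^bsub>E\<^esub> \<phi> y) l = sw E (\<lambda>x y. \<phi> (h \<star> S x) \<otimes>\<^bsub>E\<^esub> \<phi> y) l"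
    and pr5: "h \<in> HC \<Longrightarrow> l \<in> HC \<Longrightarrow> sw E (\<lambda>x y. \<phi> (S x) \<otimes>\<^bsub>E\<^esub> \<phi> y \<otimes>\<^bsub>E\<^esub> \<phi> l) h = sw E (\<lambda>x y. \<phi> (S x) \<otimes>\<^bsub>E\<^esub> \<phi> (y \<star> l)) h"
begin

sublocale EM: module k E by (rule k_algebraD[OF E_algebra])
sublocale E: ring E by (rule k_algebraD[OF E_algebra])

abbreviation emult (infixl "\<cdot>\<cdot>" 70) where "a \<cdot>\<cdot> b \<equiv> a \<otimes>\<^bsub>E\<^esub> b"

lemma phi_closed [simp, intro]: "x \<in> HC \<Longrightarrow> \<phi> x \<in> carrier E"
  by (rule linear_on_closed[OF phi_linear])

lemma linear_phi: "linear_on k M H f \<Longrightarrow> linear_on k M E (\<lambda>x. \<phi> (f x))"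
  by (rule linear_on_comp[OF phi_linear])

lemmas elin = lin linear_tau linear_phi linear_on_mult_left[OF E_algebra] linear_on_mult_right[OF E_algebra] EM.module_axioms

lemmas Eg = EM.abelian_group_axioms and Em = EM.module_axioms

definition e where "e h = sw E (\<lambda>x y. \<phi> x \<cdot>\<cdot> \<phi> (S y)) h"
definition e' where "e' h = sw E (\<lambda>x y. \<phi> y \<cdot>\<cdot> \<phi> (\<tau> x)) h"

lemma e_closed [simp, intro]: "h \<in> HC \<Longrightarrow> e h \<in> carrier E"
  unfolding e_def by (rule sw_closed[OF Eg]) auto

lemma e'_closed [simp, intro]: "h \<in> HC \<Longrightarrow> e' h \<in> carrier E"
  unfolding e'_def by (rule sw_closed[OF Eg]) auto

lemma linear_e: "linear_on k M H f \<Longrightarrow> linear_on k M E (\<lambda>x. e (f x))"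
  unfolding e_def by (auto intro!: elin)

lemma linear_e': "linear_on k M H f \<Longrightarrow> linear_on k M E (\<lambda>x. e' (f x))"
  unfolding e'_def by (auto intro!: elin)

text \<open>The axioms come in pairs that are exchanged by the opposite comultiplication, after the substitution
  of \<open>S l\<close> for \<open>l\<close>.\<close>

lemma cop_par_rep: "par_rep k cop E \<phi>"
proof (intro par_rep.intro cop_hopf_bij par_rep_axioms.intro)
  show "k_algebra k E" by (rule E_algebra)
  show "linear_on k cop E \<phi>" using phi_linear by simp
  show "\<phi> \<one>\<^bsub>cop\<^esub> = \<one>\<^bsub>E\<^esub>" using phi_unit by simp
  fix h l assume "h \<in> carrier cop" "l \<in> carrier cop"
  then have h: "h \<in> HC" and l: "l \<in> HC" by auto
  have t: "\<tau> h \<in> HC" "\<tau> l \<in> HC" using h l by auto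
  have cong: "sw E f x = sw E g x" if "x \<in> HC" "\<And>u v. u \<in> HC \<Longrightarrow> v \<in> HC \<Longrightarrow> f u v = g u v"
    "\<And>u v. u \<in> HC \<Longrightarrow> v \<in> HC \<Longrightarrow> g u v \<in> carrier E" for f g x
    by (rule sw_cong[OF Eg]) (use that in auto)
  note conv = trans[OF sw_cop_tau[OF Em] trans[OF cong trans[OF _ trans[OF cong[symmetric] sw_cop_tau[OF Em, symmetric]]]]]
  show "sweedler cop E (\<lambda>x y. \<phi> h \<cdot>\<cdot> \<phi> x \<cdot>\<cdot> \<phi> (antipode cop y)) l = sweedler cop E (\<lambda>x y. \<phi> (h \<otimes>\<^bsub>cop\<^esub> x) \<cdot>\<cdot> \<phi> (antipode cop y)) l"
    by (rule conv[OF _ _ _ _ _ _ pr4[OF h t(2)]]) (use h l t in \<open>auto intro!: elin\<close>)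
  show "sweedler cop E (\<lambda>x y. \<phi> x \<cdot>\<cdot> \<phi> (antipode cop y) \<cdot>\<cdot> \<phi> l) h = sweedler cop E (\<lambda>x y. \<phi> x \<cdot>\<cdot> \<phi> (antipode cop y \<otimes>\<^bsub>cop\<^esub> l)) h"
    by (rule conv[OF _ _ _ _ _ _ pr5[OF t(1) l]]) (use h l t in \<open>auto intro!: elin\<close>)
  show "sweedler cop E (\<lambda>x y. \<phi> h \<cdot>\<cdot> \<phi> (antipode cop x) \<cdot>\<cdot> \<phi> y) l = sweedler cop E (\<lambda>x y. \<phi> (h \<otimes>\<^bsub>cop\<^esub> antipode cop x) \<cdot>\<cdot> \<phi> y) l"
    by (rule conv[OF _ _ _ _ _ _ pr2[OF h t(2)]]) (use h l t in \<open>auto intro!: elin\<close>)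
  show "sweedler cop E (\<lambda>x y. \<phi> (antipode cop x) \<cdot>\<cdot> \<phi> y \<cdot>\<cdot> \<phi> l) h = sweedler cop E (\<lambda>x y. \<phi> (antipode cop x) \<cdot>\<cdot> \<phi> (y \<otimes>\<^bsub>cop\<^esub> l)) h"
    by (rule conv[OF _ _ _ _ _ _ pr3[OF t(1) l]]) (use h l t in \<open>auto intro!: elin\<close>)
qed

text \<open>The partial representation axioms say that in \<open>\<phi> u \<phi>(S v) \<phi> y\<close> and its mirror images the outer factor
  may be absorbed.\<close>

lemma e_mult: "h \<in> HC \<Longrightarrow> y \<in> HC \<Longrightarrow> e h \<cdot>\<cdot> \<phi> y = sw E (\<lambda>u v. \<phi> u \<cdot>\<cdot> \<phi> (S v \<star> y)) h"
  unfolding e_def by (subst sw_mult_right[OF E_algebra]) (auto simp: pr3)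

lemma mult_e:
  assumes "h \<in> HC" "y \<in> HC"
  shows "\<phi> y \<cdot>\<cdot> e h = sw E (\<lambda>u v. \<phi> (y \<star> u) \<cdot>\<cdot> \<phi> (S v)) h"
proof -
  have "\<phi> y \<cdot>\<cdot> e h = sw E (\<lambda>u v. \<phi> y \<cdot>\<cdot> (\<phi> u \<cdot>\<cdot> \<phi> (S v))) h"
    unfolding e_def by (rule sw_mult_left[OF E_algebra]) (use assms in auto)
  also have "\<dots> = sw E (\<lambda>u v. \<phi> y \<cdot>\<cdot> \<phi> u \<cdot>\<cdot> \<phi> (S v)) h"
    by (rule sw_cong[OF Eg]) (use assms in \<open>auto simp: E.m_assoc\<close>)
  finally show ?thesis using pr2 assms by simp
qed

text \<open>Expand \<open>e\<close> and cancel \<open>S(h\<^sub>2) h\<^sub>3\<close>.\<close>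

lemma e_reduce:
  assumes "h \<in> HC" "l \<in> HC"
  shows "sw E (\<lambda>x y. e x \<cdot>\<cdot> \<phi> (y \<star> l)) h = \<phi> h \<cdot>\<cdot> \<phi> l"
proof -
  have "sw E (\<lambda>x y. e x \<cdot>\<cdot> \<phi> (y \<star> l)) h = sw E (\<lambda>x y. sw E (\<lambda>u v. \<phi> u \<cdot>\<cdot> \<phi> ((S v \<star> y) \<star> l)) x) h"
    by (rule sw_cong[OF Eg]) (use assms in \<open>auto simp: e_mult H.m_assoc intro!: sw_cong[OF Eg] sw_closed Eg\<close>)
  also have "\<dots> = \<phi> h \<cdot>\<cdot> \<phi> (unit \<star> l)"
    by (rule collapse_S_right'[OF Em]) (use assms in \<open>auto intro!: elin\<close>)
  finally show ?thesis using assms by simp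
qed

text \<open>Both sides are \<open>\<phi>(h l\<^sub>1) \<phi>(S l\<^sub>2)\<close>; on the right-hand side \<open>S(h\<^sub>2) h\<^sub>3\<close> cancels.\<close>

lemma e_commute:
  assumes "h \<in> HC" "l \<in> HC"
  shows "\<phi> h \<cdot>\<cdot> e l = sw E (\<lambda>x y. e (x \<star> l) \<cdot>\<cdot> \<phi> y) h"
proof -
  have "sw E (\<lambda>x y. e (x \<star> l) \<cdot>\<cdot> \<phi> y) h =
     sw E (\<lambda>x y. sw E (\<lambda>a b. sw E (\<lambda>p q. \<phi> (a \<star> p) \<cdot>\<cdot> \<phi> (S q \<star> (S b \<star> y))) l) x) h"
  proof (rule sw_cong[OF Eg assms(1)], goal_cases)
    case (2 x y)
    have "e (x \<star> l) \<cdot>\<cdot> \<phi> y = sw E (\<lambda>a b. sw E (\<lambda>p q. \<phi> (a \<star> p) \<cdot>\<cdot> \<phi> (S (b \<star> q) \<star> y)) l) x"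
      using 2 assms by (subst e_mult) (auto intro!: sw_comul_mult[OF Em] bilinear_onI elin)
    also have "\<dots> = sw E (\<lambda>a b. sw E (\<lambda>p q. \<phi> (a \<star> p) \<cdot>\<cdot> \<phi> (S q \<star> (S b \<star> y))) l) x"
      by (intro sw_cong[OF Eg]) (use 2 assms in \<open>auto simp: antipode_mult H.m_assoc intro!: sw_closed Eg\<close>)
    finally show ?case .
  qed (use assms in \<open>auto intro!: sw_closed Eg\<close>)
  also have "\<dots> = sw E (\<lambda>p q. \<phi> (h \<star> p) \<cdot>\<cdot> \<phi> (S q \<star> unit)) l"
    by (rule collapse_S_right'[OF Em]) (use assms in \<open>auto intro!: elin\<close>)
  also have "\<dots> = sw E (\<lambda>p q. \<phi> (h \<star> p) \<cdot>\<cdot> \<phi> (S q)) l"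
    by (rule sw_cong[OF Eg]) (use assms in auto)
  finally show ?thesis using mult_e assms by simp
qed

lemma cop_e: "h \<in> HC \<Longrightarrow> par_rep.e cop E \<phi> h = e' h"
  by (simp add: par_rep.e_def[OF cop_par_rep] e'_def sw_cop[OF Em] elin)

lemma cop_e': "h \<in> HC \<Longrightarrow> par_rep.e' cop E \<phi> h = e h"
  unfolding par_rep.e'_def[OF cop_par_rep] e_def
  by (rule sw_cop_cong[OF Em, of _ "\<lambda>x y. \<phi> y \<cdot>\<cdot> \<phi> (S x)"]) (auto simp: antipode_inv_cop intro!: elin)

lemma e'_reduce:
  assumes "h \<in> HC" "l \<in> HC"
  shows "sw E (\<lambda>x y. e' y \<cdot>\<cdot> \<phi> (x \<star> l)) h = \<phi> h \<cdot>\<cdot> \<phi> l"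
proof -
  have "sweedler cop E (\<lambda>x y. par_rep.e cop E \<phi> x \<cdot>\<cdot> \<phi> (y \<star> l)) h = \<phi> h \<cdot>\<cdot> \<phi> l"
    using par_rep.e_reduce[OF cop_par_rep] assms by simp
  moreover have "sweedler cop E (\<lambda>x y. par_rep.e cop E \<phi> x \<cdot>\<cdot> \<phi> (y \<star> l)) h = sw E (\<lambda>x y. e' y \<cdot>\<cdot> \<phi> (x \<star> l)) h"
    by (rule sw_cop_cong[OF Em]) (use assms in \<open>auto simp: cop_e intro!: elin linear_e'\<close>)
  ultimately show ?thesis by simp
qed

lemma e'_commute:
  assumes "h \<in> HC" "l \<in> HC"
  shows "\<phi> h \<cdot>\<cdot> e' l = sw E (\<lambda>x y. e' (y \<star> l) \<cdot>\<cdot> \<phi> x) h"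
proof -
  have "\<phi> h \<cdot>\<cdot> e' l = sweedler cop E (\<lambda>x y. par_rep.e cop E \<phi> (x \<star> l) \<cdot>\<cdot> \<phi> y) h"
    using par_rep.e_commute[OF cop_par_rep] assms by (simp add: cop_e)
  also have "\<dots> = sw E (\<lambda>x y. e' (y \<star> l) \<cdot>\<cdot> \<phi> x) h"
    by (rule sw_cop_cong[OF Em]) (use assms in \<open>auto simp: cop_e intro!: elin linear_e'\<close>)
  finally show ?thesis .
qed

text \<open>Move \<open>e l\<close> first past \<open>\<phi>(\<tau> h\<^sub>1)\<close> and then past \<open>\<phi> h\<^sub>2\<close>: it becomes \<open>e\<close> of \<open>h\<^sub>3 \<tau>(h\<^sub>2) l\<close>
  for adjacent legs, where \<open>h\<^sub>3 \<tau>(h\<^sub>2)\<close> cancels.  For \<open>H\<^sub>p\<^sub>a\<^sub>r\<close> the two commuting families are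
  generators of \<open>t(A)\<close> and \<open>A\<close>.\<close>

lemma e_e'_commute:
  assumes h: "h \<in> HC" and l: "l \<in> HC"
  shows "e' h \<cdot>\<cdot> e l = e l \<cdot>\<cdot> e' h"
proof -
  have "e' h \<cdot>\<cdot> e l = sw E (\<lambda>x y. \<phi> y \<cdot>\<cdot> (\<phi> (\<tau> x) \<cdot>\<cdot> e l)) h"
    unfolding e'_def by (subst sw_mult_right[OF E_algebra]) (use assms in \<open>auto simp: E.m_assoc intro!: sw_cong[OF Eg]\<close>)
  also have "\<dots> = sw E (\<lambda>x y. sw E (\<lambda>a b. sw E (\<lambda>c d. e ((c \<star> \<tau> b) \<star> l) \<cdot>\<cdot> (\<phi> d \<cdot>\<cdot> \<phi> (\<tau> a))) y) x) h"
  proof (rule sw_cong[OF Eg h], goal_cases)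
    case (2 x y)
    have "\<phi> (\<tau> x) \<cdot>\<cdot> e l = sw E (\<lambda>a b. e (\<tau> b \<star> l) \<cdot>\<cdot> \<phi> (\<tau> a)) x"
      using 2 l by (subst e_commute) (auto intro!: sw_tau[OF Em] elin linear_e)
    then have "\<phi> y \<cdot>\<cdot> (\<phi> (\<tau> x) \<cdot>\<cdot> e l) = sw E (\<lambda>a b. \<phi> y \<cdot>\<cdot> (e (\<tau> b \<star> l) \<cdot>\<cdot> \<phi> (\<tau> a))) x"
      using 2 l by (simp add: sw_mult_left[OF E_algebra])
    also have "\<dots> = sw E (\<lambda>a b. sw E (\<lambda>c d. e ((c \<star> \<tau> b) \<star> l) \<cdot>\<cdot> (\<phi> d \<cdot>\<cdot> \<phi> (\<tau> a))) y) x"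
    proof (rule sw_cong[OF Eg 2(1)], goal_cases)
      case (2 a b)
      have "\<phi> y \<cdot>\<cdot> (e (\<tau> b \<star> l) \<cdot>\<cdot> \<phi> (\<tau> a)) = (\<phi> y \<cdot>\<cdot> e (\<tau> b \<star> l)) \<cdot>\<cdot> \<phi> (\<tau> a)"
        using 2 \<open>y \<in> HC\<close> l by (simp add: E.m_assoc)
      also have "\<dots> = sw E (\<lambda>c d. e (c \<star> (\<tau> b \<star> l)) \<cdot>\<cdot> \<phi> d \<cdot>\<cdot> \<phi> (\<tau> a)) y"
        using 2 \<open>y \<in> HC\<close> l by (simp add: e_commute sw_mult_right[OF E_algebra])
      also have "\<dots> = sw E (\<lambda>c d. e ((c \<star> \<tau> b) \<star> l) \<cdot>\<cdot> (\<phi> d \<cdot>\<cdot> \<phi> (\<tau> a))) y"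
        by (rule sw_cong[OF Eg]) (use 2 \<open>y \<in> HC\<close> l in \<open>auto simp: E.m_assoc H.m_assoc\<close>)
      finally show ?case .
    qed (use 2 l in \<open>auto intro!: sw_closed Eg\<close>)
    finally show ?case .
  qed (use l in \<open>auto intro!: sw_closed Eg\<close>)
  also have "\<dots> = sw E (\<lambda>a w. sw E (\<lambda>b y. sw E (\<lambda>c d. e ((c \<star> \<tau> b) \<star> l) \<cdot>\<cdot> (\<phi> d \<cdot>\<cdot> \<phi> (\<tau> a))) y) w) h"
    by (rule sw_coassoc[OF Em h]) (use l in \<open>auto intro!: elin linear_e\<close>)
  also have "\<dots> = sw E (\<lambda>a w. e (unit \<star> l) \<cdot>\<cdot> (\<phi> w \<cdot>\<cdot> \<phi> (\<tau> a))) h"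
  proof (rule sw_cong[OF Eg h], goal_cases)
    case (2 a w)
    show ?case
      by (rule collapse_tau_left[OF Em 2(2), where F="\<lambda>x d. e (x \<star> l) \<cdot>\<cdot> (\<phi> d \<cdot>\<cdot> \<phi> (\<tau> a))"])
        (use 2 l in \<open>auto intro!: elin linear_e\<close>)
  qed (use l in auto)
  also have "\<dots> = e l \<cdot>\<cdot> e' h"
    unfolding e'_def using h l by (simp add: sw_mult_left[OF E_algebra])
  finally show ?thesis .
qed

lemma e'_antipode: "h \<in> HC \<Longrightarrow> e' (S h) = sw E (\<lambda>x y. \<phi> (S x) \<cdot>\<cdot> \<phi> y) h"
  unfolding e'_def by (subst sw_antipode[OF Em]) (auto intro!: elin sw_cong[OF Eg])

end

text \<open>Two readings of the four legs of a coproduct: as two pairs, and with the two middle legs paired.  In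
  \<open>x\<^sub>1, x\<^sub>2, S(y\<^sub>1), S(y\<^sub>2)\<close> the legs that can interact are the middle ones and the outer ones.\<close>

lemma (in hopf_algebra) sw_regroup:
  assumes G: "module k G" and h: "h \<in> HC"
    and F1: "\<And>x y z. x \<in> HC \<Longrightarrow> y \<in> HC \<Longrightarrow> z \<in> HC \<Longrightarrow> linear_on k H G (\<lambda>v. F v x y z)"
    and F2: "\<And>x y z. x \<in> HC \<Longrightarrow> y \<in> HC \<Longrightarrow> z \<in> HC \<Longrightarrow> linear_on k H G (\<lambda>v. F x v y z)"
    and F3: "\<And>x y z. x \<in> HC \<Longrightarrow> y \<in> HC \<Longrightarrow> z \<in> HC \<Longrightarrow> linear_on k H G (\<lambda>v. F x y v z)"
    and F4: "\<And>x y z. x \<in> HC \<Longrightarrow> y \<in> HC \<Longrightarrow> z \<in> HC \<Longrightarrow> linear_on k H G (\<lambda>v. F x y z v)"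
  shows "sw G (\<lambda>x y. sw G (\<lambda>c d. sw G (\<lambda>a b. F a b c d) x) y) h = sw G (\<lambda>w d. sw G (\<lambda>a z. sw G (\<lambda>b c. F a b c d) z) w) h"
proof -
  interpret G: module k G by fact
  note Gg = G.abelian_group_axioms
  have Fc: "F x y z v \<in> carrier G" if "x \<in> HC" "y \<in> HC" "z \<in> HC" "v \<in> HC" for x y z v
    using linear_on_closed[OF F1] that by auto
  have "sw G (\<lambda>x y. sw G (\<lambda>c d. sw G (\<lambda>a b. F a b c d) x) y) h = sw G (\<lambda>x y. sw G (\<lambda>a b. sw G (\<lambda>c d. F a b c d) y) x) h"
    by (rule sw_cong[OF Gg h]) (auto intro!: sw_swap[OF Gg] sw_closed Gg Fc)
  also have "\<dots> = sw G (\<lambda>a w. sw G (\<lambda>b y. sw G (\<lambda>c d. F a b c d) y) w) h"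
    by (rule sw_coassoc[OF G h]) (auto intro!: lin G F1 F2 F3 F4)
  also have "\<dots> = sw G (\<lambda>a w. sw G (\<lambda>z d. sw G (\<lambda>b c. F a b c d) z) w) h"
    by (rule sw_cong[OF Gg h]) (auto intro!: sw_coassoc[OF G, symmetric] F1 F2 F3 F4 sw_closed Gg Fc)
  also have "\<dots> = sw G (\<lambda>w d. sw G (\<lambda>a z. sw G (\<lambda>b c. F a b c d) z) w) h"
    by (rule sw_coassoc[OF G h, symmetric]) (auto intro!: lin G F1 F2 F3 F4)
  finally show ?thesis .
qed

text \<open>The diagonal action, in abstract form: \<open>\<beta>\<close> stands for the tensor product over \<open>A\<close> and \<open>\<pi>\<close> for the
  induced operators.  Balancedness is stated for \<open>e\<close> and \<open>e'\<close> only, so the setting is invariant under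
  exchanging the factors and passing to the opposite comultiplication (\<open>cop_diagonal\<close> below).\<close>

locale diagonal = par_rep k H E \<phi>
  for k :: "'k ring" and H :: "('k, 'h) hopf" and E :: "('k, 'e, 'z) module_scheme" and \<phi> +
  fixes M :: "('e, 'm, 'y) module_scheme" and N :: "('e, 'n, 'x) module_scheme" and G :: "('k, 'g, 'w) module_scheme"
    and \<beta> :: "'m \<Rightarrow> 'n \<Rightarrow> 'g" and \<pi> :: "'h \<Rightarrow> 'g \<Rightarrow> 'g"
  assumes M: "left_module E M" and N: "left_module E N" and G: "module k G"
    and beta_left: "n \<in> carrier N \<Longrightarrow> linear_on k (restrict_scalars E M) G (\<lambda>m. \<beta> m n)"
    and beta_right: "m \<in> carrier M \<Longrightarrow> linear_on k (restrict_scalars E N) G (\<lambda>n. \<beta> m n)"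
    and balanced: "h \<in> HC \<Longrightarrow> m \<in> carrier M \<Longrightarrow> n \<in> carrier N \<Longrightarrow> \<beta> (e' h \<odot>\<^bsub>M\<^esub> m) n = \<beta> m (e h \<odot>\<^bsub>N\<^esub> n)"
    and pi_linear: "h \<in> HC \<Longrightarrow> linear_on k G G (\<pi> h)"
    and pi_linear_arg: "X \<in> carrier G \<Longrightarrow> linear_on k H G (\<lambda>h. \<pi> h X)"
    and pi_beta: "h \<in> HC \<Longrightarrow> m \<in> carrier M \<Longrightarrow> n \<in> carrier N \<Longrightarrow>
      \<pi> h (\<beta> m n) = sw G (\<lambda>x y. \<beta> (\<phi> x \<odot>\<^bsub>M\<^esub> m) (\<phi> y \<odot>\<^bsub>N\<^esub> n)) h"
begin

sublocale G: module k G by (rule G)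

abbreviation actM (infixr "\<bullet>" 75) where "a \<bullet> m \<equiv> a \<odot>\<^bsub>M\<^esub> m"
abbreviation actN (infixr "\<circ>\<circ>" 75) where "a \<circ>\<circ> n \<equiv> a \<odot>\<^bsub>N\<^esub> n"

lemmas Gg = G.abelian_group_axioms

lemma actM_closed [simp, intro]: "a \<in> carrier E \<Longrightarrow> m \<in> carrier M \<Longrightarrow> a \<bullet> m \<in> carrier M"
  by (rule left_moduleD(3)[OF M])

lemma actN_closed [simp, intro]: "a \<in> carrier E \<Longrightarrow> n \<in> carrier N \<Longrightarrow> a \<circ>\<circ> n \<in> carrier N"
  by (rule left_moduleD(3)[OF N])

lemma beta_closed [simp, intro]: "m \<in> carrier M \<Longrightarrow> n \<in> carrier N \<Longrightarrow> \<beta> m n \<in> carrier G"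
  using linear_on_closed[OF beta_left] by simp

lemma pi_closed [simp, intro]: "h \<in> HC \<Longrightarrow> X \<in> carrier G \<Longrightarrow> \<pi> h X \<in> carrier G"
  by (rule linear_on_closed[OF pi_linear])

lemma lin_beta_left:
  "n \<in> carrier N \<Longrightarrow> linear_on k K (restrict_scalars E M) f \<Longrightarrow> linear_on k K G (\<lambda>x. \<beta> (f x) n)"
  by (rule linear_on_comp[OF beta_left])

lemma lin_beta_right:
  "m \<in> carrier M \<Longrightarrow> linear_on k K (restrict_scalars E N) f \<Longrightarrow> linear_on k K G (\<lambda>x. \<beta> m (f x))"
  by (rule linear_on_comp[OF beta_right])

lemma lin_pi: "h \<in> HC \<Longrightarrow> linear_on k K G f \<Longrightarrow> linear_on k K G (\<lambda>x. \<pi> h (f x))"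
  by (rule linear_on_comp[OF pi_linear])

lemma lin_pi_arg: "X \<in> carrier G \<Longrightarrow> linear_on k K H f \<Longrightarrow> linear_on k K G (\<lambda>x. \<pi> (f x) X)"
  by (rule linear_on_comp[OF pi_linear_arg])

lemmas dlin = elin G linear_on_act_left[OF E_algebra M] linear_on_act_left[OF E_algebra N]
  linear_on_act_right[OF E_algebra M] linear_on_act_right[OF E_algebra N] lin_beta_left lin_beta_right lin_pi lin_pi_arg
  linear_e linear_e'

lemma beta_sw_left:
  assumes "h \<in> HC" "m \<in> carrier M" "n \<in> carrier N" "\<And>x y. x \<in> HC \<Longrightarrow> y \<in> HC \<Longrightarrow> f x y \<in> carrier E"
  shows "\<beta> (sw E f h \<bullet> m) n = sw G (\<lambda>x y. \<beta> (f x y \<bullet> m) n) h"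
  by (rule sw_linear_apply[OF Em G, where \<phi>="\<lambda>a. \<beta> (a \<bullet> m) n"]) (use assms in \<open>auto intro!: dlin\<close>)

lemma beta_sw_right:
  assumes "h \<in> HC" "m \<in> carrier M" "n \<in> carrier N" "\<And>x y. x \<in> HC \<Longrightarrow> y \<in> HC \<Longrightarrow> f x y \<in> carrier E"
  shows "\<beta> m (sw E f h \<circ>\<circ> n) = sw G (\<lambda>x y. \<beta> m (f x y \<circ>\<circ> n)) h"
  by (rule sw_linear_apply[OF Em G, where \<phi>="\<lambda>a. \<beta> m (a \<circ>\<circ> n)"]) (use assms in \<open>auto intro!: dlin\<close>)

lemma pi_sw:
  assumes "h \<in> HC" "l \<in> HC" "\<And>x y. x \<in> HC \<Longrightarrow> y \<in> HC \<Longrightarrow> f x y \<in> carrier G"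
  shows "\<pi> h (sw G f l) = sw G (\<lambda>x y. \<pi> h (f x y)) l"
  by (rule sw_linear_apply[OF G G pi_linear]) (use assms in auto)

lemma mult_act: "a \<in> carrier E \<Longrightarrow> b \<in> carrier E \<Longrightarrow> m \<in> carrier M \<Longrightarrow> (a \<cdot>\<cdot> b) \<bullet> m = a \<bullet> b \<bullet> m"
  "a \<in> carrier E \<Longrightarrow> b \<in> carrier E \<Longrightarrow> n \<in> carrier N \<Longrightarrow> (a \<cdot>\<cdot> b) \<circ>\<circ> n = a \<circ>\<circ> b \<circ>\<circ> n"
  by (auto simp: left_moduleD(6)[OF M] left_moduleD(6)[OF N])

lemma one_act [simp]: "m \<in> carrier M \<Longrightarrow> \<one>\<^bsub>E\<^esub> \<bullet> m = m" "n \<in> carrier N \<Longrightarrow> \<one>\<^bsub>E\<^esub> \<circ>\<circ> n = n"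
  by (auto simp: left_moduleD(7)[OF M] left_moduleD(7)[OF N])

text \<open>In \<open>[x\<^sub>1][S(y\<^sub>2) a] m \<otimes> [x\<^sub>2][S(y\<^sub>1) b] n\<close> the legs \<open>x\<^sub>2, y\<^sub>1\<close> are adjacent and give \<open>e\<close> in the right
  factor.  It is carried over to the left factor as \<open>e'\<close>, where it is absorbed by \<open>[x\<^sub>1]\<close>; the remaining
  two legs give \<open>e\<close> in the left factor.\<close>

lemma pi_pi_S_fixed:
  assumes h: "h \<in> HC" and a: "a \<in> HC" and b: "b \<in> HC" and m: "m \<in> carrier M" and n: "n \<in> carrier N"
  shows "sw G (\<lambda>x y. sw G (\<lambda>y1 y2. sw G (\<lambda>x1 x2. \<beta> (\<phi> x1 \<bullet> \<phi> (S y2 \<star> a) \<bullet> m) (\<phi> x2 \<circ>\<circ> \<phi> (S y1 \<star> b) \<circ>\<circ> n)) x) y) h =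
    \<beta> (e h \<bullet> \<phi> a \<bullet> m) (\<phi> b \<circ>\<circ> n)"
proof -
  have "sw G (\<lambda>x y. sw G (\<lambda>y1 y2. sw G (\<lambda>x1 x2. \<beta> (\<phi> x1 \<bullet> \<phi> (S y2 \<star> a) \<bullet> m) (\<phi> x2 \<circ>\<circ> \<phi> (S y1 \<star> b) \<circ>\<circ> n)) x) y) h =
    sw G (\<lambda>w y2. sw G (\<lambda>x1 z. sw G (\<lambda>x2 y1. \<beta> (\<phi> x1 \<bullet> \<phi> (S y2 \<star> a) \<bullet> m) (\<phi> x2 \<circ>\<circ> \<phi> (S y1 \<star> b) \<circ>\<circ> n)) z) w) h"
    by (rule sw_regroup[OF G h]) (use assms in \<open>auto intro!: dlin\<close>)
  also have "\<dots> = sw G (\<lambda>w y2. sw G (\<lambda>x1 z. \<beta> (e' z \<bullet> \<phi> x1 \<bullet> \<phi> (S y2 \<star> a) \<bullet> m) (\<phi> b \<circ>\<circ> n)) w) h"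
  proof (intro sw_cong[OF Gg] h, goal_cases)
    case (4 w y2 x1 z)
    have "sw G (\<lambda>x2 y1. \<beta> (\<phi> x1 \<bullet> \<phi> (S y2 \<star> a) \<bullet> m) (\<phi> x2 \<circ>\<circ> \<phi> (S y1 \<star> b) \<circ>\<circ> n)) z =
       \<beta> (\<phi> x1 \<bullet> \<phi> (S y2 \<star> a) \<bullet> m) ((e z \<cdot>\<cdot> \<phi> b) \<circ>\<circ> n)"
      using 4 assms by (simp add: e_mult beta_sw_right) (auto intro!: sw_cong[OF Gg] simp: mult_act)
    also have "\<dots> = \<beta> (e' z \<bullet> \<phi> x1 \<bullet> \<phi> (S y2 \<star> a) \<bullet> m) (\<phi> b \<circ>\<circ> n)"
      using 4 assms by (simp add: balanced mult_act)
    finally show ?case .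
  qed (use assms in \<open>auto intro!: sw_closed Gg\<close>)
  also have "\<dots> = sw G (\<lambda>w y2. \<beta> (\<phi> w \<bullet> \<phi> (S y2 \<star> a) \<bullet> m) (\<phi> b \<circ>\<circ> n)) h"
  proof (intro sw_cong[OF Gg] h, goal_cases)
    case (2 w y2)
    have "\<phi> w = sw E (\<lambda>x y. e' y \<cdot>\<cdot> \<phi> (x \<star> unit)) w"
      using e'_reduce[of w unit] 2 by (simp add: phi_unit)
    also have "\<dots> = sw E (\<lambda>x y. e' y \<cdot>\<cdot> \<phi> x) w" using 2 by (auto intro!: sw_cong[OF Eg])
    finally show ?case
      using 2 assms by (simp add: beta_sw_left) (auto intro!: sw_cong[OF Gg] simp: mult_act)
  qed (use assms in auto)
  also have "\<dots> = \<beta> ((e h \<cdot>\<cdot> \<phi> a) \<bullet> m) (\<phi> b \<circ>\<circ> n)"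
    using assms by (simp add: e_mult beta_sw_left) (auto intro!: sw_cong[OF Gg] simp: mult_act)
  finally show ?thesis using assms by (simp add: mult_act)
qed

text \<open>The elements \<open>a\<close>, \<open>b\<close> of the preceding lemma are the legs of \<open>l\<close>.\<close>

lemma pi_pi_S_mult:
  assumes h: "h \<in> HC" and l: "l \<in> HC" and m: "m \<in> carrier M" and n: "n \<in> carrier N"
  shows "sw G (\<lambda>x y. \<pi> x (\<pi> (S y \<star> l) (\<beta> m n))) h = sw G (\<lambda>a b. \<beta> (e h \<bullet> \<phi> a \<bullet> m) (\<phi> b \<circ>\<circ> n)) l"
proof -
  have step: "\<pi> x (\<pi> (S y \<star> l) (\<beta> m n)) = sw G (\<lambda>a b. sw G (\<lambda>y1 y2. sw G (\<lambda>x1 x2.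
      \<beta> (\<phi> x1 \<bullet> \<phi> (S y2 \<star> a) \<bullet> m) (\<phi> x2 \<circ>\<circ> \<phi> (S y1 \<star> b) \<circ>\<circ> n)) x) y) l" if xy: "x \<in> HC" "y \<in> HC" for x y
  proof -
    have "\<pi> (S y \<star> l) (\<beta> m n) = sw G (\<lambda>p q. sw G (\<lambda>a b. \<beta> (\<phi> (p \<star> a) \<bullet> m) (\<phi> (q \<star> b) \<circ>\<circ> n)) l) (S y)"
      using xy assms by (subst pi_beta) (auto intro!: sw_comul_mult[OF G] bilinear_onI dlin)
    also have "\<dots> = sw G (\<lambda>y1 y2. sw G (\<lambda>a b. \<beta> (\<phi> (S y2 \<star> a) \<bullet> m) (\<phi> (S y1 \<star> b) \<circ>\<circ> n)) l) y"
      by (rule sw_antipode[OF G]) (use xy assms in \<open>auto intro!: dlin\<close>)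
    also have "\<dots> = sw G (\<lambda>a b. sw G (\<lambda>y1 y2. \<beta> (\<phi> (S y2 \<star> a) \<bullet> m) (\<phi> (S y1 \<star> b) \<circ>\<circ> n)) y) l"
      by (rule sw_swap[OF Gg]) (use xy assms in auto)
    finally have "\<pi> x (\<pi> (S y \<star> l) (\<beta> m n)) = sw G (\<lambda>a b. sw G (\<lambda>y1 y2. \<pi> x (\<beta> (\<phi> (S y2 \<star> a) \<bullet> m) (\<phi> (S y1 \<star> b) \<circ>\<circ> n))) y) l"
      using xy assms by (simp add: pi_sw sw_closed Gg) (auto intro!: sw_cong[OF Gg] sw_closed Gg simp: pi_sw)
    also have "\<dots> = sw G (\<lambda>a b. sw G (\<lambda>y1 y2. sw G (\<lambda>x1 x2.
      \<beta> (\<phi> x1 \<bullet> \<phi> (S y2 \<star> a) \<bullet> m) (\<phi> x2 \<circ>\<circ> \<phi> (S y1 \<star> b) \<circ>\<circ> n)) x) y) l"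
      by (intro sw_cong[OF Gg]) (use xy assms in \<open>auto simp: pi_beta intro!: sw_closed Gg\<close>)
    finally show ?thesis .
  qed
  have "sw G (\<lambda>x y. \<pi> x (\<pi> (S y \<star> l) (\<beta> m n))) h = sw G (\<lambda>x y. sw G (\<lambda>a b. sw G (\<lambda>y1 y2. sw G (\<lambda>x1 x2.
      \<beta> (\<phi> x1 \<bullet> \<phi> (S y2 \<star> a) \<bullet> m) (\<phi> x2 \<circ>\<circ> \<phi> (S y1 \<star> b) \<circ>\<circ> n)) x) y) l) h"
    by (rule sw_cong[OF Gg h]) (use assms in \<open>auto simp: step intro!: sw_closed Gg\<close>)
  also have "\<dots> = sw G (\<lambda>a b. sw G (\<lambda>x y. sw G (\<lambda>y1 y2. sw G (\<lambda>x1 x2.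
      \<beta> (\<phi> x1 \<bullet> \<phi> (S y2 \<star> a) \<bullet> m) (\<phi> x2 \<circ>\<circ> \<phi> (S y1 \<star> b) \<circ>\<circ> n)) x) y) h) l"
    by (rule sw_swap[OF Gg h l]) (use assms in \<open>auto intro!: sw_closed Gg\<close>)
  also have "\<dots> = sw G (\<lambda>a b. \<beta> (e h \<bullet> \<phi> a \<bullet> m) (\<phi> b \<circ>\<circ> n)) l"
    by (rule sw_cong[OF Gg l]) (use assms in \<open>auto simp: pi_pi_S_fixed\<close>)
  finally show ?thesis .
qed

lemma pi_pi_S:
  assumes h: "h \<in> HC" and m: "m \<in> carrier M" and n: "n \<in> carrier N"
  shows "sw G (\<lambda>x y. \<pi> x (\<pi> (S y) (\<beta> m n))) h = \<beta> (e h \<bullet> m) n"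
proof -
  have "sw G (\<lambda>x y. \<pi> x (\<pi> (S y) (\<beta> m n))) h = sw G (\<lambda>x y. \<pi> x (\<pi> (S y \<star> unit) (\<beta> m n))) h"
    by (rule sw_cong[OF Gg h]) (use assms in auto)
  also have "\<dots> = sw G (\<lambda>a b. \<beta> (e h \<bullet> \<phi> a \<bullet> m) (\<phi> b \<circ>\<circ> n)) unit"
    by (rule pi_pi_S_mult) (use assms in auto)
  also have "\<dots> = \<beta> (e h \<bullet> m) n"
    by (subst sw_unit[OF G]) (use assms in \<open>auto simp: phi_unit intro!: bilinear_onI dlin\<close>)
  finally show ?thesis .
qed

text \<open>The computation of \<open>pi_pi_S\<close> with an additional factor \<open>h\<close> in front.  The inner pair of legs of \<open>l\<close>
  contributes \<open>e\<close> to the right factor, but has to pass the second leg of \<open>h\<close> (\<open>e_commute\<close>) before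
  it can be carried over; it is absorbed by \<open>\<phi>(h' w)\<close> at the end.\<close>

lemma pi_e_balanced:
  assumes h: "h \<in> HC" and l: "l \<in> HC" and m: "m \<in> carrier M" and n: "n \<in> carrier N"
  shows "sw G (\<lambda>x y. \<pi> (h \<star> x) (\<pi> (S y) (\<beta> m n))) l = \<pi> h (\<beta> (e l \<bullet> m) n)"
proof -
  \<comment> \<open>\<open>K\<close> is the summand after all operators and coproducts have been expanded.\<close>
  define K where "K = (\<lambda>a b x1 x2 y1 y2. \<beta> (\<phi> (a \<star> x1) \<bullet> \<phi> (S y2) \<bullet> m) (\<phi> (b \<star> x2) \<circ>\<circ> \<phi> (S y1) \<circ>\<circ> n))"
  have Kc: "K a b x1 x2 y1 y2 \<in> carrier G" if "a \<in> HC" "b \<in> HC" "x1 \<in> HC" "x2 \<in> HC" "y1 \<in> HC" "y2 \<in> HC" for a b x1 x2 y1 y2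
    using that m n by (auto simp: K_def)
  have step: "\<pi> (h \<star> x) (\<pi> (S y) (\<beta> m n)) = sw G (\<lambda>a b. sw G (\<lambda>y1 y2. sw G (\<lambda>x1 x2. K a b x1 x2 y1 y2) x) y) h"
    if xy: "x \<in> HC" "y \<in> HC" for x y
  proof -
    have "\<pi> (S y) (\<beta> m n) = sw G (\<lambda>y1 y2. \<beta> (\<phi> (S y2) \<bullet> m) (\<phi> (S y1) \<circ>\<circ> n)) y"
      using xy m n by (subst pi_beta) (auto intro!: sw_antipode[OF G] dlin)
    then have "\<pi> (h \<star> x) (\<pi> (S y) (\<beta> m n)) = sw G (\<lambda>y1 y2. \<pi> (h \<star> x) (\<beta> (\<phi> (S y2) \<bullet> m) (\<phi> (S y1) \<circ>\<circ> n))) y"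
      using xy assms by (simp add: pi_sw)
    also have "\<dots> = sw G (\<lambda>y1 y2. sw G (\<lambda>a b. sw G (\<lambda>x1 x2. K a b x1 x2 y1 y2) x) h) y"
      unfolding K_def
      by (rule sw_cong[OF Gg xy(2)])
        (use xy assms in \<open>auto simp: pi_beta intro!: sw_closed Gg sw_comul_mult[OF G] bilinear_onI dlin\<close>)
    also have "\<dots> = sw G (\<lambda>a b. sw G (\<lambda>y1 y2. sw G (\<lambda>x1 x2. K a b x1 x2 y1 y2) x) y) h"
      by (rule sw_swap[OF Gg]) (use xy assms in \<open>auto intro!: sw_closed Gg Kc\<close>)
    finally show ?thesis .
  qed
  \<comment> \<open>\<open>L\<close> is the summand after the inner legs have been carried over to the left factor.\<close>
  define L where "L = (\<lambda>b1 z a x1 n' y2. \<beta> (e' (b1 \<star> z) \<bullet> \<phi> (a \<star> x1) \<bullet> \<phi> (S y2) \<bullet> m) n')"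
  have Lc: "L b1 z a x1 n' y2 \<in> carrier G" if "b1 \<in> HC" "z \<in> HC" "a \<in> HC" "x1 \<in> HC" "y2 \<in> HC" "n' \<in> carrier N" for b1 z a x1 n' y2
    using that m n by (auto simp: L_def)
  have inner: "sw G (\<lambda>x2 y1. K a b x1 x2 y1 y2) z = sw G (\<lambda>b1 b2. L b1 z a x1 (\<phi> b2 \<circ>\<circ> n) y2) b"
    if *: "a \<in> HC" "b \<in> HC" "x1 \<in> HC" "z \<in> HC" "y2 \<in> HC" for a b x1 z y2
  proof -
    have "sw G (\<lambda>x2 y1. K a b x1 x2 y1 y2) z = \<beta> (\<phi> (a \<star> x1) \<bullet> \<phi> (S y2) \<bullet> m) ((\<phi> b \<cdot>\<cdot> e z) \<circ>\<circ> n)"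
      using * m n by (simp add: mult_e beta_sw_right K_def) (auto intro!: sw_cong[OF Gg] simp: mult_act)
    also have "\<dots> = sw G (\<lambda>b1 b2. L b1 z a x1 (\<phi> b2 \<circ>\<circ> n) y2) b"
      using * m n by (simp add: e_commute beta_sw_right L_def) (auto intro!: sw_cong[OF Gg] simp: mult_act balanced)
    finally show ?thesis .
  qed
  have "sw G (\<lambda>x y. \<pi> (h \<star> x) (\<pi> (S y) (\<beta> m n))) l =
      sw G (\<lambda>x y. sw G (\<lambda>a b. sw G (\<lambda>y1 y2. sw G (\<lambda>x1 x2. K a b x1 x2 y1 y2) x) y) h) l"
    by (rule sw_cong[OF Gg l]) (use assms in \<open>auto simp: step intro!: sw_closed Gg Kc\<close>)
  also have "\<dots> = sw G (\<lambda>a b. sw G (\<lambda>x y. sw G (\<lambda>y1 y2. sw G (\<lambda>x1 x2. K a b x1 x2 y1 y2) x) y) l) h"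
    by (rule sw_swap[OF Gg l h]) (use assms in \<open>auto intro!: sw_closed Gg Kc\<close>)
  also have "\<dots> = sw G (\<lambda>a b. sw G (\<lambda>w y2. sw G (\<lambda>x1 z. sw G (\<lambda>x2 y1. K a b x1 x2 y1 y2) z) w) l) h"
    by (rule sw_cong[OF Gg h]) (use assms in \<open>auto simp: K_def intro!: sw_regroup[OF G l] dlin sw_closed Gg\<close>)
  also have "\<dots> = sw G (\<lambda>a b. sw G (\<lambda>w y2. sw G (\<lambda>x1 z. sw G (\<lambda>b1 b2. L b1 z a x1 (\<phi> b2 \<circ>\<circ> n) y2) b) w) l) h"
    by (intro sw_cong[OF Gg] h l) (use n in \<open>auto simp: inner intro!: sw_closed Gg Lc l\<close>)
  also have "\<dots> = sw G (\<lambda>a b. sw G (\<lambda>w y2. sw G (\<lambda>b1 b2. sw G (\<lambda>x1 z. L b1 z a x1 (\<phi> b2 \<circ>\<circ> n) y2) w) b) l) h"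
    by (intro sw_cong[OF Gg] h l sw_swap[OF Gg]) (use n in \<open>auto intro!: sw_closed Gg Lc l\<close>)
  also have "\<dots> = sw G (\<lambda>a b. sw G (\<lambda>b1 b2. sw G (\<lambda>w y2. sw G (\<lambda>x1 z. L b1 z a x1 (\<phi> b2 \<circ>\<circ> n) y2) w) l) b) h"
    by (intro sw_cong[OF Gg] h l sw_swap[OF Gg]) (use n in \<open>auto intro!: sw_closed Gg Lc l\<close>)
  also have "\<dots> = sw G (\<lambda>h' b2. sw G (\<lambda>a b1. sw G (\<lambda>w y2. sw G (\<lambda>x1 z. L b1 z a x1 (\<phi> b2 \<circ>\<circ> n) y2) w) l) h') h"
    by (rule sw_coassoc[OF G h, symmetric]) (use m n l in \<open>auto simp: L_def intro!: dlin\<close>)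
  also have "\<dots> = sw G (\<lambda>h' b2. sw G (\<lambda>w y2. sw G (\<lambda>a b1. sw G (\<lambda>x1 z. L b1 z a x1 (\<phi> b2 \<circ>\<circ> n) y2) w) h') l) h"
    by (intro sw_cong[OF Gg] h l sw_swap[OF Gg]) (use n in \<open>auto intro!: sw_closed Gg Lc l\<close>)
  also have "\<dots> = sw G (\<lambda>h' b2. sw G (\<lambda>w y2. \<beta> (\<phi> (h' \<star> w) \<bullet> \<phi> (S y2) \<bullet> m) (\<phi> b2 \<circ>\<circ> n)) l) h"
  proof (intro sw_cong[OF Gg] h l, goal_cases)
    case (3 h' b2 w y2)
    have "sw G (\<lambda>a b1. sw G (\<lambda>x1 z. L b1 z a x1 (\<phi> b2 \<circ>\<circ> n) y2) w) h' =
       sw G (\<lambda>p q. \<beta> (e' q \<bullet> \<phi> p \<bullet> \<phi> (S y2) \<bullet> m) (\<phi> b2 \<circ>\<circ> n)) (h' \<star> w)"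
      unfolding L_def by (rule sw_comul_mult[OF G, symmetric]) (use 3 m n in \<open>auto intro!: bilinear_onI dlin\<close>)
    also have "\<dots> = \<beta> (sw E (\<lambda>p q. e' q \<cdot>\<cdot> \<phi> p) (h' \<star> w) \<bullet> \<phi> (S y2) \<bullet> m) (\<phi> b2 \<circ>\<circ> n)"
      using 3 m n by (subst beta_sw_left) (auto intro!: sw_cong[OF Gg] simp: mult_act)
    also have "sw E (\<lambda>p q. e' q \<cdot>\<cdot> \<phi> p) (h' \<star> w) = sw E (\<lambda>p q. e' q \<cdot>\<cdot> \<phi> (p \<star> unit)) (h' \<star> w)"
      by (rule sw_cong[OF Eg]) (use 3 in auto)
    also have "\<dots> = \<phi> (h' \<star> w)" using e'_reduce[of "h' \<star> w" unit] 3 by (simp add: phi_unit)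
    finally show ?case .
  qed (use m n l in \<open>auto intro!: sw_closed Gg\<close>)
  also have "\<dots> = sw G (\<lambda>h' b2. \<beta> (\<phi> h' \<bullet> e l \<bullet> m) (\<phi> b2 \<circ>\<circ> n)) h"
  proof (intro sw_cong[OF Gg] h, goal_cases)
    case (2 h' b2)
    have "\<beta> (\<phi> h' \<bullet> e l \<bullet> m) (\<phi> b2 \<circ>\<circ> n) = \<beta> ((\<phi> h' \<cdot>\<cdot> e l) \<bullet> m) (\<phi> b2 \<circ>\<circ> n)"
      using 2 m n l by (simp add: mult_act)
    also have "\<dots> = sw G (\<lambda>w y2. \<beta> (\<phi> (h' \<star> w) \<bullet> \<phi> (S y2) \<bullet> m) (\<phi> b2 \<circ>\<circ> n)) l"
      using 2 m n l by (simp add: mult_e beta_sw_left) (auto intro!: sw_cong[OF Gg] simp: mult_act)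
    finally show ?case by simp
  qed (use m n l in auto)
  also have "\<dots> = \<pi> h (\<beta> (e l \<bullet> m) n)" using assms by (simp add: pi_beta)
  finally show ?thesis .
qed

lemma pi_rel2:
  assumes h: "h \<in> HC" and l: "l \<in> HC" and m: "m \<in> carrier M" and n: "n \<in> carrier N"
  shows "sw G (\<lambda>x y. \<pi> h (\<pi> x (\<pi> (S y) (\<beta> m n)))) l = sw G (\<lambda>x y. \<pi> (h \<star> x) (\<pi> (S y) (\<beta> m n))) l"
  using assms by (simp add: pi_e_balanced pi_sw[symmetric] pi_pi_S)

lemma pi_rel3:
  assumes h: "h \<in> HC" and l: "l \<in> HC" and m: "m \<in> carrier M" and n: "n \<in> carrier N"
  shows "sw G (\<lambda>x y. \<pi> x (\<pi> (S y) (\<pi> l (\<beta> m n)))) h = sw G (\<lambda>x y. \<pi> x (\<pi> (S y \<star> l) (\<beta> m n))) h"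
proof -
  have "sw G (\<lambda>x y. \<pi> x (\<pi> (S y) (\<pi> l (\<beta> m n)))) h = sw G (\<lambda>x y. sw G (\<lambda>a b. \<pi> x (\<pi> (S y) (\<beta> (\<phi> a \<bullet> m) (\<phi> b \<circ>\<circ> n)))) l) h"
    by (rule sw_cong[OF Gg h]) (use assms in \<open>auto simp: pi_beta[OF l] pi_sw intro!: sw_closed Gg\<close>)
  also have "\<dots> = sw G (\<lambda>a b. sw G (\<lambda>x y. \<pi> x (\<pi> (S y) (\<beta> (\<phi> a \<bullet> m) (\<phi> b \<circ>\<circ> n)))) h) l"
    by (rule sw_swap[OF Gg h l]) (use assms in auto)
  also have "\<dots> = sw G (\<lambda>a b. \<beta> (e h \<bullet> \<phi> a \<bullet> m) (\<phi> b \<circ>\<circ> n)) l"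
    by (rule sw_cong[OF Gg l]) (use assms in \<open>auto simp: pi_pi_S\<close>)
  finally show ?thesis using pi_pi_S_mult assms by simp
qed

text \<open>Flipping the tensor factors compensates for flipping the comultiplication.\<close>

lemma cop_diagonal: "diagonal k cop E \<phi> N M G (\<lambda>n m. \<beta> m n) \<pi>"
proof (intro diagonal.intro cop_par_rep diagonal_axioms.intro)
  show "left_module E N" "left_module E M" "module k G" by (rule N M G)+
  show "\<beta> m (par_rep.e' cop E \<phi> h \<circ>\<circ> n) = \<beta> (par_rep.e cop E \<phi> h \<bullet> m) n"
    if "h \<in> carrier cop" "n \<in> carrier N" "m \<in> carrier M" for h m n
    using that by (simp add: cop_e cop_e' balanced)
  show "\<pi> h (\<beta> m n) = sweedler cop G (\<lambda>x y. \<beta> (\<phi> y \<bullet> m) (\<phi> x \<circ>\<circ> n)) h"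
    if "h \<in> carrier cop" "n \<in> carrier N" "m \<in> carrier M" for h m n
    using that by (simp add: pi_beta sw_cop[OF G] dlin)
qed (auto intro!: dlin)

lemma pi_pi_tau:
  assumes h: "h \<in> HC" and m: "m \<in> carrier M" and n: "n \<in> carrier N"
  shows "sw G (\<lambda>x y. \<pi> y (\<pi> (\<tau> x) (\<beta> m n))) h = \<beta> m (e' h \<circ>\<circ> n)"
  using diagonal.pi_pi_S[OF cop_diagonal, of h n m] assms by (simp add: cop_e sw_cop[OF G] dlin)

lemma pi_rel4:
  assumes h: "h \<in> HC" and l: "l \<in> HC" and m: "m \<in> carrier M" and n: "n \<in> carrier N"
  shows "sw G (\<lambda>x y. \<pi> h (\<pi> (S x) (\<pi> y (\<beta> m n)))) l = sw G (\<lambda>x y. \<pi> (h \<star> S x) (\<pi> y (\<beta> m n))) l"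
proof -
  have "sweedler cop G (\<lambda>x y. \<pi> h (\<pi> x (\<pi> (\<tau> y) (\<beta> m n)))) (S l) = sweedler cop G (\<lambda>x y. \<pi> (h \<star> x) (\<pi> (\<tau> y) (\<beta> m n))) (S l)"
    using diagonal.pi_rel2[OF cop_diagonal, of h "S l" n m] assms by simp
  then have "sw G (\<lambda>x y. \<pi> h (\<pi> (S x) (\<pi> (\<tau> (S y)) (\<beta> m n)))) l = sw G (\<lambda>x y. \<pi> (h \<star> S x) (\<pi> (\<tau> (S y)) (\<beta> m n))) l"
    using assms by (simp add: sw_cop_tau[OF G] dlin)
  moreover have "sw G (\<lambda>x y. \<pi> h (\<pi> (S x) (\<pi> (\<tau> (S y)) (\<beta> m n)))) l = sw G (\<lambda>x y. \<pi> h (\<pi> (S x) (\<pi> y (\<beta> m n)))) l"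
    "sw G (\<lambda>x y. \<pi> (h \<star> S x) (\<pi> (\<tau> (S y)) (\<beta> m n))) l = sw G (\<lambda>x y. \<pi> (h \<star> S x) (\<pi> y (\<beta> m n))) l"
    by (rule sw_cong[OF Gg l], use assms in auto)+
  ultimately show ?thesis by simp
qed

lemma pi_rel5:
  assumes h: "h \<in> HC" and l: "l \<in> HC" and m: "m \<in> carrier M" and n: "n \<in> carrier N"
  shows "sw G (\<lambda>x y. \<pi> (S x) (\<pi> y (\<pi> l (\<beta> m n)))) h = sw G (\<lambda>x y. \<pi> (S x) (\<pi> (y \<star> l) (\<beta> m n))) h"
proof -
  have "sweedler cop G (\<lambda>x y. \<pi> x (\<pi> (\<tau> y) (\<pi> l (\<beta> m n)))) (S h) = sweedler cop G (\<lambda>x y. \<pi> x (\<pi> (\<tau> y \<star> l) (\<beta> m n))) (S h)"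
    using diagonal.pi_rel3[OF cop_diagonal, of "S h" l n m] assms by simp
  then have "sw G (\<lambda>x y. \<pi> (S x) (\<pi> (\<tau> (S y)) (\<pi> l (\<beta> m n)))) h = sw G (\<lambda>x y. \<pi> (S x) (\<pi> (\<tau> (S y) \<star> l) (\<beta> m n))) h"
    using assms by (simp add: sw_cop_tau[OF G] dlin)
  moreover have "sw G (\<lambda>x y. \<pi> (S x) (\<pi> (\<tau> (S y)) (\<pi> l (\<beta> m n)))) h = sw G (\<lambda>x y. \<pi> (S x) (\<pi> y (\<pi> l (\<beta> m n)))) h"
    "sw G (\<lambda>x y. \<pi> (S x) (\<pi> (\<tau> (S y) \<star> l) (\<beta> m n))) h = sw G (\<lambda>x y. \<pi> (S x) (\<pi> (y \<star> l) (\<beta> m n))) h"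
    by (rule sw_cong[OF Gg h], use assms in auto)+
  ultimately show ?thesis by simp
qed

end

section \<open>Quotients of algebras\<close>

context
  fixes k :: "'k ring" and R :: "('k, 'a) module" and I :: "'a set"
  assumes R: "k_algebra k R" and I: "ideal I R"
begin

interpretation R: module k R by (rule k_algebraD[OF R])
interpretation Rr: ring R by (rule k_algebraD[OF R])
interpretation I: ideal I R by (rule I)

abbreviation (input) "Quo \<equiv> quotient_algebra R I"

lemma quotient_carrier: "carrier Quo = (\<lambda>x. I +>\<^bsub>R\<^esub> x) ` carrier R"
  by (auto simp: quotient_algebra_def FactRing_simps)

lemma coset_eq_iff: "x \<in> carrier R \<Longrightarrow> y \<in> carrier R \<Longrightarrow> I +>\<^bsub>R\<^esub> x = I +>\<^bsub>R\<^esub> y \<longleftrightarrow> x \<ominus>\<^bsub>R\<^esub> y \<in> I"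
  by (rule Rr.quotient_eq_iff_same_a_r_cos[OF I, symmetric])

lemma quotient_simps:
  "\<one>\<^bsub>Quo\<^esub> = I +>\<^bsub>R\<^esub> \<one>\<^bsub>R\<^esub>" "\<zero>\<^bsub>Quo\<^esub> = I +>\<^bsub>R\<^esub> \<zero>\<^bsub>R\<^esub>"
  "x \<in> carrier R \<Longrightarrow> y \<in> carrier R \<Longrightarrow> (I +>\<^bsub>R\<^esub> x) \<oplus>\<^bsub>Quo\<^esub> (I +>\<^bsub>R\<^esub> y) = I +>\<^bsub>R\<^esub> (x \<oplus>\<^bsub>R\<^esub> y)"
  "x \<in> carrier R \<Longrightarrow> y \<in> carrier R \<Longrightarrow> (I +>\<^bsub>R\<^esub> x) \<otimes>\<^bsub>Quo\<^esub> (I +>\<^bsub>R\<^esub> y) = I +>\<^bsub>R\<^esub> (x \<otimes>\<^bsub>R\<^esub> y)"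
  by (simp_all add: quotient_algebra_def FactRing_def I.rcoset_mult_add I.a_rcos_sum Rr.a_rcos_zero[OF I])

lemma smult_ideal: "c \<in> carrier k \<Longrightarrow> x \<in> I \<Longrightarrow> c \<odot>\<^bsub>R\<^esub> x \<in> I"
  using I.I_l_closed[of x "c \<odot>\<^bsub>R\<^esub> \<one>\<^bsub>R\<^esub>"] I.Icarr[of x] by (simp add: k_algebraD(3)[OF R])

text \<open>The union that defines a scalar multiple of a coset is over elements with the same coset.\<close>

lemma quotient_smult:
  assumes c: "c \<in> carrier k" and x: "x \<in> carrier R"
  shows "c \<odot>\<^bsub>Quo\<^esub> (I +>\<^bsub>R\<^esub> x) = I +>\<^bsub>R\<^esub> (c \<odot>\<^bsub>R\<^esub> x)"
proof -
  have eq: "I +>\<^bsub>R\<^esub> (c \<odot>\<^bsub>R\<^esub> y) = I +>\<^bsub>R\<^esub> (c \<odot>\<^bsub>R\<^esub> x)" if "y \<in> I +>\<^bsub>R\<^esub> x" for y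
  proof -
    obtain i where i: "i \<in> I" "y = i \<oplus>\<^bsub>R\<^esub> x" using \<open>y \<in> I +>\<^bsub>R\<^esub> x\<close> by (auto simp: a_r_coset_def r_coset_def)
    have ic: "i \<in> carrier R" using i by (auto intro: I.Icarr)
    have "c \<odot>\<^bsub>R\<^esub> y \<ominus>\<^bsub>R\<^esub> c \<odot>\<^bsub>R\<^esub> x = c \<odot>\<^bsub>R\<^esub> i"
      using ic c x by (simp add: i R.smult_r_distr a_minus_def R.a_assoc R.r_neg)
    then show ?thesis using coset_eq_iff[of "c \<odot>\<^bsub>R\<^esub> y" "c \<odot>\<^bsub>R\<^esub> x"] smult_ideal[OF c i(1)] i ic c x by simp
  qed
  have "(\<Union>y\<in>I +>\<^bsub>R\<^esub> x. I +>\<^bsub>R\<^esub> (c \<odot>\<^bsub>R\<^esub> y)) = (\<Union>y\<in>I +>\<^bsub>R\<^esub> x. I +>\<^bsub>R\<^esub> (c \<odot>\<^bsub>R\<^esub> x))"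
    by (rule SUP_cong[OF refl eq])
  also have "\<dots> = I +>\<^bsub>R\<^esub> (c \<odot>\<^bsub>R\<^esub> x)" using I.a_rcos_self[OF x] by blast
  finally show ?thesis by (simp add: quotient_algebra_def)
qed

lemma quotient_abelian: "abelian_group Quo"
  by (rule abelian_group_transfer[OF ring.is_abelian_group[OF I.quotient_is_ring]]) (simp_all add: quotient_algebra_def)

lemma quotient_k_algebra: "k_algebra k Quo"
proof -
  have "ring Quo"
    by (rule ring_transfer[OF I.quotient_is_ring]) (simp_all add: quotient_algebra_def)
  moreover have "module k Quo"
    by (rule moduleI[OF R.R.is_cring quotient_abelian])
      (auto simp: quotient_carrier quotient_smult quotient_simps R.smult_l_distr R.smult_r_distr R.smult_assoc1)
  ultimately show ?thesis
    by (auto simp: k_algebra_def quotient_carrier quotient_smult quotient_simps k_algebraD[OF R])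
qed

lemma projection_algebra_map: "algebra_map k R Quo ((+>\<^bsub>R\<^esub>) I)"
  by (auto simp: algebra_map_def linear_on_def ring_hom_def quotient_carrier quotient_smult quotient_simps)

lemma quotient_lift:
  assumes f: "algebra_map k R E f" and E: "k_algebra k E" and ker: "\<And>x. x \<in> I \<Longrightarrow> f x = \<zero>\<^bsub>E\<^esub>"
  shows "\<exists>g. algebra_map k Quo E g \<and> (\<forall>x\<in>carrier R. g (I +>\<^bsub>R\<^esub> x) = f x)"
proof -
  interpret E: module k E by (rule k_algebraD[OF E])
  have lin: "linear_on k R E f" and hom: "f \<in> ring_hom R E" using f by (auto simp: algebra_map_def)
  define g where "g = (\<lambda>X. f (SOME x. x \<in> X))"
  have g: "g (I +>\<^bsub>R\<^esub> x) = f x" if x: "x \<in> carrier R" for x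
  proof -
    have "x \<in> I +>\<^bsub>R\<^esub> x" by (rule I.a_rcos_self[OF x])
    then have "(SOME y. y \<in> I +>\<^bsub>R\<^esub> x) \<in> I +>\<^bsub>R\<^esub> x" by (rule someI)
    then obtain i where i: "i \<in> I" "(SOME y. y \<in> I +>\<^bsub>R\<^esub> x) = i \<oplus>\<^bsub>R\<^esub> x"
      by (auto simp: a_r_coset_def r_coset_def)
    then show ?thesis using ker[OF i(1)] x linear_on_closed[OF lin x]
      by (simp add: g_def linear_on_add[OF lin] I.Icarr)
  qed
  have "algebra_map k Quo E g"
    using hom by (auto simp: algebra_map_def linear_on_def ring_hom_def quotient_carrier quotient_smult quotient_simps g
        linear_on_closed[OF lin] linear_on_add[OF lin] linear_on_smult[OF lin])
  then show ?thesis using g by blast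
qed

end

section \<open>The free algebra\<close>

text \<open>The free algebra consists of functions on words; \<open>word_value E \<phi> w\<close> is the image of the word \<open>w\<close>
  under the algebra map that extends \<open>\<phi>\<close>.\<close>

definition word_value :: "('e, 'z) monoid_scheme \<Rightarrow> ('h \<Rightarrow> 'e) \<Rightarrow> 'h list \<Rightarrow> 'e" where
  "word_value E \<phi> w = foldr (\<lambda>x a. \<phi> x \<otimes>\<^bsub>E\<^esub> a) w \<one>\<^bsub>E\<^esub>"

locale free_alg = cring k for k :: "'k ring" +
  fixes X :: "'h set"
begin

definition conv :: "('h list \<Rightarrow> 'k) \<Rightarrow> ('h list \<Rightarrow> 'k) \<Rightarrow> 'h list \<Rightarrow> 'k" where
  "conv f g w = (\<Oplus>\<^bsub>k\<^esub>i\<in>{..length w}. f (take i w) \<otimes>\<^bsub>k\<^esub> g (drop i w))"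

lemma conv_Nil: "f [] \<in> carrier k \<Longrightarrow> g [] \<in> carrier k \<Longrightarrow> conv f g [] = f [] \<otimes>\<^bsub>k\<^esub> g []"
  by (simp add: conv_def)

text \<open>Splitting off the first letter gives a recursion in which associativity of the convolution is an easy
  induction.\<close>

lemma conv_Cons:
  assumes "\<And>w. f w \<in> carrier k" "\<And>w. g w \<in> carrier k"
  shows "conv f g (x # w) = f [] \<otimes>\<^bsub>k\<^esub> g (x # w) \<oplus>\<^bsub>k\<^esub> conv (\<lambda>u. f (x # u)) g w"
proof -
  have "conv f g (x # w) = (\<Oplus>\<^bsub>k\<^esub>i\<in>{..Suc (length w)}. f (take i (x # w)) \<otimes>\<^bsub>k\<^esub> g (drop i (x # w)))"
    by (simp add: conv_def)
  also have "\<dots> = (\<Oplus>\<^bsub>k\<^esub>i\<in>{..length w}. f (take (Suc i) (x # w)) \<otimes>\<^bsub>k\<^esub> g (drop (Suc i) (x # w))) \<oplus>\<^bsub>k\<^esub>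
      f (take 0 (x # w)) \<otimes>\<^bsub>k\<^esub> g (drop 0 (x # w))"
    by (rule finsum_Suc2) (use assms in auto)
  also have "\<dots> = f [] \<otimes>\<^bsub>k\<^esub> g (x # w) \<oplus>\<^bsub>k\<^esub> conv (\<lambda>u. f (x # u)) g w"
    using assms by (simp add: conv_def a_comm Pi_def)
  finally show ?thesis .
qed

abbreviation coeffs where "coeffs f \<equiv> (\<forall>w. f w \<in> carrier k)"

lemma conv_closed [simp]: "coeffs f \<Longrightarrow> coeffs g \<Longrightarrow> conv f g w \<in> carrier k"
  by (simp add: conv_def Pi_def)

lemma conv_add_left: "coeffs f \<Longrightarrow> coeffs f' \<Longrightarrow> coeffs g \<Longrightarrow> conv (\<lambda>u. f u \<oplus>\<^bsub>k\<^esub> f' u) g w = conv f g w \<oplus>\<^bsub>k\<^esub> conv f' g w"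
  by (induction w arbitrary: f f') (simp_all add: conv_Nil conv_Cons l_distr a_ac)

lemma conv_add_right: "coeffs f \<Longrightarrow> coeffs g \<Longrightarrow> coeffs g' \<Longrightarrow> conv f (\<lambda>u. g u \<oplus>\<^bsub>k\<^esub> g' u) w = conv f g w \<oplus>\<^bsub>k\<^esub> conv f g' w"
  by (induction w arbitrary: f) (simp_all add: conv_Nil conv_Cons r_distr a_ac)

lemma conv_smult_left: "c \<in> carrier k \<Longrightarrow> coeffs f \<Longrightarrow> coeffs g \<Longrightarrow> conv (\<lambda>u. c \<otimes>\<^bsub>k\<^esub> f u) g w = c \<otimes>\<^bsub>k\<^esub> conv f g w"
  by (induction w arbitrary: f) (simp_all add: conv_Nil conv_Cons r_distr m_assoc)

lemma conv_smult_right: "c \<in> carrier k \<Longrightarrow> coeffs f \<Longrightarrow> coeffs g \<Longrightarrow> conv f (\<lambda>u. c \<otimes>\<^bsub>k\<^esub> g u) w = c \<otimes>\<^bsub>k\<^esub> conv f g w"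
  by (induction w arbitrary: f) (simp_all add: conv_Nil conv_Cons r_distr m_lcomm)

lemma conv_zero_left: "coeffs g \<Longrightarrow> conv (\<lambda>u. \<zero>\<^bsub>k\<^esub>) g w = \<zero>\<^bsub>k\<^esub>"
  by (induction w) (simp_all add: conv_Nil conv_Cons)

lemma conv_one_left: "coeffs g \<Longrightarrow> conv (\<lambda>u. if u = [] then \<one>\<^bsub>k\<^esub> else \<zero>\<^bsub>k\<^esub>) g w = g w"
  by (cases w) (simp_all add: conv_Nil conv_Cons conv_zero_left)

lemma conv_one_right: "coeffs f \<Longrightarrow> conv f (\<lambda>u. if u = [] then \<one>\<^bsub>k\<^esub> else \<zero>\<^bsub>k\<^esub>) w = f w"
  by (induction w arbitrary: f) (simp_all add: conv_Nil conv_Cons)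

lemma conv_assoc: "coeffs f \<Longrightarrow> coeffs g \<Longrightarrow> coeffs h \<Longrightarrow> conv (conv f g) h w = conv f (conv g h) w"
proof (induction w arbitrary: f)
  case Nil
  then show ?case by (simp add: conv_Nil m_assoc)
next
  case (Cons x w)
  have "conv (conv f g) h (x # w) = (f [] \<otimes>\<^bsub>k\<^esub> g []) \<otimes>\<^bsub>k\<^esub> h (x # w) \<oplus>\<^bsub>k\<^esub>
      conv (\<lambda>u. f [] \<otimes>\<^bsub>k\<^esub> g (x # u) \<oplus>\<^bsub>k\<^esub> conv (\<lambda>u. f (x # u)) g u) h w"
    using Cons.prems by (simp add: conv_Cons conv_Nil)
  also have "\<dots> = (f [] \<otimes>\<^bsub>k\<^esub> g []) \<otimes>\<^bsub>k\<^esub> h (x # w) \<oplus>\<^bsub>k\<^esub>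
      (f [] \<otimes>\<^bsub>k\<^esub> conv (\<lambda>u. g (x # u)) h w \<oplus>\<^bsub>k\<^esub> conv (\<lambda>u. f (x # u)) (conv g h) w)"
    using Cons by (simp add: conv_add_left conv_smult_left)
  also have "\<dots> = conv f (conv g h) (x # w)"
    using Cons.prems by (simp add: conv_Cons r_distr m_assoc a_assoc)
  finally show ?case .
qed

lemma conv_nonzero:
  assumes "coeffs f" "coeffs g" "conv f g w \<noteq> \<zero>\<^bsub>k\<^esub>"
  shows "\<exists>u v. w = u @ v \<and> f u \<noteq> \<zero>\<^bsub>k\<^esub> \<and> g v \<noteq> \<zero>\<^bsub>k\<^esub>"
proof (rule ccontr)
  assume "\<not> ?thesis"
  then have "\<And>i. f (take i w) \<otimes>\<^bsub>k\<^esub> g (drop i w) = \<zero>\<^bsub>k\<^esub>"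
    using assms by (metis append_take_drop_id l_null r_null)
  then have "conv f g w = \<zero>\<^bsub>k\<^esub>" by (simp add: conv_def add.finprod_one_eqI)
  then show False using assms by simp
qed

abbreviation F where "F \<equiv> free_algebra k X"

lemma F_simps:
  "f \<in> carrier F \<longleftrightarrow> coeffs f \<and> finite {w. f w \<noteq> \<zero>\<^bsub>k\<^esub>} \<and> (\<forall>w. w \<notin> lists X \<longrightarrow> f w = \<zero>\<^bsub>k\<^esub>)"
  "mult F = conv" "\<one>\<^bsub>F\<^esub> = (\<lambda>w. if w = [] then \<one>\<^bsub>k\<^esub> else \<zero>\<^bsub>k\<^esub>)" "\<zero>\<^bsub>F\<^esub> = (\<lambda>w. \<zero>\<^bsub>k\<^esub>)"
  "add F = (\<lambda>f g w. f w \<oplus>\<^bsub>k\<^esub> g w)" "smult F = (\<lambda>c f w. c \<otimes>\<^bsub>k\<^esub> f w)"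
  by (auto simp: free_algebra_def conv_def fun_eq_iff)

lemma F_conv_closed:
  assumes "f \<in> carrier F" "g \<in> carrier F"
  shows "conv f g \<in> carrier F"
proof -
  have c: "coeffs f" "coeffs g" using assms by (auto simp: F_simps)
  have "{w. conv f g w \<noteq> \<zero>\<^bsub>k\<^esub>} \<subseteq> (\<lambda>(u, v). u @ v) ` ({w. f w \<noteq> \<zero>\<^bsub>k\<^esub>} \<times> {w. g w \<noteq> \<zero>\<^bsub>k\<^esub>})"
    using conv_nonzero[OF c] by fastforce
  moreover have "finite ((\<lambda>(u, v). u @ v) ` ({w. f w \<noteq> \<zero>\<^bsub>k\<^esub>} \<times> {w. g w \<noteq> \<zero>\<^bsub>k\<^esub>}))"
    using assms by (auto simp: F_simps)
  ultimately have "finite {w. conv f g w \<noteq> \<zero>\<^bsub>k\<^esub>}" by (rule finite_subset)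
  moreover have "w \<in> lists X" if "conv f g w \<noteq> \<zero>\<^bsub>k\<^esub>" for w
  proof -
    obtain u v where "w = u @ v" "f u \<noteq> \<zero>\<^bsub>k\<^esub>" "g v \<noteq> \<zero>\<^bsub>k\<^esub>" using conv_nonzero[OF c \<open>conv f g w \<noteq> \<zero>\<^bsub>k\<^esub>\<close>] by auto
    moreover from this have "u \<in> lists X" "v \<in> lists X" using assms by (auto simp: F_simps(1))
    ultimately show ?thesis by simp
  qed
  ultimately show ?thesis using c by (auto simp: F_simps)
qed

lemma F_add_closed:
  assumes "f \<in> carrier F" "g \<in> carrier F"
  shows "(\<lambda>w. f w \<oplus>\<^bsub>k\<^esub> g w) \<in> carrier F"
proof -
  have "{w. f w \<oplus>\<^bsub>k\<^esub> g w \<noteq> \<zero>\<^bsub>k\<^esub>} \<subseteq> {w. f w \<noteq> \<zero>\<^bsub>k\<^esub>} \<union> {w. g w \<noteq> \<zero>\<^bsub>k\<^esub>}"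
    using assms by (auto simp: F_simps(1))
  then have "finite {w. f w \<oplus>\<^bsub>k\<^esub> g w \<noteq> \<zero>\<^bsub>k\<^esub>}" by (rule finite_subset) (use assms in \<open>simp add: F_simps(1)\<close>)
  then show ?thesis using assms by (simp add: F_simps(1))
qed

lemma F_smult_closed:
  assumes "c \<in> carrier k" "f \<in> carrier F"
  shows "(\<lambda>w. c \<otimes>\<^bsub>k\<^esub> f w) \<in> carrier F"
proof -
  have "{w. c \<otimes>\<^bsub>k\<^esub> f w \<noteq> \<zero>\<^bsub>k\<^esub>} \<subseteq> {w. f w \<noteq> \<zero>\<^bsub>k\<^esub>}" using assms by (auto simp: F_simps(1))
  then have "finite {w. c \<otimes>\<^bsub>k\<^esub> f w \<noteq> \<zero>\<^bsub>k\<^esub>}" by (rule finite_subset) (use assms in \<open>simp add: F_simps(1)\<close>)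
  then show ?thesis using assms by (simp add: F_simps(1))
qed

lemma F_abelian: "abelian_group F"
proof (rule abelian_groupI, goal_cases)
  case (6 f)
  then have "(\<lambda>w. \<ominus>\<^bsub>k\<^esub> \<one>\<^bsub>k\<^esub> \<otimes>\<^bsub>k\<^esub> f w) \<in> carrier F" by (intro F_smult_closed) auto
  moreover have "(\<lambda>w. \<ominus>\<^bsub>k\<^esub> \<one>\<^bsub>k\<^esub> \<otimes>\<^bsub>k\<^esub> f w) \<oplus>\<^bsub>F\<^esub> f = \<zero>\<^bsub>F\<^esub>"
    using 6 by (auto simp: F_simps fun_eq_iff l_minus l_neg)
  ultimately show ?case by blast
next
  case (1 f g)
  then show ?case using F_add_closed by (simp add: F_simps(5))
next
  case (3 f g h)
  then show ?case by (auto simp: F_simps fun_eq_iff a_assoc)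
next
  case (4 f g)
  then show ?case by (auto simp: F_simps fun_eq_iff a_comm)
qed (auto simp: F_simps fun_eq_iff)

lemma F_k_algebra: "k_algebra k F"
  unfolding k_algebra_def
proof (intro conjI ballI)
  have one: "\<one>\<^bsub>F\<^esub> \<in> carrier F"
    by (auto simp: F_simps intro: finite_subset[of _ "{[]}"] split: if_splits)
  show "module k F"
    by (rule moduleI[OF is_cring F_abelian])
       (use F_smult_closed in \<open>auto simp: F_simps(2-) fun_eq_iff\<close>, auto simp: F_simps(1) l_distr r_distr m_assoc)
  show "ring F"
  proof (rule ringI[OF F_abelian], goal_cases)
    case 1
    show ?case
    proof (rule monoidI, goal_cases)
      case (1 f g) then show ?case using F_conv_closed by (simp add: F_simps(2))
    qed (use one in \<open>auto simp: F_simps fun_eq_iff conv_assoc conv_one_left conv_one_right\<close>)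
  qed (auto simp: F_simps fun_eq_iff conv_add_left conv_add_right)
  fix c f g assume "c \<in> carrier k" "f \<in> carrier F" "g \<in> carrier F"
  then show "(c \<odot>\<^bsub>F\<^esub> f) \<otimes>\<^bsub>F\<^esub> g = c \<odot>\<^bsub>F\<^esub> (f \<otimes>\<^bsub>F\<^esub> g)" "f \<otimes>\<^bsub>F\<^esub> (c \<odot>\<^bsub>F\<^esub> g) = c \<odot>\<^bsub>F\<^esub> (f \<otimes>\<^bsub>F\<^esub> g)"
    by (auto simp: F_simps fun_eq_iff conv_smult_left conv_smult_right)
qed

definition single :: "'h list \<Rightarrow> 'k \<Rightarrow> 'h list \<Rightarrow> 'k" where
  "single w c = (\<lambda>u. if u = w then c else \<zero>\<^bsub>k\<^esub>)"

lemma single_closed: "c \<in> carrier k \<Longrightarrow> w \<in> lists X \<Longrightarrow> single w c \<in> carrier F"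
  by (auto simp: F_simps single_def intro: finite_subset[of _ "{w}"] split: if_splits)

lemma conv_single:
  assumes g: "coeffs g" and c: "c \<in> carrier k"
  shows "conv (single u c) g w = (if take (length u) w = u then c \<otimes>\<^bsub>k\<^esub> g (drop (length u) w) else \<zero>\<^bsub>k\<^esub>)"
proof (induction u arbitrary: w)
  case Nil
  show ?case
  proof (cases w)
    case (Cons x v)
    have "(\<lambda>u. single [] c (x # u)) = (\<lambda>u. \<zero>\<^bsub>k\<^esub>)" by (simp add: single_def)
    then show ?thesis using assms Cons by (simp add: conv_Cons conv_zero_left) (simp add: single_def conv_Cons conv_zero_left)
  qed (use assms in \<open>simp add: conv_Nil single_def\<close>)
next
  case (Cons y u)
  show ?case
  proof (cases w)
    case Nil
    then show ?thesis using assms by (simp add: conv_Nil single_def)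
  next
    case (Cons x v)
    have "(\<lambda>t. single (y # u) c (x # t)) = (if x = y then single u c else (\<lambda>t. \<zero>\<^bsub>k\<^esub>))"
      by (auto simp: single_def fun_eq_iff)
    moreover have "conv (single (y # u) c) g (x # v) = single (y # u) c [] \<otimes>\<^bsub>k\<^esub> g (x # v) \<oplus>\<^bsub>k\<^esub> conv (\<lambda>t. single (y # u) c (x # t)) g v"
      by (rule conv_Cons) (use assms in \<open>auto simp: single_def\<close>)
    moreover have "single (y # u) c [] = \<zero>\<^bsub>k\<^esub>" by (simp add: single_def)
    ultimately show ?thesis using assms Cons Cons.IH[of v] by (auto simp: conv_zero_left single_def)
  qed
qed

lemma single_mult:
  assumes "c \<in> carrier k" "d \<in> carrier k"
  shows "conv (single u c) (single v d) = single (u @ v) (c \<otimes>\<^bsub>k\<^esub> d)"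
proof
  fix w
  have "take (length u) w = u \<and> drop (length u) w = v \<longleftrightarrow> w = u @ v"
    by (metis append_eq_conv_conj)
  then show "conv (single u c) (single v d) w = single (u @ v) (c \<otimes>\<^bsub>k\<^esub> d) w"
    using assms by (subst conv_single) (auto simp: single_def)
qed

lemma F_induct [consumes 1, case_names single add]:
  assumes f: "f \<in> carrier F"
    and single: "\<And>w c. w \<in> lists X \<Longrightarrow> c \<in> carrier k \<Longrightarrow> P (single w c)"
    and add: "\<And>f g. f \<in> carrier F \<Longrightarrow> g \<in> carrier F \<Longrightarrow> P f \<Longrightarrow> P g \<Longrightarrow> P (f \<oplus>\<^bsub>F\<^esub> g)"
  shows "P f"
proof -
  have "finite K \<Longrightarrow> f \<in> carrier F \<Longrightarrow> {w. f w \<noteq> \<zero>\<^bsub>k\<^esub>} \<subseteq> K \<Longrightarrow> P f" for K f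
  proof (induction K arbitrary: f rule: finite_induct)
    case empty
    then have "f = single [] \<zero>\<^bsub>k\<^esub>" by (auto simp: single_def fun_eq_iff)
    then show ?case using single by auto
  next
    case (insert w K)
    let ?g = "\<lambda>u. if u = w then \<zero>\<^bsub>k\<^esub> else f u"
    have c: "f w \<in> carrier k" using insert by (simp add: F_simps)
    have s: "{u. ?g u \<noteq> \<zero>\<^bsub>k\<^esub>} \<subseteq> K" using insert by auto
    have g: "?g \<in> carrier F"
      using insert.prems finite_subset[OF s insert.hyps(1)] by (auto simp: F_simps)
    show ?case
    proof (cases "w \<in> lists X")
      case True
      have "f = single w (f w) \<oplus>\<^bsub>F\<^esub> ?g"
        using insert.prems by (auto simp: F_simps single_def fun_eq_iff)
      then show ?thesis using add[OF single_closed[OF c True] g single[OF True c] insert.IH[OF g s]] by simp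
    next
      case False
      then have "f = ?g" using insert.prems by (auto simp: F_simps fun_eq_iff)
      then show ?thesis using insert.IH[OF g s] by simp
    qed
  qed
  then show ?thesis using f by (metis (no_types) F_simps(1) order_refl)
qed

definition ev :: "('k, 'e, 'z) module_scheme \<Rightarrow> ('h \<Rightarrow> 'e) \<Rightarrow> ('h list \<Rightarrow> 'k) \<Rightarrow> 'e" where
  "ev E \<phi> f = (\<Oplus>\<^bsub>E\<^esub>w\<in>{w. f w \<noteq> \<zero>\<^bsub>k\<^esub>}. f w \<odot>\<^bsub>E\<^esub> word_value E \<phi> w)"

context
  fixes E :: "('k, 'e, 'z) module_scheme" and \<phi> :: "'h \<Rightarrow> 'e"
  assumes E: "k_algebra k E" and \<phi>: "\<And>x. x \<in> X \<Longrightarrow> \<phi> x \<in> carrier E"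
begin

interpretation E: module k E by (rule k_algebraD[OF E])
interpretation Er: ring E by (rule k_algebraD[OF E])

lemma word_value_closed: "w \<in> lists X \<Longrightarrow> word_value E \<phi> w \<in> carrier E"
  by (induction w) (auto simp: word_value_def \<phi>)

lemma word_value_append: "u \<in> lists X \<Longrightarrow> v \<in> lists X \<Longrightarrow> word_value E \<phi> (u @ v) = word_value E \<phi> u \<otimes>\<^bsub>E\<^esub> word_value E \<phi> v"
proof (induction u)
  case (Cons x u)
  then show ?case using word_value_closed[of u] word_value_closed[of v] word_value_closed[of "u @ v"] \<phi>[of x]
    by (simp add: word_value_def Er.m_assoc)
qed (simp add: word_value_closed, simp add: word_value_def word_value_closed[unfolded word_value_def])

lemma ev_superset:
  assumes "f \<in> carrier F" "finite K" "{w. f w \<noteq> \<zero>\<^bsub>k\<^esub>} \<subseteq> K" "K \<subseteq> lists X"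
  shows "ev E \<phi> f = (\<Oplus>\<^bsub>E\<^esub>w\<in>K. f w \<odot>\<^bsub>E\<^esub> word_value E \<phi> w)"
  unfolding ev_def
  by (rule E.add.finprod_mono_neutral_cong_left) (use assms in \<open>auto simp: F_simps word_value_closed subset_iff\<close>)

lemma ev_add:
  assumes f: "f \<in> carrier F" and g: "g \<in> carrier F"
  shows "ev E \<phi> (f \<oplus>\<^bsub>F\<^esub> g) = ev E \<phi> f \<oplus>\<^bsub>E\<^esub> ev E \<phi> g"
proof -
  let ?K = "{w. f w \<noteq> \<zero>\<^bsub>k\<^esub>} \<union> {w. g w \<noteq> \<zero>\<^bsub>k\<^esub>}"
  have K: "finite ?K" "?K \<subseteq> lists X" using f g by (auto simp: F_simps)
  have m: "h w \<odot>\<^bsub>E\<^esub> word_value E \<phi> w \<in> carrier E" if "h \<in> carrier F" "w \<in> ?K" for h w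
    using word_value_closed[OF subsetD[OF K(2) that(2)]] that(1) by (simp add: F_simps(1))
  have fg: "f \<oplus>\<^bsub>F\<^esub> g \<in> carrier F" using F_add_closed[OF f g] by (simp add: F_simps(5))
  have "ev E \<phi> (f \<oplus>\<^bsub>F\<^esub> g) = (\<Oplus>\<^bsub>E\<^esub>w\<in>?K. (f \<oplus>\<^bsub>F\<^esub> g) w \<odot>\<^bsub>E\<^esub> word_value E \<phi> w)"
    by (rule ev_superset[OF fg K(1) _ K(2)]) (auto simp: F_simps(5))
  also have "\<dots> = (\<Oplus>\<^bsub>E\<^esub>w\<in>?K. f w \<odot>\<^bsub>E\<^esub> word_value E \<phi> w \<oplus>\<^bsub>E\<^esub> g w \<odot>\<^bsub>E\<^esub> word_value E \<phi> w)"
    by (rule E.finsum_cong'[OF refl]) (use f g K(2) in \<open>auto simp: F_simps subset_iff word_value_closed E.smult_l_distr\<close>)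
  also have "\<dots> = ev E \<phi> f \<oplus>\<^bsub>E\<^esub> ev E \<phi> g"
    using m[OF f] m[OF g] by (subst E.finsum_addf)
      (auto simp: ev_superset[OF f K(1) _ K(2)] ev_superset[OF g K(1) _ K(2)])
  finally show ?thesis .
qed

lemma ev_single:
  assumes "c \<in> carrier k" "w \<in> lists X"
  shows "ev E \<phi> (single w c) = c \<odot>\<^bsub>E\<^esub> word_value E \<phi> w"
proof -
  have "ev E \<phi> (single w c) = (\<Oplus>\<^bsub>E\<^esub>u\<in>{w}. single w c u \<odot>\<^bsub>E\<^esub> word_value E \<phi> u)"
    by (rule ev_superset[OF single_closed[OF assms]]) (use assms in \<open>auto simp: single_def\<close>)
  then show ?thesis using assms word_value_closed by (simp add: single_def)
qed

lemma ev_closed: "f \<in> carrier F \<Longrightarrow> ev E \<phi> f \<in> carrier E"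
  by (induction f rule: F_induct) (auto simp: ev_add ev_single word_value_closed)

lemma ev_smult:
  assumes "f \<in> carrier F" "c \<in> carrier k"
  shows "ev E \<phi> (c \<odot>\<^bsub>F\<^esub> f) = c \<odot>\<^bsub>E\<^esub> ev E \<phi> f"
proof -
  interpret F: module k F by (rule k_algebraD[OF F_k_algebra])
  show ?thesis using assms(1)
  proof (induction f rule: F_induct)
    case (single w d)
    have "c \<odot>\<^bsub>F\<^esub> single w d = single w (c \<otimes>\<^bsub>k\<^esub> d)" using assms(2) by (auto simp: F_simps single_def fun_eq_iff)
    then show ?case using single assms(2) by (simp add: ev_single E.smult_assoc1 word_value_closed)
  next
    case (add f g)
    then show ?case using assms(2) by (simp add: F.smult_r_distr ev_add E.smult_r_distr ev_closed)
  qed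
qed

lemma ev_mult:
  assumes "f \<in> carrier F" "g \<in> carrier F"
  shows "ev E \<phi> (f \<otimes>\<^bsub>F\<^esub> g) = ev E \<phi> f \<otimes>\<^bsub>E\<^esub> ev E \<phi> g"
proof -
  interpret F: ring F by (rule k_algebraD[OF F_k_algebra])
  show ?thesis using assms(1)
  proof (induction f rule: F_induct)
    case (single u c)
    show ?case using assms(2)
    proof (induction g rule: F_induct)
      case (single v d)
      then show ?case using \<open>u \<in> lists X\<close> \<open>c \<in> carrier k\<close>
        by (simp add: F_simps(2) single_mult ev_single word_value_append word_value_closed k_algebraD[OF E] E.smult_assoc1[symmetric] m_comm)
    next
      case (add f g)
      then show ?case using single by (simp add: F.r_distr single_closed ev_add ev_closed Er.r_distr)
    qed
  next
    case (add f f')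
    then show ?case using assms(2) by (simp add: F.l_distr ev_add ev_closed Er.l_distr)
  qed
qed

lemma ev_algebra_map: "algebra_map k F E (ev E \<phi>)"
proof -
  have "\<one>\<^bsub>F\<^esub> = single [] \<one>\<^bsub>k\<^esub>" by (auto simp: F_simps single_def)
  then have "ev E \<phi> \<one>\<^bsub>F\<^esub> = \<one>\<^bsub>E\<^esub>" by (simp add: ev_single word_value_def)
  then show ?thesis
    by (auto simp: algebra_map_def linear_on_def ring_hom_def ev_closed ev_add ev_smult ev_mult)
qed

lemma ev_gen: "x \<in> X \<Longrightarrow> ev E \<phi> (free_gen k x) = \<phi> x"
  using ev_single[of "\<one>\<^bsub>k\<^esub>" "[x]"] \<phi>[of x] by (simp add: free_gen_def single_def word_value_def)

end

lemma free_gen_closed: "x \<in> X \<Longrightarrow> free_gen k x \<in> carrier F"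
  using single_closed[of "\<one>\<^bsub>k\<^esub>" "[x]"] by (simp add: free_gen_def single_def)

end

lemma algebra_map_comp: "algebra_map k A B f \<Longrightarrow> algebra_map k B C g \<Longrightarrow> algebra_map k A C (\<lambda>x. g (f x))"
  by (auto simp: algebra_map_def linear_on_def ring_hom_def Pi_def)

lemma algebra_mapD:
  assumes "algebra_map k A B f"
  shows "linear_on k A B f" "f \<in> ring_hom A B" "f \<one>\<^bsub>A\<^esub> = \<one>\<^bsub>B\<^esub>" "x \<in> carrier A \<Longrightarrow> f x \<in> carrier B"
    "x \<in> carrier A \<Longrightarrow> y \<in> carrier A \<Longrightarrow> f (x \<otimes>\<^bsub>A\<^esub> y) = f x \<otimes>\<^bsub>B\<^esub> f y"
    "x \<in> carrier A \<Longrightarrow> y \<in> carrier A \<Longrightarrow> f (x \<oplus>\<^bsub>A\<^esub> y) = f x \<oplus>\<^bsub>B\<^esub> f y"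
  using assms by (auto simp: algebra_map_def linear_on_def ring_hom_def)

lemma algebra_map_minus:
  assumes "k_algebra k A" "k_algebra k B" "algebra_map k A B f" "x \<in> carrier A" "y \<in> carrier A"
  shows "f (x \<ominus>\<^bsub>A\<^esub> y) = f x \<ominus>\<^bsub>B\<^esub> f y"
proof -
  interpret A: ring A by (rule k_algebraD[OF assms(1)])
  interpret B: ring B by (rule k_algebraD[OF assms(2)])
  note f = linear_on_additive[OF algebra_mapD(1)[OF assms(3)]]
  show ?thesis using assms(4,5)
    by (simp add: a_minus_def additive_on_add[OF f] additive_on_minus[OF A.is_abelian_group B.is_abelian_group f])
qed

lemma algebra_map_vanishes_on_ideal:
  assumes A: "k_algebra k A" and B: "k_algebra k B" and f: "algebra_map k A B f" and U: "U \<subseteq> carrier A"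
    and v: "\<And>x. x \<in> U \<Longrightarrow> f x = \<zero>\<^bsub>B\<^esub>" and x: "x \<in> Idl\<^bsub>A\<^esub> U"
  shows "f x = \<zero>\<^bsub>B\<^esub>"
proof -
  interpret A: ring A by (rule k_algebraD[OF A])
  interpret B: ring B by (rule k_algebraD[OF B])
  interpret f: ring_hom_ring A B f
    by (rule ring_hom_ringI2[OF A.ring_axioms B.ring_axioms algebra_mapD(2)[OF f]])
  have "U \<subseteq> a_kernel A B f" unfolding a_kernel_def' using U v by blast
  then have "Idl\<^bsub>A\<^esub> U \<subseteq> a_kernel A B f" by (rule A.genideal_minimal[OF f.kernel_is_ideal])
  then show ?thesis using x unfolding a_kernel_def' by blast
qed

section \<open>The universal property of \<open>H\<^sub>p\<^sub>a\<^sub>r\<close>\<close>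

context hopf_bij
begin

sublocale fa: free_alg k HC by unfold_locales

abbreviation "FA \<equiv> free_algebra k HC"
abbreviation "TA \<equiv> tensor_algebra k H"
abbreviation "HP \<equiv> Hpar k H"
abbreviation "TI \<equiv> tensor_algebra_ideal k H"
abbreviation "HI \<equiv> Hpar_ideal k H"
abbreviation "tg \<equiv> tensor_gen k H"
abbreviation "cl \<equiv> cls k H"

definition tensor_algebra_relations :: "('h list \<Rightarrow> 'k) set" where
  "tensor_algebra_relations = {free_gen k (x \<oplus>\<^bsub>H\<^esub> y) \<ominus>\<^bsub>FA\<^esub> (free_gen k x \<oplus>\<^bsub>FA\<^esub> free_gen k y) | x y.
              x \<in> HC \<and> y \<in> HC} \<union>
            {free_gen k (c \<odot>\<^bsub>H\<^esub> x) \<ominus>\<^bsub>FA\<^esub> (c \<odot>\<^bsub>FA\<^esub> free_gen k x) | c x.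
              c \<in> carrier k \<and> x \<in> HC}"

lemma TI_eq: "TI = Idl\<^bsub>FA\<^esub> tensor_algebra_relations"
  by (simp add: tensor_algebra_ideal_def tensor_algebra_relations_def Let_def)

lemma FA_minus_closed: "f \<in> carrier FA \<Longrightarrow> g \<in> carrier FA \<Longrightarrow> f \<ominus>\<^bsub>FA\<^esub> g \<in> carrier FA"
  using ring.ring_simprules(4)[OF k_algebraD(2)[OF fa.F_k_algebra]] by blast

lemma FA_ops_closed: "f \<in> carrier FA \<Longrightarrow> g \<in> carrier FA \<Longrightarrow> f \<oplus>\<^bsub>FA\<^esub> g \<in> carrier FA"
  "c \<in> carrier k \<Longrightarrow> f \<in> carrier FA \<Longrightarrow> c \<odot>\<^bsub>FA\<^esub> f \<in> carrier FA"
  using fa.F_add_closed fa.F_smult_closed by (simp_all add: fa.F_simps(5,6))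

lemma tensor_algebra_relations_subset: "tensor_algebra_relations \<subseteq> carrier FA"
  unfolding tensor_algebra_relations_def
  by (auto intro!: FA_minus_closed FA_ops_closed fa.free_gen_closed)

lemma TI_ideal: "ideal TI FA"
  unfolding TI_eq by (rule ring.genideal_ideal[OF k_algebraD(2)[OF fa.F_k_algebra] tensor_algebra_relations_subset])

lemma TI_I: "x \<in> tensor_algebra_relations \<Longrightarrow> x \<in> TI"
  unfolding TI_eq using ring.genideal_self[OF k_algebraD(2)[OF fa.F_k_algebra] tensor_algebra_relations_subset] by auto

lemmas TA_algebra = quotient_k_algebra[OF fa.F_k_algebra TI_ideal, folded tensor_algebra_def]
lemmas TA_proj = projection_algebra_map[OF fa.F_k_algebra TI_ideal, folded tensor_algebra_def]
lemmas TA_lift = quotient_lift[OF fa.F_k_algebra TI_ideal, folded tensor_algebra_def]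
lemmas TA_simps = quotient_simps[OF fa.F_k_algebra TI_ideal, folded tensor_algebra_def]
  quotient_smult[OF fa.F_k_algebra TI_ideal, folded tensor_algebra_def]
lemmas TA_carrier = quotient_carrier[OF fa.F_k_algebra TI_ideal, folded tensor_algebra_def]

sublocale TA: ring TA by (rule k_algebraD[OF TA_algebra])
sublocale TAm: module k TA by (rule k_algebraD[OF TA_algebra])

lemma tg_linear: "linear_on k H TA tg"
proof (rule linear_onI)
  fix x y assume x: "x \<in> HC" and y: "y \<in> HC"
  have "free_gen k (x \<oplus>\<^bsub>H\<^esub> y) \<ominus>\<^bsub>FA\<^esub> (free_gen k x \<oplus>\<^bsub>FA\<^esub> free_gen k y) \<in> TI"
    by (rule TI_I) (use x y in \<open>auto simp: tensor_algebra_relations_def\<close>)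
  then show "tg (x \<oplus>\<^bsub>H\<^esub> y) = tg x \<oplus>\<^bsub>TA\<^esub> tg y" using x y
    by (simp add: tensor_gen_def TA_simps fa.free_gen_closed coset_eq_iff[OF fa.F_k_algebra TI_ideal] FA_ops_closed)
next
  fix c x assume c: "c \<in> carrier k" and x: "x \<in> HC"
  have "free_gen k (c \<odot>\<^bsub>H\<^esub> x) \<ominus>\<^bsub>FA\<^esub> (c \<odot>\<^bsub>FA\<^esub> free_gen k x) \<in> TI"
    by (rule TI_I) (use x c in \<open>auto simp: tensor_algebra_relations_def\<close>)
  then show "tg (c \<odot>\<^bsub>H\<^esub> x) = c \<odot>\<^bsub>TA\<^esub> tg x" using x c
    by (simp add: tensor_gen_def TA_simps fa.free_gen_closed coset_eq_iff[OF fa.F_k_algebra TI_ideal] FA_ops_closed)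
qed (auto simp: tensor_gen_def TA_carrier fa.free_gen_closed)

lemma tg_closed [simp, intro]: "x \<in> HC \<Longrightarrow> tg x \<in> carrier TA"
  by (rule linear_on_closed[OF tg_linear])

lemma TA_universal:
  assumes E: "k_algebra k E" and \<phi>: "linear_on k H E \<phi>"
  shows "\<exists>f. algebra_map k TA E f \<and> (\<forall>x\<in>HC. f (tg x) = \<phi> x)"
proof -
  interpret E: module k E by (rule k_algebraD[OF E])
  have c: "\<And>x. x \<in> HC \<Longrightarrow> \<phi> x \<in> carrier E" by (rule linear_on_closed[OF \<phi>])
  define f where "f = fa.ev E \<phi>"
  have f: "algebra_map k FA E f" unfolding f_def by (rule fa.ev_algebra_map[OF E c])
  have fg: "f (free_gen k x) = \<phi> x" if "x \<in> HC" for x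
    unfolding f_def by (rule fa.ev_gen[OF E c that])
  have self: "a \<ominus>\<^bsub>E\<^esub> a = \<zero>\<^bsub>E\<^esub>" if "a \<in> carrier E" for a
    using that by (simp add: a_minus_def E.r_neg)
  have "f x = \<zero>\<^bsub>E\<^esub>" if "x \<in> TI" for x
    using that unfolding TI_eq
  proof (rule algebra_map_vanishes_on_ideal[OF fa.F_k_algebra E f tensor_algebra_relations_subset, rotated])
    fix r assume "r \<in> tensor_algebra_relations"
    then show "f r = \<zero>\<^bsub>E\<^esub>"
      unfolding tensor_algebra_relations_def
      by (auto simp: algebra_map_minus[OF fa.F_k_algebra E f] fg fa.free_gen_closed FA_ops_closed algebra_mapD(6)[OF f]
          linear_on_smult[OF algebra_mapD(1)[OF f]] linear_on_add[OF \<phi>] linear_on_smult[OF \<phi>] c self)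
  qed
  from TA_lift[OF f E this] obtain g where "algebra_map k TA E g" "\<forall>x\<in>carrier FA. g (TI +>\<^bsub>FA\<^esub> x) = f x" by blast
  then show ?thesis using fg fa.free_gen_closed by (auto simp: tensor_gen_def)
qed

definition Hpar_relations :: "('h list \<Rightarrow> 'k) set set" where
  "Hpar_relations = {tg unit \<ominus>\<^bsub>TA\<^esub> \<one>\<^bsub>TA\<^esub>} \<union>
       {sw TA (\<lambda>l1 l2. tg h \<otimes>\<^bsub>TA\<^esub> tg l1 \<otimes>\<^bsub>TA\<^esub> tg (S l2)) l \<ominus>\<^bsub>TA\<^esub>
        sw TA (\<lambda>l1 l2. tg (h \<star> l1) \<otimes>\<^bsub>TA\<^esub> tg (S l2)) l | h l. h \<in> HC \<and> l \<in> HC} \<union>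
       {sw TA (\<lambda>h1 h2. tg h1 \<otimes>\<^bsub>TA\<^esub> tg (S h2) \<otimes>\<^bsub>TA\<^esub> tg l) h \<ominus>\<^bsub>TA\<^esub>
        sw TA (\<lambda>h1 h2. tg h1 \<otimes>\<^bsub>TA\<^esub> tg (S h2 \<star> l)) h | h l. h \<in> HC \<and> l \<in> HC} \<union>
       {sw TA (\<lambda>l1 l2. tg h \<otimes>\<^bsub>TA\<^esub> tg (S l1) \<otimes>\<^bsub>TA\<^esub> tg l2) l \<ominus>\<^bsub>TA\<^esub>
        sw TA (\<lambda>l1 l2. tg (h \<star> S l1) \<otimes>\<^bsub>TA\<^esub> tg l2) l | h l. h \<in> HC \<and> l \<in> HC} \<union>
       {sw TA (\<lambda>h1 h2. tg (S h1) \<otimes>\<^bsub>TA\<^esub> tg h2 \<otimes>\<^bsub>TA\<^esub> tg l) h \<ominus>\<^bsub>TA\<^esub>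
        sw TA (\<lambda>h1 h2. tg (S h1) \<otimes>\<^bsub>TA\<^esub> tg (h2 \<star> l)) h | h l. h \<in> HC \<and> l \<in> HC}"

lemma Hpar_relationI:
  assumes "h \<in> HC" "l \<in> HC"
  shows "sw TA (\<lambda>l1 l2. tg h \<otimes>\<^bsub>TA\<^esub> tg l1 \<otimes>\<^bsub>TA\<^esub> tg (S l2)) l \<ominus>\<^bsub>TA\<^esub>
        sw TA (\<lambda>l1 l2. tg (h \<star> l1) \<otimes>\<^bsub>TA\<^esub> tg (S l2)) l \<in> Hpar_relations"
    "sw TA (\<lambda>h1 h2. tg h1 \<otimes>\<^bsub>TA\<^esub> tg (S h2) \<otimes>\<^bsub>TA\<^esub> tg l) h \<ominus>\<^bsub>TA\<^esub>
        sw TA (\<lambda>h1 h2. tg h1 \<otimes>\<^bsub>TA\<^esub> tg (S h2 \<star> l)) h \<in> Hpar_relations"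
    "sw TA (\<lambda>l1 l2. tg h \<otimes>\<^bsub>TA\<^esub> tg (S l1) \<otimes>\<^bsub>TA\<^esub> tg l2) l \<ominus>\<^bsub>TA\<^esub>
        sw TA (\<lambda>l1 l2. tg (h \<star> S l1) \<otimes>\<^bsub>TA\<^esub> tg l2) l \<in> Hpar_relations"
    "sw TA (\<lambda>h1 h2. tg (S h1) \<otimes>\<^bsub>TA\<^esub> tg h2 \<otimes>\<^bsub>TA\<^esub> tg l) h \<ominus>\<^bsub>TA\<^esub>
        sw TA (\<lambda>h1 h2. tg (S h1) \<otimes>\<^bsub>TA\<^esub> tg (h2 \<star> l)) h \<in> Hpar_relations"
  unfolding Hpar_relations_def using assms by blast+

lemma HI_eq: "HI = Idl\<^bsub>TA\<^esub> Hpar_relations"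
  by (simp add: Hpar_ideal_def Hpar_relations_def Let_def)

lemma Hpar_relations_subset: "Hpar_relations \<subseteq> carrier TA"
  unfolding Hpar_relations_def by (auto intro!: TA.minus_closed sw_closed TA.is_abelian_group)

lemma HI_ideal: "ideal HI TA"
  unfolding HI_eq by (rule TA.genideal_ideal[OF Hpar_relations_subset])

lemmas HP_algebra = quotient_k_algebra[OF TA_algebra HI_ideal, folded Hpar_def]
lemmas HP_proj = projection_algebra_map[OF TA_algebra HI_ideal, folded Hpar_def]
lemmas HP_lift = quotient_lift[OF TA_algebra HI_ideal, folded Hpar_def]
lemmas HP_simps = quotient_simps[OF TA_algebra HI_ideal, folded Hpar_def]
  quotient_smult[OF TA_algebra HI_ideal, folded Hpar_def]
lemmas HP_carrier = quotient_carrier[OF TA_algebra HI_ideal, folded Hpar_def]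

sublocale HP: ring HP by (rule k_algebraD[OF HP_algebra])
sublocale HPm: module k HP by (rule k_algebraD[OF HP_algebra])

lemma cls_linear: "linear_on k H HP cl"
  unfolding cls_def[abs_def] by (rule linear_on_comp[OF algebra_mapD(1)[OF HP_proj] tg_linear])

lemma HI_relation: "x \<ominus>\<^bsub>TA\<^esub> y \<in> Hpar_relations \<Longrightarrow> x \<in> carrier TA \<Longrightarrow> y \<in> carrier TA \<Longrightarrow> HI +>\<^bsub>TA\<^esub> x = HI +>\<^bsub>TA\<^esub> y"
  by (subst coset_eq_iff[OF TA_algebra HI_ideal])
    (use TA.genideal_self[OF Hpar_relations_subset] in \<open>auto simp: HI_eq\<close>)

lemma proj_sw:
  assumes "h \<in> HC" "\<And>x y. x \<in> HC \<Longrightarrow> y \<in> HC \<Longrightarrow> f x y \<in> carrier TA"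
  shows "HI +>\<^bsub>TA\<^esub> sw TA f h = sw HP (\<lambda>x y. HI +>\<^bsub>TA\<^esub> f x y) h"
  by (rule sw_linear_apply[OF TAm.module_axioms HPm.module_axioms algebra_mapD(1)[OF HP_proj] assms])

text \<open>A generator of the ideal is a difference of two Sweedler sums; their images in the quotient are the
  Sweedler sums of the images.\<close>

lemma Hpar_sw_relation:
  assumes "sw TA f h \<ominus>\<^bsub>TA\<^esub> sw TA g h \<in> Hpar_relations" "h \<in> HC"
    "\<And>x y. x \<in> HC \<Longrightarrow> y \<in> HC \<Longrightarrow> f x y \<in> carrier TA" "\<And>x y. x \<in> HC \<Longrightarrow> y \<in> HC \<Longrightarrow> g x y \<in> carrier TA"
    "\<And>x y. x \<in> HC \<Longrightarrow> y \<in> HC \<Longrightarrow> f' x y = HI +>\<^bsub>TA\<^esub> f x y" "\<And>x y. x \<in> HC \<Longrightarrow> y \<in> HC \<Longrightarrow> g' x y = HI +>\<^bsub>TA\<^esub> g x y"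
  shows "sw HP f' h = sw HP g' h"
proof -
  have c: "sw TA f h \<in> carrier TA" "sw TA g h \<in> carrier TA"
    using assms by (auto intro!: sw_closed TA.is_abelian_group)
  have "sw HP f' h = sw HP (\<lambda>x y. HI +>\<^bsub>TA\<^esub> f x y) h"
    by (rule sw_cong[OF HP.is_abelian_group assms(2)]) (use assms algebra_mapD(4)[OF HP_proj] in auto)
  also have "\<dots> = sw HP (\<lambda>x y. HI +>\<^bsub>TA\<^esub> g x y) h"
    using HI_relation[OF assms(1) c] assms by (simp add: proj_sw)
  also have "\<dots> = sw HP g' h"
    by (rule sw_cong[OF HP.is_abelian_group assms(2), symmetric]) (use assms algebra_mapD(4)[OF HP_proj] in auto)
  finally show ?thesis .
qed

lemma Hpar_par_rep: "par_rep k H HP cl"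
proof (intro par_rep.intro hopf_bij_axioms par_rep_axioms.intro HP_algebra cls_linear)
  show "cl unit = \<one>\<^bsub>HP\<^esub>"
    unfolding cls_def HP_simps by (rule HI_relation) (auto simp: Hpar_relations_def)
  fix h l assume h: "h \<in> HC" and l: "l \<in> HC"
  have cl: "cl x = HI +>\<^bsub>TA\<^esub> tg x" for x by (simp add: cls_def)
  show "sw HP (\<lambda>x y. cl h \<otimes>\<^bsub>HP\<^esub> cl x \<otimes>\<^bsub>HP\<^esub> cl (S y)) l = sw HP (\<lambda>x y. cl (h \<star> x) \<otimes>\<^bsub>HP\<^esub> cl (S y)) l"
    by (rule Hpar_sw_relation[OF Hpar_relationI(1)[OF h l]]) (use h l in \<open>auto simp: cl HP_simps\<close>)
  show "sw HP (\<lambda>x y. cl x \<otimes>\<^bsub>HP\<^esub> cl (S y) \<otimes>\<^bsub>HP\<^esub> cl l) h = sw HP (\<lambda>x y. cl x \<otimes>\<^bsub>HP\<^esub> cl (S y \<star> l)) h"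
    by (rule Hpar_sw_relation[OF Hpar_relationI(2)[OF h l]]) (use h l in \<open>auto simp: cl HP_simps\<close>)
  show "sw HP (\<lambda>x y. cl h \<otimes>\<^bsub>HP\<^esub> cl (S x) \<otimes>\<^bsub>HP\<^esub> cl y) l = sw HP (\<lambda>x y. cl (h \<star> S x) \<otimes>\<^bsub>HP\<^esub> cl y) l"
    by (rule Hpar_sw_relation[OF Hpar_relationI(3)[OF h l]]) (use h l in \<open>auto simp: cl HP_simps\<close>)
  show "sw HP (\<lambda>x y. cl (S x) \<otimes>\<^bsub>HP\<^esub> cl y \<otimes>\<^bsub>HP\<^esub> cl l) h = sw HP (\<lambda>x y. cl (S x) \<otimes>\<^bsub>HP\<^esub> cl (y \<star> l)) h"
    by (rule Hpar_sw_relation[OF Hpar_relationI(4)[OF h l]]) (use h l in \<open>auto simp: cl HP_simps\<close>)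
qed

text \<open>First extend to the free algebra, then use linearity to pass to the tensor algebra and the partial
  representation axioms to pass to the quotient.\<close>

lemma Hpar_universal:
  assumes "par_rep k H E \<phi>"
  shows "\<exists>f. algebra_map k HP E f \<and> (\<forall>x\<in>HC. f (cl x) = \<phi> x)"
proof -
  interpret E: par_rep k H E \<phi> by fact
  obtain f where f: "algebra_map k TA E f" and fg: "\<And>x. x \<in> HC \<Longrightarrow> f (tg x) = \<phi> x"
    using TA_universal[OF E.E_algebra E.phi_linear] by blast
  have fsw: "f (sw TA g h) = sw E g' h"
    if "h \<in> HC" "\<And>x y. x \<in> HC \<Longrightarrow> y \<in> HC \<Longrightarrow> g x y \<in> carrier TA"
      "\<And>x y. x \<in> HC \<Longrightarrow> y \<in> HC \<Longrightarrow> f (g x y) = g' x y" for g g' h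
  proof -
    have "f (sw TA g h) = sw E (\<lambda>x y. f (g x y)) h"
      by (rule sw_linear_apply[OF TAm.module_axioms E.Em algebra_mapD(1)[OF f] that(1,2)])
    also have "\<dots> = sw E g' h"
    proof (rule sw_cong[OF E.Eg that(1)])
      fix x y assume xy: "x \<in> HC" "y \<in> HC"
      show eq: "f (g x y) = g' x y" by (rule that(3)[OF xy])
      show "g' x y \<in> carrier E" using algebra_mapD(4)[OF f that(2)[OF xy]] by (simp add: eq)
    qed
    finally show ?thesis .
  qed
  have self: "a \<ominus>\<^bsub>E\<^esub> a = \<zero>\<^bsub>E\<^esub>" if "a \<in> carrier E" for a
    using that by (simp add: a_minus_def E.EM.r_neg)
  have van: "f (sw TA g h \<ominus>\<^bsub>TA\<^esub> sw TA g2 h) = \<zero>\<^bsub>E\<^esub>"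
    if "sw E g' h = sw E g2' h" "h \<in> HC" "\<And>x y. x \<in> HC \<Longrightarrow> y \<in> HC \<Longrightarrow> g x y \<in> carrier TA" "\<And>x y. x \<in> HC \<Longrightarrow> y \<in> HC \<Longrightarrow> g2 x y \<in> carrier TA"
      "\<And>x y. x \<in> HC \<Longrightarrow> y \<in> HC \<Longrightarrow> f (g x y) = g' x y" "\<And>x y. x \<in> HC \<Longrightarrow> y \<in> HC \<Longrightarrow> f (g2 x y) = g2' x y" for g g2 g' g2' h
  proof -
    have c: "sw TA g h \<in> carrier TA" "sw TA g2 h \<in> carrier TA"
      using that by (auto intro!: sw_closed TA.is_abelian_group)
    have "f (sw TA g h) = f (sw TA g2 h)" using that fsw[of h g g'] fsw[of h g2 g2'] by simp
    then show ?thesis using c algebra_mapD(4)[OF f c(2)]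
      by (simp add: algebra_map_minus[OF TA_algebra E.E_algebra f] self)
  qed
  note fm = algebra_mapD(5)[OF f] fg
  have "f x = \<zero>\<^bsub>E\<^esub>" if "x \<in> HI" for x
    using that unfolding HI_eq
  proof (rule algebra_map_vanishes_on_ideal[OF TA_algebra E.E_algebra f Hpar_relations_subset, rotated])
    fix r assume "r \<in> Hpar_relations"
    then show "f r = \<zero>\<^bsub>E\<^esub>"
      unfolding Hpar_relations_def
    proof (elim UnE CollectE exE conjE singletonE)
      assume "r = tg unit \<ominus>\<^bsub>TA\<^esub> \<one>\<^bsub>TA\<^esub>"
      then show ?thesis
        by (simp add: algebra_map_minus[OF TA_algebra E.E_algebra f] fg algebra_mapD(3)[OF f] E.phi_unit self)
    next
      fix h l assume "r = sw TA (\<lambda>l1 l2. tg h \<otimes>\<^bsub>TA\<^esub> tg l1 \<otimes>\<^bsub>TA\<^esub> tg (S l2)) l \<ominus>\<^bsub>TA\<^esub>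
        sw TA (\<lambda>l1 l2. tg (h \<star> l1) \<otimes>\<^bsub>TA\<^esub> tg (S l2)) l" and "h \<in> HC" "l \<in> HC"
      then show ?thesis by (auto intro!: van[OF E.pr2[of h l]] simp: fm)
    next
      fix h l assume "r = sw TA (\<lambda>h1 h2. tg h1 \<otimes>\<^bsub>TA\<^esub> tg (S h2) \<otimes>\<^bsub>TA\<^esub> tg l) h \<ominus>\<^bsub>TA\<^esub>
        sw TA (\<lambda>h1 h2. tg h1 \<otimes>\<^bsub>TA\<^esub> tg (S h2 \<star> l)) h" and "h \<in> HC" "l \<in> HC"
      then show ?thesis by (auto intro!: van[OF E.pr3[of h l]] simp: fm)
    next
      fix h l assume "r = sw TA (\<lambda>l1 l2. tg h \<otimes>\<^bsub>TA\<^esub> tg (S l1) \<otimes>\<^bsub>TA\<^esub> tg l2) l \<ominus>\<^bsub>TA\<^esub>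
        sw TA (\<lambda>l1 l2. tg (h \<star> S l1) \<otimes>\<^bsub>TA\<^esub> tg l2) l" and "h \<in> HC" "l \<in> HC"
      then show ?thesis by (auto intro!: van[OF E.pr4[of h l]] simp: fm)
    next
      fix h l assume "r = sw TA (\<lambda>h1 h2. tg (S h1) \<otimes>\<^bsub>TA\<^esub> tg h2 \<otimes>\<^bsub>TA\<^esub> tg l) h \<ominus>\<^bsub>TA\<^esub>
        sw TA (\<lambda>h1 h2. tg (S h1) \<otimes>\<^bsub>TA\<^esub> tg (h2 \<star> l)) h" and "h \<in> HC" "l \<in> HC"
      then show ?thesis by (auto intro!: van[OF E.pr5[of h l]] simp: fm)
    qed
  qed
  from HP_lift[OF f E.E_algebra this] obtain g where "algebra_map k HP E g" "\<forall>x\<in>carrier TA. g (HI +>\<^bsub>TA\<^esub> x) = f x" by blast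
  then show ?thesis using fg by (auto simp: cls_def)
qed

sublocale HPr: par_rep k H HP cl by (rule Hpar_par_rep)

text \<open>Scalar multiples are covered by products because \<open>c x = [c 1\<^sub>H] x\<close>.\<close>

lemma Hpar_induct [consumes 1, case_names cls add mult]:
  assumes x: "x \<in> carrier HP"
    and cls: "\<And>h. h \<in> HC \<Longrightarrow> P (cl h)"
    and add: "\<And>x y. x \<in> carrier HP \<Longrightarrow> y \<in> carrier HP \<Longrightarrow> P x \<Longrightarrow> P y \<Longrightarrow> P (x \<oplus>\<^bsub>HP\<^esub> y)"
    and mult: "\<And>x y. x \<in> carrier HP \<Longrightarrow> y \<in> carrier HP \<Longrightarrow> P x \<Longrightarrow> P y \<Longrightarrow> P (x \<otimes>\<^bsub>HP\<^esub> y)"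
  shows "P x"
proof -
  define p where "p = (\<lambda>f. HI +>\<^bsub>TA\<^esub> (TI +>\<^bsub>FA\<^esub> f))"
  have p: "algebra_map k FA HP p"
    unfolding p_def by (rule algebra_map_comp[OF TA_proj HP_proj])
  obtain f where f: "f \<in> carrier FA" "x = p f"
    using x by (auto simp: HP_carrier TA_carrier p_def)
  have "P (p f)" using f(1)
  proof (induction f rule: fa.F_induct)
    case (single w c)
    then show ?case
    proof (induction w)
      case Nil
      have "fa.single [] c = c \<odot>\<^bsub>FA\<^esub> \<one>\<^bsub>FA\<^esub>" using Nil by (auto simp: fa.single_def fa.F_simps fun_eq_iff)
      then have "p (fa.single [] c) = c \<odot>\<^bsub>HP\<^esub> \<one>\<^bsub>HP\<^esub>"
        using Nil ring.ring_simprules(6)[OF k_algebraD(2)[OF fa.F_k_algebra]]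
        by (simp add: linear_on_smult[OF algebra_mapD(1)[OF p]] algebra_mapD(3)[OF p])
      also have "\<dots> = cl (c \<odot>\<^bsub>H\<^esub> unit)" using Nil by (simp add: linear_on_smult[OF cls_linear] HPr.phi_unit)
      finally show ?case using cls Nil by simp
    next
      case (Cons y w)
      have "fa.single (y # w) c = free_gen k y \<otimes>\<^bsub>FA\<^esub> fa.single w c"
        using fa.single_mult[of "\<one>\<^bsub>k\<^esub>" c "[y]" w] Cons by (simp add: fa.F_simps(2) free_gen_def fa.single_def)
      then have "p (fa.single (y # w) c) = cl y \<otimes>\<^bsub>HP\<^esub> p (fa.single w c)"
        using Cons by (simp add: algebra_mapD(5)[OF p] fa.free_gen_closed fa.single_closed) (simp add: p_def cls_def tensor_gen_def)
      then show ?case using Cons cls mult algebra_mapD(4)[OF p] by (simp add: fa.single_closed)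
    qed
  next
    case (add f g)
    then show ?case using assms(3) algebra_mapD(4)[OF p] by (simp add: algebra_mapD(6)[OF p])
  qed
  then show ?thesis using f by simp
qed

end

section \<open>Modules over \<open>H\<^sub>p\<^sub>a\<^sub>r\<close> from partial representations\<close>

text \<open>Endomorphisms are extensional functions, so that equality in the algebra is equality of the maps on
  the carrier.\<close>

definition end_algebra :: "('k, 'p) ring_scheme \<Rightarrow> ('k, 'g, 'z) module_scheme \<Rightarrow> ('k, 'g \<Rightarrow> 'g) module" where
  "end_algebra k G = \<lparr>carrier = {f \<in> extensional (carrier G). linear_on k G G f},
     monoid.mult = (\<lambda>f g. \<lambda>x\<in>carrier G. f (g x)), one = (\<lambda>x\<in>carrier G. x), ring.zero = (\<lambda>x\<in>carrier G. \<zero>\<^bsub>G\<^esub>),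
     add = (\<lambda>f g. \<lambda>x\<in>carrier G. f x \<oplus>\<^bsub>G\<^esub> g x), smult = (\<lambda>c f. \<lambda>x\<in>carrier G. c \<odot>\<^bsub>G\<^esub> f x)\<rparr>"

lemma end_algebra_simps:
  "f \<in> carrier (end_algebra k G) \<longleftrightarrow> f \<in> extensional (carrier G) \<and> linear_on k G G f"
  "f \<otimes>\<^bsub>end_algebra k G\<^esub> g = (\<lambda>x\<in>carrier G. f (g x))" "\<one>\<^bsub>end_algebra k G\<^esub> = (\<lambda>x\<in>carrier G. x)"
  "\<zero>\<^bsub>end_algebra k G\<^esub> = (\<lambda>x\<in>carrier G. \<zero>\<^bsub>G\<^esub>)" "f \<oplus>\<^bsub>end_algebra k G\<^esub> g = (\<lambda>x\<in>carrier G. f x \<oplus>\<^bsub>G\<^esub> g x)"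
  "c \<odot>\<^bsub>end_algebra k G\<^esub> f = (\<lambda>x\<in>carrier G. c \<odot>\<^bsub>G\<^esub> f x)"
  by (auto simp: end_algebra_def)

lemma end_algebra_k_algebra:
  assumes "module k G"
  shows "k_algebra k (end_algebra k G)"
proof -
  interpret G: module k G by fact
  let ?E = "end_algebra k G"
  have cl: "f x \<in> carrier G" if "f \<in> carrier ?E" "x \<in> carrier G" for f x
    using that linear_on_closed by (auto simp: end_algebra_simps)
  have eqI: "f = g" if "f \<in> extensional (carrier G)" "g \<in> extensional (carrier G)" "\<And>x. x \<in> carrier G \<Longrightarrow> f x = g x" for f g :: "'c \<Rightarrow> 'c"
    using that by (rule extensionalityI)
  have ad: "f (x \<oplus>\<^bsub>G\<^esub> y) = f x \<oplus>\<^bsub>G\<^esub> f y" if "f \<in> carrier ?E" "x \<in> carrier G" "y \<in> carrier G" for f x y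
    using that linear_on_add by (auto simp: end_algebra_simps)
  have sm: "f (c \<odot>\<^bsub>G\<^esub> x) = c \<odot>\<^bsub>G\<^esub> f x" if "f \<in> carrier ?E" "c \<in> carrier k" "x \<in> carrier G" for f x c
    using that linear_on_smult by (auto simp: end_algebra_simps)
  have comm: "c \<odot>\<^bsub>G\<^esub> (r \<odot>\<^bsub>G\<^esub> y) = r \<odot>\<^bsub>G\<^esub> (c \<odot>\<^bsub>G\<^esub> y)" if "c \<in> carrier k" "r \<in> carrier k" "y \<in> carrier G" for r y c
    using that by (metis G.R.m_comm G.smult_assoc1)
  have c_add: "f \<oplus>\<^bsub>?E\<^esub> g \<in> carrier ?E" if "f \<in> carrier ?E" "g \<in> carrier ?E" for f g
    unfolding end_algebra_simps(1) using that
    by (auto simp: end_algebra_simps(5) cl ad sm G.a_ac G.smult_r_distr intro!: linear_onI)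
  have c_zero: "\<zero>\<^bsub>?E\<^esub> \<in> carrier ?E"
    unfolding end_algebra_simps(1) by (auto simp: end_algebra_simps(4) intro!: linear_onI)
  have c_smult: "c \<odot>\<^bsub>?E\<^esub> f \<in> carrier ?E" if "f \<in> carrier ?E" "c \<in> carrier k" for f c
    unfolding end_algebra_simps(1) using that
    by (auto simp: end_algebra_simps(6) cl ad sm G.smult_r_distr comm intro!: linear_onI)
  have c_mult: "f \<otimes>\<^bsub>?E\<^esub> g \<in> carrier ?E" if "f \<in> carrier ?E" "g \<in> carrier ?E" for f g
    unfolding end_algebra_simps(1) using that
    by (auto simp: end_algebra_simps(2) cl ad sm intro!: linear_onI)
  have c_one: "\<one>\<^bsub>?E\<^esub> \<in> carrier ?E"
    unfolding end_algebra_simps(1) by (auto simp: end_algebra_simps(3) intro!: linear_onI)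
  have ext: "f \<in> extensional (carrier G)" if "f \<in> carrier ?E" for f
    using that by (simp add: end_algebra_simps)
  have E_ab: "abelian_group ?E"
  proof (rule abelian_groupI, goal_cases)
    case (6 f)
    have "(\<ominus>\<^bsub>k\<^esub> \<one>\<^bsub>k\<^esub>) \<odot>\<^bsub>?E\<^esub> f \<oplus>\<^bsub>?E\<^esub> f = \<zero>\<^bsub>?E\<^esub>"
      by (rule eqI) (auto simp: end_algebra_simps(2-) cl[OF 6] G.smult_l_minus G.l_neg)
    then show ?case using c_smult[OF 6, of "\<ominus>\<^bsub>k\<^esub> \<one>\<^bsub>k\<^esub>"] by auto
  next
    case (3 f g h)
    show ?case by (rule eqI) (auto simp: end_algebra_simps(2-) cl 3 G.a_assoc)
  next
    case (4 f g)
    show ?case by (rule eqI) (auto simp: end_algebra_simps(2-) cl 4 G.a_comm)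
  next
    case (5 f)
    show ?case by (rule eqI) (auto simp: end_algebra_simps(2-) cl 5 ext)
  qed (auto intro: c_add c_zero)
  show ?thesis
    unfolding k_algebra_def
  proof (intro conjI ballI)
    show "module k ?E"
    proof (rule moduleI[OF G.R.is_cring E_ab], goal_cases)
      case (1 c f) then show ?case by (intro c_smult)
    next
      case (2 c d f) show ?case by (rule eqI) (auto simp: end_algebra_simps(2-) cl 2 G.smult_l_distr)
    next
      case (3 c f g) show ?case by (rule eqI) (auto simp: end_algebra_simps(2-) cl 3 G.smult_r_distr)
    next
      case (4 c d f) show ?case by (rule eqI) (auto simp: end_algebra_simps(2-) cl 4 G.smult_assoc1)
    next
      case (5 f) show ?case by (rule eqI) (auto simp: end_algebra_simps(2-) cl 5 ext)
    qed
    show "ring ?E"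
    proof (rule ringI[OF E_ab], goal_cases)
      case 1
      show ?case
      proof (rule monoidI, goal_cases)
        case (3 f g h) show ?case by (rule eqI) (auto simp: end_algebra_simps(2-) cl 3)
      next
        case (4 f) show ?case by (rule eqI) (auto simp: end_algebra_simps(2-) cl 4 ext)
      next
        case (5 f) show ?case by (rule eqI) (auto simp: end_algebra_simps(2-) cl 5 ext)
      qed (auto intro: c_mult c_one)
    next
      case (2 f g h) show ?case by (rule eqI) (auto simp: end_algebra_simps(2-) cl 2)
    next
      case (3 f g h) show ?case by (rule eqI) (auto simp: end_algebra_simps(2-) cl 3 ad)
    qed
    fix c f g assume *: "c \<in> carrier k" "f \<in> carrier ?E" "g \<in> carrier ?E"
    show "c \<odot>\<^bsub>?E\<^esub> f \<otimes>\<^bsub>?E\<^esub> g = c \<odot>\<^bsub>?E\<^esub> (f \<otimes>\<^bsub>?E\<^esub> g)" by (rule eqI) (auto simp: end_algebra_simps(2-) cl *)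
    show "f \<otimes>\<^bsub>?E\<^esub> (c \<odot>\<^bsub>?E\<^esub> g) = c \<odot>\<^bsub>?E\<^esub> (f \<otimes>\<^bsub>?E\<^esub> g)" by (rule eqI) (auto simp: end_algebra_simps(2-) cl * sm)
  qed
qed

lemma (in hopf_bij) Hpar_module_unique:
  assumes M: "left_module HP M" and N: "left_module HP N" and c: "carrier M = carrier N" and a: "add M = add N"
    and cls: "\<And>h x. h \<in> HC \<Longrightarrow> x \<in> carrier M \<Longrightarrow> cl h \<odot>\<^bsub>M\<^esub> x = cl h \<odot>\<^bsub>N\<^esub> x"
    and r: "r \<in> carrier HP" and x: "x \<in> carrier M"
  shows "r \<odot>\<^bsub>M\<^esub> x = r \<odot>\<^bsub>N\<^esub> x"
  using r x
proof (induction r arbitrary: x rule: Hpar_induct)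
  case (cls h) then show ?case using assms by simp
next
  case (add p q)
  then show ?case using c a by (simp add: left_moduleD(4)[OF M] left_moduleD(4)[OF N])
next
  case (mult p q)
  then show ?case using c left_moduleD(3)[OF M, of q x] by (simp add: left_moduleD(6)[OF M] left_moduleD(6)[OF N])
qed

text \<open>A partial representation on a \<open>k\<close>-module, written with operators instead of elements of the endomorphism
  algebra.\<close>

locale par_module = hopf_bij k H for k :: "'k ring" and H :: "('k, 'h) hopf" +
  fixes G :: "('k, 'g, 'w) module_scheme" and \<pi> :: "'h \<Rightarrow> 'g \<Rightarrow> 'g"
  assumes G: "module k G"
    and pi_linear: "h \<in> HC \<Longrightarrow> linear_on k G G (\<pi> h)"
    and pi_linear_arg: "X \<in> carrier G \<Longrightarrow> linear_on k H G (\<lambda>h. \<pi> h X)"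
    and pi_unit: "X \<in> carrier G \<Longrightarrow> \<pi> unit X = X"
    and rel2: "h \<in> HC \<Longrightarrow> l \<in> HC \<Longrightarrow> X \<in> carrier G \<Longrightarrow>
      sw G (\<lambda>x y. \<pi> h (\<pi> x (\<pi> (S y) X))) l = sw G (\<lambda>x y. \<pi> (h \<star> x) (\<pi> (S y) X)) l"
    and rel3: "h \<in> HC \<Longrightarrow> l \<in> HC \<Longrightarrow> X \<in> carrier G \<Longrightarrow>
      sw G (\<lambda>x y. \<pi> x (\<pi> (S y) (\<pi> l X))) h = sw G (\<lambda>x y. \<pi> x (\<pi> (S y \<star> l) X)) h"
    and rel4: "h \<in> HC \<Longrightarrow> l \<in> HC \<Longrightarrow> X \<in> carrier G \<Longrightarrow>
      sw G (\<lambda>x y. \<pi> h (\<pi> (S x) (\<pi> y X))) l = sw G (\<lambda>x y. \<pi> (h \<star> S x) (\<pi> y X)) l"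
    and rel5: "h \<in> HC \<Longrightarrow> l \<in> HC \<Longrightarrow> X \<in> carrier G \<Longrightarrow>
      sw G (\<lambda>x y. \<pi> (S x) (\<pi> y (\<pi> l X))) h = sw G (\<lambda>x y. \<pi> (S x) (\<pi> (y \<star> l) X)) h"
begin

sublocale G: module k G by (rule G)

lemmas Gg = G.abelian_group_axioms

lemma pi_closed [simp, intro]: "h \<in> HC \<Longrightarrow> X \<in> carrier G \<Longrightarrow> \<pi> h X \<in> carrier G"
  by (rule linear_on_closed[OF pi_linear])

abbreviation "EG \<equiv> end_algebra k G"
abbreviation "\<rho> \<equiv> (\<lambda>h. \<lambda>X\<in>carrier G. \<pi> h X)"

lemma EG_module: "module k EG" and EG_algebra: "k_algebra k EG"
  using end_algebra_k_algebra[OF G] k_algebraD(1) by auto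

lemma rho_closed [simp, intro]: "h \<in> HC \<Longrightarrow> \<rho> h \<in> carrier EG"
  by (auto simp: end_algebra_simps linear_on_add[OF pi_linear] linear_on_smult[OF pi_linear] intro!: linear_onI)

lemma sw_end_apply:
  assumes "h \<in> HC" "\<And>x y. x \<in> HC \<Longrightarrow> y \<in> HC \<Longrightarrow> f x y \<in> carrier EG" "X \<in> carrier G"
    and eq: "\<And>x y. x \<in> HC \<Longrightarrow> y \<in> HC \<Longrightarrow> f x y X = g x y"
  shows "sw EG f h X = sw G g h"
proof -
  interpret EG: module k EG by (rule EG_module)
  have cl: "f x y X \<in> carrier G" if "x \<in> HC" "y \<in> HC" for x y
    using assms(2)[OF that] assms(3) linear_on_closed by (auto simp: end_algebra_simps)
  have "additive_on EG G (\<lambda>f. f X)"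
    using assms(3) by (intro additive_onI) (auto simp: end_algebra_simps intro: linear_on_closed)
  from sw_additive[OF EG.abelian_group_axioms Gg this assms(1,2)]
  have "sw EG f h X = sw G (\<lambda>x y. f x y X) h" by simp
  also have "\<dots> = sw G g h" by (rule sw_cong[OF Gg assms(1)]) (use eq cl in fastforce)+
  finally show ?thesis .
qed

lemma end_eqI:
  assumes "f \<in> carrier EG" "g \<in> carrier EG" "\<And>X. X \<in> carrier G \<Longrightarrow> f X = g X"
  shows "f = g"
  using assms by (intro extensionalityI[of f "carrier G"]) (auto simp: end_algebra_simps)

lemma end_par_rep: "par_rep k H EG \<rho>"
proof (intro par_rep.intro hopf_bij_axioms par_rep_axioms.intro EG_algebra)
  interpret EG: ring EG by (rule k_algebraD[OF EG_algebra])
  have cl: "\<rho> x \<otimes>\<^bsub>EG\<^esub> \<rho> y \<in> carrier EG" "\<rho> x \<otimes>\<^bsub>EG\<^esub> \<rho> y \<otimes>\<^bsub>EG\<^esub> \<rho> z \<in> carrier EG" if "x \<in> HC" "y \<in> HC" "z \<in> HC" for x y z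
    using that by auto
  have ev: "(\<rho> x \<otimes>\<^bsub>EG\<^esub> \<rho> y) X = \<pi> x (\<pi> y X)" "(\<rho> x \<otimes>\<^bsub>EG\<^esub> \<rho> y \<otimes>\<^bsub>EG\<^esub> \<rho> z) X = \<pi> x (\<pi> y (\<pi> z X))"
    if "x \<in> HC" "y \<in> HC" "z \<in> HC" "X \<in> carrier G" for x y z X
    using that by (simp_all add: end_algebra_simps(2))
  show "linear_on k H EG \<rho>"
    by (rule linear_onI, erule rho_closed)
      (auto simp: end_algebra_simps(5,6) linear_on_add[OF pi_linear_arg] linear_on_smult[OF pi_linear_arg] fun_eq_iff restrict_def)
  show "\<rho> unit = \<one>\<^bsub>EG\<^esub>" by (auto simp: end_algebra_simps pi_unit fun_eq_iff restrict_def)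
  have main: "sw EG f h = sw EG g h"
    if "\<And>X. X \<in> carrier G \<Longrightarrow> sw G (f' X) h = sw G (g' X) h" "h \<in> HC"
      "\<And>x y. x \<in> HC \<Longrightarrow> y \<in> HC \<Longrightarrow> f x y \<in> carrier EG" "\<And>x y. x \<in> HC \<Longrightarrow> y \<in> HC \<Longrightarrow> g x y \<in> carrier EG"
      "\<And>x y X. x \<in> HC \<Longrightarrow> y \<in> HC \<Longrightarrow> X \<in> carrier G \<Longrightarrow> f x y X = f' X x y"
      "\<And>x y X. x \<in> HC \<Longrightarrow> y \<in> HC \<Longrightarrow> X \<in> carrier G \<Longrightarrow> g x y X = g' X x y" for f g h f' g'
  proof (rule end_eqI)
    show "sw EG f h \<in> carrier EG" "sw EG g h \<in> carrier EG"
      by (rule sw_closed[OF EG.is_abelian_group that(2)], rule that, assumption+)+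
    fix X assume X: "X \<in> carrier G"
    have "sw EG f h X = sw G (f' X) h" by (rule sw_end_apply[OF that(2,3) X that(5)[OF _ _ X]])
    moreover have "sw EG g h X = sw G (g' X) h" by (rule sw_end_apply[OF that(2,4) X that(6)[OF _ _ X]])
    ultimately show "sw EG f h X = sw EG g h X" using that(1)[OF X] by simp
  qed
  fix h l assume h: "h \<in> HC" and l: "l \<in> HC"
  show "sw EG (\<lambda>x y. \<rho> h \<otimes>\<^bsub>EG\<^esub> \<rho> x \<otimes>\<^bsub>EG\<^esub> \<rho> (S y)) l = sw EG (\<lambda>x y. \<rho> (h \<star> x) \<otimes>\<^bsub>EG\<^esub> \<rho> (S y)) l"
    by (rule main[OF rel2[OF h l] l]) (simp_all add: ev cl h l del: restrict_apply)
  show "sw EG (\<lambda>x y. \<rho> x \<otimes>\<^bsub>EG\<^esub> \<rho> (S y) \<otimes>\<^bsub>EG\<^esub> \<rho> l) h = sw EG (\<lambda>x y. \<rho> x \<otimes>\<^bsub>EG\<^esub> \<rho> (S y \<star> l)) h"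
    by (rule main[OF rel3[OF h l] h]) (simp_all add: ev cl h l del: restrict_apply)
  show "sw EG (\<lambda>x y. \<rho> h \<otimes>\<^bsub>EG\<^esub> \<rho> (S x) \<otimes>\<^bsub>EG\<^esub> \<rho> y) l = sw EG (\<lambda>x y. \<rho> (h \<star> S x) \<otimes>\<^bsub>EG\<^esub> \<rho> y) l"
    by (rule main[OF rel4[OF h l] l]) (simp_all add: ev cl h l del: restrict_apply)
  show "sw EG (\<lambda>x y. \<rho> (S x) \<otimes>\<^bsub>EG\<^esub> \<rho> y \<otimes>\<^bsub>EG\<^esub> \<rho> l) h = sw EG (\<lambda>x y. \<rho> (S x) \<otimes>\<^bsub>EG\<^esub> \<rho> (y \<star> l)) h"
    by (rule main[OF rel5[OF h l] h]) (simp_all add: ev cl h l del: restrict_apply)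
qed

text \<open>Existence comes from the universal property of \<open>H\<^sub>p\<^sub>a\<^sub>r\<close> for the endomorphism algebra; with uniqueness this evaluates
  the definite description in \<^const>\<open>induced_module\<close>.  The group is given up to a change of record type.\<close>

lemma induced_module:
  fixes G' :: "('g, 'w') ring_scheme"
  assumes G': "carrier G' = carrier G" "add G' = add G" "\<zero>\<^bsub>G'\<^esub> = \<zero>\<^bsub>G\<^esub>"
    and act: "\<And>h X. h \<in> HC \<Longrightarrow> X \<in> carrier G \<Longrightarrow> act h X = \<pi> h X"
  defines "M \<equiv> induced_module k H G' act"
  shows "carrier M = carrier G" "add M = add G" "\<zero>\<^bsub>M\<^esub> = \<zero>\<^bsub>G\<^esub>" "mult M = undefined" "\<one>\<^bsub>M\<^esub> = undefined"
    "left_module HP M" "extensional2 (carrier HP) (carrier G) (smult M)"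
    "\<And>h X. h \<in> HC \<Longrightarrow> X \<in> carrier G \<Longrightarrow> cl h \<odot>\<^bsub>M\<^esub> X = \<pi> h X"
proof -
  define N where "N = (\<lambda>s. \<lparr>carrier = carrier G', monoid.mult = undefined, one = undefined,
                    ring.zero = \<zero>\<^bsub>G'\<^esub>, add = add G', smult = s\<rparr> :: (('k, 'h) hpar, 'g) module)"
  define P where "P = (\<lambda>s. extensional2 (carrier HP) (carrier G') s \<and> left_module HP (N s) \<and>
     (\<forall>h\<in>HC. \<forall>x\<in>carrier G'. s (cl h) x = act h x))"
  have M: "M = N (THE s. P s)"
    by (simp add: M_def induced_module_def N_def P_def Let_def)
  obtain f where f: "algebra_map k HP EG f" and fc: "\<And>h. h \<in> HC \<Longrightarrow> f (cl h) = \<rho> h"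
    using Hpar_universal[OF end_par_rep] by blast
  define s where "s = (\<lambda>r\<in>carrier HP. \<lambda>X\<in>carrier G. f r X)"
  have fE: "f r \<in> carrier EG" if "r \<in> carrier HP" for r by (rule algebra_mapD(4)[OF f that])
  have fl: "linear_on k G G (f r)" if "r \<in> carrier HP" for r using fE[OF that] by (simp add: end_algebra_simps)
  have N_ab: "abelian_group (N s)" for s
    by (rule abelian_group_transfer[OF Gg]) (simp_all add: N_def G')
  have Ps: "P s"
    unfolding P_def
  proof (intro conjI)
    show "extensional2 (carrier HP) (carrier G') s"
      by (auto simp: extensional2_def s_def G' fun_eq_iff restrict_def)
    show "\<forall>h\<in>HC. \<forall>x\<in>carrier G'. s (cl h) x = act h x"
      using HPr.phi_closed by (auto simp: s_def G' fc act)
    show "left_module HP (N s)"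
      unfolding left_module_def using HP.ring_axioms N_ab
      by (auto simp: N_def G' s_def linear_on_closed[OF fl] linear_on_add[OF fl] algebra_mapD[OF f] end_algebra_simps)
  qed
  have uniq: "s' = s" if "P s'" for s'
  proof -
    have e: "extensional2 (carrier HP) (carrier G') s'" "extensional2 (carrier HP) (carrier G') s" using that Ps by (auto simp: P_def)
    have "s' r x = s r x" if "r \<in> carrier HP" "x \<in> carrier G'" for r x
      using Hpar_module_unique[of "N s'" "N s" r x] Ps \<open>P s'\<close> that by (auto simp: P_def N_def)
    then have "(\<lambda>x\<in>carrier HP. \<lambda>y\<in>carrier G'. s' x y) = (\<lambda>x\<in>carrier HP. \<lambda>y\<in>carrier G'. s x y)"
      by (auto simp: fun_eq_iff restrict_def)
    then show ?thesis using e unfolding extensional2_def by simp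
  qed
  have M: "M = N s" unfolding M using the_equality[of P s, OF Ps uniq] by simp
  show "carrier M = carrier G" "add M = add G" "\<zero>\<^bsub>M\<^esub> = \<zero>\<^bsub>G\<^esub>" "mult M = undefined" "\<one>\<^bsub>M\<^esub> = undefined"
    by (simp_all add: M N_def G')
  show "left_module HP M" "extensional2 (carrier HP) (carrier G) (smult M)"
    using Ps by (auto simp: M P_def G' N_def)
  show "cl h \<odot>\<^bsub>M\<^esub> X = \<pi> h X" if "h \<in> HC" "X \<in> carrier G" for h X
    using Ps that by (auto simp: M P_def N_def G' act)
qed

end

section \<open>The base algebra \<open>A\<close>\<close>

definition op_algebra :: "('k, 'e, 'z) module_scheme \<Rightarrow> ('k, 'e, 'z) module_scheme" where
  "op_algebra E = E\<lparr>monoid.mult := \<lambda>x y. y \<otimes>\<^bsub>E\<^esub> x\<rparr>"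

lemma op_algebra_simps [simp]:
  "carrier (op_algebra E) = carrier E" "\<one>\<^bsub>op_algebra E\<^esub> = \<one>\<^bsub>E\<^esub>" "\<zero>\<^bsub>op_algebra E\<^esub> = \<zero>\<^bsub>E\<^esub>" "add (op_algebra E) = add E"
  "smult (op_algebra E) = smult E" "x \<otimes>\<^bsub>op_algebra E\<^esub> y = y \<otimes>\<^bsub>E\<^esub> x"
  by (simp_all add: op_algebra_def)

lemma op_k_algebra:
  assumes E: "k_algebra k E"
  shows "k_algebra k (op_algebra E)"
proof -
  interpret E: ring E by (rule k_algebraD[OF E])
  interpret Em: module k E by (rule k_algebraD[OF E])
  have ab: "abelian_group (op_algebra E)" by (rule abelian_group_transfer[OF E.is_abelian_group]) simp_all
  have "module k (op_algebra E)" by (rule module_transfer[OF Em.module_axioms]) simp_all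
  moreover have "ring (op_algebra E)"
    by (rule ringI[OF ab]) (auto intro!: monoidI simp: E.m_assoc E.l_distr E.r_distr)
  ultimately show ?thesis by (auto simp: k_algebra_def k_algebraD[OF E])
qed

context par_rep
begin

lemma cop_relations:
  assumes h: "h \<in> HC" and l: "l \<in> HC"
  shows "sw E (\<lambda>x y. \<phi> h \<cdot>\<cdot> \<phi> y \<cdot>\<cdot> \<phi> (\<tau> x)) l = sw E (\<lambda>x y. \<phi> (h \<star> y) \<cdot>\<cdot> \<phi> (\<tau> x)) l"
    "sw E (\<lambda>x y. \<phi> y \<cdot>\<cdot> \<phi> (\<tau> x) \<cdot>\<cdot> \<phi> l) h = sw E (\<lambda>x y. \<phi> y \<cdot>\<cdot> \<phi> (\<tau> x \<star> l)) h"
    "sw E (\<lambda>x y. \<phi> h \<cdot>\<cdot> \<phi> (\<tau> y) \<cdot>\<cdot> \<phi> x) l = sw E (\<lambda>x y. \<phi> (h \<star> \<tau> y) \<cdot>\<cdot> \<phi> x) l"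
    "sw E (\<lambda>x y. \<phi> (\<tau> y) \<cdot>\<cdot> \<phi> x \<cdot>\<cdot> \<phi> l) h = sw E (\<lambda>x y. \<phi> (\<tau> y) \<cdot>\<cdot> \<phi> (x \<star> l)) h"
  using par_rep.pr2[OF cop_par_rep, of h l] par_rep.pr3[OF cop_par_rep, of h l]
    par_rep.pr4[OF cop_par_rep, of h l] par_rep.pr5[OF cop_par_rep, of h l] h l
  by (simp_all add: sw_cop[OF Em] elin)

text \<open>\<open>\<tau>\<close> reverses products and coproducts, so composition with it exchanges the relations with those of the
  mirror image.  For \<open>H\<^sub>p\<^sub>a\<^sub>r\<close> the induced map extends \<open>t\<close> to an anti-endomorphism.\<close>

lemma op_par_rep: "par_rep k H (op_algebra E) (\<lambda>h. \<phi> (\<tau> h))"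
proof (intro par_rep.intro hopf_bij_axioms par_rep_axioms.intro op_k_algebra E_algebra)
  show "linear_on k H (op_algebra E) (\<lambda>h. \<phi> (\<tau> h))"
    using linear_phi[OF antipode_inv_linear] by (simp add: linear_on_def)
  show "\<phi> (\<tau> unit) = \<one>\<^bsub>op_algebra E\<^esub>" by (simp add: tau_unit phi_unit)
  have t: "sw (op_algebra E) f h = sw E f h" for f h by (rule sw_transfer) simp_all
  fix h l assume h: "h \<in> HC" and l: "l \<in> HC"
  have conv: "sw (op_algebra E) f x = sw (op_algebra E) g x"
    if "sw E f' x = sw E g' x" "x \<in> HC" "\<And>u v. u \<in> HC \<Longrightarrow> v \<in> HC \<Longrightarrow> f u v = f' u v" "\<And>u v. u \<in> HC \<Longrightarrow> v \<in> HC \<Longrightarrow> g u v = g' u v"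
      "\<And>u v. u \<in> HC \<Longrightarrow> v \<in> HC \<Longrightarrow> f' u v \<in> carrier E" "\<And>u v. u \<in> HC \<Longrightarrow> v \<in> HC \<Longrightarrow> g' u v \<in> carrier E" for f g f' g' x
    using sw_cong[OF Eg that(2,5,3)] sw_cong[OF Eg that(2,6,4)] that(1) by (simp add: t)
  show "sw (op_algebra E) (\<lambda>x y. \<phi> (\<tau> h) \<otimes>\<^bsub>op_algebra E\<^esub> \<phi> (\<tau> x) \<otimes>\<^bsub>op_algebra E\<^esub> \<phi> (\<tau> (S y))) l =
     sw (op_algebra E) (\<lambda>x y. \<phi> (\<tau> (h \<star> x)) \<otimes>\<^bsub>op_algebra E\<^esub> \<phi> (\<tau> (S y))) l"
    by (rule conv[OF cop_relations(2)[of l "\<tau> h"]]) (use h l in \<open>auto simp: tau_mult E.m_assoc\<close>)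
  show "sw (op_algebra E) (\<lambda>x y. \<phi> (\<tau> x) \<otimes>\<^bsub>op_algebra E\<^esub> \<phi> (\<tau> (S y)) \<otimes>\<^bsub>op_algebra E\<^esub> \<phi> (\<tau> l)) h =
     sw (op_algebra E) (\<lambda>x y. \<phi> (\<tau> x) \<otimes>\<^bsub>op_algebra E\<^esub> \<phi> (\<tau> (S y \<star> l))) h"
    by (rule conv[OF cop_relations(1)[of "\<tau> l" h]]) (use h l in \<open>auto simp: tau_mult E.m_assoc\<close>)
  show "sw (op_algebra E) (\<lambda>x y. \<phi> (\<tau> h) \<otimes>\<^bsub>op_algebra E\<^esub> \<phi> (\<tau> (S x)) \<otimes>\<^bsub>op_algebra E\<^esub> \<phi> (\<tau> y)) l =
     sw (op_algebra E) (\<lambda>x y. \<phi> (\<tau> (h \<star> S x)) \<otimes>\<^bsub>op_algebra E\<^esub> \<phi> (\<tau> y)) l"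
    by (rule conv[OF cop_relations(4)[of l "\<tau> h"]]) (use h l in \<open>auto simp: tau_mult E.m_assoc\<close>)
  show "sw (op_algebra E) (\<lambda>x y. \<phi> (\<tau> (S x)) \<otimes>\<^bsub>op_algebra E\<^esub> \<phi> (\<tau> y) \<otimes>\<^bsub>op_algebra E\<^esub> \<phi> (\<tau> l)) h =
     sw (op_algebra E) (\<lambda>x y. \<phi> (\<tau> (S x)) \<otimes>\<^bsub>op_algebra E\<^esub> \<phi> (\<tau> (y \<star> l))) h"
    by (rule conv[OF cop_relations(3)[of "\<tau> l" h]]) (use h l in \<open>auto simp: tau_mult E.m_assoc\<close>)
qed

definition A :: "'e set" where
  "A = \<Inter>{U. subring U E \<and> (\<forall>c\<in>carrier k. \<forall>x\<in>U. c \<odot>\<^bsub>E\<^esub> x \<in> U) \<and> e ` HC \<subseteq> U}"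

lemma A_subset: "A \<subseteq> carrier E"
proof -
  have "subring (carrier E) E" by (rule E.carrier_is_subring)
  then show ?thesis unfolding A_def by (intro Inter_lower) auto
qed

lemma A_carrier [simp, intro]: "a \<in> A \<Longrightarrow> a \<in> carrier E"
  using A_subset by auto

lemma A_closed [simp, intro]:
  "h \<in> HC \<Longrightarrow> e h \<in> A" "\<one>\<^bsub>E\<^esub> \<in> A" "\<zero>\<^bsub>E\<^esub> \<in> A" "a \<in> A \<Longrightarrow> b \<in> A \<Longrightarrow> a \<oplus>\<^bsub>E\<^esub> b \<in> A"
  "a \<in> A \<Longrightarrow> b \<in> A \<Longrightarrow> a \<cdot>\<cdot> b \<in> A" "c \<in> carrier k \<Longrightarrow> a \<in> A \<Longrightarrow> c \<odot>\<^bsub>E\<^esub> a \<in> A"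
  unfolding A_def by (auto dest: subringE)

lemma A_induct [consumes 1, case_names e one add mult smult]:
  assumes a: "a \<in> A"
    and P: "\<And>h. h \<in> HC \<Longrightarrow> P (e h)" "P \<one>\<^bsub>E\<^esub>" "\<And>a b. a \<in> A \<Longrightarrow> b \<in> A \<Longrightarrow> P a \<Longrightarrow> P b \<Longrightarrow> P (a \<oplus>\<^bsub>E\<^esub> b)"
      "\<And>a b. a \<in> A \<Longrightarrow> b \<in> A \<Longrightarrow> P a \<Longrightarrow> P b \<Longrightarrow> P (a \<cdot>\<cdot> b)"
      "\<And>c a. c \<in> carrier k \<Longrightarrow> a \<in> A \<Longrightarrow> P a \<Longrightarrow> P (c \<odot>\<^bsub>E\<^esub> a)"
  shows "P a"
proof -
  let ?U = "{a \<in> A. P a}"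
  have "subring ?U E"
  proof (rule E.subringI)
    fix h assume h: "h \<in> ?U"
    then have "\<ominus>\<^bsub>E\<^esub> h = (\<ominus>\<^bsub>k\<^esub> \<one>\<^bsub>k\<^esub>) \<odot>\<^bsub>E\<^esub> h" by (simp add: EM.smult_l_minus)
    then show "\<ominus>\<^bsub>E\<^esub> h \<in> ?U" using h P(5)[of "\<ominus>\<^bsub>k\<^esub> \<one>\<^bsub>k\<^esub>" h] A_closed(6)[of "\<ominus>\<^bsub>k\<^esub> \<one>\<^bsub>k\<^esub>" h] by simp
  qed (use P in auto)
  then have "A \<subseteq> ?U" unfolding A_def[of] by (intro Inter_lower) (use P in \<open>auto simp: A_def[symmetric]\<close>)
  then show ?thesis using a by auto
qed

abbreviation "EA \<equiv> E\<lparr>carrier := A\<rparr>"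

lemma EA_algebra: "k_algebra k EA"
proof -
  have "abelian_group EA"
  proof (rule abelian_groupI, goal_cases)
    case (6 a)
    have "(\<ominus>\<^bsub>k\<^esub> \<one>\<^bsub>k\<^esub>) \<odot>\<^bsub>E\<^esub> a \<oplus>\<^bsub>E\<^esub> a = \<zero>\<^bsub>E\<^esub>" using 6 by (simp add: EM.smult_l_minus EM.l_neg)
    then show ?case using 6 A_closed(6)[of "\<ominus>\<^bsub>k\<^esub> \<one>\<^bsub>k\<^esub>" a] by auto
  qed (auto simp: EM.a_ac)
  note ab = this
  have "module k EA"
    by (rule moduleI[OF k_cring ab]) (auto simp: EM.smult_l_distr EM.smult_r_distr EM.smult_assoc1)
  moreover have "ring EA" by (rule ringI[OF ab]) (auto intro!: monoidI simp: E.m_assoc E.l_distr E.r_distr)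
  ultimately show ?thesis by (auto simp: k_algebra_def k_algebraD[OF E_algebra])
qed

lemma sw_EA:
  assumes "h \<in> HC" "\<And>x y. x \<in> HC \<Longrightarrow> y \<in> HC \<Longrightarrow> f x y \<in> A"
  shows "sw EA f h = sw E f h" "sw E f h \<in> A"
proof -
  interpret EA: ring EA by (rule k_algebraD[OF EA_algebra])
  have "additive_on EA E (\<lambda>x. x)" by (rule additive_onI) auto
  from sw_additive[OF EA.is_abelian_group Eg this assms(1), of f] assms(2)
  show *: "sw EA f h = sw E f h" by simp
  show "sw E f h \<in> A" using sw_closed[OF EA.is_abelian_group assms(1), of f] assms(2) by (simp add: *)
qed

lemma e'_A_commute:
  assumes "a \<in> A" "h \<in> HC"
  shows "e' h \<cdot>\<cdot> a = a \<cdot>\<cdot> e' h"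
  using assms(1)
proof (induction a rule: A_induct)
  case (e l) then show ?case using assms by (simp add: e_e'_commute)
next
  case (mult a b) then show ?case using assms by (metis A_carrier E.m_assoc e'_closed)
next
  case (smult c a) then show ?case using assms by (simp add: k_algebraD[OF E_algebra])
qed (use assms in \<open>auto simp: E.l_distr E.r_distr\<close>)

text \<open>The adjoint action; on \<open>A\<close> it is the module structure of the unit object.\<close>

definition ad :: "'h \<Rightarrow> 'e \<Rightarrow> 'e" where
  "ad h a = sw E (\<lambda>x y. \<phi> x \<cdot>\<cdot> a \<cdot>\<cdot> \<phi> (S y)) h"

lemma ad_carrier [simp]: "h \<in> HC \<Longrightarrow> a \<in> carrier E \<Longrightarrow> ad h a \<in> carrier E"
  unfolding ad_def by (rule sw_closed[OF Eg]) auto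

lemma linear_ad: "linear_on k K H f \<Longrightarrow> a \<in> carrier E \<Longrightarrow> linear_on k K E (\<lambda>x. ad (f x) a)"
  unfolding ad_def by (auto intro!: elin)

lemma linear_ad_arg:
  assumes h: "h \<in> HC"
  shows "linear_on k E E (ad h)"
  unfolding ad_def
proof (rule sw_body_linear[OF Em h Em])
  show "linear_on k E E (\<lambda>x. \<phi> u \<cdot>\<cdot> x \<cdot>\<cdot> \<phi> (S v))" if "u \<in> HC" "v \<in> HC" for u v
    using that by (auto intro!: elin)
qed

lemma ad_one: "h \<in> HC \<Longrightarrow> ad h \<one>\<^bsub>E\<^esub> = e h"
  unfolding ad_def e_def by (rule sw_cong[OF Eg]) auto

lemma e'_S_reduce:
  assumes "w \<in> HC"
  shows "sw E (\<lambda>x y. e' (S x) \<cdot>\<cdot> \<phi> (S y)) w = \<phi> (S w)"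
proof -
  have "\<phi> (S w) = sw E (\<lambda>x y. e' y \<cdot>\<cdot> \<phi> (x \<star> unit)) (S w)"
    using e'_reduce[of "S w" unit] assms by (simp add: phi_unit)
  also have "\<dots> = sw E (\<lambda>x y. e' (S x) \<cdot>\<cdot> \<phi> (S y \<star> unit)) w"
    by (rule sw_antipode[OF Em]) (use assms in \<open>auto intro!: elin linear_e'\<close>)
  also have "\<dots> = sw E (\<lambda>x y. e' (S x) \<cdot>\<cdot> \<phi> (S y)) w"
    by (rule sw_cong[OF Eg]) (use assms in auto)
  finally show ?thesis by simp
qed

lemma phi_mult_e'_S:
  assumes h: "h \<in> HC" and l: "l \<in> HC"
  shows "sw E (\<lambda>u v. \<phi> (h \<star> u) \<cdot>\<cdot> e' (S v)) l = \<phi> h \<cdot>\<cdot> \<phi> l"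
proof -
  have "sw E (\<lambda>u v. \<phi> (h \<star> u) \<cdot>\<cdot> e' (S v)) l = sw E (\<lambda>u v. sw E (\<lambda>p q. \<phi> (h \<star> u) \<cdot>\<cdot> \<phi> (S p) \<cdot>\<cdot> \<phi> q) v) l"
    by (rule sw_cong[OF Eg l]) (use h in \<open>auto simp: e'_antipode sw_mult_left[OF E_algebra] E.m_assoc intro!: sw_closed Eg sw_cong[OF Eg]\<close>)
  also have "\<dots> = sw E (\<lambda>z q. sw E (\<lambda>u p. \<phi> (h \<star> u) \<cdot>\<cdot> \<phi> (S p) \<cdot>\<cdot> \<phi> q) z) l"
    by (rule sw_coassoc[OF Em l, symmetric]) (use h in \<open>auto intro!: elin\<close>)
  also have "\<dots> = sw E (\<lambda>z q. \<phi> h \<cdot>\<cdot> (e z \<cdot>\<cdot> \<phi> (q \<star> unit))) l"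
  proof (rule sw_cong[OF Eg l], goal_cases)
    case (2 z q)
    have "sw E (\<lambda>u p. \<phi> (h \<star> u) \<cdot>\<cdot> \<phi> (S p) \<cdot>\<cdot> \<phi> q) z = sw E (\<lambda>u p. \<phi> (h \<star> u) \<cdot>\<cdot> \<phi> (S p)) z \<cdot>\<cdot> \<phi> q"
      by (rule sw_mult_right[OF E_algebra, symmetric]) (use 2 h in auto)
    also have "\<dots> = \<phi> h \<cdot>\<cdot> (e z \<cdot>\<cdot> \<phi> q)" using 2 h by (simp add: mult_e[symmetric] E.m_assoc)
    finally show ?case using 2 by simp
  qed (use h in auto)
  also have "\<dots> = \<phi> h \<cdot>\<cdot> sw E (\<lambda>z q. e z \<cdot>\<cdot> \<phi> (q \<star> unit)) l"
    by (rule sw_mult_left[OF E_algebra, symmetric]) (use h l in auto)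
  also have "\<dots> = \<phi> h \<cdot>\<cdot> \<phi> l" using e_reduce[OF l] l by (simp add: phi_unit)
  finally show ?thesis .
qed

text \<open>Expanding \<open>ad\<close> produces \<open>\<phi>(S h\<^sub>2) \<phi> h\<^sub>3 = e'(S h\<^sub>2)\<close> behind \<open>a\<close>.  It commutes with \<open>a \<in> A\<close> and is then
  absorbed by \<open>\<phi> h\<^sub>1\<close>.\<close>

lemma phi_A:
  assumes h: "h \<in> HC" and a: "a \<in> A"
  shows "\<phi> h \<cdot>\<cdot> a = sw E (\<lambda>x y. ad x a \<cdot>\<cdot> \<phi> y) h"
proof -
  have ac: "a \<in> carrier E" using a by auto
  have "sw E (\<lambda>x y. ad x a \<cdot>\<cdot> \<phi> y) h = sw E (\<lambda>x y. sw E (\<lambda>u v. \<phi> u \<cdot>\<cdot> a \<cdot>\<cdot> (\<phi> (S v) \<cdot>\<cdot> \<phi> y)) x) h"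
    by (rule sw_cong[OF Eg h]) (use ac in \<open>auto simp: ad_def sw_mult_right[OF E_algebra] E.m_assoc intro!: sw_closed Eg sw_cong[OF Eg]\<close>)
  also have "\<dots> = sw E (\<lambda>u w. sw E (\<lambda>v y. \<phi> u \<cdot>\<cdot> a \<cdot>\<cdot> (\<phi> (S v) \<cdot>\<cdot> \<phi> y)) w) h"
    by (rule sw_coassoc[OF Em h]) (use ac in \<open>auto intro!: elin\<close>)
  also have "\<dots> = sw E (\<lambda>u w. \<phi> (unit \<star> u) \<cdot>\<cdot> e' (S w) \<cdot>\<cdot> a) h"
    by (rule sw_cong[OF Eg h]) (use a ac in \<open>auto simp: sw_mult_left[OF E_algebra, symmetric] e'_antipode[symmetric] E.m_assoc e'_A_commute\<close>)
  also have "\<dots> = sw E (\<lambda>u w. \<phi> (unit \<star> u) \<cdot>\<cdot> e' (S w)) h \<cdot>\<cdot> a"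
    by (rule sw_mult_right[OF E_algebra, symmetric]) (use h ac in auto)
  also have "\<dots> = \<phi> h \<cdot>\<cdot> a" using phi_mult_e'_S[of unit h] h by (simp add: phi_unit)
  finally show ?thesis by simp
qed

text \<open>Expand \<open>ad h\<^sub>2 b\<close>; then \<open>ad h\<^sub>1 a \<phi> h\<^sub>2 = \<phi> h\<^sub>1 a\<close> by \<open>phi_A\<close>.\<close>

lemma ad_mult:
  assumes h: "h \<in> HC" and a: "a \<in> A" and b: "b \<in> carrier E"
  shows "ad h (a \<cdot>\<cdot> b) = sw E (\<lambda>x y. ad x a \<cdot>\<cdot> ad y b) h"
proof -
  have ac: "a \<in> carrier E" using a by auto
  have "sw E (\<lambda>x y. ad x a \<cdot>\<cdot> ad y b) h = sw E (\<lambda>x y. sw E (\<lambda>p q. ad x a \<cdot>\<cdot> \<phi> p \<cdot>\<cdot> b \<cdot>\<cdot> \<phi> (S q)) y) h"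
    by (rule sw_cong[OF Eg h]) (use ac b in \<open>auto simp: ad_def[of _ b] sw_mult_left[OF E_algebra] E.m_assoc intro!: sw_closed Eg sw_cong[OF Eg]\<close>)
  also have "\<dots> = sw E (\<lambda>w q. sw E (\<lambda>x p. ad x a \<cdot>\<cdot> \<phi> p \<cdot>\<cdot> b \<cdot>\<cdot> \<phi> (S q)) w) h"
    by (rule sw_coassoc[OF Em h, symmetric]) (use ac b in \<open>auto intro!: elin linear_ad\<close>)
  also have "\<dots> = sw E (\<lambda>w q. \<phi> w \<cdot>\<cdot> (a \<cdot>\<cdot> b) \<cdot>\<cdot> \<phi> (S q)) h"
  proof (rule sw_cong[OF Eg h], goal_cases)
    case (2 w q)
    have "sw E (\<lambda>x p. ad x a \<cdot>\<cdot> \<phi> p \<cdot>\<cdot> b \<cdot>\<cdot> \<phi> (S q)) w = sw E (\<lambda>x p. ad x a \<cdot>\<cdot> \<phi> p \<cdot>\<cdot> (b \<cdot>\<cdot> \<phi> (S q))) w"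
      by (rule sw_cong[OF Eg]) (use 2 ac b in \<open>auto simp: E.m_assoc\<close>)
    also have "\<dots> = sw E (\<lambda>x p. ad x a \<cdot>\<cdot> \<phi> p) w \<cdot>\<cdot> (b \<cdot>\<cdot> \<phi> (S q))"
      by (rule sw_mult_right[OF E_algebra, symmetric]) (use 2 ac b in auto)
    finally show ?case using 2 a ac b by (simp add: phi_A[symmetric] E.m_assoc)
  qed (use ac b in auto)
  finally show ?thesis by (simp add: ad_def)
qed

text \<open>Write \<open>\<phi> p a\<close> as \<open>ad u a \<phi> v\<close> on both sides; what remains is \<open>e_mult\<close>.\<close>

lemma ad_phi:
  assumes l: "l \<in> HC" and a: "a \<in> A" and y: "y \<in> HC"
  shows "ad l a \<cdot>\<cdot> \<phi> y = sw E (\<lambda>p q. \<phi> p \<cdot>\<cdot> a \<cdot>\<cdot> \<phi> (S q \<star> y)) l"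
proof -
  have ac: "a \<in> carrier E" using a by auto
  have exp: "sw E (\<lambda>p q. \<phi> p \<cdot>\<cdot> a \<cdot>\<cdot> \<phi> (f q)) l = sw E (\<lambda>u w. sw E (\<lambda>v q. ad u a \<cdot>\<cdot> (\<phi> v \<cdot>\<cdot> \<phi> (f q))) w) l"
    if f: "linear_on k H H f" for f
  proof -
    have fc: "\<And>x. x \<in> HC \<Longrightarrow> f x \<in> HC" by (rule linear_on_closed[OF f])
    have "sw E (\<lambda>p q. \<phi> p \<cdot>\<cdot> a \<cdot>\<cdot> \<phi> (f q)) l = sw E (\<lambda>p q. sw E (\<lambda>u v. ad u a \<cdot>\<cdot> (\<phi> v \<cdot>\<cdot> \<phi> (f q))) p) l"
      by (rule sw_cong[OF Eg l]) (use a ac in \<open>auto simp: phi_A sw_mult_right[OF E_algebra] E.m_assoc fc intro!: sw_closed Eg sw_cong[OF Eg]\<close>)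
    also have "\<dots> = sw E (\<lambda>u w. sw E (\<lambda>v q. ad u a \<cdot>\<cdot> (\<phi> v \<cdot>\<cdot> \<phi> (f q))) w) l"
      by (rule sw_coassoc[OF Em l]) (use ac f in \<open>auto intro!: elin linear_ad simp: fc\<close>)
    finally show ?thesis .
  qed
  have "ad l a = sw E (\<lambda>u w. ad u a \<cdot>\<cdot> e w) l"
    unfolding ad_def[of l] exp[OF antipode_linear]
    by (rule sw_cong[OF Eg l]) (use ac in \<open>auto simp: e_def sw_mult_left[OF E_algebra] intro!: sw_closed Eg\<close>)
  then have "ad l a \<cdot>\<cdot> \<phi> y = sw E (\<lambda>u w. ad u a \<cdot>\<cdot> (e w \<cdot>\<cdot> \<phi> y)) l"
    using ac l y by (simp add: sw_mult_right[OF E_algebra]) (auto intro!: sw_cong[OF Eg] simp: E.m_assoc)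
  also have "\<dots> = sw E (\<lambda>u w. sw E (\<lambda>v q. ad u a \<cdot>\<cdot> (\<phi> v \<cdot>\<cdot> \<phi> (S q \<star> y))) w) l"
    by (rule sw_cong[OF Eg l]) (use ac y in \<open>auto simp: e_mult sw_mult_left[OF E_algebra] intro!: sw_closed Eg\<close>)
  also have "\<dots> = sw E (\<lambda>p q. \<phi> p \<cdot>\<cdot> a \<cdot>\<cdot> \<phi> (S q \<star> y)) l"
    by (rule exp[symmetric]) (use y in \<open>auto intro!: lin\<close>)
  finally show ?thesis .
qed

text \<open>By \<open>e_reduce\<close> and \<open>ad_phi\<close> the right-hand side becomes \<open>\<phi> h\<^sub>1 (ad l a) \<phi>(S h\<^sub>2)\<close>.\<close>

lemma ad_ad_left:
  assumes h: "h \<in> HC" and l: "l \<in> HC" and a: "a \<in> A"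
  shows "ad h (ad l a) = sw E (\<lambda>x y. ad x \<one>\<^bsub>E\<^esub> \<cdot>\<cdot> ad (y \<star> l) a) h"
proof -
  have ac: "a \<in> carrier E" using a by auto
  have "sw E (\<lambda>x y. ad x \<one>\<^bsub>E\<^esub> \<cdot>\<cdot> ad (y \<star> l) a) h = sw E (\<lambda>x y. sw E (\<lambda>y1 y2. sw E (\<lambda>l1 l2.
     e x \<cdot>\<cdot> \<phi> (y1 \<star> l1) \<cdot>\<cdot> (a \<cdot>\<cdot> \<phi> (S l2 \<star> S y2))) l) y) h"
  proof (rule sw_cong[OF Eg h], goal_cases)
    case (2 x y)
    have "ad (y \<star> l) a = sw E (\<lambda>y1 y2. sw E (\<lambda>l1 l2. \<phi> (y1 \<star> l1) \<cdot>\<cdot> a \<cdot>\<cdot> \<phi> (S (y2 \<star> l2))) l) y"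
      unfolding ad_def by (rule sw_comul_mult[OF Em]) (use 2 l ac in \<open>auto intro!: bilinear_onI elin\<close>)
    then have "ad x \<one>\<^bsub>E\<^esub> \<cdot>\<cdot> ad (y \<star> l) a = sw E (\<lambda>y1 y2. e x \<cdot>\<cdot> sw E (\<lambda>l1 l2. \<phi> (y1 \<star> l1) \<cdot>\<cdot> a \<cdot>\<cdot> \<phi> (S (y2 \<star> l2))) l) y"
      using 2 l ac by (simp add: ad_one sw_mult_left[OF E_algebra] sw_closed[OF Eg])
    also have "\<dots> = sw E (\<lambda>y1 y2. sw E (\<lambda>l1 l2. e x \<cdot>\<cdot> \<phi> (y1 \<star> l1) \<cdot>\<cdot> (a \<cdot>\<cdot> \<phi> (S l2 \<star> S y2))) l) y"
      by (rule sw_cong[OF Eg]) (use 2 l ac in \<open>auto simp: sw_mult_left[OF E_algebra] antipode_mult E.m_assoc intro!: sw_closed Eg sw_cong[OF Eg]\<close>)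
    finally show ?case .
  qed (use ac l in \<open>auto intro!: sw_closed Eg\<close>)
  also have "\<dots> = sw E (\<lambda>w y2. sw E (\<lambda>x y1. sw E (\<lambda>l1 l2. e x \<cdot>\<cdot> \<phi> (y1 \<star> l1) \<cdot>\<cdot> (a \<cdot>\<cdot> \<phi> (S l2 \<star> S y2))) l) w) h"
    by (rule sw_coassoc[OF Em h, symmetric]) (use ac l in \<open>auto intro!: elin linear_e\<close>)
  also have "\<dots> = sw E (\<lambda>w y2. sw E (\<lambda>l1 l2. \<phi> w \<cdot>\<cdot> \<phi> l1 \<cdot>\<cdot> (a \<cdot>\<cdot> \<phi> (S l2 \<star> S y2))) l) h"
  proof (rule sw_cong[OF Eg h], goal_cases)
    case (2 w y2)
    have "sw E (\<lambda>x y1. sw E (\<lambda>l1 l2. e x \<cdot>\<cdot> \<phi> (y1 \<star> l1) \<cdot>\<cdot> (a \<cdot>\<cdot> \<phi> (S l2 \<star> S y2))) l) w =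
      sw E (\<lambda>l1 l2. sw E (\<lambda>x y1. e x \<cdot>\<cdot> \<phi> (y1 \<star> l1) \<cdot>\<cdot> (a \<cdot>\<cdot> \<phi> (S l2 \<star> S y2))) w) l"
      by (rule sw_swap[OF Eg]) (use 2 ac l in auto)
    also have "\<dots> = sw E (\<lambda>l1 l2. \<phi> w \<cdot>\<cdot> \<phi> l1 \<cdot>\<cdot> (a \<cdot>\<cdot> \<phi> (S l2 \<star> S y2))) l"
      by (rule sw_cong[OF Eg l]) (use 2 ac in \<open>auto simp: sw_mult_right[OF E_algebra, symmetric] e_reduce\<close>)
    finally show ?case .
  qed (use ac l in \<open>auto intro!: sw_closed Eg\<close>)
  also have "\<dots> = sw E (\<lambda>w y2. \<phi> w \<cdot>\<cdot> ad l a \<cdot>\<cdot> \<phi> (S y2)) h"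
    by (rule sw_cong[OF Eg h]) (use ac a l in \<open>auto simp: E.m_assoc ad_phi sw_mult_left[OF E_algebra] intro!: sw_cong[OF Eg] sw_closed Eg\<close>)
  finally show ?thesis by (simp add: ad_def[of h])
qed

text \<open>The counterpart of \<open>ad_phi\<close> on the other side; here \<open>e'(S v)\<close> appears and commutes past \<open>a\<close>.\<close>

lemma phi_mult_ad:
  assumes h: "h \<in> HC" and l: "l \<in> HC" and a: "a \<in> A"
  shows "sw E (\<lambda>x y. \<phi> (h \<star> x) \<cdot>\<cdot> a \<cdot>\<cdot> \<phi> (S y)) l = \<phi> h \<cdot>\<cdot> ad l a"
proof -
  have ac: "a \<in> carrier E" using a by auto
  have "\<phi> h \<cdot>\<cdot> ad l a = sw E (\<lambda>x y. \<phi> h \<cdot>\<cdot> \<phi> x \<cdot>\<cdot> (a \<cdot>\<cdot> \<phi> (S y))) l"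
    unfolding ad_def by (subst sw_mult_left[OF E_algebra]) (use ac h l in \<open>auto simp: E.m_assoc intro!: sw_cong[OF Eg]\<close>)
  also have "\<dots> = sw E (\<lambda>x y. sw E (\<lambda>u v. \<phi> (h \<star> u) \<cdot>\<cdot> e' (S v) \<cdot>\<cdot> (a \<cdot>\<cdot> \<phi> (S y))) x) l"
    by (rule sw_cong[OF Eg l]) (use ac h in \<open>auto simp: phi_mult_e'_S[symmetric] sw_mult_right[OF E_algebra] intro!: sw_closed Eg\<close>)
  also have "\<dots> = sw E (\<lambda>u w. sw E (\<lambda>v y. \<phi> (h \<star> u) \<cdot>\<cdot> e' (S v) \<cdot>\<cdot> (a \<cdot>\<cdot> \<phi> (S y))) w) l"
    by (rule sw_coassoc[OF Em l]) (use ac h in \<open>auto intro!: elin linear_e'\<close>)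
  also have "\<dots> = sw E (\<lambda>u w. \<phi> (h \<star> u) \<cdot>\<cdot> a \<cdot>\<cdot> \<phi> (S w)) l"
  proof (rule sw_cong[OF Eg l], goal_cases)
    case (2 u w)
    have "sw E (\<lambda>v y. \<phi> (h \<star> u) \<cdot>\<cdot> e' (S v) \<cdot>\<cdot> (a \<cdot>\<cdot> \<phi> (S y))) w = sw E (\<lambda>v y. \<phi> (h \<star> u) \<cdot>\<cdot> a \<cdot>\<cdot> (e' (S v) \<cdot>\<cdot> \<phi> (S y))) w"
    proof (rule sw_cong[OF Eg 2(2)], goal_cases)
      case (2 v y)
      have "e' (S v) \<cdot>\<cdot> (a \<cdot>\<cdot> \<phi> (S y)) = a \<cdot>\<cdot> (e' (S v) \<cdot>\<cdot> \<phi> (S y))"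
        using 2 ac e'_A_commute[OF a, of "S v"] by (simp add: E.m_assoc[symmetric])
      then show ?case using 2 ac h \<open>u \<in> HC\<close> by (simp add: E.m_assoc)
    qed (use 2 ac h in auto)
    also have "\<dots> = \<phi> (h \<star> u) \<cdot>\<cdot> a \<cdot>\<cdot> \<phi> (S w)"
      using 2 ac h by (simp add: sw_mult_left[OF E_algebra, symmetric] e'_S_reduce)
    finally show ?case .
  qed (use ac h in auto)
  finally show ?thesis by simp
qed

lemma phi_S_e:
  assumes c: "c \<in> HC" and w: "w \<in> HC"
  shows "sw E (\<lambda>x y. \<phi> (c \<star> S x) \<cdot>\<cdot> e y) w = \<phi> c \<cdot>\<cdot> \<phi> (S w)"
proof -
  have "sw E (\<lambda>x y. \<phi> (c \<star> S x) \<cdot>\<cdot> e y) w = sw E (\<lambda>x y. sw E (\<lambda>p q. \<phi> (c \<star> S x) \<cdot>\<cdot> \<phi> p \<cdot>\<cdot> \<phi> (S q)) y) w"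
    by (rule sw_cong[OF Eg w]) (use c in \<open>auto simp: e_def sw_mult_left[OF E_algebra] E.m_assoc intro!: sw_closed Eg sw_cong[OF Eg]\<close>)
  also have "\<dots> = sw E (\<lambda>z q. sw E (\<lambda>x p. \<phi> (c \<star> S x) \<cdot>\<cdot> \<phi> p \<cdot>\<cdot> \<phi> (S q)) z) w"
    by (rule sw_coassoc[OF Em w, symmetric]) (use c in \<open>auto intro!: elin\<close>)
  also have "\<dots> = sw E (\<lambda>z q. \<phi> c \<cdot>\<cdot> (e' (S z) \<cdot>\<cdot> \<phi> (S q))) w"
  proof (rule sw_cong[OF Eg w], goal_cases)
    case (2 z q)
    have "sw E (\<lambda>x p. \<phi> (c \<star> S x) \<cdot>\<cdot> \<phi> p \<cdot>\<cdot> \<phi> (S q)) z = sw E (\<lambda>x p. \<phi> (c \<star> S x) \<cdot>\<cdot> \<phi> p) z \<cdot>\<cdot> \<phi> (S q)"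
      by (rule sw_mult_right[OF E_algebra, symmetric]) (use 2 c in auto)
    also have "sw E (\<lambda>x p. \<phi> (c \<star> S x) \<cdot>\<cdot> \<phi> p) z = sw E (\<lambda>x p. \<phi> c \<cdot>\<cdot> (\<phi> (S x) \<cdot>\<cdot> \<phi> p)) z"
      unfolding pr4[OF c 2(1), symmetric] by (rule sw_cong[OF Eg]) (use 2 c in \<open>auto simp: E.m_assoc\<close>)
    also have "\<dots> = \<phi> c \<cdot>\<cdot> e' (S z)" using 2 c by (simp add: sw_mult_left[OF E_algebra, symmetric] e'_antipode)
    finally show ?case using 2 c by (simp add: E.m_assoc)
  qed (use c in auto)
  also have "\<dots> = \<phi> c \<cdot>\<cdot> \<phi> (S w)"
    using c w by (simp add: sw_mult_left[OF E_algebra, symmetric] e'_S_reduce)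
  finally show ?thesis .
qed

text \<open>The counterpart of \<open>ad_ad_left\<close>, with \<open>phi_S_e\<close> and \<open>phi_mult_ad\<close> in the roles of \<open>e_reduce\<close> and \<open>ad_phi\<close>.\<close>

lemma ad_ad_right:
  assumes h: "h \<in> HC" and l: "l \<in> HC" and a: "a \<in> A"
  shows "ad h (ad l a) = sw E (\<lambda>x y. ad (x \<star> l) a \<cdot>\<cdot> ad y \<one>\<^bsub>E\<^esub>) h"
proof -
  have ac: "a \<in> carrier E" using a by auto
  have "sw E (\<lambda>x y. ad (x \<star> l) a \<cdot>\<cdot> ad y \<one>\<^bsub>E\<^esub>) h = sw E (\<lambda>x y. sw E (\<lambda>x1 x2. sw E (\<lambda>l1 l2.
     \<phi> (x1 \<star> l1) \<cdot>\<cdot> a \<cdot>\<cdot> (\<phi> (S l2 \<star> S x2) \<cdot>\<cdot> e y)) l) x) h"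
  proof (rule sw_cong[OF Eg h], goal_cases)
    case (2 x y)
    have "ad (x \<star> l) a = sw E (\<lambda>x1 x2. sw E (\<lambda>l1 l2. \<phi> (x1 \<star> l1) \<cdot>\<cdot> a \<cdot>\<cdot> \<phi> (S (x2 \<star> l2))) l) x"
      unfolding ad_def by (rule sw_comul_mult[OF Em]) (use 2 l ac in \<open>auto intro!: bilinear_onI elin\<close>)
    then have "ad (x \<star> l) a \<cdot>\<cdot> ad y \<one>\<^bsub>E\<^esub> = sw E (\<lambda>x1 x2. sw E (\<lambda>l1 l2. \<phi> (x1 \<star> l1) \<cdot>\<cdot> a \<cdot>\<cdot> \<phi> (S (x2 \<star> l2))) l \<cdot>\<cdot> e y) x"
      using 2 l ac by (simp add: ad_one sw_mult_right[OF E_algebra] sw_closed[OF Eg])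
    also have "\<dots> = sw E (\<lambda>x1 x2. sw E (\<lambda>l1 l2. \<phi> (x1 \<star> l1) \<cdot>\<cdot> a \<cdot>\<cdot> (\<phi> (S l2 \<star> S x2) \<cdot>\<cdot> e y)) l) x"
      by (rule sw_cong[OF Eg]) (use 2 l ac in \<open>auto simp: sw_mult_right[OF E_algebra] antipode_mult E.m_assoc intro!: sw_closed Eg sw_cong[OF Eg]\<close>)
    finally show ?case .
  qed (use ac l in \<open>auto intro!: sw_closed Eg\<close>)
  also have "\<dots> = sw E (\<lambda>x1 w. sw E (\<lambda>x2 y. sw E (\<lambda>l1 l2. \<phi> (x1 \<star> l1) \<cdot>\<cdot> a \<cdot>\<cdot> (\<phi> (S l2 \<star> S x2) \<cdot>\<cdot> e y)) l) w) h"
    by (rule sw_coassoc[OF Em h]) (use ac l in \<open>auto intro!: elin linear_e\<close>)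
  also have "\<dots> = sw E (\<lambda>x1 w. sw E (\<lambda>l1 l2. \<phi> (x1 \<star> l1) \<cdot>\<cdot> a \<cdot>\<cdot> \<phi> (S l2) \<cdot>\<cdot> \<phi> (S w)) l) h"
  proof (rule sw_cong[OF Eg h], goal_cases)
    case (2 x1 w)
    have "sw E (\<lambda>x2 y. sw E (\<lambda>l1 l2. \<phi> (x1 \<star> l1) \<cdot>\<cdot> a \<cdot>\<cdot> (\<phi> (S l2 \<star> S x2) \<cdot>\<cdot> e y)) l) w =
       sw E (\<lambda>l1 l2. sw E (\<lambda>x2 y. \<phi> (x1 \<star> l1) \<cdot>\<cdot> a \<cdot>\<cdot> (\<phi> (S l2 \<star> S x2) \<cdot>\<cdot> e y)) w) l"
      by (rule sw_swap[OF Eg]) (use 2 ac l in auto)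
    also have "\<dots> = sw E (\<lambda>l1 l2. \<phi> (x1 \<star> l1) \<cdot>\<cdot> a \<cdot>\<cdot> \<phi> (S l2) \<cdot>\<cdot> \<phi> (S w)) l"
      by (rule sw_cong[OF Eg l]) (use 2 ac in \<open>auto simp: sw_mult_left[OF E_algebra, symmetric] phi_S_e E.m_assoc\<close>)
    finally show ?case .
  qed (use ac l in \<open>auto intro!: sw_closed Eg\<close>)
  also have "\<dots> = sw E (\<lambda>x1 w. \<phi> x1 \<cdot>\<cdot> ad l a \<cdot>\<cdot> \<phi> (S w)) h"
    by (rule sw_cong[OF Eg h]) (use ac a l in \<open>auto simp: phi_mult_ad[symmetric] sw_mult_right[OF E_algebra, symmetric] intro!: sw_closed Eg\<close>)
  finally show ?thesis by (simp add: ad_def[of h])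
qed

text \<open>For \<open>a = e l\<close>, move \<open>e l\<close> to the left by \<open>e_commute\<close>.  In particular \<open>ad\<close> preserves the generators of \<open>A\<close> and
  hence, being multiplicative on \<open>A\<close>, the whole of \<open>A\<close>.\<close>

lemma ad_e:
  assumes h: "h \<in> HC" and l: "l \<in> HC"
  shows "ad h (e l) = sw E (\<lambda>u w. e (u \<star> l) \<cdot>\<cdot> e w) h"
proof -
  have "ad h (e l) = sw E (\<lambda>x y. sw E (\<lambda>u v. e (u \<star> l) \<cdot>\<cdot> (\<phi> v \<cdot>\<cdot> \<phi> (S y))) x) h"
    unfolding ad_def by (rule sw_cong[OF Eg h]) (use l in \<open>auto simp: e_commute sw_mult_right[OF E_algebra] E.m_assoc intro!: sw_closed Eg sw_cong[OF Eg]\<close>)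
  also have "\<dots> = sw E (\<lambda>u w. sw E (\<lambda>v y. e (u \<star> l) \<cdot>\<cdot> (\<phi> v \<cdot>\<cdot> \<phi> (S y))) w) h"
    by (rule sw_coassoc[OF Em h]) (use l in \<open>auto intro!: elin linear_e\<close>)
  also have "\<dots> = sw E (\<lambda>u w. e (u \<star> l) \<cdot>\<cdot> e w) h"
    by (rule sw_cong[OF Eg h]) (use l in \<open>auto simp: e_def[symmetric] sw_mult_left[OF E_algebra, symmetric]\<close>)
  finally show ?thesis .
qed

lemma ad_A:
  assumes "a \<in> A" "h \<in> HC"
  shows "ad h a \<in> A"
  using assms
proof (induction a arbitrary: h rule: A_induct)
  case (e l) then show ?case by (simp add: ad_e sw_EA(2))
next
  case one then show ?case by (simp add: ad_one)
next
  case (add a b) then show ?case by (simp add: linear_on_add[OF linear_ad_arg])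
next
  case (mult a b) then show ?case by (simp add: ad_mult sw_EA(2))
next
  case (smult c a) then show ?case by (simp add: linear_on_smult[OF linear_ad_arg])
qed

end

context hopf_bij
begin

lemma ad_partial_module_algebra: "partial_module_algebra k H HPr.EA HPr.ad"
  unfolding partial_module_algebra_def
proof (intro conjI ballI)
  show "k_algebra k HPr.EA" by (rule HPr.EA_algebra)
  show "linear_on k HPr.EA HPr.EA (HPr.ad h)" if "h \<in> HC" for h
    using that HPr.linear_ad_arg[OF that] by (auto simp: linear_on_def HPr.ad_A)
  show "linear_on k H HPr.EA (\<lambda>h. HPr.ad h a)" if "a \<in> carrier HPr.EA" for a
    using that HPr.linear_ad[OF linear_on_id, of a] by (auto simp: linear_on_def HPr.ad_A)
  show "HPr.ad unit a = a" if "a \<in> carrier HPr.EA" for a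
    using that unfolding HPr.ad_def by (subst sw_unit[OF HPr.Em]) (auto intro!: bilinear_onI HPr.elin simp: antipode_unit HPr.phi_unit)
  show "HPr.ad h (a \<otimes>\<^bsub>HPr.EA\<^esub> b) = sw HPr.EA (\<lambda>x y. HPr.ad x a \<otimes>\<^bsub>HPr.EA\<^esub> HPr.ad y b) h" if "h \<in> HC" "a \<in> carrier HPr.EA" "b \<in> carrier HPr.EA" for h a b
    using that by (subst HPr.sw_EA) (auto simp: HPr.ad_A HPr.ad_mult)
  show "HPr.ad h (HPr.ad l a) = sw HPr.EA (\<lambda>x y. HPr.ad x \<one>\<^bsub>HPr.EA\<^esub> \<otimes>\<^bsub>HPr.EA\<^esub> HPr.ad (y \<star> l) a) h" if "h \<in> HC" "l \<in> HC" "a \<in> carrier HPr.EA" for h l a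
    using that by (subst HPr.sw_EA) (auto simp: HPr.ad_A HPr.ad_ad_left)
  show "HPr.ad h (HPr.ad l a) = sw HPr.EA (\<lambda>x y. HPr.ad (x \<star> l) a \<otimes>\<^bsub>HPr.EA\<^esub> HPr.ad y \<one>\<^bsub>HPr.EA\<^esub>) h" if "h \<in> HC" "l \<in> HC" "a \<in> carrier HPr.EA" for h l a
    using that by (subst HPr.sw_EA) (auto simp: HPr.ad_A HPr.ad_ad_right)
qed

end

section \<open>Partial module algebras as partial modules\<close>

locale part_mod_alg = hopf_bij k H for k :: "'k ring" and H :: "('k, 'h) hopf" +
  fixes B :: "('k, 'b) module" and act :: "'h \<Rightarrow> 'b \<Rightarrow> 'b"
  assumes part_mod_alg: "partial_module_algebra k H B act"
begin

lemma B_algebra: "k_algebra k B"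
  and act_linear: "h \<in> HC \<Longrightarrow> linear_on k B B (act h)"
  and act_linear_arg: "a \<in> carrier B \<Longrightarrow> linear_on k H B (\<lambda>h. act h a)"
  and act_unit: "a \<in> carrier B \<Longrightarrow> act unit a = a"
  and act_mult: "h \<in> HC \<Longrightarrow> a \<in> carrier B \<Longrightarrow> b \<in> carrier B \<Longrightarrow>
    act h (a \<otimes>\<^bsub>B\<^esub> b) = sw B (\<lambda>x y. act x a \<otimes>\<^bsub>B\<^esub> act y b) h"
  and act_act_left: "h \<in> HC \<Longrightarrow> l \<in> HC \<Longrightarrow> a \<in> carrier B \<Longrightarrow>
    act h (act l a) = sw B (\<lambda>x y. act x \<one>\<^bsub>B\<^esub> \<otimes>\<^bsub>B\<^esub> act (y \<star> l) a) h"
  and act_act_right: "h \<in> HC \<Longrightarrow> l \<in> HC \<Longrightarrow> a \<in> carrier B \<Longrightarrow>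
    act h (act l a) = sw B (\<lambda>x y. act (x \<star> l) a \<otimes>\<^bsub>B\<^esub> act y \<one>\<^bsub>B\<^esub>) h"
  using part_mod_alg unfolding partial_module_algebra_def by blast+

sublocale Bm: module k B by (rule k_algebraD[OF B_algebra])
sublocale B: ring B by (rule k_algebraD[OF B_algebra])

abbreviation bmult (infixl "\<cdot>\<cdot>" 70) where "a \<cdot>\<cdot> b \<equiv> a \<otimes>\<^bsub>B\<^esub> b"
abbreviation "oneB \<equiv> \<one>\<^bsub>B\<^esub>"

lemmas Bg = B.is_abelian_group and Bmod = Bm.module_axioms

lemma act_closed [simp, intro]: "h \<in> HC \<Longrightarrow> a \<in> carrier B \<Longrightarrow> act h a \<in> carrier B"
  by (rule linear_on_closed[OF act_linear])

lemma lin_act: "h \<in> HC \<Longrightarrow> linear_on k K B f \<Longrightarrow> linear_on k K B (\<lambda>x. act h (f x))"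
  by (rule linear_on_comp[OF act_linear])

lemma lin_act_arg: "a \<in> carrier B \<Longrightarrow> linear_on k K H f \<Longrightarrow> linear_on k K B (\<lambda>x. act (f x) a)"
  by (rule linear_on_comp[OF act_linear_arg])

lemmas blin = lin linear_tau lin_act lin_act_arg linear_on_mult_left[OF B_algebra] linear_on_mult_right[OF B_algebra] Bmod

text \<open>Expand the inner action by the left axiom and cancel \<open>h\<^sub>2 S(h\<^sub>3)\<close>.  For \<open>l = 1\<close> this says that \<open>\<epsilon>\<^sub>h\<close> acts
  as left multiplication by \<open>h \<cdot> 1\<close>.\<close>

lemma act_act_S_mult:
  assumes h: "h \<in> HC" and l: "l \<in> HC" and a: "a \<in> carrier B"
  shows "sw B (\<lambda>x y. act x (act (S y \<star> l) a)) h = act h oneB \<cdot>\<cdot> act l a"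
proof -
  have "sw B (\<lambda>x y. act x (act (S y \<star> l) a)) h = sw B (\<lambda>x y. sw B (\<lambda>u v. act u oneB \<cdot>\<cdot> act ((v \<star> S y) \<star> l) a) x) h"
    by (rule sw_cong[OF Bg h]) (use l a in \<open>auto simp: act_act_left H.m_assoc intro!: sw_closed Bg sw_cong[OF Bg]\<close>)
  also have "\<dots> = act h oneB \<cdot>\<cdot> act (unit \<star> l) a"
    by (rule collapse_right_S'[OF Bmod h]) (use l a in \<open>auto intro!: blin\<close>)
  finally show ?thesis using l by simp
qed

lemma act_act_S:
  assumes h: "h \<in> HC" and a: "a \<in> carrier B"
  shows "sw B (\<lambda>x y. act x (act (S y) a)) h = act h oneB \<cdot>\<cdot> a"
proof -
  have "sw B (\<lambda>x y. act x (act (S y) a)) h = sw B (\<lambda>x y. act x (act (S y \<star> unit) a)) h"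
    by (rule sw_cong[OF Bg h]) (use a in auto)
  then show ?thesis using act_act_S_mult[OF h _ a, of unit] a by (simp add: act_unit)
qed

text \<open>The right axiom produces an extra factor \<open>h\<^sub>2 \<cdot> 1\<close>, which is absorbed by \<open>h\<^sub>3 \<cdot> a\<close>.\<close>

lemma act_mult_act:
  assumes h: "h \<in> HC" and l: "l \<in> HC" and a: "a \<in> carrier B"
  shows "act h (act l oneB \<cdot>\<cdot> a) = sw B (\<lambda>u v. act (u \<star> l) oneB \<cdot>\<cdot> act v a) h"
proof -
  have "act h (act l oneB \<cdot>\<cdot> a) = sw B (\<lambda>x y. act x (act l oneB) \<cdot>\<cdot> act y a) h"
    using assms by (simp add: act_mult)
  also have "\<dots> = sw B (\<lambda>x y. sw B (\<lambda>u v. act (u \<star> l) oneB \<cdot>\<cdot> (act v oneB \<cdot>\<cdot> act y a)) x) h"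
    by (rule sw_cong[OF Bg h]) (use l a in \<open>auto simp: act_act_right sw_mult_right[OF B_algebra] B.m_assoc intro!: sw_closed Bg sw_cong[OF Bg]\<close>)
  also have "\<dots> = sw B (\<lambda>u w. sw B (\<lambda>v y. act (u \<star> l) oneB \<cdot>\<cdot> (act v oneB \<cdot>\<cdot> act y a)) w) h"
    by (rule sw_coassoc[OF Bmod h]) (use l a in \<open>auto intro!: blin\<close>)
  also have "\<dots> = sw B (\<lambda>u v. act (u \<star> l) oneB \<cdot>\<cdot> act v a) h"
    by (rule sw_cong[OF Bg h]) (use l a in \<open>auto simp: sw_mult_left[OF B_algebra, symmetric] act_mult[symmetric]\<close>)
  finally show ?thesis .
qed

lemma act_rel2:
  assumes h: "h \<in> HC" and l: "l \<in> HC" and a: "a \<in> carrier B"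
  shows "sw B (\<lambda>x y. act h (act x (act (S y) a))) l = sw B (\<lambda>x y. act (h \<star> x) (act (S y) a)) l"
proof -
  have "sw B (\<lambda>x y. act (h \<star> x) (act (S y) a)) l =
    sw B (\<lambda>x y. sw B (\<lambda>u v. sw B (\<lambda>p q. act (u \<star> p) oneB \<cdot>\<cdot> act (v \<star> (q \<star> S y)) a) x) h) l"
  proof (rule sw_cong[OF Bg l], goal_cases)
    case (2 x y)
    have "act (h \<star> x) (act (S y) a) = sw B (\<lambda>u v. sw B (\<lambda>p q. act (u \<star> p) oneB \<cdot>\<cdot> act ((v \<star> q) \<star> S y) a) x) h"
      using 2 h a by (subst act_act_left) (auto intro!: sw_comul_mult[OF Bmod] bilinear_onI blin)
    also have "\<dots> = sw B (\<lambda>u v. sw B (\<lambda>p q. act (u \<star> p) oneB \<cdot>\<cdot> act (v \<star> (q \<star> S y)) a) x) h"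
      by (intro sw_cong[OF Bg] h) (use 2 a in \<open>auto simp: H.m_assoc intro!: sw_closed Bg\<close>)
    finally show ?case .
  qed (use h a in \<open>auto intro!: sw_closed Bg\<close>)
  also have "\<dots> = sw B (\<lambda>u v. sw B (\<lambda>x y. sw B (\<lambda>p q. act (u \<star> p) oneB \<cdot>\<cdot> act (v \<star> (q \<star> S y)) a) x) l) h"
    by (rule sw_swap[OF Bg l h]) (use a in \<open>auto intro!: sw_closed Bg\<close>)
  also have "\<dots> = sw B (\<lambda>u v. act (u \<star> l) oneB \<cdot>\<cdot> act v a) h"
  proof (rule sw_cong[OF Bg h], goal_cases)
    case (2 u v)
    have "sw B (\<lambda>x y. sw B (\<lambda>p q. act (u \<star> p) oneB \<cdot>\<cdot> act (v \<star> (q \<star> S y)) a) x) l = act (u \<star> l) oneB \<cdot>\<cdot> act (v \<star> unit) a"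
      by (rule collapse_right_S'[OF Bmod l, where F="\<lambda>p w. act (u \<star> p) oneB \<cdot>\<cdot> act (v \<star> w) a"]) (use 2 a in \<open>auto intro!: blin\<close>)
    then show ?case using 2 by simp
  qed (use l a in auto)
  also have "\<dots> = act h (sw B (\<lambda>x y. act x (act (S y) a)) l)"
    using assms by (simp add: act_act_S act_mult_act)
  also have "\<dots> = sw B (\<lambda>x y. act h (act x (act (S y) a))) l"
    by (rule sw_linear_apply[OF Bmod Bmod act_linear]) (use assms in auto)
  finally show ?thesis by simp
qed

lemma act_rel3:
  assumes h: "h \<in> HC" and l: "l \<in> HC" and a: "a \<in> carrier B"
  shows "sw B (\<lambda>x y. act x (act (S y) (act l a))) h = sw B (\<lambda>x y. act x (act (S y \<star> l) a)) h"
  using assms by (simp add: act_act_S_mult act_act_S)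

text \<open>The opposite comultiplication and the opposite multiplication together exchange the two axioms for
  \<open>h \<cdot> (l \<cdot> a)\<close>; this gives the two remaining relations of a partial representation.\<close>

lemma cop_pma: "part_mod_alg k cop (op_algebra B) act"
proof (intro part_mod_alg.intro cop_hopf_bij part_mod_alg_axioms.intro)
  have O: "module k (op_algebra B)" by (rule k_algebraD(1)[OF op_k_algebra[OF B_algebra]])
  have t: "sw (op_algebra B) f h = sw B f h" for f h by (rule sw_transfer) simp_all
  have L: "linear_on k K (op_algebra B) f = linear_on k K B f" for K :: "('k, 'x, 'y) module_scheme" and f
    by (simp add: linear_on_def)
  have c: "sweedler cop (op_algebra B) F h = sw B (\<lambda>x y. F y x) h" if "h \<in> HC"
    "\<And>y. y \<in> HC \<Longrightarrow> linear_on k H B (\<lambda>x. F x y)" "\<And>x. x \<in> HC \<Longrightarrow> linear_on k H B (\<lambda>y. F x y)" for F h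
    using sw_cop[OF O that(1), of F] that(2,3) by (simp add: L t)
  show "partial_module_algebra k cop (op_algebra B) act"
    unfolding partial_module_algebra_def
  proof (intro conjI ballI)
    show "k_algebra k (op_algebra B)" by (rule op_k_algebra[OF B_algebra])
    show "linear_on k (op_algebra B) (op_algebra B) (act h)" if "h \<in> carrier cop" for h
      using act_linear[of h] that by (simp add: linear_on_def)
    show "linear_on k cop (op_algebra B) (\<lambda>h. act h a)" if "a \<in> carrier (op_algebra B)" for a
      using act_linear_arg[of a] that by (simp add: L)
    show "act \<one>\<^bsub>cop\<^esub> a = a" if "a \<in> carrier (op_algebra B)" for a
      using act_unit that by simp
    fix h l a b assume "h \<in> carrier cop" "a \<in> carrier (op_algebra B)"
    then have h: "h \<in> HC" and a: "a \<in> carrier B" by auto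
    show "act h (a \<otimes>\<^bsub>op_algebra B\<^esub> b) = sweedler cop (op_algebra B) (\<lambda>x y. act x a \<otimes>\<^bsub>op_algebra B\<^esub> act y b) h"
      if "b \<in> carrier (op_algebra B)"
      using that h a by (subst c) (auto intro!: blin simp: act_mult)
    assume "l \<in> carrier cop"
    then have l: "l \<in> HC" by simp
    show "act h (act l a) = sweedler cop (op_algebra B) (\<lambda>x y. act x \<one>\<^bsub>op_algebra B\<^esub> \<otimes>\<^bsub>op_algebra B\<^esub> act (y \<otimes>\<^bsub>cop\<^esub> l) a) h"
      using h l a by (subst c) (auto intro!: blin simp: act_act_right)
    show "act h (act l a) = sweedler cop (op_algebra B) (\<lambda>x y. act (x \<otimes>\<^bsub>cop\<^esub> l) a \<otimes>\<^bsub>op_algebra B\<^esub> act y \<one>\<^bsub>op_algebra B\<^esub>) h"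
      using h l a by (subst c) (auto intro!: blin simp: act_act_left)
  qed
qed

lemma sw_cop_op:
  assumes "h \<in> HC" "\<And>y. y \<in> HC \<Longrightarrow> linear_on k H B (\<lambda>x. F x y)" "\<And>x. x \<in> HC \<Longrightarrow> linear_on k H B (\<lambda>y. F x y)"
  shows "sweedler cop (op_algebra B) F h = sw B (\<lambda>x y. F y x) h"
    "sweedler cop (op_algebra B) F h = sw B (\<lambda>x y. F (S x) (S y)) (\<tau> h)"
proof -
  have O: "module k (op_algebra B)" by (rule k_algebraD(1)[OF op_k_algebra[OF B_algebra]])
  have t: "sw (op_algebra B) f h = sw B f h" for f h by (rule sw_transfer) simp_all
  have L: "linear_on k K (op_algebra B) f = linear_on k K B f" for K :: "('k, 'x, 'y) module_scheme" and f
    by (simp add: linear_on_def)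
  show "sweedler cop (op_algebra B) F h = sw B (\<lambda>x y. F y x) h"
    using sw_cop[OF O assms(1), of F] assms(2,3) by (simp add: L t)
  show "sweedler cop (op_algebra B) F h = sw B (\<lambda>x y. F (S x) (S y)) (\<tau> h)"
    using sw_cop_tau[OF O assms(1), of F] assms(2,3) by (simp add: L t)
qed

lemma act_act_tau:
  assumes h: "h \<in> HC" and a: "a \<in> carrier B"
  shows "sw B (\<lambda>x y. act y (act (\<tau> x) a)) h = a \<cdot>\<cdot> act h oneB"
proof -
  have "sweedler cop (op_algebra B) (\<lambda>x y. act x (act (\<tau> y) a)) h = a \<cdot>\<cdot> act h oneB"
    using part_mod_alg.act_act_S[OF cop_pma, of h a] assms by simp
  then show ?thesis using assms by (subst (asm) sw_cop_op(1)) (auto intro!: blin)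
qed

lemma act_rel4:
  assumes h: "h \<in> HC" and l: "l \<in> HC" and a: "a \<in> carrier B"
  shows "sw B (\<lambda>x y. act h (act (S x) (act y a))) l = sw B (\<lambda>x y. act (h \<star> S x) (act y a)) l"
proof -
  have "sweedler cop (op_algebra B) (\<lambda>x y. act h (act x (act (\<tau> y) a))) (S l) = sweedler cop (op_algebra B) (\<lambda>x y. act (h \<star> x) (act (\<tau> y) a)) (S l)"
    using part_mod_alg.act_rel2[OF cop_pma, of h "S l" a] assms by simp
  then have "sw B (\<lambda>x y. act h (act (S x) (act (\<tau> (S y)) a))) l = sw B (\<lambda>x y. act (h \<star> S x) (act (\<tau> (S y)) a)) l"
    using assms by (simp add: sw_cop_op(2) blin)
  moreover have "sw B (\<lambda>x y. act h (act (S x) (act (\<tau> (S y)) a))) l = sw B (\<lambda>x y. act h (act (S x) (act y a))) l"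
    "sw B (\<lambda>x y. act (h \<star> S x) (act (\<tau> (S y)) a)) l = sw B (\<lambda>x y. act (h \<star> S x) (act y a)) l"
    by (rule sw_cong[OF Bg l], use assms in auto)+
  ultimately show ?thesis by simp
qed

lemma act_rel5:
  assumes h: "h \<in> HC" and l: "l \<in> HC" and a: "a \<in> carrier B"
  shows "sw B (\<lambda>x y. act (S x) (act y (act l a))) h = sw B (\<lambda>x y. act (S x) (act (y \<star> l) a)) h"
proof -
  have "sweedler cop (op_algebra B) (\<lambda>x y. act x (act (\<tau> y) (act l a))) (S h) = sweedler cop (op_algebra B) (\<lambda>x y. act x (act (\<tau> y \<star> l) a)) (S h)"
    using part_mod_alg.act_rel3[OF cop_pma, of "S h" l a] assms by simp
  then have "sw B (\<lambda>x y. act (S x) (act (\<tau> (S y)) (act l a))) h = sw B (\<lambda>x y. act (S x) (act (\<tau> (S y) \<star> l) a)) h"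
    using assms by (simp add: sw_cop_op(2) blin)
  moreover have "sw B (\<lambda>x y. act (S x) (act (\<tau> (S y)) (act l a))) h = sw B (\<lambda>x y. act (S x) (act y (act l a))) h"
    "sw B (\<lambda>x y. act (S x) (act (\<tau> (S y) \<star> l) a)) h = sw B (\<lambda>x y. act (S x) (act (y \<star> l) a)) h"
    by (rule sw_cong[OF Bg h], use assms in auto)+
  ultimately show ?thesis by simp
qed

sublocale pm: par_module k H B act
  by unfold_locales (auto intro: act_linear act_linear_arg act_unit act_rel2 act_rel3 act_rel4 act_rel5)

end

section \<open>The anti-algebra map on \<open>A\<close>\<close>

context hopf_bij
begin

abbreviation "AH \<equiv> HPr.A"
abbreviation "tm \<equiv> tmap k H"

lemma eps_eq: "eps k H = HPr.e"
  by (simp add: eps_def HPr.e_def[abs_def] fun_eq_iff)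

lemma Apar_eq: "Apar k H = AH"
  by (simp add: Apar_def HPr.A_def eps_eq)

text \<open>The extension of \<open>t\<close> to all of \<open>H\<^sub>p\<^sub>a\<^sub>r\<close> maps \<open>[h\<^sub>1][S(h\<^sub>2)]\<close> to \<open>[\<tau>(S h\<^sub>2)][\<tau> h\<^sub>1] = [h\<^sub>2][\<tau> h\<^sub>1]\<close>.\<close>

lemma tmap_exists:
  "\<exists>t. t \<in> extensional AH \<and> linear_on k (HP\<lparr>carrier := AH\<rparr>) HP t \<and> t \<one>\<^bsub>HP\<^esub> = \<one>\<^bsub>HP\<^esub> \<and>
     (\<forall>a\<in>AH. \<forall>b\<in>AH. t (a \<otimes>\<^bsub>HP\<^esub> b) = t b \<otimes>\<^bsub>HP\<^esub> t a) \<and> (\<forall>h\<in>HC. t (HPr.e h) = HPr.e' h)"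
proof -
  obtain t where t: "algebra_map k HP (op_algebra HP) t" and tc: "\<And>h. h \<in> HC \<Longrightarrow> t (cl h) = cl (\<tau> h)"
    using Hpar_universal[OF HPr.op_par_rep] by blast
  have tl: "linear_on k HP HP t" using algebra_mapD(1)[OF t] by (simp add: linear_on_def)
  have tm: "t (a \<otimes>\<^bsub>HP\<^esub> b) = t b \<otimes>\<^bsub>HP\<^esub> t a" if "a \<in> carrier HP" "b \<in> carrier HP" for a b
    using algebra_mapD(5)[OF t that] by simp
  have te: "t (HPr.e h) = HPr.e' h" if h: "h \<in> HC" for h
  proof -
    have "t (HPr.e h) = sw HP (\<lambda>x y. t (cl x \<otimes>\<^bsub>HP\<^esub> cl (S y))) h"
      unfolding HPr.e_def by (rule sw_linear_apply[OF HPr.Em HPr.Em tl h]) auto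
    also have "\<dots> = HPr.e' h"
      unfolding HPr.e'_def by (rule sw_cong[OF HPr.Eg h]) (auto simp: tm tc)
    finally show ?thesis .
  qed
  have "linear_on k (HP\<lparr>carrier := AH\<rparr>) HP (restrict t AH)"
    using tl by (auto simp: linear_on_def)
  then show ?thesis using tm te algebra_mapD(3)[OF t]
    by (intro exI[of _ "restrict t AH"]) auto
qed

lemma tmap_props:
  "linear_on k (HP\<lparr>carrier := AH\<rparr>) HP tm" "tm \<one>\<^bsub>HP\<^esub> = \<one>\<^bsub>HP\<^esub>"
  "\<And>a b. a \<in> AH \<Longrightarrow> b \<in> AH \<Longrightarrow> tm (a \<otimes>\<^bsub>HP\<^esub> b) = tm b \<otimes>\<^bsub>HP\<^esub> tm a" "\<And>h. h \<in> HC \<Longrightarrow> tm (HPr.e h) = HPr.e' h"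
proof -
  define P where "P = (\<lambda>t. t \<in> extensional AH \<and> linear_on k (HP\<lparr>carrier := AH\<rparr>) HP t \<and> t \<one>\<^bsub>HP\<^esub> = \<one>\<^bsub>HP\<^esub> \<and>
     (\<forall>a\<in>AH. \<forall>b\<in>AH. t (a \<otimes>\<^bsub>HP\<^esub> b) = t b \<otimes>\<^bsub>HP\<^esub> t a) \<and> (\<forall>h\<in>HC. t (HPr.e h) = HPr.e' h))"
  have tm: "tm = (THE t. P t)"
    unfolding tmap_def P_def eps_eq Apar_eq HPr.e'_def by simp
  obtain t where t: "P t" using tmap_exists unfolding P_def by blast
  have uniq: "s = t" if s: "P s" for s
  proof (rule extensionalityI[of s AH])
    have ls: "linear_on k (HP\<lparr>carrier := AH\<rparr>) HP s" and lt: "linear_on k (HP\<lparr>carrier := AH\<rparr>) HP t"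
      using s t by (auto simp: P_def)
    fix a assume "a \<in> AH"
    then show "s a = t a"
    proof (induction a rule: HPr.A_induct)
      case (add a b)
      then show ?case using linear_on_add[OF ls, of a b] linear_on_add[OF lt, of a b] by simp
    next
      case (smult c a)
      then show ?case using linear_on_smult[OF ls, of c a] linear_on_smult[OF lt, of c a] by simp
    qed (use s t in \<open>auto simp: P_def\<close>)
  qed (use s t in \<open>auto simp: P_def\<close>)
  have "P tm" unfolding tm by (rule theI[of P t, OF t uniq])
  then show "linear_on k (HP\<lparr>carrier := AH\<rparr>) HP tm" "tm \<one>\<^bsub>HP\<^esub> = \<one>\<^bsub>HP\<^esub>"
    "\<And>a b. a \<in> AH \<Longrightarrow> b \<in> AH \<Longrightarrow> tm (a \<otimes>\<^bsub>HP\<^esub> b) = tm b \<otimes>\<^bsub>HP\<^esub> tm a" "\<And>h. h \<in> HC \<Longrightarrow> tm (HPr.e h) = HPr.e' h"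
    by (auto simp: P_def)
qed

lemma tm_closed [simp, intro]: "a \<in> AH \<Longrightarrow> tm a \<in> carrier HP"
  using linear_on_closed[OF tmap_props(1)] by simp

lemma tm_add: "a \<in> AH \<Longrightarrow> b \<in> AH \<Longrightarrow> tm (a \<oplus>\<^bsub>HP\<^esub> b) = tm a \<oplus>\<^bsub>HP\<^esub> tm b"
  using linear_on_add[OF tmap_props(1)] by simp

lemma tm_smult: "c \<in> carrier k \<Longrightarrow> a \<in> AH \<Longrightarrow> tm (c \<odot>\<^bsub>HP\<^esub> a) = c \<odot>\<^bsub>HP\<^esub> tm a"
  using linear_on_smult[OF tmap_props(1)] by simp

lemma scalar_cls: "c \<in> carrier k \<Longrightarrow> c \<odot>\<^bsub>HP\<^esub> \<one>\<^bsub>HP\<^esub> = cl (c \<odot>\<^bsub>H\<^esub> unit)"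
  by (simp add: linear_on_smult[OF cls_linear] HPr.phi_unit)

lemma scalar_act:
  assumes M: "left_module HP M" and "c \<in> carrier k" "a \<in> carrier HP" "m \<in> carrier M"
  shows "(c \<odot>\<^bsub>HP\<^esub> a) \<odot>\<^bsub>M\<^esub> m = (c \<odot>\<^bsub>HP\<^esub> \<one>\<^bsub>HP\<^esub>) \<odot>\<^bsub>M\<^esub> (a \<odot>\<^bsub>M\<^esub> m)"
    "(c \<odot>\<^bsub>HP\<^esub> a) \<odot>\<^bsub>M\<^esub> m = a \<odot>\<^bsub>M\<^esub> ((c \<odot>\<^bsub>HP\<^esub> \<one>\<^bsub>HP\<^esub>) \<odot>\<^bsub>M\<^esub> m)"
proof -
  have "c \<odot>\<^bsub>HP\<^esub> a = (c \<odot>\<^bsub>HP\<^esub> \<one>\<^bsub>HP\<^esub>) \<otimes>\<^bsub>HP\<^esub> a" "c \<odot>\<^bsub>HP\<^esub> a = a \<otimes>\<^bsub>HP\<^esub> (c \<odot>\<^bsub>HP\<^esub> \<one>\<^bsub>HP\<^esub>)"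
    using assms by (simp_all add: k_algebraD[OF HP_algebra])
  then show "(c \<odot>\<^bsub>HP\<^esub> a) \<odot>\<^bsub>M\<^esub> m = (c \<odot>\<^bsub>HP\<^esub> \<one>\<^bsub>HP\<^esub>) \<odot>\<^bsub>M\<^esub> (a \<odot>\<^bsub>M\<^esub> m)"
    "(c \<odot>\<^bsub>HP\<^esub> a) \<odot>\<^bsub>M\<^esub> m = a \<odot>\<^bsub>M\<^esub> ((c \<odot>\<^bsub>HP\<^esub> \<one>\<^bsub>HP\<^esub>) \<odot>\<^bsub>M\<^esub> m)"
    using assms by (metis HPm.smult_closed HP.one_closed left_moduleD(6)[OF M])+
qed

text \<open>Additive maps that commute with the generators \<open>[h]\<close> commute with everything.\<close>

lemma Hpar_linear_onI:
  assumes M: "left_module HP M" and N: "left_module HP N" and f: "additive_on M N f"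
    and cls: "\<And>h x. h \<in> HC \<Longrightarrow> x \<in> carrier M \<Longrightarrow> f (cl h \<odot>\<^bsub>M\<^esub> x) = cl h \<odot>\<^bsub>N\<^esub> f x"
  shows "linear_on HP M N f"
proof (rule linear_onI)
  fix r x assume "r \<in> carrier HP" "x \<in> carrier M"
  then show "f (r \<odot>\<^bsub>M\<^esub> x) = r \<odot>\<^bsub>N\<^esub> f x"
  proof (induction r arbitrary: x rule: Hpar_induct)
    case (cls h) then show ?case using assms(4) by simp
  next
    case (add p q)
    then show ?case
      by (simp add: left_moduleD[OF M] left_moduleD[OF N] additive_on_add[OF f] additive_on_closed[OF f])
  next
    case (mult p q)
    then show ?case
      by (simp add: left_moduleD(3,6)[OF M] left_moduleD(3,6)[OF N] additive_on_closed[OF f])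
  qed
qed (use f in \<open>auto simp: additive_on_def\<close>)

end

context part_mod_alg
begin

definition "par_mod = induced_module k H B act"

lemma par_mod_simps [simp]: "carrier par_mod = carrier B" "add par_mod = add B" "\<zero>\<^bsub>par_mod\<^esub> = \<zero>\<^bsub>B\<^esub>" "mult par_mod = undefined" "\<one>\<^bsub>par_mod\<^esub> = undefined"
  and par_mod_module: "left_module HP par_mod" and par_mod_extensional: "extensional2 (carrier HP) (carrier B) (smult par_mod)"
  and par_mod_cls [simp]: "h \<in> HC \<Longrightarrow> b \<in> carrier B \<Longrightarrow> cl h \<odot>\<^bsub>par_mod\<^esub> b = act h b"
  using pm.induced_module[of B act] by (simp_all add: par_mod_def)

abbreviation hact (infixr "\<bullet>" 75) where "a \<bullet> b \<equiv> a \<odot>\<^bsub>par_mod\<^esub> b"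

lemma hact_closed [simp, intro]: "a \<in> carrier HP \<Longrightarrow> b \<in> carrier B \<Longrightarrow> a \<bullet> b \<in> carrier B"
  using left_moduleD(3)[OF par_mod_module] by simp

lemma hact_additive: "b \<in> carrier B \<Longrightarrow> additive_on HP B (\<lambda>a. a \<bullet> b)"
  using left_moduleD(4)[OF par_mod_module] by (intro additive_onI) auto

lemma hact_mult: "a \<in> carrier HP \<Longrightarrow> a' \<in> carrier HP \<Longrightarrow> b \<in> carrier B \<Longrightarrow> (a \<otimes>\<^bsub>HP\<^esub> a') \<bullet> b = a \<bullet> a' \<bullet> b"
  using left_moduleD(6)[OF par_mod_module] by simp

lemma hact_sw:
  assumes "h \<in> HC" "b \<in> carrier B" "\<And>x y. x \<in> HC \<Longrightarrow> y \<in> HC \<Longrightarrow> f x y \<in> carrier HP"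
  shows "sw HP f h \<bullet> b = sw B (\<lambda>x y. f x y \<bullet> b) h"
  by (rule sw_additive[OF HPr.Eg Bg hact_additive]) (use assms in auto)

lemma hact_scalar:
  assumes "c \<in> carrier k" "b \<in> carrier B"
  shows "(c \<odot>\<^bsub>HP\<^esub> \<one>\<^bsub>HP\<^esub>) \<bullet> b = c \<odot>\<^bsub>B\<^esub> b"
  using assms by (simp add: scalar_cls linear_on_smult[OF act_linear_arg] act_unit)

lemma hact_one: "b \<in> carrier B \<Longrightarrow> \<one>\<^bsub>HP\<^esub> \<bullet> b = b"
  using left_moduleD(7)[OF par_mod_module] by simp

lemma hact_e:
  assumes "h \<in> HC" "b \<in> carrier B"
  shows "HPr.e h \<bullet> b = act h oneB \<cdot>\<cdot> b"
proof -
  have "HPr.e h \<bullet> b = sw B (\<lambda>x y. (cl x \<otimes>\<^bsub>HP\<^esub> cl (S y)) \<bullet> b) h"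
    unfolding HPr.e_def by (rule hact_sw) (use assms in auto)
  also have "\<dots> = sw B (\<lambda>x y. act x (act (S y) b)) h"
    by (rule sw_cong[OF Bg]) (use assms in \<open>auto simp: hact_mult\<close>)
  finally show ?thesis using assms by (simp add: act_act_S)
qed

lemma hact_e':
  assumes "h \<in> HC" "b \<in> carrier B"
  shows "HPr.e' h \<bullet> b = b \<cdot>\<cdot> act h oneB"
proof -
  have "HPr.e' h \<bullet> b = sw B (\<lambda>x y. (cl y \<otimes>\<^bsub>HP\<^esub> cl (\<tau> x)) \<bullet> b) h"
    unfolding HPr.e'_def by (rule hact_sw) (use assms in auto)
  also have "\<dots> = sw B (\<lambda>x y. act y (act (\<tau> x) b)) h"
    by (rule sw_cong[OF Bg]) (use assms in \<open>auto simp: hact_mult\<close>)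
  finally show ?thesis using assms by (simp add: act_act_tau)
qed

lemma hact_smult: "c \<in> carrier k \<Longrightarrow> a \<in> carrier HP \<Longrightarrow> b \<in> carrier B \<Longrightarrow> (c \<odot>\<^bsub>HP\<^esub> a) \<bullet> b = c \<odot>\<^bsub>B\<^esub> (a \<bullet> b)"
  using scalar_act(1)[OF par_mod_module, of c a b] by (simp add: hact_scalar)

text \<open>Induction on \<open>a\<close>: the generators are \<open>act_act_S\<close>, and both sides are multiplicative in \<open>a\<close>.\<close>

lemma hact_A: "a \<in> AH \<Longrightarrow> b \<in> carrier B \<Longrightarrow> a \<bullet> b = (a \<bullet> oneB) \<cdot>\<cdot> b"
proof (induction a arbitrary: b rule: HPr.A_induct)
  case (e h) then show ?case by (simp add: hact_e)
next
  case one then show ?case by (simp add: hact_one)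
next
  case (add a a')
  have "a \<bullet> b = (a \<bullet> oneB) \<cdot>\<cdot> b" "a' \<bullet> b = (a' \<bullet> oneB) \<cdot>\<cdot> b" by (rule add.IH, rule add.prems)+
  then show ?case using add.hyps add.prems by (simp add: additive_on_add[OF hact_additive] B.l_distr)
next
  case (mult a a')
  have c: "a \<in> carrier HP" "a' \<in> carrier HP" "b \<in> carrier B" using mult.hyps mult.prems by auto
  have "(a \<otimes>\<^bsub>HP\<^esub> a') \<bullet> b = (a \<bullet> oneB) \<cdot>\<cdot> (a' \<bullet> b)"
    unfolding hact_mult[OF c] by (rule mult.IH(1)) (use c in simp)
  also have "a' \<bullet> b = (a' \<bullet> oneB) \<cdot>\<cdot> b" by (rule mult.IH(2)[OF c(3)])
  finally have "(a \<otimes>\<^bsub>HP\<^esub> a') \<bullet> b = (a \<bullet> oneB) \<cdot>\<cdot> ((a' \<bullet> oneB) \<cdot>\<cdot> b)" .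
  moreover have "(a \<otimes>\<^bsub>HP\<^esub> a') \<bullet> oneB = (a \<bullet> oneB) \<cdot>\<cdot> (a' \<bullet> oneB)"
    unfolding hact_mult[OF c(1,2) B.one_closed] by (rule mult.IH(1)) (use c in simp)
  ultimately show ?case using c by (simp add: B.m_assoc)
next
  case (smult c a)
  have "a \<bullet> b = (a \<bullet> oneB) \<cdot>\<cdot> b" by (rule smult.IH, rule smult.prems)
  then show ?case using smult.hyps smult.prems by (simp add: hact_smult k_algebraD[OF B_algebra])
qed

lemma hact_mult_one: "a \<in> AH \<Longrightarrow> a' \<in> AH \<Longrightarrow> (a \<otimes>\<^bsub>HP\<^esub> a') \<bullet> oneB = (a \<bullet> oneB) \<cdot>\<cdot> (a' \<bullet> oneB)"
  using hact_A[of a "a' \<bullet> oneB"] hact_mult[of a a' oneB] by simp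

lemma hact_t: "a \<in> AH \<Longrightarrow> b \<in> carrier B \<Longrightarrow> tm a \<bullet> b = b \<cdot>\<cdot> (a \<bullet> oneB)"
proof (induction a arbitrary: b rule: HPr.A_induct)
  case (e h) then show ?case by (simp add: hact_e hact_e' tmap_props(4))
next
  case one then show ?case by (simp add: hact_one tmap_props(2))
next
  case (add a a')
  then show ?case by (simp add: tm_add additive_on_add[OF hact_additive] B.r_distr)
next
  case (mult a a')
  then show ?case by (simp add: tmap_props(3) hact_mult_one) (simp add: hact_mult B.m_assoc)
next
  case (smult c a)
  then show ?case by (simp add: tm_smult hact_smult k_algebraD[OF B_algebra])
qed

end

section \<open>The diagonal action on tensor products over \<open>A\<close>\<close>

text \<open>The tensor product over \<open>A\<close> is first made a \<open>k\<close>-module, because the calculus of Sweedler sums needs linear maps into it;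
  it becomes a module over \<open>H\<^sub>p\<^sub>a\<^sub>r\<close> once the diagonal action is known to be a partial representation.\<close>

locale hpar_tensor = hopf_bij k H for k :: "'k ring" and H :: "('k, 'h) hopf" +
  fixes M :: "(('k, 'h) hpar, 'm) module" and N :: "(('k, 'h) hpar, 'n) module"
  assumes M: "left_module HP M" and N: "left_module HP N"
begin

abbreviation "Mk \<equiv> restrict_scalars HP M"
abbreviation "Nk \<equiv> restrict_scalars HP N"

abbreviation actM (infixr "\<bullet>" 75) where "a \<bullet> m \<equiv> a \<odot>\<^bsub>M\<^esub> m"
abbreviation actN (infixr "\<circ>\<circ>" 75) where "a \<circ>\<circ> n \<equiv> a \<odot>\<^bsub>N\<^esub> n"

lemma actM_closed [simp, intro]: "a \<in> carrier HP \<Longrightarrow> m \<in> carrier M \<Longrightarrow> a \<bullet> m \<in> carrier M"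
  by (rule left_moduleD(3)[OF M])

lemma actN_closed [simp, intro]: "a \<in> carrier HP \<Longrightarrow> n \<in> carrier N \<Longrightarrow> a \<circ>\<circ> n \<in> carrier N"
  by (rule left_moduleD(3)[OF N])

lemma mult_act: "a \<in> carrier HP \<Longrightarrow> b \<in> carrier HP \<Longrightarrow> m \<in> carrier M \<Longrightarrow> (a \<otimes>\<^bsub>HP\<^esub> b) \<bullet> m = a \<bullet> b \<bullet> m"
  "a \<in> carrier HP \<Longrightarrow> b \<in> carrier HP \<Longrightarrow> n \<in> carrier N \<Longrightarrow> (a \<otimes>\<^bsub>HP\<^esub> b) \<circ>\<circ> n = a \<circ>\<circ> b \<circ>\<circ> n"
  by (auto simp: left_moduleD(6)[OF M] left_moduleD(6)[OF N])

lemma one_act [simp]: "m \<in> carrier M \<Longrightarrow> \<one>\<^bsub>HP\<^esub> \<bullet> m = m" "n \<in> carrier N \<Longrightarrow> \<one>\<^bsub>HP\<^esub> \<circ>\<circ> n = n"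
  by (auto simp: left_moduleD(7)[OF M] left_moduleD(7)[OF N])

lemmas Mm = restrict_scalars_module[OF HP_algebra M] and Nm = restrict_scalars_module[OF HP_algebra N]

sublocale tp: tensor_scalars k AH Mk "right_act k H M" N "smult N"
proof (intro tensor_scalars.intro tensor_product.intro tensor_scalars_axioms.intro Mm)
  show "abelian_group Mk" using Mm by (simp add: module_def)
  show "abelian_group N" by (rule left_moduleD(2)[OF N])
  show "right_act k H M (c \<odot>\<^bsub>Mk\<^esub> x) a = c \<odot>\<^bsub>Mk\<^esub> right_act k H M x a" if "c \<in> carrier k" "x \<in> carrier Mk" "a \<in> AH" for c x a
    using scalar_act[OF M, of c "tm a" x] that by (simp add: right_act_def)
qed (auto simp: right_act_def)

abbreviation "G \<equiv> tensor_group (Apar k H) M (right_act k H M) N (smult N)"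
abbreviation \<beta> where "\<beta> \<equiv> pure_A k H M N"

lemma G_eq: "G = tp.T" and beta_eq: "\<beta> = tp.pure"
  by (simp_all add: Apar_eq pure_A_def tensor_transfer[of Mk M N N])

lemma G_simps: "carrier G = carrier tp.TT" "add G = add tp.TT" "\<zero>\<^bsub>G\<^esub> = \<zero>\<^bsub>tp.TT\<^esub>"
  by (simp_all add: G_eq tp.TT_simps)

lemmas Tm = tp.TT_module

lemma Tg: "abelian_group tp.TT"
  using Tm by (simp add: module_def)

lemma beta_closed [simp, intro]: "m \<in> carrier M \<Longrightarrow> n \<in> carrier N \<Longrightarrow> \<beta> m n \<in> carrier tp.TT"
  by (simp add: beta_eq tp.TT_simps)

lemma beta_balanced: "m \<in> carrier M \<Longrightarrow> n \<in> carrier N \<Longrightarrow> a \<in> AH \<Longrightarrow> \<beta> (tm a \<bullet> m) n = \<beta> m (a \<circ>\<circ> n)"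
  using tp.pure_balanced[of m a n] by (simp add: beta_eq right_act_def)

lemma beta_left: "n \<in> carrier N \<Longrightarrow> linear_on k Mk tp.TT (\<lambda>m. \<beta> m n)"
  unfolding beta_eq by (rule tp.pure_linear_left)

lemma beta_right:
  assumes m: "m \<in> carrier M"
  shows "linear_on k Nk tp.TT (\<lambda>n. \<beta> m n)"
proof (rule linear_onI)
  fix c n assume c: "c \<in> carrier k" and n: "n \<in> carrier Nk"
  have "\<beta> m ((c \<odot>\<^bsub>HP\<^esub> \<one>\<^bsub>HP\<^esub>) \<circ>\<circ> n) = \<beta> ((c \<odot>\<^bsub>HP\<^esub> \<one>\<^bsub>HP\<^esub>) \<bullet> m) n"
    using beta_balanced[of m n "c \<odot>\<^bsub>HP\<^esub> \<one>\<^bsub>HP\<^esub>"] m n c by (simp add: tm_smult tmap_props(2))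
  then show "\<beta> m (c \<odot>\<^bsub>Nk\<^esub> n) = c \<odot>\<^bsub>tp.TT\<^esub> \<beta> m n"
    using linear_on_smult[OF beta_left, of n c m] m n c by simp
qed (use m tp.pure_add_right in \<open>auto simp: beta_eq tp.TT_simps\<close>)

lemma lin_beta_left: "n \<in> carrier N \<Longrightarrow> linear_on k K Mk f \<Longrightarrow> linear_on k K tp.TT (\<lambda>x. \<beta> (f x) n)"
  by (rule linear_on_comp[OF beta_left])

lemma lin_beta_right: "m \<in> carrier M \<Longrightarrow> linear_on k K Nk f \<Longrightarrow> linear_on k K tp.TT (\<lambda>x. \<beta> m (f x))"
  by (rule linear_on_comp[OF beta_right])

lemmas tlin = HPr.elin linear_on_act_left[OF HP_algebra M] linear_on_act_left[OF HP_algebra N]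
  linear_on_act_right[OF HP_algebra M] linear_on_act_right[OF HP_algebra N] lin_beta_left lin_beta_right
  HPr.linear_e HPr.linear_e' Tm

text \<open>Both \<open>t(a)\<close> on the left and \<open>a\<close> on the right can be moved past the operators of the diagonal action: for a
  generator, \<open>[h\<^sub>1] t(\<epsilon>\<^sub>l) = t(\<epsilon>\<^bsub>h\<^sub>2 l\<^esub>) [h\<^sub>1]\<close> and \<open>\<epsilon>\<^bsub>h\<^sub>2 l\<^esub> [h\<^sub>3] = [h\<^sub>2] \<epsilon>\<^sub>l\<close>, so the common value is
  \<open>[h\<^sub>1] m \<otimes> \<epsilon>\<^bsub>h\<^sub>2 l\<^esub> [h\<^sub>3] n\<close>.\<close>

lemma diagonal_balanced:
  assumes h: "h \<in> HC" and a: "a \<in> AH"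
  shows "m \<in> carrier M \<Longrightarrow> n \<in> carrier N \<Longrightarrow>
    sw tp.TT (\<lambda>x y. \<beta> (cl x \<bullet> tm a \<bullet> m) (cl y \<circ>\<circ> n)) h = sw tp.TT (\<lambda>x y. \<beta> (cl x \<bullet> m) (cl y \<circ>\<circ> a \<circ>\<circ> n)) h"
  using a
proof (induction a arbitrary: m n rule: HPr.A_induct)
  case (e l)
  have "sw tp.TT (\<lambda>x y. \<beta> (cl x \<bullet> tm (HPr.e l) \<bullet> m) (cl y \<circ>\<circ> n)) h =
    sw tp.TT (\<lambda>x y. sw tp.TT (\<lambda>u v. \<beta> (cl u \<bullet> m) (HPr.e (v \<star> l) \<circ>\<circ> cl y \<circ>\<circ> n)) x) h"
  proof (rule sw_cong[OF Tg h], goal_cases)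
    case (2 x y)
    have "\<beta> (cl x \<bullet> tm (HPr.e l) \<bullet> m) (cl y \<circ>\<circ> n) = \<beta> ((cl x \<otimes>\<^bsub>HP\<^esub> HPr.e' l) \<bullet> m) (cl y \<circ>\<circ> n)"
      using 2 e by (simp add: tmap_props(4) mult_act)
    also have "\<dots> = \<beta> (sw HP (\<lambda>u v. HPr.e' (v \<star> l) \<otimes>\<^bsub>HP\<^esub> cl u) x \<bullet> m) (cl y \<circ>\<circ> n)"
      using 2 e by (simp add: HPr.e'_commute)
    also have "\<dots> = sw tp.TT (\<lambda>u v. \<beta> ((HPr.e' (v \<star> l) \<otimes>\<^bsub>HP\<^esub> cl u) \<bullet> m) (cl y \<circ>\<circ> n)) x"
      by (rule sw_linear_apply[OF HPr.Em Tm, where \<phi>="\<lambda>a. \<beta> (a \<bullet> m) (cl y \<circ>\<circ> n)"]) (use 2 e in \<open>auto intro!: tlin\<close>)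
    also have "\<dots> = sw tp.TT (\<lambda>u v. \<beta> (cl u \<bullet> m) (HPr.e (v \<star> l) \<circ>\<circ> cl y \<circ>\<circ> n)) x"
      by (rule sw_cong[OF Tg]) (use 2 e in \<open>auto simp: mult_act tmap_props(4)[symmetric] beta_balanced\<close>)
    finally show ?case .
  qed (use e in \<open>auto intro!: sw_closed Tg\<close>)
  also have "\<dots> = sw tp.TT (\<lambda>u w. sw tp.TT (\<lambda>v y. \<beta> (cl u \<bullet> m) (HPr.e (v \<star> l) \<circ>\<circ> cl y \<circ>\<circ> n)) w) h"
    by (rule sw_coassoc[OF Tm h]) (use e in \<open>auto intro!: tlin\<close>)
  also have "\<dots> = sw tp.TT (\<lambda>x y. \<beta> (cl x \<bullet> m) (cl y \<circ>\<circ> HPr.e l \<circ>\<circ> n)) h"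
  proof (rule sw_cong[OF Tg h], goal_cases)
    case (2 u w)
    have "\<beta> (cl u \<bullet> m) (cl w \<circ>\<circ> HPr.e l \<circ>\<circ> n) = \<beta> (cl u \<bullet> m) (sw HP (\<lambda>v y. HPr.e (v \<star> l) \<otimes>\<^bsub>HP\<^esub> cl y) w \<circ>\<circ> n)"
      using 2 e by (simp add: HPr.e_commute[symmetric] mult_act)
    also have "\<dots> = sw tp.TT (\<lambda>v y. \<beta> (cl u \<bullet> m) ((HPr.e (v \<star> l) \<otimes>\<^bsub>HP\<^esub> cl y) \<circ>\<circ> n)) w"
      by (rule sw_linear_apply[OF HPr.Em Tm, where \<phi>="\<lambda>a. \<beta> (cl u \<bullet> m) (a \<circ>\<circ> n)"]) (use 2 e in \<open>auto intro!: tlin\<close>)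
    also have "\<dots> = sw tp.TT (\<lambda>v y. \<beta> (cl u \<bullet> m) (HPr.e (v \<star> l) \<circ>\<circ> cl y \<circ>\<circ> n)) w"
      by (rule sw_cong[OF Tg]) (use 2 e in \<open>auto simp: mult_act\<close>)
    finally show ?case by simp
  qed (use e in auto)
  finally show ?case .
next
  case one
  then show ?case by (simp add: tmap_props(2))
next
  case (add a b)
  have "sw tp.TT (\<lambda>x y. \<beta> (cl x \<bullet> tm (a \<oplus>\<^bsub>HP\<^esub> b) \<bullet> m) (cl y \<circ>\<circ> n)) h =
    sw tp.TT (\<lambda>x y. \<beta> (cl x \<bullet> tm a \<bullet> m) (cl y \<circ>\<circ> n) \<oplus>\<^bsub>tp.TT\<^esub> \<beta> (cl x \<bullet> tm b \<bullet> m) (cl y \<circ>\<circ> n)) h"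
    by (rule sw_cong[OF Tg h])
      (use add in \<open>auto simp: tm_add left_moduleD[OF M] linear_on_add[OF beta_left, simplified] intro!: abelian_monoid.a_closed[OF abelian_group.axioms(1)[OF Tg]]\<close>)
  also have "\<dots> = sw tp.TT (\<lambda>x y. \<beta> (cl x \<bullet> tm a \<bullet> m) (cl y \<circ>\<circ> n)) h \<oplus>\<^bsub>tp.TT\<^esub> sw tp.TT (\<lambda>x y. \<beta> (cl x \<bullet> tm b \<bullet> m) (cl y \<circ>\<circ> n)) h"
    by (rule sw_add[OF Tg h]) (use add in auto)
  also have "\<dots> = sw tp.TT (\<lambda>x y. \<beta> (cl x \<bullet> m) (cl y \<circ>\<circ> a \<circ>\<circ> n)) h \<oplus>\<^bsub>tp.TT\<^esub> sw tp.TT (\<lambda>x y. \<beta> (cl x \<bullet> m) (cl y \<circ>\<circ> b \<circ>\<circ> n)) h"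
    using add by simp
  also have "\<dots> = sw tp.TT (\<lambda>x y. \<beta> (cl x \<bullet> m) (cl y \<circ>\<circ> a \<circ>\<circ> n) \<oplus>\<^bsub>tp.TT\<^esub> \<beta> (cl x \<bullet> m) (cl y \<circ>\<circ> b \<circ>\<circ> n)) h"
    by (rule sw_add[OF Tg h, symmetric]) (use add in auto)
  also have "\<dots> = sw tp.TT (\<lambda>x y. \<beta> (cl x \<bullet> m) (cl y \<circ>\<circ> (a \<oplus>\<^bsub>HP\<^esub> b) \<circ>\<circ> n)) h"
    by (rule sw_cong[OF Tg h])
      (use add in \<open>auto simp: left_moduleD[OF N] linear_on_add[OF beta_right, simplified] intro!: abelian_monoid.a_closed[OF abelian_group.axioms(1)[OF Tg]]\<close>)
  finally show ?case .
next
  case (mult a b)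
  have "sw tp.TT (\<lambda>x y. \<beta> (cl x \<bullet> tm (a \<otimes>\<^bsub>HP\<^esub> b) \<bullet> m) (cl y \<circ>\<circ> n)) h = sw tp.TT (\<lambda>x y. \<beta> (cl x \<bullet> tm b \<bullet> tm a \<bullet> m) (cl y \<circ>\<circ> n)) h"
    by (rule sw_cong[OF Tg h]) (use mult in \<open>auto simp: tmap_props(3) mult_act\<close>)
  also have "\<dots> = sw tp.TT (\<lambda>x y. \<beta> (cl x \<bullet> m) (cl y \<circ>\<circ> a \<circ>\<circ> b \<circ>\<circ> n)) h"
    using mult by simp
  also have "\<dots> = sw tp.TT (\<lambda>x y. \<beta> (cl x \<bullet> m) (cl y \<circ>\<circ> (a \<otimes>\<^bsub>HP\<^esub> b) \<circ>\<circ> n)) h"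
    by (rule sw_cong[OF Tg h]) (use mult in \<open>auto simp: mult_act\<close>)
  finally show ?case .
next
  case (smult c a)
  let ?c = "c \<odot>\<^bsub>HP\<^esub> \<one>\<^bsub>HP\<^esub>"
  have c: "?c \<in> AH" using smult.hyps by simp
  have "sw tp.TT (\<lambda>x y. \<beta> (cl x \<bullet> tm (c \<odot>\<^bsub>HP\<^esub> a) \<bullet> m) (cl y \<circ>\<circ> n)) h = sw tp.TT (\<lambda>x y. \<beta> (cl x \<bullet> tm a \<bullet> ?c \<bullet> m) (cl y \<circ>\<circ> n)) h"
    by (rule sw_cong[OF Tg h])
      (use smult.hyps smult.prems in \<open>auto simp: tm_smult scalar_act(2)[OF M, of c "tm a" m]\<close>)
  also have "\<dots> = sw tp.TT (\<lambda>x y. \<beta> (cl x \<bullet> ?c \<bullet> m) (cl y \<circ>\<circ> a \<circ>\<circ> n)) h"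
    using smult c by (simp add: HPr.A_carrier)
  also have "\<dots> = sw tp.TT (\<lambda>x y. \<beta> (cl x \<bullet> m) (cl y \<circ>\<circ> (c \<odot>\<^bsub>HP\<^esub> a) \<circ>\<circ> n)) h"
  proof (rule sw_cong[OF Tg h], goal_cases)
    case (2 x y)
    have 1: "cl x \<bullet> ?c \<bullet> m = tm ?c \<bullet> cl x \<bullet> m"
      using scalar_act[OF M, of c "cl x" m] 2 smult by (simp add: tm_smult tmap_props(2))
    have 3: "cl y \<circ>\<circ> (c \<odot>\<^bsub>HP\<^esub> a) \<circ>\<circ> n = ?c \<circ>\<circ> cl y \<circ>\<circ> a \<circ>\<circ> n"
      using scalar_act(1)[OF N, of c a n] scalar_act[OF N, of c "cl y" "a \<circ>\<circ> n"] 2 smult.hyps smult.prems by simp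
    show ?case unfolding 1 3 by (rule beta_balanced) (use 2 smult.hyps smult.prems c in auto)
  qed (use smult.hyps smult.prems in auto)
  finally show ?case .
qed

definition \<pi> :: "'h \<Rightarrow> ('m, 'n) tensor \<Rightarrow> ('m, 'n) tensor" where
  "\<pi> h = tensor_lift tp.TT (\<lambda>m n. sw tp.TT (\<lambda>x y. \<beta> (cl x \<bullet> m) (cl y \<circ>\<circ> n)) h)"

lemma diagonal_map_balanced:
  assumes h: "h \<in> HC"
  shows "tp.balanced tp.TT (\<lambda>m n. sw tp.TT (\<lambda>x y. \<beta> (cl x \<bullet> m) (cl y \<circ>\<circ> n)) h)"
    and "n \<in> carrier N \<Longrightarrow> linear_on k Mk tp.TT (\<lambda>m. sw tp.TT (\<lambda>x y. \<beta> (cl x \<bullet> m) (cl y \<circ>\<circ> n)) h)"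
proof -
  show l: "linear_on k Mk tp.TT (\<lambda>m. sw tp.TT (\<lambda>x y. \<beta> (cl x \<bullet> m) (cl y \<circ>\<circ> n)) h)" if "n \<in> carrier N" for n
    by (rule sw_body_linear[OF Tm h Mm]) (use that in \<open>auto intro!: tlin\<close>)
  have r: "linear_on k Nk tp.TT (\<lambda>n. sw tp.TT (\<lambda>x y. \<beta> (cl x \<bullet> m) (cl y \<circ>\<circ> n)) h)" if "m \<in> carrier M" for m
    by (rule sw_body_linear[OF Tm h Nm]) (use that in \<open>auto intro!: tlin\<close>)
  show "tp.balanced tp.TT (\<lambda>m n. sw tp.TT (\<lambda>x y. \<beta> (cl x \<bullet> m) (cl y \<circ>\<circ> n)) h)"
  proof (rule tp.balancedI)
    show "additive_on Mk tp.TT (\<lambda>m. sw tp.TT (\<lambda>x y. \<beta> (cl x \<bullet> m) (cl y \<circ>\<circ> n)) h)" if "n \<in> carrier N" for n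
      by (rule linear_on_additive[OF l[OF that]])
    show "additive_on N tp.TT (\<lambda>n. sw tp.TT (\<lambda>x y. \<beta> (cl x \<bullet> m) (cl y \<circ>\<circ> n)) h)" if "m \<in> carrier Mk" for m
      using linear_on_additive[OF r, of m] that by (simp add: additive_on_def)
    show "sw tp.TT (\<lambda>x y. \<beta> (cl x \<bullet> right_act k H M m a) (cl y \<circ>\<circ> n)) h = sw tp.TT (\<lambda>x y. \<beta> (cl x \<bullet> m) (cl y \<circ>\<circ> a \<circ>\<circ> n)) h"
      if "m \<in> carrier Mk" "a \<in> AH" "n \<in> carrier N" for m a n
      using diagonal_balanced[OF h] that by (simp add: right_act_def)
  qed
qed

lemma pi_beta:
  assumes "h \<in> HC" "m \<in> carrier M" "n \<in> carrier N"
  shows "\<pi> h (\<beta> m n) = sw tp.TT (\<lambda>x y. \<beta> (cl x \<bullet> m) (cl y \<circ>\<circ> n)) h"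
  using tp.tensor_lift_pure[OF Tg diagonal_map_balanced(1)[OF assms(1)], of m n] assms
  by (simp add: \<pi>_def beta_eq)

lemma pi_linear:
  assumes h: "h \<in> HC"
  shows "linear_on k tp.TT tp.TT (\<pi> h)"
  unfolding \<pi>_def by (rule tp.tensor_lift_scalar_linear[OF Tm diagonal_map_balanced[OF h]])

lemma TT_induct [consumes 1, case_names beta add]:
  assumes "X \<in> carrier tp.TT" "\<And>m n. m \<in> carrier M \<Longrightarrow> n \<in> carrier N \<Longrightarrow> P (\<beta> m n)"
    "\<And>X Y. X \<in> carrier tp.TT \<Longrightarrow> Y \<in> carrier tp.TT \<Longrightarrow> P X \<Longrightarrow> P Y \<Longrightarrow> P (X \<oplus>\<^bsub>tp.TT\<^esub> Y)"
  shows "P X"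
  using assms(1) unfolding tp.TT_simps(1)
  by (induction X rule: tp.tensor_induct) (use assms(2,3) in \<open>auto simp: beta_eq tp.TT_simps\<close>)

sublocale TT: module k tp.TT by (rule Tm)

lemma pi_linear_arg:
  assumes "X \<in> carrier tp.TT"
  shows "linear_on k H tp.TT (\<lambda>h. \<pi> h X)"
  using assms
proof (induction X rule: TT_induct)
  case (beta m n)
  have "linear_on k H tp.TT (\<lambda>h. sw tp.TT (\<lambda>x y. \<beta> (cl x \<bullet> m) (cl y \<circ>\<circ> n)) h)"
    using beta by (auto intro!: tlin)
  then show ?case
    by (rule linear_on_cong[OF _ _ HM.abelian_group_axioms]) (use beta in \<open>auto simp: pi_beta\<close>)
next
  case (add X Y)
  show ?case
    by (rule linear_onI)
      (use add in \<open>simp_all add: linear_on_add[OF pi_linear] linear_on_closed[OF pi_linear] linear_on_add[OF add.IH(1)]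
        linear_on_add[OF add.IH(2)] linear_on_smult[OF add.IH(1)] linear_on_smult[OF add.IH(2)] TT.a_ac TT.smult_r_distr\<close>)
qed

sublocale dg: diagonal k H HP cl M N tp.TT \<beta> \<pi>
proof (intro diagonal.intro diagonal_axioms.intro Hpar_par_rep M N Tm beta_left beta_right pi_linear pi_linear_arg pi_beta)
  show "\<beta> (HPr.e' h \<bullet> m) n = \<beta> m (HPr.e h \<circ>\<circ> n)" if "h \<in> HC" "m \<in> carrier M" "n \<in> carrier N" for h m n
    using beta_balanced[of m n "HPr.e h"] that by (simp add: tmap_props(4))
qed

text \<open>Relations between the operators need to be checked on pure tensors only.\<close>

lemma sw_eq_all:
  assumes "\<And>m n. m \<in> carrier M \<Longrightarrow> n \<in> carrier N \<Longrightarrow> sw tp.TT (f (\<beta> m n)) h = sw tp.TT (g (\<beta> m n)) h"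
    and "h \<in> HC" and X: "X \<in> carrier tp.TT"
    and f: "\<And>x y. x \<in> HC \<Longrightarrow> y \<in> HC \<Longrightarrow> linear_on k tp.TT tp.TT (\<lambda>X. f X x y)"
    and g: "\<And>x y. x \<in> HC \<Longrightarrow> y \<in> HC \<Longrightarrow> linear_on k tp.TT tp.TT (\<lambda>X. g X x y)"
  shows "sw tp.TT (f X) h = sw tp.TT (g X) h"
proof -
  have lf: "linear_on k tp.TT tp.TT (\<lambda>X. sw tp.TT (f X) h)" by (rule sw_body_linear[OF Tm assms(2) Tm f])
  have lg: "linear_on k tp.TT tp.TT (\<lambda>X. sw tp.TT (g X) h)" by (rule sw_body_linear[OF Tm assms(2) Tm g])
  show ?thesis using X
    by (induction X rule: TT_induct) (simp_all add: assms(1) linear_on_add[OF lf] linear_on_add[OF lg])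
qed

lemma lin_pi: "h \<in> HC \<Longrightarrow> linear_on k K tp.TT f \<Longrightarrow> linear_on k K tp.TT (\<lambda>x. \<pi> h (f x))"
  by (rule linear_on_comp[OF pi_linear])

lemma pi_unit: "X \<in> carrier tp.TT \<Longrightarrow> \<pi> unit X = X"
proof (induction X rule: TT_induct)
  case (beta m n)
  then show ?case
    by (simp add: pi_beta) (subst sw_unit[OF Tm], auto intro!: bilinear_onI tlin simp: HPr.phi_unit)
next
  case (add X Y) then show ?case by (simp add: linear_on_add[OF pi_linear])
qed

sublocale pm: par_module k H tp.TT \<pi>
proof (intro par_module.intro par_module_axioms.intro hopf_bij_axioms Tm pi_linear pi_linear_arg pi_unit)
  fix h l X assume h: "h \<in> HC" and l: "l \<in> HC" and X: "X \<in> carrier tp.TT"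
  show "sw tp.TT (\<lambda>x y. \<pi> h (\<pi> x (\<pi> (S y) X))) l = sw tp.TT (\<lambda>x y. \<pi> (h \<star> x) (\<pi> (S y) X)) l"
    by (rule sw_eq_all[where f="\<lambda>X. \<lambda>x y. \<pi> h (\<pi> x (\<pi> (S y) X))" and g="\<lambda>X. \<lambda>x y. \<pi> (h \<star> x) (\<pi> (S y) X)", OF dg.pi_rel2[OF h l] l X]) (use h l in \<open>auto intro!: lin_pi linear_on_id\<close>)
  show "sw tp.TT (\<lambda>x y. \<pi> x (\<pi> (S y) (\<pi> l X))) h = sw tp.TT (\<lambda>x y. \<pi> x (\<pi> (S y \<star> l) X)) h"
    by (rule sw_eq_all[where f="\<lambda>X. \<lambda>x y. \<pi> x (\<pi> (S y) (\<pi> l X))" and g="\<lambda>X. \<lambda>x y. \<pi> x (\<pi> (S y \<star> l) X)", OF dg.pi_rel3[OF h l] h X]) (use h l in \<open>auto intro!: lin_pi linear_on_id\<close>)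
  show "sw tp.TT (\<lambda>x y. \<pi> h (\<pi> (S x) (\<pi> y X))) l = sw tp.TT (\<lambda>x y. \<pi> (h \<star> S x) (\<pi> y X)) l"
    by (rule sw_eq_all[where f="\<lambda>X. \<lambda>x y. \<pi> h (\<pi> (S x) (\<pi> y X))" and g="\<lambda>X. \<lambda>x y. \<pi> (h \<star> S x) (\<pi> y X)", OF dg.pi_rel4[OF h l] l X]) (use h l in \<open>auto intro!: lin_pi linear_on_id\<close>)
  show "sw tp.TT (\<lambda>x y. \<pi> (S x) (\<pi> y (\<pi> l X))) h = sw tp.TT (\<lambda>x y. \<pi> (S x) (\<pi> (y \<star> l) X)) h"
    by (rule sw_eq_all[where f="\<lambda>X. \<lambda>x y. \<pi> (S x) (\<pi> y (\<pi> l X))" and g="\<lambda>X. \<lambda>x y. \<pi> (S x) (\<pi> (y \<star> l) X)", OF dg.pi_rel5[OF h l] h X]) (use h l in \<open>auto intro!: lin_pi linear_on_id\<close>)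
qed

abbreviation "TM \<equiv> tensor_A k H M N"

lemma pi_eq: "tensor_lift G (\<lambda>m n. sweedler H G (\<lambda>x y. \<beta> (cl x \<odot>\<^bsub>M\<^esub> m) (cl y \<odot>\<^bsub>N\<^esub> n)) h) X = \<pi> h X"
proof -
  have s: "sw G f h = sw tp.TT f h" for f h by (rule sw_transfer) (simp_all add: G_simps)
  show ?thesis unfolding \<pi>_def tensor_lift_eq_frag_eval s by (rule frag_eval_transfer) (simp_all add: G_simps)
qed

lemma TM_eq: "TM = induced_module k H G (\<lambda>h. tensor_lift G (\<lambda>m n. sweedler H G (\<lambda>x y. \<beta> (cl x \<odot>\<^bsub>M\<^esub> m) (cl y \<odot>\<^bsub>N\<^esub> n)) h))"
  by (simp add: tensor_A_def Let_def)

lemma TM_simps: "carrier TM = carrier tp.TT" "add TM = add tp.TT" "\<zero>\<^bsub>TM\<^esub> = \<zero>\<^bsub>tp.TT\<^esub>"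
  and TM_module: "left_module HP TM"
  and TM_cls: "h \<in> HC \<Longrightarrow> X \<in> carrier tp.TT \<Longrightarrow> cl h \<odot>\<^bsub>TM\<^esub> X = \<pi> h X"
  using pm.induced_module[of G "\<lambda>h. tensor_lift G (\<lambda>m n. sweedler H G (\<lambda>x y. \<beta> (cl x \<odot>\<^bsub>M\<^esub> m) (cl y \<odot>\<^bsub>N\<^esub> n)) h)"]
  unfolding TM_eq by (simp_all add: G_simps pi_eq)

end

section \<open>Tensor products over \<open>A\<close> and their universal property\<close>

context hpar_tensor
begin

lemma TM_induct [consumes 1, case_names pure add]:
  assumes "X \<in> carrier TM" "\<And>m n. m \<in> carrier M \<Longrightarrow> n \<in> carrier N \<Longrightarrow> P (\<beta> m n)"
    "\<And>X Y. X \<in> carrier TM \<Longrightarrow> Y \<in> carrier TM \<Longrightarrow> P X \<Longrightarrow> P Y \<Longrightarrow> P (X \<oplus>\<^bsub>TM\<^esub> Y)"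
  shows "P X"
  using assms(1) unfolding TM_simps
  by (induction X rule: TT_induct) (use assms(2,3) in \<open>auto simp: TM_simps\<close>)

lemma TM_beta:
  assumes "m \<in> carrier M" "n \<in> carrier N"
  shows "\<beta> m n \<in> carrier TM"
    "m' \<in> carrier M \<Longrightarrow> \<beta> (m \<oplus>\<^bsub>M\<^esub> m') n = \<beta> m n \<oplus>\<^bsub>TM\<^esub> \<beta> m' n"
    "n' \<in> carrier N \<Longrightarrow> \<beta> m (n \<oplus>\<^bsub>N\<^esub> n') = \<beta> m n \<oplus>\<^bsub>TM\<^esub> \<beta> m n'"
    "h \<in> HC \<Longrightarrow> cl h \<odot>\<^bsub>TM\<^esub> \<beta> m n = sw TM (\<lambda>x y. \<beta> (cl x \<odot>\<^bsub>M\<^esub> m) (cl y \<odot>\<^bsub>N\<^esub> n)) h"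
  using assms linear_on_add[OF beta_left, of n m m'] linear_on_add[OF beta_right, of m n n']
  by (simp_all add: TM_simps TM_cls pi_beta sw_transfer[of TM tp.TT])

lemma TM_scalar:
  assumes c: "c \<in> carrier k" and m: "m \<in> carrier M" and n: "n \<in> carrier N"
  shows "(c \<odot>\<^bsub>HP\<^esub> \<one>\<^bsub>HP\<^esub>) \<odot>\<^bsub>TM\<^esub> \<beta> m n = \<beta> ((c \<odot>\<^bsub>HP\<^esub> \<one>\<^bsub>HP\<^esub>) \<odot>\<^bsub>M\<^esub> m) n"
    "(c \<odot>\<^bsub>HP\<^esub> \<one>\<^bsub>HP\<^esub>) \<odot>\<^bsub>TM\<^esub> \<beta> m n = \<beta> m ((c \<odot>\<^bsub>HP\<^esub> \<one>\<^bsub>HP\<^esub>) \<odot>\<^bsub>N\<^esub> n)"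
proof -
  have "(c \<odot>\<^bsub>HP\<^esub> \<one>\<^bsub>HP\<^esub>) \<odot>\<^bsub>TM\<^esub> \<beta> m n = \<pi> (c \<odot>\<^bsub>H\<^esub> unit) (\<beta> m n)"
    using assms by (simp add: scalar_cls TM_cls)
  also have "\<dots> = c \<odot>\<^bsub>tp.TT\<^esub> \<beta> m n"
    using assms by (simp add: linear_on_smult[OF pi_linear_arg] pi_unit)
  finally have 1: "(c \<odot>\<^bsub>HP\<^esub> \<one>\<^bsub>HP\<^esub>) \<odot>\<^bsub>TM\<^esub> \<beta> m n = c \<odot>\<^bsub>tp.TT\<^esub> \<beta> m n" .
  show "(c \<odot>\<^bsub>HP\<^esub> \<one>\<^bsub>HP\<^esub>) \<odot>\<^bsub>TM\<^esub> \<beta> m n = \<beta> ((c \<odot>\<^bsub>HP\<^esub> \<one>\<^bsub>HP\<^esub>) \<odot>\<^bsub>M\<^esub> m) n"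
    using assms linear_on_smult[OF beta_left, of n c m] by (simp add: 1)
  show "(c \<odot>\<^bsub>HP\<^esub> \<one>\<^bsub>HP\<^esub>) \<odot>\<^bsub>TM\<^esub> \<beta> m n = \<beta> m ((c \<odot>\<^bsub>HP\<^esub> \<one>\<^bsub>HP\<^esub>) \<odot>\<^bsub>N\<^esub> n)"
    using assms linear_on_smult[OF beta_right, of m c n] by (simp add: 1)
qed

lemma TM_cls_cls:
  assumes "h \<in> HC" "X \<in> carrier TM" "\<And>x y. x \<in> HC \<Longrightarrow> y \<in> HC \<Longrightarrow> u x y \<in> HC \<and> v x y \<in> HC"
  shows "sw HP (\<lambda>x y. cl (u x y) \<otimes>\<^bsub>HP\<^esub> cl (v x y)) h \<odot>\<^bsub>TM\<^esub> X = sw tp.TT (\<lambda>x y. \<pi> (u x y) (\<pi> (v x y) X)) h"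
proof -
  have X: "X \<in> carrier tp.TT" using assms(2) by (simp add: TM_simps)
  have "additive_on HP tp.TT (\<lambda>a. a \<odot>\<^bsub>TM\<^esub> X)"
    using left_moduleD(3,4)[OF TM_module] X by (intro additive_onI) (simp_all add: TM_simps)
  from sw_additive[OF HPr.Eg Tg this assms(1), of "\<lambda>x y. cl (u x y) \<otimes>\<^bsub>HP\<^esub> cl (v x y)"] assms(3)
  have "sw HP (\<lambda>x y. cl (u x y) \<otimes>\<^bsub>HP\<^esub> cl (v x y)) h \<odot>\<^bsub>TM\<^esub> X =
    sw tp.TT (\<lambda>x y. (cl (u x y) \<otimes>\<^bsub>HP\<^esub> cl (v x y)) \<odot>\<^bsub>TM\<^esub> X) h" by simp
  also have "\<dots> = sw tp.TT (\<lambda>x y. \<pi> (u x y) (\<pi> (v x y) X)) h"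
  proof (rule sw_cong[OF Tg assms(1)])
    fix x y assume "x \<in> HC" "y \<in> HC"
    then have uv: "u x y \<in> HC" "v x y \<in> HC" using assms(3) by auto
    show "\<pi> (u x y) (\<pi> (v x y) X) \<in> carrier tp.TT" using uv X by (simp add: linear_on_closed[OF pi_linear])
    show "(cl (u x y) \<otimes>\<^bsub>HP\<^esub> cl (v x y)) \<odot>\<^bsub>TM\<^esub> X = \<pi> (u x y) (\<pi> (v x y) X)"
      using uv X by (simp add: left_moduleD(6)[OF TM_module] TM_simps TM_cls linear_on_closed[OF pi_linear])
  qed
  finally show ?thesis .
qed

text \<open>\<open>\<epsilon>\<^sub>h\<close> acts diagonally as \<open>[h\<^sub>1][S(h\<^sub>2)]\<close>, which \<open>pi_pi_S\<close> identifies as the action of \<open>\<epsilon>\<^sub>h\<close> on the left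
  factor.  This lemma and its mirror image make iterated tensor products over \<open>A\<close> associative.\<close>

lemma TM_A_left:
  assumes "a \<in> AH" "m \<in> carrier M" "n \<in> carrier N"
  shows "a \<odot>\<^bsub>TM\<^esub> \<beta> m n = \<beta> (a \<odot>\<^bsub>M\<^esub> m) n"
  using assms
proof (induction a arbitrary: m rule: HPr.A_induct)
  case (e h)
  then show ?case
    unfolding HPr.e_def by (subst TM_cls_cls) (simp_all add: TM_simps dg.pi_pi_S HPr.e_def[symmetric])
next
  case one then show ?case by (simp add: left_moduleD[OF TM_module] TM_beta)
next
  case (add a b)
  then show ?case by (simp add: left_moduleD(4)[OF TM_module] left_moduleD(4)[OF M] TM_beta)
next
  case (mult a b)
  then show ?case by (simp add: left_moduleD(6)[OF TM_module] TM_beta mult_act)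
next
  case (smult c a)
  have "a \<odot>\<^bsub>TM\<^esub> \<beta> m n = \<beta> (a \<odot>\<^bsub>M\<^esub> m) n" by (rule smult.IH, rule smult.prems, rule smult.prems)
  then show ?case using smult.hyps smult.prems scalar_act(1)[OF TM_module, of c a "\<beta> m n"] scalar_act(1)[OF M, of c a m]
    by (simp add: TM_beta TM_scalar(1))
qed

lemma TM_A_right:
  assumes "a \<in> AH" "m \<in> carrier M" "n \<in> carrier N"
  shows "tm a \<odot>\<^bsub>TM\<^esub> \<beta> m n = \<beta> m (tm a \<odot>\<^bsub>N\<^esub> n)"
  using assms
proof (induction a arbitrary: n rule: HPr.A_induct)
  case (e h)
  then show ?case
    unfolding tmap_props(4)[OF e(1)] HPr.e'_def
    by (subst TM_cls_cls) (simp_all add: TM_simps dg.pi_pi_tau HPr.e'_def[symmetric])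
next
  case one then show ?case by (simp add: tmap_props(2) left_moduleD[OF TM_module] TM_beta)
next
  case (add a b)
  then show ?case by (simp add: tm_add left_moduleD(4)[OF TM_module] left_moduleD(4)[OF N] TM_beta)
next
  case (mult a b)
  then show ?case by (simp add: tmap_props(3) left_moduleD(6)[OF TM_module] TM_beta mult_act)
next
  case (smult c a)
  have "tm a \<odot>\<^bsub>TM\<^esub> \<beta> m n = \<beta> m (tm a \<odot>\<^bsub>N\<^esub> n)" by (rule smult.IH, rule smult.prems, rule smult.prems)
  then show ?case using smult.hyps smult.prems scalar_act(1)[OF TM_module, of c "tm a" "\<beta> m n"] scalar_act(1)[OF N, of c "tm a" n]
    by (simp add: tm_smult TM_beta TM_scalar(2))
qed

definition A_balanced :: "('g, 's) ring_scheme \<Rightarrow> ('m \<Rightarrow> 'n \<Rightarrow> 'g) \<Rightarrow> bool" where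
  "A_balanced P f \<longleftrightarrow> (\<forall>n\<in>carrier N. additive_on M P (\<lambda>m. f m n)) \<and> (\<forall>m\<in>carrier M. additive_on N P (f m)) \<and>
     (\<forall>m\<in>carrier M. \<forall>a\<in>AH. \<forall>n\<in>carrier N. f (tm a \<odot>\<^bsub>M\<^esub> m) n = f m (a \<odot>\<^bsub>N\<^esub> n))"

lemma A_balancedI:
  assumes "\<And>n. n \<in> carrier N \<Longrightarrow> additive_on M P (\<lambda>m. f m n)" "\<And>m. m \<in> carrier M \<Longrightarrow> additive_on N P (f m)"
    "\<And>m a n. m \<in> carrier M \<Longrightarrow> a \<in> AH \<Longrightarrow> n \<in> carrier N \<Longrightarrow> f (tm a \<odot>\<^bsub>M\<^esub> m) n = f m (a \<odot>\<^bsub>N\<^esub> n)"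
  shows "A_balanced P f"
  using assms by (simp add: A_balanced_def)

lemma A_balanced_iff: "A_balanced P f \<longleftrightarrow> tp.balanced P f"
  by (simp add: A_balanced_def tp.balanced_def additive_on_def right_act_def)

lemma lift_beta: "abelian_group P \<Longrightarrow> A_balanced P f \<Longrightarrow> m \<in> carrier M \<Longrightarrow> n \<in> carrier N \<Longrightarrow> tensor_lift P f (\<beta> m n) = f m n"
  unfolding beta_eq by (rule tp.tensor_lift_pure) (simp_all add: A_balanced_iff)

lemma lift_additive: "abelian_group P \<Longrightarrow> A_balanced P f \<Longrightarrow> additive_on TM P (tensor_lift P f)"
  using tp.tensor_lift_additive[of P f] by (simp add: A_balanced_iff additive_on_def TM_simps tp.TT_simps)

lemma TM_additive_eqI:
  assumes f: "additive_on TM P f" and g: "additive_on TM P g" and "X \<in> carrier TM"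
    and "\<And>m n. m \<in> carrier M \<Longrightarrow> n \<in> carrier N \<Longrightarrow> f (\<beta> m n) = g (\<beta> m n)"
  shows "f X = g X"
  using assms(3) by (induction X rule: TM_induct) (simp_all add: assms(4) additive_on_add[OF f] additive_on_add[OF g])

lemma TM_abelian: "abelian_group TM"
  by (rule left_moduleD(2)[OF TM_module])

lemma TM_linearI:
  assumes P: "left_module HP P" and f: "additive_on TM P f"
    and pure: "\<And>h m n. h \<in> HC \<Longrightarrow> m \<in> carrier M \<Longrightarrow> n \<in> carrier N \<Longrightarrow>
      sw P (\<lambda>x y. f (\<beta> (cl x \<odot>\<^bsub>M\<^esub> m) (cl y \<odot>\<^bsub>N\<^esub> n))) h = cl h \<odot>\<^bsub>P\<^esub> f (\<beta> m n)"
  shows "linear_on HP TM P f"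
proof (rule Hpar_linear_onI[OF TM_module P f])
  fix h X assume h: "h \<in> HC" and X: "X \<in> carrier TM"
  have 1: "additive_on TM P (\<lambda>X. f (cl h \<odot>\<^bsub>TM\<^esub> X))" "additive_on TM P (\<lambda>X. cl h \<odot>\<^bsub>P\<^esub> f X)"
    using h by (auto intro!: additive_onI simp: left_moduleD[OF TM_module] left_moduleD[OF P] additive_on_add[OF f] additive_on_closed[OF f])
  show "f (cl h \<odot>\<^bsub>TM\<^esub> X) = cl h \<odot>\<^bsub>P\<^esub> f X"
  proof (rule TM_additive_eqI[OF 1 X])
    fix m n assume mn: "m \<in> carrier M" "n \<in> carrier N"
    show "f (cl h \<odot>\<^bsub>TM\<^esub> \<beta> m n) = cl h \<odot>\<^bsub>P\<^esub> f (\<beta> m n)"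
      unfolding pure[OF h mn, symmetric] TM_beta(4)[OF mn h]
      by (rule sw_additive[OF TM_abelian left_moduleD(2)[OF P] f h]) (use mn in \<open>simp add: TM_beta\<close>)
  qed
qed

end

section \<open>The coherence maps of the monoidal structure\<close>

context hopf_bij
begin

lemma hpar_tensorI: "left_module HP M \<Longrightarrow> left_module HP N \<Longrightarrow> hpar_tensor k H M N"
  by (intro hpar_tensor.intro hopf_bij_axioms hpar_tensor_axioms.intro)

lemma tensor_map_pure:
  assumes M: "left_module HP M" and N: "left_module HP N" and M': "left_module HP M'" and N': "left_module HP N'"
    and f: "linear_on HP M M' f" and g: "linear_on HP N N' g"
  shows "m \<in> carrier M \<Longrightarrow> n \<in> carrier N \<Longrightarrow>
      tensor_map k H M' N' f g (pure_A k H M N m n) = pure_A k H M' N' (f m) (g n)"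
    and "additive_on (tensor_A k H M N) (tensor_A k H M' N') (tensor_map k H M' N' f g)"
proof -
  note MN = hpar_tensorI[OF M N] and MN' = hpar_tensorI[OF M' N']
  note cl = linear_on_closed[OF f] linear_on_closed[OF g]
  have b: "hpar_tensor.A_balanced k H M N (tensor_A k H M' N') (\<lambda>m n. pure_A k H M' N' (f m) (g n))"
  proof (rule hpar_tensor.A_balancedI[OF MN])
    fix m a n assume "m \<in> carrier M" "a \<in> AH" "n \<in> carrier N"
    then show "pure_A k H M' N' (f (tm a \<odot>\<^bsub>M\<^esub> m)) (g n) = pure_A k H M' N' (f m) (g (a \<odot>\<^bsub>N\<^esub> n))"
      by (simp add: linear_on_smult[OF f] linear_on_smult[OF g] HPr.A_carrier cl hpar_tensor.beta_balanced[OF MN'])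
  qed (auto intro!: additive_onI simp: cl hpar_tensor.TM_beta[OF MN'] linear_on_add[OF f] linear_on_add[OF g])
  note ab = hpar_tensor.TM_abelian[OF MN']
  show "m \<in> carrier M \<Longrightarrow> n \<in> carrier N \<Longrightarrow> tensor_map k H M' N' f g (pure_A k H M N m n) = pure_A k H M' N' (f m) (g n)"
    unfolding tensor_map_def by (rule hpar_tensor.lift_beta[OF MN ab b])
  show "additive_on (tensor_A k H M N) (tensor_A k H M' N') (tensor_map k H M' N' f g)"
    unfolding tensor_map_def by (rule hpar_tensor.lift_additive[OF MN ab b])
qed

text \<open>The outer function is balanced because \<open>t(a)\<close> acts on \<open>M \<otimes>\<^sub>A N\<close> through \<open>N\<close>, the inner one because \<open>a\<close>
  acts on \<open>N \<otimes>\<^sub>A P\<close> through \<open>N\<close>.\<close>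

lemma associator_pure:
  assumes M: "left_module HP M" and N: "left_module HP N" and P: "left_module HP P"
  shows "m \<in> carrier M \<Longrightarrow> n \<in> carrier N \<Longrightarrow> p \<in> carrier P \<Longrightarrow>
      associator k H M N P (pure_A k H (tensor_A k H M N) P (pure_A k H M N m n) p) =
      pure_A k H M (tensor_A k H N P) m (pure_A k H N P n p)"
    and "additive_on (tensor_A k H (tensor_A k H M N) P) (tensor_A k H M (tensor_A k H N P)) (associator k H M N P)"
proof -
  let ?MN = "tensor_A k H M N" and ?NP = "tensor_A k H N P"
  let ?T = "tensor_A k H M ?NP"
  note MN = hpar_tensorI[OF M N] and NP = hpar_tensorI[OF N P]
  note M_NP = hpar_tensorI[OF M hpar_tensor.TM_module[OF NP]] and MN_P = hpar_tensorI[OF hpar_tensor.TM_module[OF MN] P]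
  note T = hpar_tensor.TM_abelian[OF M_NP]
  note pc = hpar_tensor.TM_beta[OF MN] hpar_tensor.TM_beta[OF NP] hpar_tensor.TM_beta[OF M_NP]
  define f where "f p = (\<lambda>m n. pure_A k H M ?NP m (pure_A k H N P n p))" for p
  define F where "F X p = tensor_lift ?T (f p) X" for X p
  have b: "hpar_tensor.A_balanced k H M N ?T (f p)" if "p \<in> carrier P" for p
  proof (rule hpar_tensor.A_balancedI[OF MN])
    fix m a n assume "m \<in> carrier M" "a \<in> AH" "n \<in> carrier N"
    then show "f p (tm a \<odot>\<^bsub>M\<^esub> m) n = f p m (a \<odot>\<^bsub>N\<^esub> n)"
      using that by (simp add: f_def hpar_tensor.beta_balanced[OF M_NP] hpar_tensor.TM_A_left[OF NP] pc(5))
  qed (use that in \<open>auto intro!: additive_onI simp: f_def pc\<close>)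
  note Fp = hpar_tensor.lift_beta[OF MN T b, folded F_def]
  have Fa: "additive_on ?MN ?T (\<lambda>X. F X p)" if "p \<in> carrier P" for p
    unfolding F_def by (rule hpar_tensor.lift_additive[OF MN T b[OF that]])
  have Fc: "F X p \<in> carrier ?T" if "X \<in> carrier ?MN" "p \<in> carrier P" for X p
    using additive_on_closed[OF Fa] that by simp
  interpret T: abelian_group ?T by (rule T)
  have B: "hpar_tensor.A_balanced k H ?MN P ?T F"
  proof (rule hpar_tensor.A_balancedI[OF MN_P])
    show "additive_on ?MN ?T (\<lambda>X. F X p)" if "p \<in> carrier P" for p
      using Fa[OF that] .
    show "additive_on P ?T (F X)" if X: "X \<in> carrier ?MN" for X
    proof (rule additive_onI)
      show "F X p \<in> carrier ?T" if "p \<in> carrier P" for p using Fc[OF X that] .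
      fix p q assume p: "p \<in> carrier P" and q: "q \<in> carrier P"
      interpret P: abelian_group P by (rule left_moduleD(2)[OF P])
      have pq: "p \<oplus>\<^bsub>P\<^esub> q \<in> carrier P" using p q by simp
      show "F X (p \<oplus>\<^bsub>P\<^esub> q) = F X p \<oplus>\<^bsub>?T\<^esub> F X q"
      proof (rule hpar_tensor.TM_additive_eqI[OF MN Fa[OF pq] _ X])
        show "additive_on ?MN ?T (\<lambda>X. F X p \<oplus>\<^bsub>?T\<^esub> F X q)"
          by (rule additive_onI) (simp_all add: Fc p q additive_on_add[OF Fa] T.a_ac)
        show "F (pure_A k H M N m n) (p \<oplus>\<^bsub>P\<^esub> q) = F (pure_A k H M N m n) p \<oplus>\<^bsub>?T\<^esub> F (pure_A k H M N m n) q"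
          if "m \<in> carrier M" "n \<in> carrier N" for m n
          using that p q pq by (simp add: Fp) (simp add: f_def pc)
      qed
    qed
    show "F (tm a \<odot>\<^bsub>?MN\<^esub> X) p = F X (a \<odot>\<^bsub>P\<^esub> p)" if X: "X \<in> carrier ?MN" and a: "a \<in> AH" and p: "p \<in> carrier P" for X a p
    proof -
      have ap: "a \<odot>\<^bsub>P\<^esub> p \<in> carrier P" using a p by (simp add: left_moduleD(3)[OF P] HPr.A_carrier)
      show ?thesis
      proof (rule hpar_tensor.TM_additive_eqI[OF MN _ Fa[OF ap] X])
        show "additive_on ?MN ?T (\<lambda>X. F (tm a \<odot>\<^bsub>?MN\<^esub> X) p)"
          by (rule additive_onI)
            (simp_all add: Fc p a left_moduleD[OF hpar_tensor.TM_module[OF MN]] additive_on_add[OF Fa])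
        show "F (tm a \<odot>\<^bsub>?MN\<^esub> pure_A k H M N m n) p = F (pure_A k H M N m n) (a \<odot>\<^bsub>P\<^esub> p)"
          if mn: "m \<in> carrier M" "n \<in> carrier N" for m n
        proof -
          have "tm a \<odot>\<^bsub>N\<^esub> n \<in> carrier N" using mn a by (simp add: left_moduleD(3)[OF N])
          then show ?thesis
            using mn p ap a by (simp add: Fp hpar_tensor.TM_A_right[OF MN]) (simp add: f_def hpar_tensor.beta_balanced[OF NP])
        qed
      qed
    qed
  qed
  have A: "associator k H M N P = tensor_lift ?T F"
    by (simp add: associator_def Let_def F_def[abs_def] f_def)
  show "m \<in> carrier M \<Longrightarrow> n \<in> carrier N \<Longrightarrow> p \<in> carrier P \<Longrightarrow>
      associator k H M N P (pure_A k H ?MN P (pure_A k H M N m n) p) = pure_A k H M ?NP m (pure_A k H N P n p)"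
    by (simp add: A hpar_tensor.lift_beta[OF MN_P T B] pc(1) Fp) (simp add: f_def)
  show "additive_on (tensor_A k H ?MN P) ?T (associator k H M N P)"
    unfolding A by (rule hpar_tensor.lift_additive[OF MN_P T B])
qed

abbreviation "UA \<equiv> unit_A k H"

lemma ad_pma: "part_mod_alg k H HPr.EA HPr.ad"
  by (intro part_mod_alg.intro hopf_bij_axioms part_mod_alg_axioms.intro ad_partial_module_algebra)

text \<open>The unit object is the partial module of the partial module algebra \<open>A\<close>; the actions of \<open>a\<close> and \<open>t(a)\<close>
  on it are then known to be the left and right multiplication by \<open>a\<close>.\<close>

lemma unit_A_eq: "UA = part_mod_alg.par_mod k H HPr.EA HPr.ad"
  unfolding part_mod_alg.par_mod_def[OF ad_pma] unit_A_def Apar_eq by (simp add: HPr.ad_def[abs_def])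

lemma UA_simps [simp]: "carrier UA = AH" "add UA = add HP"
  and UA_module: "left_module HP UA"
  and UA_cls: "h \<in> HC \<Longrightarrow> a \<in> AH \<Longrightarrow> cl h \<odot>\<^bsub>UA\<^esub> a = HPr.ad h a"
  using part_mod_alg.par_mod_simps[OF ad_pma] part_mod_alg.par_mod_module[OF ad_pma] part_mod_alg.par_mod_cls[OF ad_pma] unfolding unit_A_eq by simp_all

lemma UA_one: "a \<in> AH \<Longrightarrow> a \<odot>\<^bsub>UA\<^esub> \<one>\<^bsub>HP\<^esub> = a"
proof (induction a rule: HPr.A_induct)
  case (e h)
  show ?case using part_mod_alg.hact_e[OF ad_pma e, of "\<one>\<^bsub>HP\<^esub>"] e by (simp add: unit_A_eq HPr.ad_one)
next
  case one then show ?case by (simp add: left_moduleD(7)[OF UA_module])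
next
  case (add a b) then show ?case by (simp add: left_moduleD(4)[OF UA_module])
next
  case (mult a b) then show ?case using part_mod_alg.hact_mult_one[OF ad_pma, of a b] by (simp add: unit_A_eq)
next
  case (smult c a) then show ?case using part_mod_alg.hact_smult[OF ad_pma, of c a "\<one>\<^bsub>HP\<^esub>"] by (simp add: unit_A_eq)
qed

lemma UA_act:
  assumes "a \<in> AH" "b \<in> AH"
  shows "a \<odot>\<^bsub>UA\<^esub> b = a \<otimes>\<^bsub>HP\<^esub> b" "tm a \<odot>\<^bsub>UA\<^esub> b = b \<otimes>\<^bsub>HP\<^esub> a"
  using part_mod_alg.hact_A[OF ad_pma, of a b] part_mod_alg.hact_t[OF ad_pma, of a b] UA_one[of a] assms by (simp_all add: unit_A_eq)

section \<open>Algebra objects in terms of elements\<close>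

lemma left_unitor_pure:
  assumes M: "left_module HP M"
  shows "a \<in> AH \<Longrightarrow> m \<in> carrier M \<Longrightarrow> left_unitor M (pure_A k H UA M a m) = a \<odot>\<^bsub>M\<^esub> m"
    "additive_on (tensor_A k H UA M) M (left_unitor M)"
proof -
  note UM = hpar_tensorI[OF UA_module M] and ab = left_moduleD(2)[OF M]
  have b: "hpar_tensor.A_balanced k H UA M M (\<lambda>a m. a \<odot>\<^bsub>M\<^esub> m)"
    by (rule hpar_tensor.A_balancedI[OF UM]) (auto intro!: additive_onI simp: left_moduleD[OF M] UA_act)
  show "a \<in> AH \<Longrightarrow> m \<in> carrier M \<Longrightarrow> left_unitor M (pure_A k H UA M a m) = a \<odot>\<^bsub>M\<^esub> m"
    unfolding left_unitor_def by (rule hpar_tensor.lift_beta[OF UM ab b]) simp_all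
  show "additive_on (tensor_A k H UA M) M (left_unitor M)"
    unfolding left_unitor_def by (rule hpar_tensor.lift_additive[OF UM ab b])
qed

lemma right_unitor_pure:
  assumes M: "left_module HP M"
  shows "a \<in> AH \<Longrightarrow> m \<in> carrier M \<Longrightarrow> right_unitor k H M (pure_A k H M UA m a) = tm a \<odot>\<^bsub>M\<^esub> m"
    "additive_on (tensor_A k H M UA) M (right_unitor k H M)"
proof -
  note MU = hpar_tensorI[OF M UA_module] and ab = left_moduleD(2)[OF M]
  have b: "hpar_tensor.A_balanced k H M UA M (\<lambda>m a. right_act k H M m a)"
    by (rule hpar_tensor.A_balancedI[OF MU])
      (auto intro!: additive_onI simp: right_act_def left_moduleD[OF M] UA_act tm_add tmap_props(3))
  show "a \<in> AH \<Longrightarrow> m \<in> carrier M \<Longrightarrow> right_unitor k H M (pure_A k H M UA m a) = tm a \<odot>\<^bsub>M\<^esub> m"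
    unfolding right_unitor_def by (subst hpar_tensor.lift_beta[OF MU ab b]) (simp_all add: right_act_def)
  show "additive_on (tensor_A k H M UA) M (right_unitor k H M)"
    unfolding right_unitor_def by (rule hpar_tensor.lift_additive[OF MU ab b])
qed

text \<open>Both sides of each diagram are additive, so it suffices to evaluate them on pure tensors.\<close>

lemma algebra_object_iff:
  assumes B: "left_module HP B"
    and mu: "\<mu> \<in> par_hom k H (tensor_A k H B B) B" and eta: "\<eta> \<in> par_hom k H UA B"
  shows "algebra_object k H B \<mu> \<eta> \<longleftrightarrow>
     (\<forall>a\<in>carrier B. \<forall>b\<in>carrier B. \<forall>c\<in>carrier B. \<mu> (pure_A k H B B (\<mu> (pure_A k H B B a b)) c) =
        \<mu> (pure_A k H B B a (\<mu> (pure_A k H B B b c)))) \<and>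
     (\<forall>a\<in>AH. \<forall>b\<in>carrier B. \<mu> (pure_A k H B B (\<eta> a) b) = a \<odot>\<^bsub>B\<^esub> b \<and> \<mu> (pure_A k H B B b (\<eta> a)) = tm a \<odot>\<^bsub>B\<^esub> b)"
    (is "_ \<longleftrightarrow> ?R")
proof -
  let ?BB = "tensor_A k H B B"
  have ml: "linear_on HP ?BB B \<mu>" and el: "linear_on HP UA B \<eta>" using mu eta by (auto simp: par_hom_def)
  have id: "linear_on HP B B (\<lambda>b. b)" by (rule linear_on_id)
  note BB = hpar_tensorI[OF B B]
  note BBm = hpar_tensor.TM_module[OF BB]
  note ma = linear_on_additive[OF ml]
  note pc = hpar_tensor.TM_beta(1)[OF BB]
  note T1 = tensor_map_pure[OF BBm B B B ml id] and T2 = tensor_map_pure[OF B BBm B B id ml]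
    and TL = tensor_map_pure[OF UA_module B B B el id] and TR = tensor_map_pure[OF B UA_module B B id el]
  note as = associator_pure[OF B B B]
  have ec: "\<eta> a \<in> carrier B" if "a \<in> AH" for a using linear_on_closed[OF el] that by simp
  note simps = T1(1) T2(1) TL(1) TR(1) as(1) pc ec left_unitor_pure(1)[OF B] right_unitor_pure(1)[OF B]
  show ?thesis
  proof
    assume ao: "algebra_object k H B \<mu> \<eta>"
    show ?R
    proof (intro conjI ballI)
      fix a b c assume abc: "a \<in> carrier B" "b \<in> carrier B" "c \<in> carrier B"
      have "pure_A k H ?BB B (pure_A k H B B a b) c \<in> carrier (tensor_A k H ?BB B)"
        by (rule hpar_tensor.TM_beta(1)[OF hpar_tensorI[OF BBm B]]) (use abc pc in auto)
      then have "\<mu> (tensor_map k H B B \<mu> (\<lambda>b. b) (pure_A k H ?BB B (pure_A k H B B a b) c)) =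
        \<mu> (tensor_map k H B B (\<lambda>b. b) \<mu> (associator k H B B B (pure_A k H ?BB B (pure_A k H B B a b) c)))"
        using ao by (simp add: algebra_object_def)
      then show "\<mu> (pure_A k H B B (\<mu> (pure_A k H B B a b)) c) = \<mu> (pure_A k H B B a (\<mu> (pure_A k H B B b c)))"
        using abc by (simp add: simps)
    next
      fix a b assume ab: "a \<in> AH" "b \<in> carrier B"
      have "pure_A k H UA B a b \<in> carrier (tensor_A k H UA B)"
        by (rule hpar_tensor.TM_beta(1)[OF hpar_tensorI[OF UA_module B]]) (use ab in auto)
      then have "\<mu> (tensor_map k H B B \<eta> (\<lambda>b. b) (pure_A k H UA B a b)) = left_unitor B (pure_A k H UA B a b)"
        using ao by (simp add: algebra_object_def)
      then show "\<mu> (pure_A k H B B (\<eta> a) b) = a \<odot>\<^bsub>B\<^esub> b" using ab by (simp add: simps)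
      have "pure_A k H B UA b a \<in> carrier (tensor_A k H B UA)"
        by (rule hpar_tensor.TM_beta(1)[OF hpar_tensorI[OF B UA_module]]) (use ab in auto)
      then have "\<mu> (tensor_map k H B B (\<lambda>b. b) \<eta> (pure_A k H B UA b a)) = right_unitor k H B (pure_A k H B UA b a)"
        using ao by (simp add: algebra_object_def)
      then show "\<mu> (pure_A k H B B b (\<eta> a)) = tm a \<odot>\<^bsub>B\<^esub> b" using ab by (simp add: simps)
    qed
  next
    assume R: ?R
    have "\<mu> (tensor_map k H B B \<mu> (\<lambda>b. b) X) = \<mu> (tensor_map k H B B (\<lambda>b. b) \<mu> (associator k H B B B X))"
      if X: "X \<in> carrier (tensor_A k H ?BB B)" for X
    proof -
      note L = additive_on_comp[OF T1(2) ma] and Rt = additive_on_comp[OF additive_on_comp[OF as(2) T2(2)] ma]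
      show ?thesis
      proof (rule hpar_tensor.TM_additive_eqI[OF hpar_tensorI[OF BBm B] L Rt X])
        fix Y c assume Y: "Y \<in> carrier ?BB" and c: "c \<in> carrier B"
        interpret S: hpar_tensor k H ?BB B by (rule hpar_tensorI[OF BBm B])
        have add: "additive_on ?BB (tensor_A k H ?BB B) (\<lambda>Y. pure_A k H ?BB B Y c)"
          using c by (intro additive_onI) (simp_all add: S.TM_beta)
        show "\<mu> (tensor_map k H B B \<mu> (\<lambda>b. b) (pure_A k H ?BB B Y c)) =
          \<mu> (tensor_map k H B B (\<lambda>b. b) \<mu> (associator k H B B B (pure_A k H ?BB B Y c)))"
          by (rule hpar_tensor.TM_additive_eqI[OF BB additive_on_comp[OF add L] additive_on_comp[OF add Rt] Y])
            (use R c in \<open>simp add: simps\<close>)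
      qed
    qed
    moreover have "\<mu> (tensor_map k H B B \<eta> (\<lambda>b. b) X) = left_unitor B X" if X: "X \<in> carrier (tensor_A k H UA B)" for X
      by (rule hpar_tensor.TM_additive_eqI[OF hpar_tensorI[OF UA_module B] additive_on_comp[OF TL(2) ma] left_unitor_pure(2)[OF B] X])
        (use R in \<open>simp add: simps\<close>)
    moreover have "\<mu> (tensor_map k H B B (\<lambda>b. b) \<eta> X) = right_unitor k H B X" if X: "X \<in> carrier (tensor_A k H B UA)" for X
      by (rule hpar_tensor.TM_additive_eqI[OF hpar_tensorI[OF B UA_module] additive_on_comp[OF TR(2) ma] right_unitor_pure(2)[OF B] X])
        (use R in \<open>simp add: simps\<close>)
    ultimately show "algebra_object k H B \<mu> \<eta>"
      using B mu eta by (simp add: algebra_object_def)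
  qed
qed

end

section \<open>From partial module algebras to algebra objects\<close>

context part_mod_alg
begin

abbreviation "MM \<equiv> tensor_A k H par_mod par_mod"
abbreviation "bp \<equiv> pure_A k H par_mod par_mod"
definition "mult_map = restrict (tensor_lift B (mult B)) (carrier MM)"
definition "unit_map = (\<lambda>a\<in>AH. a \<bullet> oneB)"

lemmas MM_tensor = hpar_tensorI[OF par_mod_module par_mod_module]
lemmas bp_facts = hpar_tensor.TM_beta[OF MM_tensor, simplified]

lemma BMg: "abelian_group par_mod"
  by (rule left_moduleD(2)[OF par_mod_module])

text \<open>\<open>(t(a) b) c\<close> and \<open>b (a c)\<close> are both \<open>b (a \<cdot> 1) c\<close>.\<close>

lemma mult_balanced: "hpar_tensor.A_balanced k H par_mod par_mod B (mult B)"
  by (rule hpar_tensor.A_balancedI[OF MM_tensor])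
    (auto intro!: additive_onI simp: B.l_distr B.r_distr hact_t hact_A[symmetric] B.m_assoc)

lemma mult_map_pure [simp]: "a \<in> carrier B \<Longrightarrow> b \<in> carrier B \<Longrightarrow> mult_map (bp a b) = a \<cdot>\<cdot> b"
  unfolding mult_map_def using hpar_tensor.lift_beta[OF MM_tensor Bg mult_balanced, of a b]
  by (simp add: bp_facts)

lemma mult_map_par_hom: "mult_map \<in> par_hom k H MM par_mod"
proof -
  have l: "additive_on MM B (tensor_lift B (mult B))" by (rule hpar_tensor.lift_additive[OF MM_tensor Bg mult_balanced])
  interpret MM: abelian_group MM by (rule hpar_tensor.TM_abelian[OF MM_tensor])
  have add: "additive_on MM par_mod mult_map"
    using l by (intro additive_onI) (auto simp: mult_map_def additive_on_def)
  have "linear_on HP MM par_mod mult_map"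
  proof (rule hpar_tensor.TM_linearI[OF MM_tensor par_mod_module add])
    fix h m n assume a: "h \<in> HC" "m \<in> carrier par_mod" "n \<in> carrier par_mod"
    have "sw par_mod (\<lambda>x y. mult_map (bp (cl x \<bullet> m) (cl y \<bullet> n))) h = sw par_mod (\<lambda>x y. act x m \<cdot>\<cdot> act y n) h"
      by (rule sw_cong[OF BMg]) (use a in auto)
    also have "\<dots> = sw B (\<lambda>x y. act x m \<cdot>\<cdot> act y n) h" by (rule sw_transfer) simp_all
    finally show "sw par_mod (\<lambda>x y. mult_map (bp (cl x \<bullet> m) (cl y \<bullet> n))) h = cl h \<bullet> mult_map (bp m n)"
      using a by (simp add: act_mult)
  qed
  then show ?thesis by (simp add: par_hom_def mult_map_def)
qed

text \<open>This is the linearity of the unit map \<open>a \<mapsto> a \<cdot> 1\<close>.  Write \<open>[h] a\<close> as \<open>ad h\<^sub>1 a [h\<^sub>2]\<close>; on the unit, \<open>[h\<^sub>2]\<close> may be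
  replaced by \<open>\<epsilon>\<^bsub>h\<^sub>2\<^esub>\<close>, and \<open>ad h\<^sub>1 a \<epsilon>\<^bsub>h\<^sub>2\<^esub> = ad h (a 1)\<close>.\<close>

lemma hact_ad_one:
  assumes h: "h \<in> HC" and a: "a \<in> AH"
  shows "HPr.ad h a \<bullet> oneB = act h (a \<bullet> oneB)"
proof -
  have cl: "\<And>x. x \<in> HC \<Longrightarrow> HPr.ad x a \<in> AH" using a by (rule HPr.ad_A)
  have "act h (a \<bullet> oneB) = (cl h \<otimes>\<^bsub>HP\<^esub> a) \<bullet> oneB" using h a by (simp add: hact_mult)
  also have "\<dots> = sw B (\<lambda>x y. (HPr.ad x a \<otimes>\<^bsub>HP\<^esub> cl y) \<bullet> oneB) h"
    unfolding HPr.phi_A[OF h a] by (rule hact_sw) (use h cl in auto)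
  \<comment> \<open>\<open>\<epsilon>\<^sub>y\<close> acts as multiplication by \<open>y \<cdot> 1\<close>, which on the unit is the action of \<open>[y]\<close>.\<close>
  also have "\<dots> = sw B (\<lambda>x y. (HPr.ad x a \<otimes>\<^bsub>HP\<^esub> HPr.e y) \<bullet> oneB) h"
    by (rule sw_cong[OF Bg h]) (use cl in \<open>auto simp: hact_mult hact_e\<close>)
  also have "\<dots> = sw HP (\<lambda>x y. HPr.ad x a \<otimes>\<^bsub>HP\<^esub> HPr.e y) h \<bullet> oneB"
    by (rule hact_sw[symmetric]) (use h cl in auto)
  also have "sw HP (\<lambda>x y. HPr.ad x a \<otimes>\<^bsub>HP\<^esub> HPr.e y) h = HPr.ad h (a \<otimes>\<^bsub>HP\<^esub> \<one>\<^bsub>HP\<^esub>)"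
    using h a HPr.ad_mult[of h a "\<one>\<^bsub>HP\<^esub>"] by (simp del: HP.r_one) (auto intro!: sw_cong[OF HPr.Eg h] simp: HPr.ad_one cl)
  finally show ?thesis using a by simp
qed

lemma unit_map_par_hom: "unit_map \<in> par_hom k H UA par_mod"
proof -
  have "additive_on UA par_mod unit_map"
    by (rule additive_onI) (auto simp: unit_map_def additive_on_add[OF hact_additive])
  then have "linear_on HP UA par_mod unit_map"
    by (rule Hpar_linear_onI[OF UA_module par_mod_module]) (auto simp: UA_cls unit_map_def hact_ad_one HPr.ad_A)
  then show ?thesis by (simp add: par_hom_def unit_map_def)
qed

lemma algebra_object: "algebra_object k H par_mod mult_map unit_map"
  unfolding algebra_object_iff[OF par_mod_module mult_map_par_hom unit_map_par_hom]
  by (auto simp: unit_map_def B.m_assoc hact_A[symmetric] hact_t)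

lemma normal_module_BM: "normal_algebra k B \<Longrightarrow> normal_module HP par_mod"
  using par_mod_extensional by (simp add: normal_algebra_def normal_module_def)

end

section \<open>From algebra objects to partial module algebras\<close>

text \<open>Normal forms outside of the carriers turn agreement of structures on the carriers into equality.\<close>

lemma extensional2_eqI:
  assumes "extensional2 X Y f" "extensional2 X Y g" "\<And>x y. x \<in> X \<Longrightarrow> y \<in> Y \<Longrightarrow> f x y = g x y"
  shows "f = g"
proof -
  have "(\<lambda>x\<in>X. \<lambda>y\<in>Y. f x y) = (\<lambda>x\<in>X. \<lambda>y\<in>Y. g x y)"
    using assms(3) by (auto simp: fun_eq_iff restrict_def)
  then show ?thesis using assms(1,2) unfolding extensional2_def by simp
qed

lemma extensional2_restrict: "extensional2 X Y (\<lambda>x\<in>X. \<lambda>y\<in>Y. f x y)"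
  by (auto simp: extensional2_def fun_eq_iff restrict_def)

locale alg_obj = hopf_bij k H for k :: "'k ring" and H :: "('k, 'h) hopf" +
  fixes M :: "(('k, 'h) hpar, 'b) module" and \<mu> :: "('b, 'b) tensor \<Rightarrow> 'b" and \<eta> :: "('k, 'h) hpar \<Rightarrow> 'b"
  assumes ao: "algebra_object k H M \<mu> \<eta>"
begin

abbreviation "MM \<equiv> tensor_A k H M M"
abbreviation "bp \<equiv> pure_A k H M M"
abbreviation hact (infixr "\<bullet>" 75) where "a \<bullet> b \<equiv> a \<odot>\<^bsub>M\<^esub> b"
abbreviation bmult (infixl "\<cdot>\<cdot>" 70) where "a \<cdot>\<cdot> b \<equiv> \<mu> (bp a b)"
abbreviation "oneM \<equiv> \<eta> \<one>\<^bsub>HP\<^esub>"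

lemma M: "left_module HP M" and mu: "\<mu> \<in> par_hom k H MM M" and eta: "\<eta> \<in> par_hom k H UA M"
  using ao by (auto simp: algebra_object_def)

lemma mu_linear: "linear_on HP MM M \<mu>" and eta_linear: "linear_on HP UA M \<eta>"
  using mu eta by (auto simp: par_hom_def)

lemma assoc: "a \<in> carrier M \<Longrightarrow> b \<in> carrier M \<Longrightarrow> c \<in> carrier M \<Longrightarrow> (a \<cdot>\<cdot> b) \<cdot>\<cdot> c = a \<cdot>\<cdot> (b \<cdot>\<cdot> c)"
  using ao unfolding algebra_object_iff[OF M mu eta] by blast

lemma eta_mult: "a \<in> AH \<Longrightarrow> b \<in> carrier M \<Longrightarrow> \<eta> a \<cdot>\<cdot> b = a \<bullet> b" "a \<in> AH \<Longrightarrow> b \<in> carrier M \<Longrightarrow> b \<cdot>\<cdot> \<eta> a = tm a \<bullet> b"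
  using ao unfolding algebra_object_iff[OF M mu eta] by blast+

sublocale Mm: module k "restrict_scalars HP M" by (rule restrict_scalars_module[OF HP_algebra M])

lemmas tensor = hpar_tensorI[OF M M]
lemmas Mg = left_moduleD(2)[OF M]
lemmas MMg = hpar_tensor.TM_abelian[OF tensor]
lemmas add_closed [simp] = abelian_monoid.a_closed[OF abelian_group.axioms(1)[OF Mg]]
lemmas bp_facts = hpar_tensor.TM_beta[OF tensor]

lemma hact_closed [simp, intro]: "a \<in> carrier HP \<Longrightarrow> b \<in> carrier M \<Longrightarrow> a \<bullet> b \<in> carrier M"
  by (rule left_moduleD(3)[OF M])

lemma bmult_closed [simp, intro]: "a \<in> carrier M \<Longrightarrow> b \<in> carrier M \<Longrightarrow> a \<cdot>\<cdot> b \<in> carrier M"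
  by (rule linear_on_closed[OF mu_linear]) (simp add: bp_facts)

lemma eta_closed [simp, intro]: "a \<in> AH \<Longrightarrow> \<eta> a \<in> carrier M"
  using linear_on_closed[OF eta_linear] by simp

lemma bmult_add:
  "a \<in> carrier M \<Longrightarrow> b \<in> carrier M \<Longrightarrow> c \<in> carrier M \<Longrightarrow> (a \<oplus>\<^bsub>M\<^esub> b) \<cdot>\<cdot> c = a \<cdot>\<cdot> c \<oplus>\<^bsub>M\<^esub> b \<cdot>\<cdot> c"
  "a \<in> carrier M \<Longrightarrow> b \<in> carrier M \<Longrightarrow> c \<in> carrier M \<Longrightarrow> a \<cdot>\<cdot> (b \<oplus>\<^bsub>M\<^esub> c) = a \<cdot>\<cdot> b \<oplus>\<^bsub>M\<^esub> a \<cdot>\<cdot> c"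
  by (simp_all add: bp_facts linear_on_add[OF mu_linear])

lemma bmult_scalar:
  assumes "c \<in> carrier k" "a \<in> carrier M" "b \<in> carrier M"
  shows "((c \<odot>\<^bsub>HP\<^esub> \<one>\<^bsub>HP\<^esub>) \<bullet> a) \<cdot>\<cdot> b = (c \<odot>\<^bsub>HP\<^esub> \<one>\<^bsub>HP\<^esub>) \<bullet> (a \<cdot>\<cdot> b)"
    "a \<cdot>\<cdot> ((c \<odot>\<^bsub>HP\<^esub> \<one>\<^bsub>HP\<^esub>) \<bullet> b) = (c \<odot>\<^bsub>HP\<^esub> \<one>\<^bsub>HP\<^esub>) \<bullet> (a \<cdot>\<cdot> b)"
  using assms hpar_tensor.TM_scalar[OF tensor, of c a b] linear_on_smult[OF mu_linear, of "c \<odot>\<^bsub>HP\<^esub> \<one>\<^bsub>HP\<^esub>" "bp a b"]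
  by (simp_all add: bp_facts)

text \<open>In the unit object \<open>a\<close> is the result of acting with \<open>a\<close> on 1, and \<open>\<eta>\<close> is linear.\<close>

lemma eta_eq: "a \<in> AH \<Longrightarrow> \<eta> a = a \<bullet> oneM"
  using linear_on_smult[OF eta_linear, of a "\<one>\<^bsub>HP\<^esub>"] by (simp add: UA_one HPr.A_carrier)

lemma bmult_one:
  assumes "b \<in> carrier M"
  shows "oneM \<cdot>\<cdot> b = b" "b \<cdot>\<cdot> oneM = b"
  using assms eta_mult[of "\<one>\<^bsub>HP\<^esub>" b] by (simp_all add: tmap_props(2) left_moduleD(7)[OF M])

lemma cls_one: "h \<in> HC \<Longrightarrow> cl h \<bullet> oneM = \<eta> (HPr.e h)"
  using linear_on_smult[OF eta_linear, of "cl h" "\<one>\<^bsub>HP\<^esub>"] by (simp add: UA_cls HPr.ad_one)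

lemma cls_mult:
  assumes "h \<in> HC" "a \<in> carrier M" "b \<in> carrier M"
  shows "cl h \<bullet> (a \<cdot>\<cdot> b) = sw M (\<lambda>x y. (cl x \<bullet> a) \<cdot>\<cdot> (cl y \<bullet> b)) h"
proof -
  have "cl h \<bullet> (a \<cdot>\<cdot> b) = \<mu> (cl h \<odot>\<^bsub>MM\<^esub> bp a b)"
    using assms linear_on_smult[OF mu_linear, of "cl h" "bp a b"] by (simp add: bp_facts)
  also have "\<dots> = sw M (\<lambda>x y. (cl x \<bullet> a) \<cdot>\<cdot> (cl y \<bullet> b)) h"
    unfolding bp_facts(4)[OF assms(2,3,1)]
    by (rule sw_additive[OF MMg Mg linear_on_additive[OF mu_linear]]) (use assms in \<open>auto simp: bp_facts\<close>)
  finally show ?thesis .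
qed

lemma sw_act:
  assumes "h \<in> HC" "b \<in> carrier M" "\<And>x y. x \<in> HC \<Longrightarrow> y \<in> HC \<Longrightarrow> f x y \<in> carrier HP"
  shows "sw HP f h \<bullet> b = sw M (\<lambda>x y. f x y \<bullet> b) h"
proof -
  have "additive_on HP M (\<lambda>a. a \<bullet> b)" using assms(2) by (intro additive_onI) (simp_all add: left_moduleD[OF M])
  from sw_additive[OF HPr.Eg Mg this] show ?thesis using assms by simp
qed

text \<open>By the unit laws, left multiplication by \<open>h \<cdot> 1\<close> is the action of \<open>\<epsilon>\<^sub>h\<close> and right multiplication by it is the
  action of \<open>t(\<epsilon>\<^sub>h)\<close>, so the two sums are instances of \<open>e_reduce\<close> and \<open>e'_reduce\<close>.\<close>

lemma cls_cls:
  assumes h: "h \<in> HC" and l: "l \<in> HC" and a: "a \<in> carrier M"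
  shows "cl h \<bullet> cl l \<bullet> a = sw M (\<lambda>x y. (cl x \<bullet> oneM) \<cdot>\<cdot> (cl (y \<star> l) \<bullet> a)) h"
    "cl h \<bullet> cl l \<bullet> a = sw M (\<lambda>x y. (cl (x \<star> l) \<bullet> a) \<cdot>\<cdot> (cl y \<bullet> oneM)) h"
proof -
  have m: "cl h \<bullet> cl l \<bullet> a = (cl h \<otimes>\<^bsub>HP\<^esub> cl l) \<bullet> a" using assms by (simp add: left_moduleD(6)[OF M])
  have "cl h \<bullet> cl l \<bullet> a = sw M (\<lambda>x y. (HPr.e x \<otimes>\<^bsub>HP\<^esub> cl (y \<star> l)) \<bullet> a) h"
    unfolding m HPr.e_reduce[OF h l, symmetric] by (rule sw_act) (use assms in auto)
  also have "\<dots> = sw M (\<lambda>x y. (cl x \<bullet> oneM) \<cdot>\<cdot> (cl (y \<star> l) \<bullet> a)) h"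
    by (rule sw_cong[OF Mg h]) (use assms in \<open>auto simp: left_moduleD(6)[OF M] cls_one eta_mult\<close>)
  finally show "cl h \<bullet> cl l \<bullet> a = sw M (\<lambda>x y. (cl x \<bullet> oneM) \<cdot>\<cdot> (cl (y \<star> l) \<bullet> a)) h" .
  have "cl h \<bullet> cl l \<bullet> a = sw M (\<lambda>x y. (HPr.e' y \<otimes>\<^bsub>HP\<^esub> cl (x \<star> l)) \<bullet> a) h"
    unfolding m HPr.e'_reduce[OF h l, symmetric] by (rule sw_act) (use assms in auto)
  also have "\<dots> = sw M (\<lambda>x y. (cl (x \<star> l) \<bullet> a) \<cdot>\<cdot> (cl y \<bullet> oneM)) h"
    by (rule sw_cong[OF Mg h]) (use assms in \<open>auto simp: left_moduleD(6)[OF M] cls_one eta_mult tmap_props(4)\<close>)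
  finally show "cl h \<bullet> cl l \<bullet> a = sw M (\<lambda>x y. (cl (x \<star> l) \<bullet> a) \<cdot>\<cdot> (cl y \<bullet> oneM)) h" .
qed

definition "par_alg = \<lparr>carrier = carrier M, monoid.mult = (\<lambda>a\<in>carrier M. \<lambda>b\<in>carrier M. a \<cdot>\<cdot> b), one = oneM,
  ring.zero = \<zero>\<^bsub>M\<^esub>, add = add M, smult = (\<lambda>c\<in>carrier k. \<lambda>a\<in>carrier M. (c \<odot>\<^bsub>HP\<^esub> \<one>\<^bsub>HP\<^esub>) \<bullet> a)\<rparr>"
definition "par_act = (\<lambda>h\<in>HC. \<lambda>a\<in>carrier M. cl h \<bullet> a)"

lemma par_alg_simps [simp]: "carrier par_alg = carrier M" "\<one>\<^bsub>par_alg\<^esub> = oneM" "\<zero>\<^bsub>par_alg\<^esub> = \<zero>\<^bsub>M\<^esub>" "add par_alg = add M"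
  "a \<in> carrier M \<Longrightarrow> b \<in> carrier M \<Longrightarrow> a \<otimes>\<^bsub>par_alg\<^esub> b = a \<cdot>\<cdot> b"
  "c \<in> carrier k \<Longrightarrow> a \<in> carrier M \<Longrightarrow> c \<odot>\<^bsub>par_alg\<^esub> a = (c \<odot>\<^bsub>HP\<^esub> \<one>\<^bsub>HP\<^esub>) \<bullet> a"
  by (simp_all add: par_alg_def)

lemma par_act_simp [simp]: "h \<in> HC \<Longrightarrow> a \<in> carrier M \<Longrightarrow> par_act h a = cl h \<bullet> a"
  by (simp add: par_act_def)

lemma par_alg_algebra: "k_algebra k par_alg"
proof -
  have ab: "abelian_group par_alg" by (rule abelian_group_transfer[OF Mg]) simp_all
  have "module k par_alg"
    using Mm.smult_l_distr Mm.smult_r_distr Mm.smult_assoc1 Mm.smult_one Mm.smult_closed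
    by (intro moduleI[OF k_cring ab]) simp_all
  moreover have "ring par_alg"
    by (rule ringI[OF ab]) (auto intro!: monoidI simp: assoc bmult_add bmult_one)
  ultimately show ?thesis by (auto simp: k_algebra_def bmult_scalar)
qed

lemma partial_module_algebra: "partial_module_algebra k H par_alg par_act"
  unfolding partial_module_algebra_def
proof (intro conjI ballI)
  have t: "sw par_alg f h = sw M f h" for f h by (rule sw_transfer) simp_all
  show "k_algebra k par_alg" by (rule par_alg_algebra)
  show "linear_on k par_alg par_alg (par_act h)" if h: "h \<in> HC" for h
  proof -
    have l: "linear_on k (restrict_scalars HP M) (restrict_scalars HP M) (\<lambda>a. cl h \<bullet> a)"
      using h by (auto intro!: linear_on_act_right[OF HP_algebra M linear_on_id])
    show ?thesis
      using h linear_on_smult[OF l] linear_on_add[OF l] by (intro linear_onI) simp_all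
  qed
  show "linear_on k H par_alg (\<lambda>h. par_act h a)" if a: "a \<in> carrier par_alg" for a
  proof -
    have l: "linear_on k H (restrict_scalars HP M) (\<lambda>h. cl h \<bullet> a)"
      using a by (auto intro!: linear_on_act_left[OF HP_algebra M cls_linear])
    show ?thesis
      using a linear_on_smult[OF l] linear_on_add[OF l] by (intro linear_onI) simp_all
  qed
  show "par_act unit a = a" if "a \<in> carrier par_alg" for a
    using that by (simp add: HPr.phi_unit left_moduleD(7)[OF M])
  fix h assume h: "h \<in> HC"
  show "par_act h (a \<otimes>\<^bsub>par_alg\<^esub> b) = sw par_alg (\<lambda>x y. par_act x a \<otimes>\<^bsub>par_alg\<^esub> par_act y b) h" if "a \<in> carrier par_alg" "b \<in> carrier par_alg" for a b
    using that h by (simp add: t cls_mult) (auto intro!: sw_cong[OF Mg h])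
  show "par_act h (par_act l a) = sw par_alg (\<lambda>x y. par_act x \<one>\<^bsub>par_alg\<^esub> \<otimes>\<^bsub>par_alg\<^esub> par_act (y \<star> l) a) h" if "l \<in> HC" "a \<in> carrier par_alg" for l a
  proof -
    have "par_act h (par_act l a) = sw M (\<lambda>x y. (cl x \<bullet> oneM) \<cdot>\<cdot> (cl (y \<star> l) \<bullet> a)) h" using that h cls_cls(1)[of h l a] by simp
    also have "\<dots> = sw par_alg (\<lambda>x y. par_act x \<one>\<^bsub>par_alg\<^esub> \<otimes>\<^bsub>par_alg\<^esub> par_act (y \<star> l) a) h"
      unfolding t by (rule sw_cong[OF Mg h, symmetric, rotated -1]) (use that in auto)
    finally show ?thesis .
  qed
  show "par_act h (par_act l a) = sw par_alg (\<lambda>x y. par_act (x \<star> l) a \<otimes>\<^bsub>par_alg\<^esub> par_act y \<one>\<^bsub>par_alg\<^esub>) h" if "l \<in> HC" "a \<in> carrier par_alg" for l a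
  proof -
    have "par_act h (par_act l a) = sw M (\<lambda>x y. (cl (x \<star> l) \<bullet> a) \<cdot>\<cdot> (cl y \<bullet> oneM)) h" using that h cls_cls(2)[of h l a] by simp
    also have "\<dots> = sw par_alg (\<lambda>x y. par_act (x \<star> l) a \<otimes>\<^bsub>par_alg\<^esub> par_act y \<one>\<^bsub>par_alg\<^esub>) h"
      unfolding t by (rule sw_cong[OF Mg h, symmetric, rotated -1]) (use that in auto)
    finally show ?thesis .
  qed
qed

lemma normal_BB: "normal_module HP M \<Longrightarrow> normal_algebra k par_alg"
  by (auto simp: normal_module_def normal_algebra_def) (auto simp: par_alg_def extensional2_restrict)

sublocale part_mod_alg: part_mod_alg k H par_alg par_act
  by (intro part_mod_alg.intro hopf_bij_axioms part_mod_alg_axioms.intro partial_module_algebra)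

lemma par_mod_eq:
  assumes n: "normal_module HP M"
  shows "part_mod_alg.par_mod = M"
proof -
  have s: "smult part_mod_alg.par_mod = smult M"
  proof (rule extensional2_eqI)
    show "extensional2 (carrier HP) (carrier M) (smult part_mod_alg.par_mod)" using part_mod_alg.par_mod_extensional by simp
    show "extensional2 (carrier HP) (carrier M) (smult M)" using n by (simp add: normal_module_def)
    show "a \<odot>\<^bsub>part_mod_alg.par_mod\<^esub> b = a \<bullet> b" if "a \<in> carrier HP" "b \<in> carrier M" for a b
      by (rule Hpar_module_unique[OF part_mod_alg.par_mod_module M]) (use that in simp_all)
  qed
  show ?thesis
    by (rule module.equality) (use n s in \<open>simp_all add: normal_module_def\<close>)
qed

lemma mult_map_unt_eq:
  assumes n: "normal_module HP M"
  shows "part_mod_alg.mult_map = \<mu>" "part_mod_alg.unit_map = \<eta>"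
proof -
  have "part_mod_alg.mult_map X = \<mu> X" if "X \<in> carrier MM" for X
  proof (rule hpar_tensor.TM_additive_eqI[OF tensor _ linear_on_additive[OF mu_linear] that])
    have "linear_on HP MM M part_mod_alg.mult_map"
      using part_mod_alg.mult_map_par_hom unfolding par_mod_eq[OF n] by (simp add: par_hom_def)
    then show "additive_on MM M part_mod_alg.mult_map" by (rule linear_on_additive)
    show "part_mod_alg.mult_map (bp a b) = \<mu> (bp a b)" if "a \<in> carrier M" "b \<in> carrier M" for a b
      using part_mod_alg.mult_map_pure[of a b] that unfolding par_mod_eq[OF n] by simp
  qed
  moreover have "part_mod_alg.mult_map \<in> extensional (carrier MM)" "\<mu> \<in> extensional (carrier MM)"
    using part_mod_alg.mult_map_par_hom mu unfolding par_mod_eq[OF n] by (simp_all add: par_hom_def)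
  ultimately show "part_mod_alg.mult_map = \<mu>" by (intro extensionalityI)
  have "\<eta> \<in> extensional AH" using eta by (simp add: par_hom_def)
  then show "part_mod_alg.unit_map = \<eta>"
    by (intro extensionalityI[of _ AH]) (auto simp: part_mod_alg.unit_map_def par_mod_eq[OF n] eta_eq[symmetric])
qed

end

section \<open>The isomorphism of categories\<close>

text \<open>If the arrows between corresponding objects are the same functions, the arrow maps of the functors are
  identities, and the category axioms need to be verified on one side only.\<close>

lemma isomorphic_categoriesI:
  assumes C: "is_category C"
    and Fo: "\<And>X. X \<in> cat_ob C \<Longrightarrow> Fo X \<in> cat_ob D" "\<And>X. X \<in> cat_ob C \<Longrightarrow> Go (Fo X) = X"
    and Go: "\<And>U. U \<in> cat_ob D \<Longrightarrow> Go U \<in> cat_ob C" "\<And>U. U \<in> cat_ob D \<Longrightarrow> Fo (Go U) = U"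
    and hom: "\<And>X Y. X \<in> cat_ob C \<Longrightarrow> Y \<in> cat_ob C \<Longrightarrow> cat_hom D (Fo X) (Fo Y) = cat_hom C X Y"
    and id: "\<And>X. X \<in> cat_ob C \<Longrightarrow> cat_id D (Fo X) = cat_id C X"
    and comp: "\<And>X Y Z. X \<in> cat_ob C \<Longrightarrow> Y \<in> cat_ob C \<Longrightarrow> Z \<in> cat_ob C \<Longrightarrow>
      cat_comp D (Fo X) (Fo Y) (Fo Z) = cat_comp C X Y Z"
  shows "isomorphic_categories C D"
proof -
  have hom': "cat_hom D U V = cat_hom C (Go U) (Go V)" if "U \<in> cat_ob D" "V \<in> cat_ob D" for U V
    using hom[OF Go(1)[OF that(1)] Go(1)[OF that(2)]] Go(2)[OF that(1)] Go(2)[OF that(2)] by simp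
  have id': "cat_id D U = cat_id C (Go U)" if "U \<in> cat_ob D" for U
    using id[OF Go(1)[OF that]] Go(2)[OF that] by simp
  have comp': "cat_comp D U V W = cat_comp C (Go U) (Go V) (Go W)" if "U \<in> cat_ob D" "V \<in> cat_ob D" "W \<in> cat_ob D" for U V W
    using comp[OF Go(1)[OF that(1)] Go(1)[OF that(2)] Go(1)[OF that(3)]]
      Go(2)[OF that(1)] Go(2)[OF that(2)] Go(2)[OF that(3)] by simp
  note c = C[unfolded is_category_def]
  have D: "is_category D"
    unfolding is_category_def
  proof (intro conjI ballI)
    fix X assume X: "X \<in> cat_ob D"
    show "cat_id D X \<in> cat_hom D X X" using c Go(1)[OF X] by (simp add: hom' id' X)
    fix Y f assume Y: "Y \<in> cat_ob D" and f: "f \<in> cat_hom D X Y"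
    show "cat_comp D X X Y f (cat_id D X) = f" "cat_comp D X Y Y (cat_id D Y) f = f"
      using c Go(1)[OF X] Go(1)[OF Y] f by (simp_all add: hom' id' comp' X Y)
    fix Z g assume Z: "Z \<in> cat_ob D" and g: "g \<in> cat_hom D Y Z"
    show "cat_comp D X Y Z g f \<in> cat_hom D X Z"
      using c Go(1)[OF X] Go(1)[OF Y] Go(1)[OF Z] f g by (simp add: hom' comp' X Y Z)
    fix W h assume W: "W \<in> cat_ob D" and h: "h \<in> cat_hom D Z W"
    show "cat_comp D X Y W (cat_comp D Y Z W h g) f = cat_comp D X Z W h (cat_comp D X Y Z g f)"
      using c Go(1)[OF X] Go(1)[OF Y] Go(1)[OF Z] Go(1)[OF W] f g h by (simp add: hom' comp' X Y Z W)
  qed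
  have "is_functor C D Fo (\<lambda>X Y f. f)" by (simp add: is_functor_def Fo hom id comp)
  moreover have "is_functor D C Go (\<lambda>U V f. f)" by (simp add: is_functor_def Go hom' id' comp')
  ultimately show ?thesis
    unfolding isomorphic_categories_def using C D Fo(2) Go(2)
    by (intro conjI exI[of _ Fo] exI[of _ "\<lambda>X Y f. f"] exI[of _ Go]) auto
qed

lemma ParAct_category:
  fixes k :: "'k ring" and H :: "('k, 'h) hopf"
  shows "is_category (ParAct k H :: (('k, 'b) module \<times> ('h \<Rightarrow> 'b \<Rightarrow> 'b), 'b \<Rightarrow> 'b) category)"
proof -
  have id: "algebra_map k B B (\<lambda>x\<in>carrier B. x)" if B: "partial_module_algebra k H B act" for B :: "('k, 'b) module" and act
  proof -
    interpret B: ring B using B by (auto simp: partial_module_algebra_def k_algebra_def)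
    interpret Bm: module k B using B by (auto simp: partial_module_algebra_def k_algebra_def)
    show ?thesis by (auto simp: algebra_map_def ring_hom_def intro!: linear_onI)
  qed
  have closed: "act h a \<in> carrier B" if "partial_module_algebra k H B act" "h \<in> carrier H" "a \<in> carrier B"
    for B :: "('k, 'b) module" and act h a
    using that unfolding partial_module_algebra_def by (auto intro: linear_on_closed)
  have comp: "algebra_map k B D (compose (carrier B) g f)"
    if "partial_module_algebra k H B act" and f: "algebra_map k B C f" and g: "algebra_map k C D g"
    for B C D :: "('k, 'b) module" and act f g
  proof -
    interpret B: ring B using that by (auto simp: partial_module_algebra_def k_algebra_def)
    interpret Bm: module k B using that by (auto simp: partial_module_algebra_def k_algebra_def)
    have "linear_on k B D (compose (carrier B) g f)"
      by (rule linear_onI)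
        (simp_all add: compose_def algebra_mapD[OF f] algebra_mapD[OF g] linear_on_smult[OF algebra_mapD(1)[OF f]]
          linear_on_smult[OF algebra_mapD(1)[OF g]])
    moreover have "compose (carrier B) g f \<in> ring_hom B D"
      by (rule ring_hom_memI) (simp_all add: compose_def algebra_mapD[OF f] algebra_mapD[OF g])
    ultimately show ?thesis by (simp add: algebra_map_def)
  qed
  let ?C = "ParAct k H :: (('k, 'b) module \<times> ('h \<Rightarrow> 'b \<Rightarrow> 'b), 'b \<Rightarrow> 'b) category"
  have funs: "f \<in> carrier (fst X) \<rightarrow> carrier (fst Y)" "f \<in> extensional (carrier (fst X))" if "f \<in> cat_hom ?C X Y" for X Y f
    using that by (auto simp: ParAct_def algebra_mapD(4) split: prod.splits)
  have comp_eq: "cat_comp ?C X Y Z g f = compose (carrier (fst X)) g f" for X Y Z g f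
    by (simp add: ParAct_def)
  have id_eq: "cat_id ?C X = (\<lambda>x\<in>carrier (fst X). x)" for X by (simp add: ParAct_def split: prod.splits)
  show ?thesis
    unfolding is_category_def comp_eq id_eq
  proof (intro conjI ballI)
    fix X assume X: "X \<in> cat_ob ?C"
    then show "(\<lambda>x\<in>carrier (fst X). x) \<in> cat_hom ?C X X"
      using id[of "fst X" "snd X"] by (auto simp: ParAct_def closed)
    fix Y f assume Y: "Y \<in> cat_ob ?C" and f: "f \<in> cat_hom ?C X Y"
    show "compose (carrier (fst X)) f (\<lambda>x\<in>carrier (fst X). x) = f"
      by (rule compose_Id[OF funs[OF f]])
    show "compose (carrier (fst X)) (\<lambda>x\<in>carrier (fst Y). x) f = f"
      by (rule Id_compose[OF funs[OF f]])
    fix Z g assume Z: "Z \<in> cat_ob ?C" and g: "g \<in> cat_hom ?C Y Z"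
    show "compose (carrier (fst X)) g f \<in> cat_hom ?C X Z"
      using X f g comp[of "fst X" "snd X" "fst Y" f "fst Z" g]
      by (auto simp: ParAct_def closed compose_eq algebra_mapD(4))
    fix W h
    show "compose (carrier (fst X)) (compose (carrier (fst Y)) h g) f = compose (carrier (fst X)) h (compose (carrier (fst X)) g f)"
      by (rule compose_assoc[OF funs(1)[OF f], symmetric])
  qed
qed

context hopf_bij
begin

definition to_algebra_object where
  "to_algebra_object = (\<lambda>(B, act). (part_mod_alg.par_mod k H B act, part_mod_alg.mult_map k H B act, part_mod_alg.unit_map k H B act))"

definition to_module_algebra where
  "to_module_algebra = (\<lambda>(M, \<mu>, \<eta>). (alg_obj.par_alg k H M \<mu> \<eta>, alg_obj.par_act k H M))"

lemma pmaI: "(B, act) \<in> cat_ob (ParAct k H) \<Longrightarrow> part_mod_alg k H B act"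
  by (auto simp: ParAct_def intro!: part_mod_alg.intro hopf_bij_axioms part_mod_alg_axioms.intro)

lemma alg_objI: "(M, \<mu>, \<eta>) \<in> cat_ob (AlgHpar k H) \<Longrightarrow> alg_obj k H M \<mu> \<eta>"
  by (auto simp: AlgHpar_def intro!: alg_obj.intro hopf_bij_axioms alg_obj_axioms.intro)

lemma to_algebra_object_ob: "X \<in> cat_ob (ParAct k H) \<Longrightarrow> to_algebra_object X \<in> cat_ob (AlgHpar k H)"
  using part_mod_alg.algebra_object[OF pmaI] part_mod_alg.normal_module_BM[OF pmaI]
  by (cases X) (auto simp: to_algebra_object_def AlgHpar_def ParAct_def)

lemma to_module_algebra_ob: "U \<in> cat_ob (AlgHpar k H) \<Longrightarrow> to_module_algebra U \<in> cat_ob (ParAct k H)"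
proof (cases U)
  case (fields M \<mu> \<eta>)
  assume U: "U \<in> cat_ob (AlgHpar k H)"
  interpret a: alg_obj k H M \<mu> \<eta> by (rule alg_objI) (use U fields in simp)
  show ?thesis
    using a.partial_module_algebra a.normal_BB U
    by (auto simp: fields to_module_algebra_def AlgHpar_def ParAct_def a.par_act_def extensional2_restrict)
qed

lemma to_algebra_object_inverse: "U \<in> cat_ob (AlgHpar k H) \<Longrightarrow> to_algebra_object (to_module_algebra U) = U"
proof (cases U)
  case (fields M \<mu> \<eta>)
  assume U: "U \<in> cat_ob (AlgHpar k H)"
  interpret a: alg_obj k H M \<mu> \<eta> by (rule alg_objI) (use U fields in simp)
  have "normal_module HP M" using U by (simp add: fields AlgHpar_def)
  then show ?thesis by (simp add: fields to_module_algebra_def to_algebra_object_def a.par_mod_eq a.mult_map_unt_eq)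
qed

lemma to_module_algebra_inverse: "X \<in> cat_ob (ParAct k H) \<Longrightarrow> to_module_algebra (to_algebra_object X) = X"
proof (cases X)
  case (Pair B act)
  assume X: "X \<in> cat_ob (ParAct k H)"
  interpret p: part_mod_alg k H B act by (rule pmaI) (use X Pair in simp)
  interpret a: alg_obj k H p.par_mod p.mult_map p.unit_map
    by (intro alg_obj.intro hopf_bij_axioms alg_obj_axioms.intro p.algebra_object)
  have n: "extensional2 (carrier B) (carrier B) (mult B)" "extensional2 (carrier k) (carrier B) (smult B)"
    "extensional2 HC (carrier B) act"
    using X by (auto simp: Pair ParAct_def normal_algebra_def)
  have "mult a.par_alg = mult B"
    by (rule extensional2_eqI[OF _ n(1)]) (simp_all add: a.par_alg_def extensional2_restrict)
  moreover have "smult a.par_alg = smult B"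
    by (rule extensional2_eqI[OF _ n(2)]) (simp_all add: a.par_alg_def extensional2_restrict p.hact_scalar)
  moreover have "a.par_act = act"
    by (rule extensional2_eqI[OF _ n(3)]) (simp_all add: a.par_act_def extensional2_restrict)
  moreover have "\<one>\<^bsub>a.par_alg\<^esub> = \<one>\<^bsub>B\<^esub>"
    unfolding a.par_alg_simps(2) by (simp add: p.unit_map_def p.hact_one)
  ultimately have "a.par_alg = B" "a.par_act = act"
    by (auto intro!: module.equality)
  then show ?thesis by (simp add: Pair to_module_algebra_def to_algebra_object_def)
qed

text \<open>A map that commutes with the action is linear over \<open>H\<^sub>p\<^sub>a\<^sub>r\<close> and conversely; the multiplication is compared on
  pure tensors, and compatibility with \<open>\<eta>\<close> is compatibility with \<open>\<eta>(1)\<close>.\<close>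

lemma hom_eq:
  assumes B: "part_mod_alg k H B act" and C: "part_mod_alg k H C act'"
  shows "algebra_object_map k H (to_algebra_object (B, act)) (to_algebra_object (C, act')) f \<longleftrightarrow>
    f \<in> extensional (carrier B) \<and> algebra_map k B C f \<and> (\<forall>h\<in>HC. \<forall>a\<in>carrier B. f (act h a) = act' h (f a))"
    (is "?L \<longleftrightarrow> ?R")
proof -
  interpret B: part_mod_alg k H B act by (rule B)
  interpret C: part_mod_alg k H C act' by (rule C)
  have L: "?L \<longleftrightarrow> f \<in> extensional (carrier B) \<and> linear_on HP B.par_mod C.par_mod f \<and>
     (\<forall>X\<in>carrier B.MM. f (B.mult_map X) = C.mult_map (tensor_map k H C.par_mod C.par_mod f f X)) \<and> (\<forall>a\<in>AH. f (B.unit_map a) = C.unit_map a)"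
    by (simp add: algebra_object_map_def to_algebra_object_def par_hom_def)
  show ?thesis
  proof
    assume l: ?L
    then have f: "f \<in> extensional (carrier B)" "linear_on HP B.par_mod C.par_mod f"
      "\<And>X. X \<in> carrier B.MM \<Longrightarrow> f (B.mult_map X) = C.mult_map (tensor_map k H C.par_mod C.par_mod f f X)"
      "\<And>a. a \<in> AH \<Longrightarrow> f (B.unit_map a) = C.unit_map a" by (simp_all add: L)
    have fc: "f a \<in> carrier C" if "a \<in> carrier B" for a using linear_on_closed[OF f(2)] that by simp
    have one: "f \<one>\<^bsub>B\<^esub> = \<one>\<^bsub>C\<^esub>"
      using f(4)[of "\<one>\<^bsub>HP\<^esub>"] by (simp add: B.unit_map_def C.unit_map_def B.hact_one C.hact_one)
    have mult: "f (a \<otimes>\<^bsub>B\<^esub> b) = f a \<otimes>\<^bsub>C\<^esub> f b" if ab: "a \<in> carrier B" "b \<in> carrier B" for a b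
      using f(3)[of "B.bp a b"] ab fc tensor_map_pure(1)[OF B.par_mod_module B.par_mod_module C.par_mod_module C.par_mod_module f(2) f(2), of a b]
      by (simp add: B.bp_facts)
    have add: "f (a \<oplus>\<^bsub>B\<^esub> b) = f a \<oplus>\<^bsub>C\<^esub> f b" if ab: "a \<in> carrier B" "b \<in> carrier B" for a b
      using linear_on_add[OF f(2), of a b] ab by simp
    have smult: "f (c \<odot>\<^bsub>B\<^esub> a) = c \<odot>\<^bsub>C\<^esub> f a" if "c \<in> carrier k" "a \<in> carrier B" for c a
      using linear_on_smult[OF f(2), of "c \<odot>\<^bsub>HP\<^esub> \<one>\<^bsub>HP\<^esub>" a] that fc by (simp add: B.hact_scalar C.hact_scalar)
    have "f (act h a) = act' h (f a)" if "h \<in> HC" "a \<in> carrier B" for h a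
      using linear_on_smult[OF f(2), of "cl h" a] that fc by simp
    then show ?R
      using f(1) fc one mult add smult by (auto simp: algebra_map_def intro!: linear_onI ring_hom_memI)
  next
    assume r: ?R
    then have f: "f \<in> extensional (carrier B)" "algebra_map k B C f"
      "\<And>h a. h \<in> HC \<Longrightarrow> a \<in> carrier B \<Longrightarrow> f (act h a) = act' h (f a)" by auto
    note fD = algebra_mapD(3-6)[OF f(2)]
    have fa: "additive_on B.par_mod C.par_mod f" by (rule additive_onI) (simp_all add: fD)
    have fl: "linear_on HP B.par_mod C.par_mod f"
      by (rule Hpar_linear_onI[OF B.par_mod_module C.par_mod_module fa]) (simp_all add: f(3) fD)
    note T = tensor_map_pure[OF B.par_mod_module B.par_mod_module C.par_mod_module C.par_mod_module fl fl]
    have m: "additive_on B.MM B.par_mod B.mult_map" "additive_on C.MM C.par_mod C.mult_map"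
      using B.mult_map_par_hom C.mult_map_par_hom by (auto simp: par_hom_def dest: linear_on_additive)
    have "f (B.mult_map X) = C.mult_map (tensor_map k H C.par_mod C.par_mod f f X)" if X: "X \<in> carrier B.MM" for X
      by (rule hpar_tensor.TM_additive_eqI[OF B.MM_tensor additive_on_comp[OF m(1) fa] additive_on_comp[OF T(2) m(2)] X])
        (simp add: T(1) fD)
    moreover have "f (B.unit_map a) = C.unit_map a" if a: "a \<in> AH" for a
      using linear_on_smult[OF fl, of a "\<one>\<^bsub>B\<^esub>"] a by (simp add: B.unit_map_def C.unit_map_def fD HPr.A_carrier)
    ultimately show ?L using f(1) fl by (simp add: L)
  qed
qed

lemma isomorphic: "isomorphic_categories
    (ParAct k H :: (('k, 'b) module \<times> ('h \<Rightarrow> 'b \<Rightarrow> 'b), 'b \<Rightarrow> 'b) category)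
    (AlgHpar k H :: ((('k, 'h) hpar, 'b) module \<times> (('b, 'b) tensor \<Rightarrow> 'b) \<times> (('k, 'h) hpar \<Rightarrow> 'b), 'b \<Rightarrow> 'b) category)"
proof (rule isomorphic_categoriesI[OF ParAct_category to_algebra_object_ob to_module_algebra_inverse
      to_module_algebra_ob to_algebra_object_inverse])
  fix X Y Z :: "('k, 'b) module \<times> ('h \<Rightarrow> 'b \<Rightarrow> 'b)"
  assume X: "X \<in> cat_ob (ParAct k H)"
  obtain B act where XB: "X = (B, act)" by (cases X)
  interpret B: part_mod_alg k H B act by (rule pmaI) (use X XB in simp)
  have car: "carrier (fst (to_algebra_object X)) = carrier B" by (simp add: XB to_algebra_object_def)
  show "cat_id (AlgHpar k H) (to_algebra_object X) = cat_id (ParAct k H) X"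
    using car by (simp add: AlgHpar_def ParAct_def XB)
  assume Y: "Y \<in> cat_ob (ParAct k H)"
  obtain C act' where YC: "Y = (C, act')" by (cases Y)
  have C: "part_mod_alg k H C act'" by (rule pmaI) (use Y YC in simp)
  show "cat_hom (AlgHpar k H) (to_algebra_object X) (to_algebra_object Y) = cat_hom (ParAct k H) X Y"
    unfolding XB YC using hom_eq[OF B.part_mod_alg_axioms C] by (auto simp: AlgHpar_def ParAct_def)
  show "cat_comp (AlgHpar k H) (to_algebra_object X) (to_algebra_object Y) (to_algebra_object Z) = cat_comp (ParAct k H) X Y Z"
    using car by (simp add: AlgHpar_def ParAct_def XB fun_eq_iff)
qed

end

theorem theorem5p6:
  fixes k :: "'k ring" and H :: "('k, 'h) hopf"
  assumes "hopf_algebra k H"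
    and "invertible_antipode H"
  shows "isomorphic_categories
    (ParAct k H :: (('k, 'b) module \<times> ('h \<Rightarrow> 'b \<Rightarrow> 'b), 'b \<Rightarrow> 'b) category)
    (AlgHpar k H :: ((('k, 'h) hpar, 'b) module \<times> (('b, 'b) tensor \<Rightarrow> 'b) \<times> (('k, 'h) hpar \<Rightarrow> 'b),
       'b \<Rightarrow> 'b) category)"
  using hopf_bij.isomorphic[OF hopf_bij.intro[OF assms(1) hopf_bij_axioms.intro[OF assms(2)]]] .

end
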